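(* The convex hull operator $\mathit{CH}:\mathcal A\to\mathcal A$, $S\mapsto$ the convex hull of $S$, is $(\psi_\circledcirc,\psi_\circledcirc)$-$\mathbf{NP}_2$-$\le^2_{\mathrm m}$-complete; that is, the multi-function $\psi_\circledcirc^{-1}\circ\mathit{CH}\circ\psi_\circledcirc$ from $\mathbf{Reg}$ to $\mathbf{Pred}$ belongs to $\mathbf{NP}_2$ and every $A\in\mathbf{NP}_2$ satisfies $A\le^2_{\mathrm m}\psi_\circledcirc^{-1}\circ\mathit{CH}\circ\psi_\circledcirc$.
   Context: $\Sigma^*$ is the set of finite strings over a finite alphabet $\Sigma$ (containing $0,1,+,-,/$); tuples of strings are encoded as strings by a fixed polynomial-time tupling function. A multi-function $F$ from $X$ to $Y$ is a subset of $X\times Y$; $F[x]=\{y:(x,y)\in F\}$ and $\operatorname{dom}F=\{x:F[x]\neq\emptyset\}$. A total function $\varphi:\Sigma^*\to\Sigma^*$ is regular if $|u|\le|v|$ implies $|\varphi(u)|\le|\varphi(v)|$. $\mathbf{Reg}$ is the set of regular functions and $\mathbf{Pred}\subseteq\mathbf{Reg}$ the set of regular functions with values in $\{0,1\}$. The size of $\varphi\in\mathbf{Reg}$ is the non-decreasing function $|\varphi|:\mathbb N\to\mathbb N$ with $|\varphi|(|u|)=|\varphi(u)|$. Second-order polynomials (in a type-1 variable $\mathtt L$ and type-0 variable $\mathtt n$) are defined inductively: every positive integer and the variable $\mathtt n$ are second-order polynomials, and if $P,Q$ are, so are $P+Q$, $P\cdot Q$ and $\mathtt L(P)$. Each such $P$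 defines a map sending a function $L:\mathbb N\to\mathbb N$ to the function $P(L):\mathbb N\to\mathbb N$ obtained by substitution. Machines are oracle Turing machines (with input, work, output and query tapes); on oracle $\varphi\in\mathbf{Reg}$, a query $w$ is answered by $\varphi(w)$. A deterministic machine $M$ computes a multi-function $A$ from $\mathbf{Reg}$ to $\mathbf{Reg}$ if for every $\varphi\in\operatorname{dom}A$ there is $\psi\in A[\varphi]$ such that $M$ with oracle $\varphi$ on input $u$ outputs $\psi(u)$ for every $u\in\Sigma^*$. A nondeterministic machine $M$ computes a multi-function $A$ from $\mathbf{Reg}$ to $\mathbf{Pred}$ if for every $\varphi\in\operatorname{dom}A$ there is $\psi\in A[\varphi]$ such that for all $u$, $\psi(u)=1$ iff $M^\varphi(u)$ has an accepting computation path. $M$ runs in (second-order) polynomial time if there is a second-order polynomial $P$ such that for all $\varphi\in\mathbf{Reg}$ and $u\in\Sigma^*$, $M^\varphi(u)$ halts within $P(|\varphi|)(|u|)$ steps on every computation path. $\mathbf{FP}_2$ is the class of multi-functions from $\mathbf{Reg}$ to $\mathbf{Reg}$ computed by a deterministic machine running in polynomial time. $\mathbf{NP}_2$ is the class of multi-functions from $\mathbf{Reg}$ to $\mathbf{Pred}$ computed by a nondeterministic machine running in polynomial time. For multi-functions $A,B$ from $\mathbf{Reg}$ to $\mathbf{Pred}$, $A\le^2_{\mathrm m}B$ if there are total $s,t:\mathbf{Reg}\to\mathbf{Reg}$ in $\mathbf{FP}_2$ such that for every $\varphi\in\operatorname{dom}A$, $s(\varphi)\in\operatorname{dom}B$ and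 for every $\theta\in B[s(\varphi)]$, $\theta\circ t(\varphi)\in A[\varphi]$. For representations (surjective partial functions from $\mathbf{Reg}$ onto a set) $\gamma$ of $X$, $\delta$ of $Y$ and a multi-function $A$ from $X$ to $Y$, $\delta^{-1}\circ A\circ\gamma$ is the multi-function with $(\delta^{-1}\circ A\circ\gamma)[\varphi]=\{\psi\in\operatorname{dom}\delta:\delta(\psi)\in A[\gamma(\varphi)]\}$ for $\varphi\in\operatorname{dom}\gamma$ and $\emptyset$ otherwise. Dyadic encoding: $\mathbf D$ is the set of strings $s\,x/1 0^n$ with $s\in\{+,-\}$, $x\in\{0,1\}^*$, $n\in\mathbb N$; such a string encodes the number $\llbracket s x/10^n\rrbracket=\pm(\text{$x$ read as a binary integer, leading zeros allowed})/2^n$. $\mathcal A$ is the set of closed subsets of $[0,1]^2$. For $p\in\mathbb R^2$ and $S\subseteq\mathbb R^2$, $\mathit{dist}(p,S)=\inf_{q\in S}\|p-q\|$ (Euclidean norm). The representation $\psi_\circledcirc$ of $\mathcal A$: $\varphi\in\mathbf{Pred}$ is a $\psi_\circledcirc$-name of $S\in\mathcal A$ iff for all $n\in\mathbb N$ and $u,v\in\mathbf D$: $\varphi(u,v,0^n)=1$ if $\mathit{dist}((\llbracket u\rrbracket,\llbracket v\rrbracket),S)<2^{-n}$, and $\varphi(u,v,0^n)=0$ if $\mathit{dist}((\llbracket u\rrbracket,\llbracket v\rrbracket),S)>2\cdot2^{-n}$. *)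

theory Defs
  imports "HOL-Analysis.Analysis"
begin

datatype sym = S0 | S1 | SPlus | SMinus | SSlash

type_synonym word = "sym list"
type_synonym fn = "word \<Rightarrow> word"

text \<open>Fixed polynomial-time tupling: each component x is preceded by 1^|x| 0 (prefix-free, injective).\<close>
definition tuple :: "word list \<Rightarrow> word" where
  "tuple xs = concat (map (\<lambda>x. replicate (length x) S1 @ [S0] @ x) xs)"

definition regular :: "fn \<Rightarrow> bool" where
  "regular f \<longleftrightarrow> (\<forall>u v. length u \<le> length v \<longrightarrow> length (f u) \<le> length (f v))"

definition Reg :: "fn set" where
  "Reg = {f. regular f}"

definition Pred :: "fn set" where
  "Pred = {f. regular f \<and> (\<forall>u. f u = [S0] \<or> f u = [S1])}"

text \<open>The size |f| of a regular function: |f|(|u|) = |f(u)|.\<close>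
definition regsize :: "fn \<Rightarrow> nat \<Rightarrow> nat" where
  "regsize f n = length (f (replicate n S0))"

datatype sopoly = PConst nat | PVar | PAdd sopoly sopoly | PMul sopoly sopoly | PApp sopoly

fun sp_ok :: "sopoly \<Rightarrow> bool" where
  "sp_ok (PConst c) = (c > 0)"
| "sp_ok PVar = True"
| "sp_ok (PAdd p q) = (sp_ok p \<and> sp_ok q)"
| "sp_ok (PMul p q) = (sp_ok p \<and> sp_ok q)"
| "sp_ok (PApp p) = sp_ok p"

fun sp_eval :: "sopoly \<Rightarrow> (nat \<Rightarrow> nat) \<Rightarrow> nat \<Rightarrow> nat" where
  "sp_eval (PConst c) L n = c"
| "sp_eval PVar L n = n"
| "sp_eval (PAdd p q) L n = sp_eval p L n + sp_eval q L n"
| "sp_eval (PMul p q) L n = sp_eval p L n * sp_eval q L n"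
| "sp_eval (PApp p) L n = L (sp_eval p L n)"

text \<open>Tape cells: a symbol of the alphabet or blank (None).\<close>
type_synonym cell = "sym option"

datatype dir = Lft | Rgt | Stay

fun move :: "dir \<Rightarrow> nat \<Rightarrow> nat" where
  "move Lft p = p - 1"
| "move Rgt p = p + 1"
| "move Stay p = p"

text \<open>A transition: (new state, work-tape write, work move, query-tape write, query move,
  input move, optional output symbol (written on the write-only output tape, which then moves right)).\<close>
type_synonym trans = "nat \<times> cell \<times> dir \<times> cell \<times> dir \<times> dir \<times> sym option"

record otm =
  nstates :: nat
  start :: nat
  qry :: nat
  ans :: nat
  final :: "nat set"
  acc :: "nat set"
  delta :: "nat \<Rightarrow> cell \<Rightarrow> cell \<Rightarrow> cell \<Rightarrow> trans set"
    \<comment> \<open>arguments: state, input cell, work cell, query cell\<close>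

definition wf_otm :: "otm \<Rightarrow> bool" where
  "wf_otm M \<longleftrightarrow>
     start M < nstates M \<and> qry M < nstates M \<and> ans M < nstates M \<and>
     final M \<subseteq> {..<nstates M} \<and> acc M \<subseteq> final M \<and> qry M \<notin> final M \<and>
     (\<forall>q a b c t. t \<in> delta M q a b c \<longrightarrow> fst t < nstates M) \<and>
     (\<forall>q a b c. q \<in> final M \<longrightarrow> delta M q a b c = {}) \<and>
     (\<forall>q a b c. q < nstates M \<and> q \<notin> final M \<and> q \<noteq> qry M \<longrightarrow> delta M q a b c \<noteq> {})"

definition deterministic :: "otm \<Rightarrow> bool" where
  "deterministic M \<longleftrightarrow> wf_otm M \<and>
     (\<forall>q a b c x y. x \<in> delta M q a b c \<and> y \<in> delta M q a b c \<longrightarrow> x = y)"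

record config =
  st :: nat
  ipos :: nat
  wtape :: "nat \<Rightarrow> cell"
  wpos :: nat
  qtape :: "nat \<Rightarrow> cell"
  qpos :: nat
  outp :: word

definition init_config :: "otm \<Rightarrow> config" where
  "init_config M = \<lparr>st = start M, ipos = 0, wtape = (\<lambda>_. None), wpos = 0,
                    qtape = (\<lambda>_. None), qpos = 0, outp = []\<rparr>"

definition input_cell :: "word \<Rightarrow> nat \<Rightarrow> cell" where
  "input_cell u i = (if i < length u then Some (u ! i) else None)"

definition query_word :: "(nat \<Rightarrow> cell) \<Rightarrow> word" where
  "query_word t = map (\<lambda>i. the (t i)) [0..<(LEAST i. t i = None)]"

definition word_tape :: "word \<Rightarrow> nat \<Rightarrow> cell" where
  "word_tape w = (\<lambda>i. if i < length w then Some (w ! i) else None)"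

definition step :: "otm \<Rightarrow> fn \<Rightarrow> word \<Rightarrow> config \<Rightarrow> config \<Rightarrow> bool" where
  "step M f u c c' \<longleftrightarrow>
     (if st c = qry M then
        c' = c\<lparr>st := ans M, qtape := word_tape (f (query_word (qtape c))), qpos := 0\<rparr>
      else
        (\<exists>q' ww wm qw qm im ob.
           (q', ww, wm, qw, qm, im, ob) \<in> delta M (st c) (input_cell u (ipos c))
                                            (wtape c (wpos c)) (qtape c (qpos c)) \<and>
           c' = \<lparr>st = q', ipos = move im (ipos c),
                 wtape = (wtape c)(wpos c := ww), wpos = move wm (wpos c),
                 qtape = (qtape c)(qpos c := qw), qpos = move qm (qpos c),
                 outp = outp c @ (case ob of None \<Rightarrow> [] | Some a \<Rightarrow> [a])\<rparr>))"

definition reach :: "otm \<Rightarrow> fn \<Rightarrow> word \<Rightarrow> nat \<Rightarrow> config \<Rightarrow> bool" where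
  "reach M f u k c \<longleftrightarrow> (step M f u ^^ k) (init_config M) c"

text \<open>M on oracle f and input u halts within T steps on every computation path
  (by well-formedness, every non-final configuration has a successor).\<close>
definition time_bounded :: "otm \<Rightarrow> fn \<Rightarrow> word \<Rightarrow> nat \<Rightarrow> bool" where
  "time_bounded M f u T \<longleftrightarrow> (\<forall>k c. reach M f u k c \<longrightarrow> k \<le> T)"

definition poly_time :: "otm \<Rightarrow> bool" where
  "poly_time M \<longleftrightarrow> (\<exists>P. sp_ok P \<and>
     (\<forall>f\<in>Reg. \<forall>u. time_bounded M f u (sp_eval P (regsize f) (length u))))"

definition outputs :: "otm \<Rightarrow> fn \<Rightarrow> word \<Rightarrow> word \<Rightarrow> bool" where
  "outputs M f u w \<longleftrightarrow> (\<exists>k c. reach M f u k c \<and> st c \<in> final M \<and> outp c = w)"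

definition accepts :: "otm \<Rightarrow> fn \<Rightarrow> word \<Rightarrow> bool" where
  "accepts M f u \<longleftrightarrow> (\<exists>k c. reach M f u k c \<and> st c \<in> acc M)"

type_synonym mfun = "(fn \<times> fn) set"

definition mdom :: "('a \<times> 'b) set \<Rightarrow> 'a set" where
  "mdom F = {x. \<exists>y. (x, y) \<in> F}"

definition mimg :: "('a \<times> 'b) set \<Rightarrow> 'a \<Rightarrow> 'b set" where
  "mimg F x = {y. (x, y) \<in> F}"

definition FP2 :: "mfun set" where
  "FP2 = {A. A \<subseteq> Reg \<times> Reg \<and>
     (\<exists>M. deterministic M \<and> poly_time M \<and>
        (\<forall>f\<in>mdom A. \<exists>g\<in>mimg A f. \<forall>u. outputs M f u (g u)))}"

definition NP2 :: "mfun set" where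
  "NP2 = {A. A \<subseteq> Reg \<times> Pred \<and>
     (\<exists>M. wf_otm M \<and> poly_time M \<and>
        (\<forall>f\<in>mdom A. \<exists>g\<in>mimg A f. \<forall>u. g u = [S1] \<longleftrightarrow> accepts M f u))}"

definition graph_on_Reg :: "(fn \<Rightarrow> fn) \<Rightarrow> mfun" where
  "graph_on_Reg s = {(f, s f) | f. f \<in> Reg}"

definition mreduces :: "mfun \<Rightarrow> mfun \<Rightarrow> bool" (infix "\<le>\<^sub>m\<^sub>2" 50) where
  "A \<le>\<^sub>m\<^sub>2 B \<longleftrightarrow> (\<exists>s t. graph_on_Reg s \<in> FP2 \<and> graph_on_Reg t \<in> FP2 \<and>
     (\<forall>f\<in>mdom A. s f \<in> mdom B \<and> (\<forall>th\<in>mimg B (s f). th \<circ> t f \<in> mimg A f)))"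

text \<open>Composition with representations: representations are partial surjections, modelled as
  partial maps fn \<rightharpoonup> 'x; the multi-function A from X to Y maps x to the set A x.\<close>
definition rep_comp :: "(fn \<Rightarrow> 'y option) \<Rightarrow> ('x \<Rightarrow> 'y set) \<Rightarrow> (fn \<Rightarrow> 'x option) \<Rightarrow> mfun" where
  "rep_comp \<delta> A \<gamma> = {(f, g). \<exists>x y. \<gamma> f = Some x \<and> \<delta> g = Some y \<and> y \<in> A x}"

definition D :: "word set" where
  "D = {[s] @ x @ [SSlash, S1] @ replicate n S0 | s x n.
          s \<in> {SPlus, SMinus} \<and> set x \<subseteq> {S0, S1}}"

definition bin_val :: "word \<Rightarrow> nat" where
  "bin_val x = foldl (\<lambda>a b. 2 * a + (if b = S1 then 1 else 0)) 0 x"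

text \<open>Value of a dyadic string s x/1 0^n: the sign, the binary integer x, and the exponent n
  (the number of trailing zeros after the slash-one).\<close>
definition dyad_val :: "word \<Rightarrow> real" where
  "dyad_val w = (let s = hd w; rest = tl w; x = takeWhile (\<lambda>c. c \<noteq> SSlash) rest;
                     n = length rest - length x - 2
                 in (if s = SMinus then -1 else 1) * real (bin_val x) / 2 ^ n)"

definition Acal :: "(real \<times> real) set set" where
  "Acal = {S. closed S \<and> S \<subseteq> {0..1} \<times> {0..1}}"

text \<open>Distance from a point to a set, as an extended real (infinite for the empty set).\<close>
definition setdist_e :: "real \<times> real \<Rightarrow> (real \<times> real) set \<Rightarrow> ereal" where
  "setdist_e p S = (INF q\<in>S. ereal (dist p q))"

definition is_psi_name :: "fn \<Rightarrow> (real \<times> real) set \<Rightarrow> bool" where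
  "is_psi_name f S \<longleftrightarrow> f \<in> Pred \<and> S \<in> Acal \<and>
     (\<forall>n u v. u \<in> D \<and> v \<in> D \<longrightarrow>
        (setdist_e (dyad_val u, dyad_val v) S < ereal ((1/2) ^ n)
           \<longrightarrow> f (tuple [u, v, replicate n S0]) = [S1]) \<and>
        (setdist_e (dyad_val u, dyad_val v) S > ereal (2 * (1/2) ^ n)
           \<longrightarrow> f (tuple [u, v, replicate n S0]) = [S0]))"

definition psi_circ :: "fn \<Rightarrow> (real \<times> real) set option" where
  "psi_circ f = (if \<exists>S. is_psi_name f S then Some (THE S. is_psi_name f S) else None)"

definition CH :: "(real \<times> real) set \<Rightarrow> (real \<times> real) set set" where
  "CH S = {convex hull S}"

end

theory Submission
  imports Defs
begin

text \<open>
  Membership: a point of the hull of a closed set is a convex combination of three of its points, and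
  such a combination \<open>c\<close> can be written as \<open>(2 c' + s + s') / 4\<close> with \<open>s\<close>, \<open>s'\<close> among the three points and \<open>c'\<close>
  again in their hull. Iterating this halves the influence of the start point, so a nondeterministic
  machine guesses \<open>n + 8\<close> pairs of grid points, checks each of them with the oracle, and averages.

  Hardness: take the parabola \<open>y = x\<^sup>2 / 64\<close> and attach at \<open>X = 0.e 100 000 w\<close> (binary) a vertical spike
  of height \<open>h = 2\<^sup>-\<^sup>(\<^sup>2\<^sup>l\<^sup>+\<^sup>1\<^sup>0\<^sup>)\<close>, \<open>l = |e|\<close>, whenever \<open>e\<close> is the (prefix-free) code of an input together with a
  time bound \<open>m\<close> in unary and the choices \<open>w\<close> (with \<open>|w| = 3 m\<close>) drive the given machine to acceptance.
  Spikes too thin to be decoded at precision \<open>n\<close> are too short to be seen at that precision, so a name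
  of this set is computable in polynomial time. At \<open>x = 0.e1\<close> the hull reaches \<open>h\<close> below the parabola, up to
  a small error, if some spike for \<open>e\<close> is present; otherwise the tangent at \<open>x\<close> bounds the hull from
  below, because a spike of another code word \<open>e'\<close> is at distance at least \<open>2\<^sup>-\<^sup>(\<^sup>l\<^sup>'\<^sup>+\<^sup>2\<^sup>)\<close> and hence stays above it.

  Both kinds of machines are written in a small language of stack programs, compiled to oracle Turing machines.
  The query tape is kept as it is, since one query costs one step however long the answer is.
\<close>

subsection \<open>Inevitability\<close>

text \<open>Averaging uses pairs because three weights with sum 1 may all be below 1/2: a single
  sample of weight 1/2 cannot always be split off, two samples of weight 1/4 can. Each round needs
  only additions and shifts, and it halves all earlier errors, so that rounding errors stay bounded
  by a constant number of grid units.

  For hardness the set needs a name that is computable without nondeterminism. Hence the choices are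
  part of the position of a spike: a query near a spike already contains a candidate certificate, a
  single run is replayed, and the search over all certificates is left to the convex hull. The time
  bound is written in unary so that this replay is polynomial in the query itself; the second-order
  bound of the given machine is evaluated only by the map that writes the query.

  Strict convexity keeps different inputs apart: at distance \<open>d\<close> the parabola has left
  its tangent by \<open>d^2 / 64\<close>, which dictates heights quadratic in the width
  \<open>2^-l\<close> of the cell of a code word. The factor 1/64 keeps slopes below 1/16, so
  vertical and Euclidean distances nearly agree.\<close>

primrec ev :: "('c => 'c => bool) => nat => ('c => bool) => 'c => bool" where
 "ev R 0 Q c = Q c"
| "ev R (Suc n) Q c = (Q c \<or> ((\<exists>d. R c d) \<and> (\<forall>d. R c d \<longrightarrow> ev R n Q d)))"

lemma ev_Suc: "ev R n Q c ==> ev R (Suc n) Q c"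
 by (induction n arbitrary: c) auto

lemma ev_mono: "ev R n Q c ==> n <= m ==> ev R m Q c"
 by (induction m) (auto simp: le_Suc_eq intro: ev_Suc simp del: ev.simps(2))

text \<open>Runs are verified from their end: a bound for the rest of the run yields one for the run
  with one more step. The \<open>ev_\<close> lemmas on code fragments all have this continuation
  form, with \<open>k\<close> and \<open>Q\<close> left free.\<close>

lemma ev_step: "(\<And>d. R c d \<longleftrightarrow> d = c') ==> ev R n Q c' ==> ev R (Suc n) Q c"
 by auto

text \<open>Configurations in \<open>Q\<close> are stuck, so no path outlasts the moment at which
  \<open>Q\<close> has become inevitable. This gives the time bounds.\<close>

lemma ev_bound:
 assumes "ev R n Q c" "\<And>d d'. Q d ==> \<not> R d d'" "(R ^^ k) c d"
 shows "k <= n"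
 using assms(1,3)
proof (induction n arbitrary: c k)
 case 0
 show ?case
 proof (cases k)
  case (Suc k')
  then show ?thesis using 0 assms(2) relpowp_Suc_D2[of k' R c d] by auto
 qed simp
next
 case (Suc n)
 show ?case
 proof (cases k)
  case (Suc k')
  then obtain e where e: "R c e" "(R ^^ k') e d" using Suc.prems(2) relpowp_Suc_D2[of k' R c d] by blast
  then show ?thesis using Suc.IH[of e k'] Suc.prems(1) assms(2) \<open>k = Suc k'\<close> by auto
 qed simp
qed

lemma ev_path: "ev R n Q c ==> \<exists>k d. (R ^^ k) c d \<and> Q d"
proof (induction n arbitrary: c)
 case 0
 then have "(R ^^ 0) c c \<and> Q c" by simp
 then show ?case by blast
next
 case (Suc n)
 show ?case
 proof (cases "Q c")
  case True
  then have "(R ^^ 0) c c \<and> Q c" by simp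
  then show ?thesis by blast
 next
  case False
  then obtain e where e: "R c e" "ev R n Q e" using Suc.prems by auto
  then obtain k d where "(R ^^ k) e d" "Q d" using Suc.IH by blast
  then have "(R ^^ Suc k) c d \<and> Q d" using e(1) by (meson relpowp_Suc_I2)
  then show ?thesis by blast
 qed
qed

declare ev.simps(2) [simp del]

subsection \<open>Stack programs and their semantics\<close>

text \<open>A loop eats up its stack, and \<open>ok\<close> bars its body from that stack; so
  termination is built in and the number of rounds is the height on entry. \<open>QLen\<close>
  converts the length of an answer to unary, since loops range over stacks only and answers stay on
  the query tape.\<close>

datatype com = Skip | Push nat sym | Seq com com | Case nat "cell => com" | For nat "sym => com"
 | QWr cell dir | QCase "cell => com" | QAsk | QLen nat

type_synonym store = "(nat => word) \<times> (nat => cell) \<times> nat"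

definition upd :: "nat => word => store => store" where
 "upd j w s = ((fst s)(j := w), snd s)"

lemma fst_upd [simp]: "fst (upd j w s) = (fst s)(j := w)" by (simp add: upd_def)
lemma snd_upd [simp]: "snd (upd j w s) = snd s" by (simp add: upd_def)
lemma upd_pair [simp]: "upd j w (ss, q) = (ss(j := w), q)" by (simp add: upd_def)

primrec floop :: "nat => (sym => store => store) => word => store => store" where
 "floop j G [] s = upd j [] s"
| "floop j G (a # w) s = floop j G w (G a (upd j w s))"

primrec fops :: "nat => (sym => store => store) => (sym => store => nat) => word => store => nat" where
 "fops j G H [] s = 1"
| "fops j G H (a # w) s = 1 + H a (upd j w s) + fops j G H w (G a (upd j w s))"

definition qlen :: "(nat => cell) => nat => nat" where
 "qlen t p = (LEAST i. t (p + i) = None)"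

primrec sem :: "fn => com => store => store" where
 "sem f Skip s = s"
| "sem f (Push j a) s = upd j (a # fst s j) s"
| "sem f (Seq c d) s = sem f d (sem f c s)"
| "sem f (Case j F) s = (case fst s j of [] => sem f (F None) s
   | a # w => sem f (F (Some a)) (upd j w s))"
| "sem f (For j F) s = floop j (%a. sem f (F a)) (fst s j) s"
| "sem f (QWr x d) s = (fst s, (fst (snd s))(snd (snd s) := x), move d (snd (snd s)))"
| "sem f (QCase F) s = sem f (F (fst (snd s) (snd (snd s)))) s"
| "sem f QAsk s = (fst s, word_tape (f (query_word (fst (snd s)))), 0)"
| "sem f (QLen j) s = (let l = qlen (fst (snd s)) (snd (snd s)) in
   ((fst s)(j := replicate l S1 @ fst s j), fst (snd s), snd (snd s) + l))"

primrec ops :: "fn => com => store => nat" where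
 "ops f Skip s = 1"
| "ops f (Push j a) s = 1"
| "ops f (Seq c d) s = ops f c s + ops f d (sem f c s)"
| "ops f (Case j F) s = 1 + (case fst s j of [] => ops f (F None) s
   | a # w => ops f (F (Some a)) (upd j w s))"
| "ops f (For j F) s = fops j (%a. sem f (F a)) (%a. ops f (F a)) (fst s j) s"
| "ops f (QWr x d) s = 1"
| "ops f (QCase F) s = 1 + ops f (F (fst (snd s) (snd (snd s)))) s"
| "ops f QAsk s = 1"
| "ops f (QLen j) s = 1 + qlen (fst (snd s)) (snd (snd s))"

primrec ok :: "nat set => com => bool" where
 "ok A Skip = True"
| "ok A (Push j a) = (j \<in> A)"
| "ok A (Seq c d) = (ok A c \<and> ok A d)"
| "ok A (Case j F) = (j \<in> A \<and> (\<forall>x. ok A (F x)))"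
| "ok A (For j F) = (j \<in> A \<and> (\<forall>x. ok (A - {j}) (F x)))"
| "ok A (QWr x d) = True"
| "ok A (QCase F) = (\<forall>x. ok A (F x))"
| "ok A QAsk = True"
| "ok A (QLen j) = (j \<in> A)"

lemma ok_mono: "ok A c ==> A \<subseteq> B ==> ok B c"
proof (induction c arbitrary: A B)
 case (For j F)
 have "A - {j} \<subseteq> B - {j}" using For.prems by auto
 then have "ok (B - {j}) (F x)" for x
  using For.IH[OF rangeI, of "A - {j}" x "B - {j}"] For.prems by auto
 then show ?case using For.prems by auto
next
 case (Seq c d)
 then show ?case by (metis ok.simps(3))
next
 case (Case j F)
 have "ok B (F x)" for x using Case.IH[OF rangeI, of A x B] Case.prems by simp
 then show ?case using Case.prems by auto
next
 case (QCase F)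
 have "ok B (F x)" for x using QCase.IH[OF rangeI, of A x B] QCase.prems by simp
 then show ?case using QCase.prems by auto
qed auto

lemma floop_frame:
 assumes "\<And>a s. fst (G a s) i = fst s i" "i ~= j"
 shows "fst (floop j G w s) i = fst s i"
 using assms by (induction w arbitrary: s) auto

lemma sem_frame: "ok A c ==> i \<notin> A ==> fst (sem f c s) i = fst s i"
proof (induction c arbitrary: A s)
 case (Seq c d)
 then show ?case by (metis ok.simps(3) sem.simps(3))
next
 case (Case j F)
 then have "i ~= j" "fst (sem f (F x) s) i = fst s i" for x s
  using Case.IH[OF rangeI, of A x s] by auto
 then show ?case by (auto split: list.split)
next
 case (For j F)
 then have ij: "i ~= j" by auto
 have "fst (sem f (F x) s) i = fst s i" for x s using For.IH[OF rangeI, of "A - {j}" x s] For.prems by auto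
 then show ?case using ij by (auto intro: floop_frame)
next
 case (QCase F)
 then show ?case using QCase.IH[OF rangeI, of A] by auto
qed (auto simp: Let_def)

text \<open>Guarantees that the scan made by \<open>QLen\<close> meets a blank, so that the
  \<open>LEAST\<close> in \<open>qlen\<close> is attained.\<close>

definition qfin :: "store => bool" where
 "qfin s \<longleftrightarrow> (\<exists>m. \<forall>i\<ge>m. fst (snd s) i = None)"

lemma qfin_upd [simp]: "qfin (upd j w s) = qfin s" by (simp add: qfin_def)

lemma floop_qfin: "(\<And>a s. qfin s ==> qfin (G a s)) ==> qfin s ==> qfin (floop j G w s)"
 by (induction w arbitrary: s) auto

lemma sem_qfin: "qfin s ==> qfin (sem f c s)"
proof (induction c arbitrary: s)
 case (Case j F)
 then show ?case by (auto split: list.split intro: rangeI)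
next
 case (For j F)
 then show ?case by (auto intro: rangeI floop_qfin)
next
 case (QWr x d)
 then obtain m where "\<forall>i\<ge>m. fst (snd s) i = None" by (auto simp: qfin_def)
 then have "\<forall>i\<ge>max m (Suc (snd (snd s))). fst (snd (sem f (QWr x d) s)) i = None" by auto
 then show ?case unfolding qfin_def by blast
next
 case QAsk
 have "\<forall>i\<ge>length (f (query_word (fst (snd s)))). fst (snd (sem f QAsk s)) i = None"
  by (auto simp: word_tape_def)
 then show ?case unfolding qfin_def by blast
next
 case (QLen j)
 then show ?case by (auto simp: qfin_def Let_def)
qed (auto intro: rangeI)

definition hgt :: "nat => store => bool" where
 "hgt B s \<longleftrightarrow> (\<forall>j. length (fst s j) <= B)"

lemma hgt_upd_tl: "hgt B s ==> fst s j = a # w ==> hgt B (upd j w s)"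
 unfolding hgt_def by (auto simp: upd_def dest: spec[of _ j])

lemma floop_hgt:
 assumes "\<And>a B s. hgt B s ==> hgt (B + H a s) (G a s)"
 assumes "\<And>a s. fst (G a s) j = fst s j"
 shows "hgt B s ==> fst s j = w ==> hgt (B + fops j G H w s) (floop j G w s)"
proof (induction w arbitrary: s B)
 case Nil
 then show ?case by (auto simp: hgt_def intro: le_SucI)
next
 case (Cons a w)
 have "hgt B (upd j w s)" using Cons.prems hgt_upd_tl by blast
 then have "hgt (B + H a (upd j w s)) (G a (upd j w s))" by (rule assms(1))
 then have "hgt (B + H a (upd j w s) + fops j G H w (G a (upd j w s))) (floop j G w (G a (upd j w s)))"
  by (rule Cons.IH) (simp add: assms(2))
 then show ?case by (auto simp: hgt_def intro: le_SucI simp: algebra_simps)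
qed

text \<open>Each unit of \<open>ops\<close> raises a stack by at most one symbol;
  \<open>QLen\<close> is charged for the whole length that it pushes.\<close>

lemma sem_hgt: "ok A c ==> hgt B s ==> hgt (B + ops f c s) (sem f c s)"
proof (induction c arbitrary: A B s)
 case (Seq c d)
 then have "hgt (B + ops f c s + ops f d (sem f c s)) (sem f d (sem f c s))" by (metis ok.simps(3))
 then show ?case by (simp add: add.assoc)
next
 case (Case j F)
 show ?case
 proof (cases "fst s j")
  case Nil
  then have "hgt (B + ops f (F None) s) (sem f (F None) s)"
   using Case.IH[OF rangeI, of A None B s] Case.prems by simp
  then show ?thesis using Nil by (auto simp: hgt_def intro: le_SucI)
 next
  case (Cons a w)
  then have "hgt B (upd j w s)" using Case.prems hgt_upd_tl by blast
  then have "hgt (B + ops f (F (Some a)) (upd j w s)) (sem f (F (Some a)) (upd j w s))"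
   using Case.IH[OF rangeI, of A "Some a" B "upd j w s"] Case.prems by simp
  then show ?thesis using Cons by (auto simp: hgt_def intro: le_SucI)
 qed
next
 case (For j F)
 have fr: "fst (sem f (F a) s) j = fst s j" for a s
  using For.prems sem_frame[of "A - {j}" "F a" j f s] by auto
 have "hgt (B + ops f (F a) s) (sem f (F a) s)" if "hgt B s" for a B s
  using For.IH[OF rangeI, of "A - {j}" a B s] For.prems that by simp
 then show ?case using floop_hgt[OF _ fr For.prems(2)] by simp
next
 case (QCase F)
 then have "hgt (B + ops f (F (fst (snd s) (snd (snd s)))) s) (sem f (F (fst (snd s) (snd (snd s)))) s)"
  using QCase.IH[OF rangeI, of A "fst (snd s) (snd (snd s))" B s] by simp
 then show ?case by (auto simp: hgt_def intro: le_SucI)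
qed (auto simp: hgt_def Let_def intro: le_SucI trans_le_add1)

subsection \<open>Compilation to oracle machines\<close>

type_synonym row = "cell => cell => cell => trans set"

definition wr :: "(cell => nat \<times> cell \<times> dir) => row" where
 "wr g = (%a b c. {(fst (g b), fst (snd (g b)), snd (snd (g b)), c, Stay, Stay, None)})"

definition mvt :: "dir => nat => nat => nat => row list" where
 "mvt d m b e = map (%i. wr (%x. (if Suc i = m then e else b + Suc i, x, d))) [0..<m]"

text \<open>One testing step and \<open>K\<close> further moves form a stride of
  \<open>Suc K\<close> cells, so the head stays on one track.\<close>

definition scan :: "nat => dir => (cell => (nat \<times> cell) option) => nat => row list" where
 "scan K d g b = wr (%x. case g x of Some (q, y) => (q, y, Stay) | None => (Suc b, x, d)) # mvt d K (Suc b) b"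

text \<open>On a stack track the bottom cell looks like any other. The head therefore changes to the
  ruler track, where the only nonblank cell is the origin, and strides left on it.\<close>

definition retc :: "nat => nat => nat => nat => row list" where
 "retc K j b e = mvt Lft (Suc j) b (b + Suc j) @
   scan K Lft (%x. case x of Some _ => Some (e, x) | None => None) (b + Suc j)"

definition pushc :: "nat => nat => sym => nat => nat => row list" where
 "pushc K j a b e = mvt Rgt (Suc j) b (b + Suc j) @
   scan K Rgt (%x. case x of None => Some (b + Suc j + Suc K, Some a) | Some _ => None) (b + Suc j) @
   retc K j (b + Suc j + Suc K) e"

definition retlen :: "nat => nat => nat" where "retlen K j = Suc j + Suc K"
definition pushlen :: "nat => nat => nat" where "pushlen K j = 2 * (Suc j + Suc K)"

fun sidx :: "sym => nat" where
 "sidx S0 = 0" | "sidx S1 = 1" | "sidx SPlus = 2" | "sidx SMinus = 3" | "sidx SSlash = 4"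

text \<open>The scan stops at the first blank above the stack. The ruler cell of that stride is
  inspected next: a mark means height zero, otherwise \<open>K - j\<close> more moves to the left
  reach the topmost symbol. The popped symbol is remembered in the control state, hence one copy of
  the return code per symbol.\<close>

definition popc :: "nat => nat => nat => (cell => nat) => row list" where
 "popc K j b ex = (let b1 = b + Suc j; b2 = b1 + Suc K; b3 = b2 + Suc j; b4 = Suc b3 + (K - j);
    r = (%a. Suc b4 + sidx a * retlen K j) in
   mvt Rgt (Suc j) b b1 @
   scan K Rgt (%x. case x of None => Some (b2, x) | Some _ => None) b1 @
   mvt Lft (Suc j) b2 b3 @
   wr (%x. case x of Some _ => (ex None, x, Stay) | None => (Suc b3, x, Stay)) #
   mvt Lft (K - j) (Suc b3) b4 @
   wr (%x. case x of Some a => (r a, None, Stay) | None => (b, x, Stay)) #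
   retc K j (r S0) (ex (Some S0)) @ retc K j (r S1) (ex (Some S1)) @
   retc K j (r SPlus) (ex (Some SPlus)) @ retc K j (r SMinus) (ex (Some SMinus)) @
   retc K j (r SSlash) (ex (Some SSlash)))"

definition poplen :: "nat => nat => nat" where
 "poplen K j = Suc j + Suc K + Suc j + Suc (K - j) + Suc (5 * retlen K j)"

lemma length_mvt [simp]: "length (mvt d m b e) = m" by (simp add: mvt_def)
lemma length_scan [simp]: "length (scan K d g b) = Suc K" by (simp add: scan_def)
lemma length_retc [simp]: "length (retc K j b e) = retlen K j" by (simp add: retc_def retlen_def)
lemma length_pushc [simp]: "length (pushc K j a b e) = pushlen K j"
 by (simp add: pushc_def pushlen_def retlen_def)
lemma length_popc [simp]: "length (popc K j b ex) = poplen K j"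
 by (simp add: popc_def poplen_def retlen_def Let_def)

definition boff :: "(cell => nat) => cell => nat" where
 "boff l x = (case x of None => 0 | Some a => l None + (case a of S0 => 0 | S1 => l (Some S0)
   | SPlus => l (Some S0) + l (Some S1) | SMinus => l (Some S0) + l (Some S1) + l (Some SPlus)
   | SSlash => l (Some S0) + l (Some S1) + l (Some SPlus) + l (Some SMinus)))"

definition btot :: "(cell => nat) => nat" where
 "btot l = l None + l (Some S0) + l (Some S1) + l (Some SPlus) + l (Some SMinus) + l (Some SSlash)"

definition blk :: "(cell => nat => row list) => (cell => nat) => nat => row list" where
 "blk h l b = h None (b + boff l None) @ h (Some S0) (b + boff l (Some S0)) @
   h (Some S1) (b + boff l (Some S1)) @ h (Some SPlus) (b + boff l (Some SPlus)) @
   h (Some SMinus) (b + boff l (Some SMinus)) @ h (Some SSlash) (b + boff l (Some SSlash))"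

lemma length_blk: "(\<And>x b. length (h x b) = l x) ==> length (blk h l b) = btot l"
 by (simp add: blk_def btot_def)

text \<open>Lengths do not depend on addresses, so forward jumps are known before the code that they
  jump over.\<close>

primrec clen :: "nat => com => nat" where
 "clen K Skip = 1"
| "clen K (Push j a) = pushlen K j"
| "clen K (Seq c d) = clen K c + clen K d"
| "clen K (Case j F) = poplen K j + btot (%x. clen K (F x))"
| "clen K (For j F) = poplen K j + btot (case_option 0 (%a. clen K (F a)))"
| "clen K (QWr x d) = 1"
| "clen K (QCase F) = 1 + btot (%x. clen K (F x))"
| "clen K QAsk = 2"
| "clen K (QLen j) = 1 + pushlen K j"

definition goto :: "nat => row" where "goto e = wr (%x. (e, x, Stay))"

text \<open>Code placed at \<open>b\<close> continues at \<open>e\<close>. A machine has a single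
  query state \<open>n\<close> and a single answer state, so a query has to remember where it came
  from: the return address becomes a position of the work head, reached by a chain of states that
  starts at \<open>n + b * Suc K\<close> and moves the head out by \<open>b * Suc K\<close>
  cells.\<close>

primrec comp :: "nat => nat => com => nat => nat => row list" where
 "comp K n Skip = (%b e. [goto e])"
| "comp K n (Push j a) = (%b e. pushc K j a b e)"
| "comp K n (Seq c d) = (%b e. comp K n c b (b + clen K c) @ comp K n d (b + clen K c) e)"
| "comp K n (Case j F) = (%b e. popc K j b (%x. b + poplen K j + boff (%x. clen K (F x)) x) @
   blk (%x b'. comp K n (F x) b' e) (%x. clen K (F x)) (b + poplen K j))"
| "comp K n (For j F) = (%b e.
   popc K j b (%x. case x of None => e | Some a => b + poplen K j + boff (case_option 0 (%a. clen K (F a))) x) @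
   blk (%x b'. case x of None => [] | Some a => comp K n (F a) b' b) (case_option 0 (%a. clen K (F a))) (b + poplen K j))"
| "comp K n (QWr x d) = (%b e. [%i w q. {(e, w, Stay, x, d, Stay, None)}])"
| "comp K n (QCase F) = (%b e. (%i w q. {(Suc b + boff (%x. clen K (F x)) q, w, Stay, q, Stay, Stay, None)}) #
   blk (%x b'. comp K n (F x) b' e) (%x. clen K (F x)) (Suc b))"
| "comp K n QAsk = (%b e. [goto (n + b * Suc K), goto e])"
| "comp K n (QLen j) = (%b e. (%i w q. case q of None => {(e, w, Stay, q, Stay, Stay, None)}
   | Some _ => {(Suc b, w, Stay, q, Rgt, Stay, None)}) # pushc K j S1 (Suc b) b)"

lemma length_comp [simp]: "length (comp K n c b e) = clen K c"
proof (induction c arbitrary: b e)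
 case (Case j F)
 have "length (comp K n (F x) b e) = clen K (F x)" for x b e using Case[OF rangeI] by blast
 then show ?case by (simp add: length_blk)
next
 case (For j F)
 have "length (comp K n (F x) b e) = clen K (F x)" for x b e using For[OF rangeI] by blast
 then have "length (case x of None => [] | Some a => comp K n (F a) b' b) = case_option 0 (%a. clen K (F a)) x" for x b'
  by (simp split: option.split)
 then show ?case by (simp add: length_blk)
next
 case (QCase F)
 have "length (comp K n (F x) b e) = clen K (F x)" for x b e using QCase[OF rangeI] by blast
 then show ?case by (simp add: length_blk)
qed auto

text \<open>Stack \<open>j\<close> occupies the cells congruent to \<open>j + 1\<close>, bottom first; the cells congruent to
 \<open>0\<close> form a ruler whose only mark is at the origin.\<close>

definition enc :: "nat => (nat => word) => nat => cell" where
 "enc K ss p = (let j = p mod Suc K; i = p div Suc K in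
   if j = 0 then (if i = 0 then Some S1 else None)
   else if i < length (ss (j - 1)) then Some (rev (ss (j - 1)) ! i) else None)"

lemma enc_ruler: "enc K ss (i * Suc K) = (if i = 0 then Some S1 else None)"
 by (simp add: enc_def del: mult_Suc_right)

lemma pos_mod_div:
 assumes "j < K"
 shows "(i * Suc K + Suc j) mod Suc K = Suc j" "(i * Suc K + Suc j) div Suc K = i"
proof -
 have "(Suc j + i * Suc K) div Suc K = i + Suc j div Suc K" by (rule div_mult_self1) simp
 then show "(i * Suc K + Suc j) div Suc K = i" using assms by (simp add: add.commute)
 show "(i * Suc K + Suc j) mod Suc K = Suc j" using assms by (simp del: mult_Suc_right)
qed

lemma enc_at: "j < K ==> enc K ss (i * Suc K + Suc j) = (if i < length (ss j) then Some (rev (ss j) ! i) else None)"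
 unfolding enc_def Let_def pos_mod_div by simp

lemma pos_eq: "j < K ==> p = i * Suc K + Suc j \<longleftrightarrow> p mod Suc K = Suc j \<and> p div Suc K = i"
 using pos_mod_div by (metis div_mult_mod_eq)

lemma enc_push: "j < K ==> (enc K ss)(length (ss j) * Suc K + Suc j := Some a) = enc K (ss(j := a # ss j))"
proof (rule ext)
 fix x assume j: "j < K"
 show "((enc K ss)(length (ss j) * Suc K + Suc j := Some a)) x = enc K (ss(j := a # ss j)) x"
 proof (cases "x = length (ss j) * Suc K + Suc j")
  case True
  show ?thesis unfolding True using j by (simp add: enc_at nth_append del: mult_Suc_right add_Suc_right)
 next
  case False
  then have "\<not> (x mod Suc K = Suc j \<and> x div Suc K = length (ss j))" using j pos_eq by blast
  then show ?thesis using False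
   by (auto simp: enc_def Let_def nth_append less_Suc_eq simp del: mult_Suc_right add_Suc_right)
 qed
qed

lemma enc_pop: "j < K ==> ss j = a # w ==> (enc K ss)(length w * Suc K + Suc j := None) = enc K (ss(j := w))"
proof (rule ext)
 fix x assume j: "j < K" and s: "ss j = a # w"
 show "((enc K ss)(length w * Suc K + Suc j := None)) x = enc K (ss(j := w)) x"
 proof (cases "x = length w * Suc K + Suc j")
  case True
  show ?thesis unfolding True using j by (simp add: enc_at del: mult_Suc_right add_Suc_right)
 next
  case False
  then have "\<not> (x mod Suc K = Suc j \<and> x div Suc K = length w)" using j pos_eq by blast
  then show ?thesis using False s
   by (auto simp: enc_def Let_def nth_append less_Suc_eq simp del: mult_Suc_right add_Suc_right)
 qed
qed

abbreviation C :: "nat => (nat => cell) => nat => nat => (nat => cell) \<times> nat => word => config" where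
 "C q t p i z ou \<equiv> \<lparr>st = q, ipos = i, wtape = t, wpos = p, qtape = fst z, qpos = snd z, outp = ou\<rparr>"

text \<open>\<open>walk_out\<close> moves the work head to the right and counts down to the query
  state; \<open>walk_back\<close> moves it to the left after the answer and counts up. A count that
  is a multiple of the stride, together with a nonblank cell, identifies the origin; the count
  divided by the stride is then the address of the caller, and control resumes one state
  further.\<close>

locale compiled =
 fixes M :: otm and f :: fn and u :: word and K n :: nat
 assumes qry: "qry M = n" and ans: "ans M = n + n * Suc K + 1"
  and walk_out: "\<And>p. 0 < p ==> p <= n * Suc K ==> delta M (n + p) = wr (%x. (n + p - 1, x, Rgt))"
  and walk_back: "\<And>p. p <= n * Suc K ==> delta M (n + n * Suc K + 1 + p) =
   wr (%x. if p mod Suc K = 0 \<and> x ~= None then (Suc (p div Suc K), x, Stay) else (Suc (n + n * Suc K + 1 + p), x, Lft))"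
begin

abbreviation R where "R \<equiv> step M f u"

definition has :: "nat => row list => bool" where
 "has b xs \<longleftrightarrow> b + length xs <= n \<and> (\<forall>i<length xs. delta M (b + i) = xs ! i)"

lemma has_Nil [simp]: "has b [] \<longleftrightarrow> b <= n" by (simp add: has_def)

lemma has_Cons: "has b (x # xs) \<longleftrightarrow> b < n \<and> delta M b = x \<and> has (Suc b) xs"
proof -
 have "(\<forall>i<Suc (length xs). delta M (b + i) = (x # xs) ! i) \<longleftrightarrow> delta M b = x \<and> (\<forall>i<length xs. delta M (Suc b + i) = xs ! i)"
  unfolding All_less_Suc2 by simp
 then show ?thesis unfolding has_def by auto
qed

lemma has_append: "has b (xs @ ys) \<longleftrightarrow> has b xs \<and> has (b + length xs) ys"
 by (induction xs arbitrary: b) (auto simp: has_Cons, auto simp: has_def)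

lemma ev_wr:
 assumes "delta M q = wr g" "q ~= n" "g (t p) = (q', w, d)" "ev R k Q (C q' (t(p := w)) (move d p) i z ou)"
 shows "ev R (Suc k) Q (C q t p i z ou)"
 using assms(4) by (rule ev_step[rotated]) (use assms(1-3) qry in \<open>auto simp: step_def wr_def\<close>)

lemma ev_mvt:
 assumes h: "has b (mvt d m b e)" and "ev R k Q (C e t ((move d ^^ m) p) i z ou)" "0 < m"
 shows "ev R (k + m) Q (C b t p i z ou)"
proof -
 have "ev R (k + r) Q (C (b + (m - r)) t p i z ou)"
  if "0 < r" "r <= m" "ev R k Q (C e t ((move d ^^ r) p) i z ou)" for r p
  using that
 proof (induction r arbitrary: p)
  case (Suc r)
  have d: "delta M (b + (m - Suc r)) = wr (%x. (if r = 0 then e else b + Suc (m - Suc r), x, d))"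
  proof -
   have "m - Suc r < m" using Suc.prems by simp
   then have "delta M (b + (m - Suc r)) = mvt d m b e ! (m - Suc r)"
    using h unfolding has_def length_mvt by blast
   also have "\<dots> = wr (%x. (if Suc (m - Suc r) = m then e else b + Suc (m - Suc r), x, d))"
    using Suc.prems unfolding mvt_def by (subst nth_map) auto
   also have "Suc (m - Suc r) = m \<longleftrightarrow> r = 0" using Suc.prems by auto
   finally show ?thesis .
  qed
  have n: "b + (m - Suc r) ~= n" using h Suc.prems by (auto simp: has_def)
  show ?case
  proof (cases "r = 0")
   case True
   have "ev R (Suc k) Q (C (b + (m - Suc r)) t p i z ou)"
    by (rule ev_wr[OF d n, of _ _ e "t p" d]) (use True Suc.prems in auto)
   then show ?thesis using True by simp
  next
   case False
   then have "ev R (k + r) Q (C (b + (m - r)) t (move d p) i z ou)"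
    using Suc.IH[of "move d p"] Suc.prems by (simp add: funpow_swap1)
   then have "ev R (Suc (k + r)) Q (C (b + (m - Suc r)) t p i z ou)"
    by (intro ev_wr[OF d n, of _ _ "b + (m - r)" "t p" d]) (use False Suc.prems in \<open>auto simp: Suc_diff_Suc\<close>)
   then show ?thesis by simp
  qed
 qed simp
 from this[of m p] show ?thesis using assms by simp
qed

lemma move_Rgt_pow [simp]: "(move Rgt ^^ m) p = p + m" by (induction m) auto
lemma move_Lft_pow [simp]: "(move Lft ^^ m) p = p - m" by (induction m) auto

lemma ev_scan_stop:
 assumes "has b (scan K d g b)" "g (t p) = Some (q, y)" "ev R k Q (C q (t(p := y)) p i z ou)"
 shows "ev R (Suc k) Q (C b t p i z ou)"
proof -
 have b: "delta M b = wr (%x. case g x of Some (q, y) => (q, y, Stay) | None => (Suc b, x, d))" "b ~= n"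
  using assms(1) by (auto simp: scan_def has_Cons)
 show ?thesis by (rule ev_wr[OF b, of t p q y Stay]) (use assms in auto)
qed

lemma ev_scan_go:
 assumes h: "has b (scan K d g b)" and "g (t p) = None" "0 < K" "ev R k Q (C b t ((move d ^^ Suc K) p) i z ou)"
 shows "ev R (k + Suc K) Q (C b t p i z ou)"
proof -
 have m: "has (Suc b) (mvt d K (Suc b) b)" and b: "delta M b = wr (%x. case g x of Some (q, y) => (q, y, Stay) | None => (Suc b, x, d))" "b ~= n"
  using h by (auto simp: scan_def has_Cons)
 have "ev R (k + K) Q (C (Suc b) t (move d p) i z ou)"
  by (rule ev_mvt[OF m _ \<open>0 < K\<close>]) (use assms(4) in \<open>simp add: funpow_swap1\<close>)
 then have "ev R (Suc (k + K)) Q (C b t p i z ou)"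
  by (intro ev_wr[OF b, of t p "Suc b" "t p" d]) (use assms(2) in auto)
 then show ?thesis by simp
qed

lemma ev_scan_right:
 assumes h: "has b (scan K Rgt (%x. case x of None => Some (q, y) | Some _ => None) b)" and j: "j < K"
  and e: "ev R k Q (C q ((enc K ss)(length (ss j) * Suc K + Suc j := y)) (length (ss j) * Suc K + Suc j) i z ou)"
 shows "ev R (k + Suc (length (ss j) * Suc K)) Q (C b (enc K ss) (Suc j) i z ou)"
proof -
 have "l <= length (ss j) ==> ev R (k + Suc (l * Suc K)) Q (C b (enc K ss) ((length (ss j) - l) * Suc K + Suc j) i z ou)" for l
 proof (induction l)
  case 0
  have "ev R (Suc k) Q (C b (enc K ss) (length (ss j) * Suc K + Suc j) i z ou)"
   by (rule ev_scan_stop[OF h _ e]) (simp add: enc_at[OF j] del: mult_Suc_right add_Suc_right)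
  then show ?case by simp
 next
  case (Suc l)
  have p: "(length (ss j) - l) * Suc K + Suc j = (length (ss j) - Suc l) * Suc K + Suc j + Suc K"
   using Suc.prems by (cases "length (ss j) - l") (auto simp: Suc_diff_le[symmetric] diff_Suc)
  have "ev R (k + Suc (l * Suc K) + Suc K) Q (C b (enc K ss) ((length (ss j) - Suc l) * Suc K + Suc j) i z ou)"
  proof (rule ev_scan_go[OF h])
   show "(case enc K ss ((length (ss j) - Suc l) * Suc K + Suc j) of None => Some (q, y) | Some _ => None) = None"
    unfolding enc_at[OF j] using Suc.prems by simp
   show "ev R (k + Suc (l * Suc K)) Q (C b (enc K ss) ((move Rgt ^^ Suc K) ((length (ss j) - Suc l) * Suc K + Suc j)) i z ou)"
    unfolding move_Rgt_pow p[symmetric] using Suc by simp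
  qed (use j in simp)
  then show ?case by (simp add: algebra_simps)
 qed
 from this[of "length (ss j)"] show ?thesis by simp
qed

lemma ev_scan_left:
 assumes h: "has b (scan K Lft (%x. case x of Some _ => Some (e, x) | None => None) b)" and K: "0 < K"
  and e: "ev R k Q (C e (enc K ss) 0 i z ou)"
 shows "ev R (k + Suc (l * Suc K)) Q (C b (enc K ss) (l * Suc K) i z ou)"
proof (induction l)
 case 0
 have "ev R (Suc k) Q (C b (enc K ss) 0 i z ou)"
  by (rule ev_scan_stop[OF h, of _ _ e "Some S1"]) (use e enc_ruler[of K ss 0] in \<open>auto simp: fun_upd_idem\<close>)
 then show ?case by simp
next
 case (Suc l)
 have "ev R (k + Suc (l * Suc K) + Suc K) Q (C b (enc K ss) (Suc l * Suc K) i z ou)"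
  by (rule ev_scan_go[OF h _ K]) (use Suc enc_ruler[of K ss "Suc l"] in \<open>auto\<close>)
 then show ?case by (simp add: algebra_simps)
qed

lemma ev_retc:
 assumes h: "has b (retc K j b e)" and j: "j < K" and e: "ev R k Q (C e (enc K ss) 0 i z ou)"
 shows "ev R (k + Suc (l * Suc K) + Suc j) Q (C b (enc K ss) (l * Suc K + Suc j) i z ou)"
proof (rule ev_mvt[of b Lft "Suc j" "b + Suc j"])
 show "has b (mvt Lft (Suc j) b (b + Suc j))" using h by (simp add: retc_def has_append)
 have "ev R (k + Suc (l * Suc K)) Q (C (b + Suc j) (enc K ss) (l * Suc K) i z ou)"
  by (rule ev_scan_left[OF _ _ e]) (use h j in \<open>auto simp: retc_def has_append\<close>)
 then show "ev R (k + Suc (l * Suc K)) Q (C (b + Suc j) (enc K ss) ((move Lft ^^ Suc j) (l * Suc K + Suc j)) i z ou)"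
  unfolding move_Lft_pow by simp
qed simp

lemma ev_pushc:
 assumes h: "has b (pushc K j a b e)" and j: "j < K" and e: "ev R k Q (C e (enc K (ss(j := a # ss j))) 0 i z ou)"
 shows "ev R (k + 8 * Suc K * Suc (length (ss j))) Q (C b (enc K ss) 0 i z ou)"
proof -
 let ?L = "length (ss j)"
 have "ev R (k + Suc (?L * Suc K) + Suc j) Q (C (b + Suc j + Suc K) (enc K (ss(j := a # ss j))) (?L * Suc K + Suc j) i z ou)"
  by (rule ev_retc[OF _ j e]) (use h in \<open>simp add: pushc_def has_append\<close>)
 then have "ev R (k + Suc (?L * Suc K) + Suc j + Suc (?L * Suc K)) Q (C (b + Suc j) (enc K ss) (Suc j) i z ou)"
  by (intro ev_scan_right[where q = "b + Suc j + Suc K" and y = "Some a"])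
   (use h j in \<open>simp_all add: pushc_def has_append enc_push del: mult_Suc_right add_Suc_right\<close>)
 then have "ev R (k + Suc (?L * Suc K) + Suc j + Suc (?L * Suc K) + Suc j) Q (C b (enc K ss) 0 i z ou)"
  by (intro ev_mvt[of b Rgt "Suc j" "b + Suc j"]) (use h in \<open>simp_all add: pushc_def has_append\<close>)
 then show ?thesis by (rule ev_mono) (use j in \<open>simp add: algebra_simps\<close>)
qed

lemma ev_popc_Nil:
 assumes h: "has b (popc K j b ex)" and j: "j < K" and s: "ss j = []" and e: "ev R k Q (C (ex None) (enc K ss) 0 i z ou)"
 shows "ev R (k + 8 * Suc K * Suc (length (ss j))) Q (C b (enc K ss) 0 i z ou)"
proof -
 let ?b2 = "b + Suc j + Suc K"
 note h' = h[unfolded popc_def Let_def has_append has_Cons length_mvt length_scan]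
 have h1: "has b (mvt Rgt (Suc j) b (b + Suc j))"
  and h2: "has (b + Suc j) (scan K Rgt (%x. case x of None => Some (b + Suc j + Suc K, x) | Some _ => None) (b + Suc j))"
  and h3: "has (b + Suc j + Suc K) (mvt Lft (Suc j) (b + Suc j + Suc K) (b + Suc j + Suc K + Suc j))"
  and h4: "delta M (b + Suc j + Suc K + Suc j) = wr (%x. case x of Some _ => (ex None, x, Stay) | None => (Suc (b + Suc j + Suc K + Suc j), x, Stay))"
  and h4': "b + Suc j + Suc K + Suc j ~= n"
  using h' by blast+
 have h2': "has (b + Suc j) (scan K Rgt (%x. case x of None => Some (b + Suc j + Suc K, None) | Some _ => None) (b + Suc j))"
  using h2 by (simp cong: option.case_cong)
 have "ev R (Suc k) Q (C (?b2 + Suc j) (enc K ss) 0 i z ou)"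
  by (rule ev_wr[OF h4 h4', of _ _ "ex None" "Some S1" Stay])
   (use e enc_ruler[of K ss 0] in \<open>auto simp: fun_upd_idem\<close>)
 then have "ev R (Suc k + Suc j) Q (C ?b2 (enc K ss) (Suc j) i z ou)"
  by (intro ev_mvt[OF h3]) simp_all
 then have "ev R (Suc k + Suc j + Suc (length (ss j) * Suc K)) Q (C (b + Suc j) (enc K ss) (Suc j) i z ou)"
  by (intro ev_scan_right[OF h2']) (use j s enc_at[OF j, of ss 0] in \<open>auto simp: fun_upd_idem\<close>)
 then have "ev R (Suc k + Suc j + Suc (length (ss j) * Suc K) + Suc j) Q (C b (enc K ss) 0 i z ou)"
  by (intro ev_mvt[OF h1]) simp_all
 then show ?thesis by (rule ev_mono) (use j s in simp)
qed

lemma ev_popc_Cons: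
 assumes h: "has b (popc K j b ex)" and j: "j < K" and s: "ss j = a # w"
  and e: "ev R k Q (C (ex (Some a)) (enc K (ss(j := w))) 0 i z ou)"
 shows "ev R (k + 8 * Suc K * Suc (length (ss j))) Q (C b (enc K ss) 0 i z ou)"
proof -
 let ?b2 = "b + Suc j + Suc K" let ?b3 = "?b2 + Suc j" let ?b4 = "Suc ?b3 + (K - j)"
 let ?r = "%a. Suc ?b4 + sidx a * retlen K j" let ?l = "length w"
 note h' = h[unfolded popc_def Let_def has_append has_Cons length_mvt length_scan length_retc]
 have h1: "has b (mvt Rgt (Suc j) b (b + Suc j))"
  and h2: "has (b + Suc j) (scan K Rgt (%x. case x of None => Some (b + Suc j + Suc K, x) | Some _ => None) (b + Suc j))"
  and h3: "has (b + Suc j + Suc K) (mvt Lft (Suc j) (b + Suc j + Suc K) (b + Suc j + Suc K + Suc j))"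
  and h4: "delta M (b + Suc j + Suc K + Suc j) = wr (%x. case x of Some _ => (ex None, x, Stay) | None => (Suc (b + Suc j + Suc K + Suc j), x, Stay))"
  and h4': "b + Suc j + Suc K + Suc j ~= n"
  using h' by blast+
 have h2': "has (b + Suc j) (scan K Rgt (%x. case x of None => Some (b + Suc j + Suc K, None) | Some _ => None) (b + Suc j))"
  using h2 by (simp cong: option.case_cong)
 have h5: "has (Suc ?b3) (mvt Lft (K - j) (Suc ?b3) ?b4)"
  and h6: "delta M ?b4 = wr (%x. case x of Some a => (?r a, None, Stay) | None => (b, x, Stay))"
  and h6': "?b4 ~= n"
  using h' by blast+
 have hr: "has (?r a) (retc K j (?r a) (ex (Some a)))"
 proof -
  have r: "X + sidx S0 * L = X" "X + sidx S1 * L = X + L" "X + sidx SPlus * L = X + L + L"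
   "X + sidx SMinus * L = X + L + L + L" "X + sidx SSlash * L = X + L + L + L + L" for X L :: nat by simp_all
  show ?thesis by (cases a; hypsubst; unfold r) (use h'[unfolded r] in blast)+
 qed
 have "ev R (k + Suc (?l * Suc K) + Suc j) Q (C (?r a) (enc K (ss(j := w))) (?l * Suc K + Suc j) i z ou)"
  by (rule ev_retc[OF hr j e])
 then have "ev R (Suc (k + Suc (?l * Suc K) + Suc j)) Q (C ?b4 (enc K ss) (?l * Suc K + Suc j) i z ou)"
  by (intro ev_wr[OF h6 h6', of _ _ "?r a" None Stay])
   (use j s in \<open>auto simp: enc_at[OF j] nth_append enc_pop simp del: mult_Suc_right add_Suc_right\<close>)
 then have "ev R (Suc (k + Suc (?l * Suc K) + Suc j) + (K - j)) Q (C (Suc ?b3) (enc K ss) (Suc ?l * Suc K) i z ou)"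
  by (intro ev_mvt[OF h5]) (use j in \<open>simp_all add: add.assoc\<close>)
 then have "ev R (Suc (Suc (k + Suc (?l * Suc K) + Suc j) + (K - j))) Q (C ?b3 (enc K ss) (Suc ?l * Suc K) i z ou)"
  by (intro ev_wr[OF h4 h4', of _ _ "Suc ?b3" None Stay])
   (use enc_ruler[of K ss "Suc ?l"] in \<open>auto simp: fun_upd_idem\<close>)
 then have "ev R (Suc (Suc (k + Suc (?l * Suc K) + Suc j) + (K - j)) + Suc j) Q (C ?b2 (enc K ss) (Suc ?l * Suc K + Suc j) i z ou)"
  by (intro ev_mvt[OF h3]) simp_all
 then have "ev R (Suc (Suc (k + Suc (?l * Suc K) + Suc j) + (K - j)) + Suc j + Suc (length (ss j) * Suc K)) Q (C (b + Suc j) (enc K ss) (Suc j) i z ou)"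
  by (intro ev_scan_right[OF h2'])
   (use j s enc_at[OF j, of ss "Suc ?l"] in \<open>auto simp: fun_upd_idem\<close>)
 then have "ev R (Suc (Suc (k + Suc (?l * Suc K) + Suc j) + (K - j)) + Suc j + Suc (length (ss j) * Suc K) + Suc j) Q (C b (enc K ss) 0 i z ou)"
  by (intro ev_mvt[OF h1]) simp_all
 then show ?thesis by (rule ev_mono) (use j s in \<open>simp add: algebra_simps\<close>)
qed

lemma has_blk:
 assumes "has b (blk h l b)" "\<And>x b. length (h x b) = l x"
 shows "has (b + boff l x) (h x (b + boff l x))"
 using assms
 by (cases x; (cases "the x")?) (auto simp: blk_def has_append boff_def add.assoc)

text \<open>A query changes neither the work tape nor the position of its head, so the address
  stored in that position survives. Walking out and back costs at most \<open>2 * n * Suc K\<close>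
  steps.\<close>

lemma ev_ask:
 assumes h: "has b (comp K n QAsk b e)"
  and e: "ev R k Q (C e (enc K ss) 0 i (word_tape (f (query_word (fst z))), 0) ou)"
 shows "ev R (k + (2 * n * Suc K + 4)) Q (C b (enc K ss) 0 i z ou)"
proof -
 let ?T = "Suc K" let ?A = "n + n * ?T + 1" let ?z = "(word_tape (f (query_word (fst z))), 0)"
 have b: "delta M b = goto (n + b * ?T)" "b ~= n" "Suc b < n" "delta M (Suc b) = goto e"
  using h by (auto simp: has_Cons)
 then have bT: "b * ?T <= n * ?T" by (intro mult_le_mono1) simp
 have e1: "ev R (Suc k) Q (C (Suc b) (enc K ss) 0 i ?z ou)"
  by (rule ev_wr[OF b(4)[unfolded goto_def], of _ _ e "enc K ss 0" Stay]) (use e b in auto)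
 have bk: "ev R (Suc (Suc k) + p) Q (C (?A + (b * ?T - p)) (enc K ss) p i ?z ou)" if "p <= b * ?T" for p
  using that
 proof (induction p)
  case 0
  have d: "delta M (?A + b * ?T) = wr (%x. if (b * ?T) mod ?T = 0 \<and> x ~= None then (Suc ((b * ?T) div ?T), x, Stay)
    else (Suc (?A + b * ?T), x, Lft))" by (rule walk_back[OF bT])
  have "ev R (Suc (Suc k)) Q (C (?A + b * ?T) (enc K ss) 0 i ?z ou)"
   by (rule ev_wr[OF d, of _ _ "Suc b" "Some S1" Stay])
    (use e1 enc_ruler[of K ss 0] in \<open>auto simp: fun_upd_idem simp del: mult_Suc_right\<close>)
  then show ?case by simp
 next
  case (Suc p)
  let ?p = "b * ?T - Suc p"
  have d: "delta M (?A + ?p) = wr (%x. if ?p mod ?T = 0 \<and> x ~= None then (Suc (?p div ?T), x, Stay)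
    else (Suc (?A + ?p), x, Lft))" by (rule walk_back) (use bT in simp)
  \<comment> \<open>No early stop: a count divisible by the stride puts the head on the ruler, and
    away from the origin the ruler is blank.\<close>
  have c: "\<not> (?p mod ?T = 0 \<and> enc K ss (Suc p) ~= None)"
  proof
   assume a: "?p mod ?T = 0 \<and> enc K ss (Suc p) ~= None"
   then have "?T dvd ?p" by presburger
   then have "?T dvd b * ?T - ?p" using dvd_triv_right dvd_diff_nat by blast
   then have "?T dvd Suc p" using Suc.prems by simp
   then obtain q where q: "Suc p = q * ?T" by (metis dvd_div_mult_self)
   have "enc K ss (Suc p) = None" unfolding q enc_ruler using q by (cases q) auto
   then show False using a by simp
  qed
  have "ev R (Suc (Suc (Suc k) + p)) Q (C (?A + ?p) (enc K ss) (Suc p) i ?z ou)"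
   by (rule ev_wr[OF d, of _ _ "?A + (b * ?T - p)" "enc K ss (Suc p)" Lft])
    (use Suc c in \<open>auto simp: Suc_diff_Suc simp del: mult_Suc_right\<close>)
  then show ?case by simp
 qed
 have "ev R (Suc (Suc k) + b * ?T) Q (C ?A (enc K ss) (b * ?T) i ?z ou)" using bk[of "b * ?T"] by simp
 then have q: "ev R (Suc (Suc (Suc k) + b * ?T)) Q (C n (enc K ss) (b * ?T) i z ou)"
  by (rule ev_step[rotated]) (auto simp: step_def qry ans)
 have out: "ev R (Suc (Suc (Suc k) + b * ?T) + p) Q (C (n + p) (enc K ss) (b * ?T - p) i z ou)" if "p <= b * ?T" for p
  using that
 proof (induction p)
  case (Suc p)
  have d: "delta M (n + Suc p) = wr (%x. (n + Suc p - 1, x, Rgt))"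
   by (rule walk_out) (use bT Suc.prems in auto)
  have "ev R (Suc (Suc (Suc (Suc k) + b * ?T) + p)) Q (C (n + Suc p) (enc K ss) (b * ?T - Suc p) i z ou)"
   by (rule ev_wr[OF d, of _ _ "n + p" "enc K ss (b * ?T - Suc p)" Rgt])
    (use Suc in \<open>auto simp: Suc_diff_Suc simp del: mult_Suc_right\<close>)
  then show ?case by simp
 qed (use q in simp)
 have "ev R (Suc (Suc (Suc (Suc k) + b * ?T) + b * ?T)) Q (C b (enc K ss) 0 i z ou)"
  by (rule ev_wr[OF b(1)[unfolded goto_def] b(2), of _ _ "n + b * ?T" "enc K ss 0" Stay])
   (use out[of "b * ?T"] in auto)
 then show ?thesis
 proof (rule ev_mono)
  show "Suc (Suc (Suc (Suc k) + b * ?T) + b * ?T) <= k + (2 * n * ?T + 4)"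
   using bT unfolding mult.assoc by linarith
 qed
qed

lemma qlen_step:
 assumes "t p ~= None" "\<exists>i. t (p + i) = None"
 shows "qlen t p = Suc (qlen t (Suc p))"
 unfolding qlen_def
 using Least_Suc[where P = "%i. t (p + i) = None"] assms by auto

text \<open>The first summand pays for a push or a pop at height at most \<open>B\<close>, the
  others for a query.\<close>

definition unit_cost :: "nat => nat" where
 "unit_cost B = 8 * Suc K * Suc B + 2 * n * Suc K + 4"

lemma unit_cost_ge: "l <= B ==> 8 * Suc K * Suc l <= unit_cost B"
 unfolding unit_cost_def using mult_le_mono2[of "Suc l" "Suc B" "8 * Suc K"] by linarith

text \<open>Compiler correctness in continuation form. Heights grow by at most \<open>ops\<close>,
  so \<open>B'\<close> bounds them throughout and every operation can be charged the same
  \<open>unit_cost B'\<close>.\<close>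

lemma ev_comp:
 assumes "has b (comp K n c b e)" "ok {..<K} c" "qfin s" "hgt B s" "B + ops f c s <= B'"
  "ev R k Q (C e (enc K (fst (sem f c s))) 0 i (snd (sem f c s)) ou)"
 shows "ev R (k + unit_cost B' * ops f c s) Q (C b (enc K (fst s)) 0 i (snd s) ou)"
 using assms
proof (induction c arbitrary: b e s k B)
 case Skip
 have d: "delta M b = wr (%x. (e, x, Stay))" "b ~= n" using Skip.prems(1) by (auto simp: has_Cons goto_def)
 have "ev R (Suc k) Q (C b (enc K (fst s)) 0 i (snd s) ou)"
  by (rule ev_wr[OF d, of _ _ e "enc K (fst s) 0" Stay]) (use Skip.prems(6) in auto)
 then show ?case by (rule ev_mono) (simp add: unit_cost_def)
next
 case (Push j a)
 have "length (fst s j) <= B'" using Push.prems(4,5) by (auto simp: hgt_def intro: order_trans)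
 then have *: "8 * Suc K * Suc (length (fst s j)) <= unit_cost B'" by (rule unit_cost_ge)
 have "ev R (k + 8 * Suc K * Suc (length (fst s j))) Q (C b (enc K (fst s)) 0 i (snd s) ou)"
  by (rule ev_pushc[of b j a e]) (use Push.prems in \<open>simp_all add: fun_upd_def\<close>)
 then show ?case
  by (rule ev_mono) (use * in simp)
next
 case (Seq c d)
 have h: "has b (comp K n c b (b + clen K c))" "has (b + clen K c) (comp K n d (b + clen K c) e)"
  using Seq.prems(1) by (auto simp: has_append)
 have "ev R (k + unit_cost B' * ops f d (sem f c s)) Q (C (b + clen K c) (enc K (fst (sem f c s))) 0 i (snd (sem f c s)) ou)"
  by (rule Seq.IH(2)[OF h(2), where B = "B + ops f c s"]) (use Seq.prems sem_qfin[of s f c] sem_hgt[of "{..<K}" c B s f] in auto)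
 then have "ev R (k + unit_cost B' * ops f d (sem f c s) + unit_cost B' * ops f c s) Q (C b (enc K (fst s)) 0 i (snd s) ou)"
  by (intro Seq.IH(1)[OF h(1), where B = B]) (use Seq.prems in auto)
 then show ?case by (simp add: algebra_simps)
next
 case (Case j F)
 let ?l = "%x. clen K (F x)"
 have h: "has b (popc K j b (%x. b + poplen K j + boff ?l x))"
  and hb: "has (b + poplen K j) (blk (%x b'. comp K n (F x) b' e) ?l (b + poplen K j))"
  using Case.prems(1) by (auto simp: has_append)
 have hx: "has (b + poplen K j + boff ?l x) (comp K n (F x) (b + poplen K j + boff ?l x) e)" for x
  by (rule has_blk[OF hb]) simp
 have j: "j < K" using Case.prems(2) by simp
 have "length (fst s j) <= B'" using Case.prems(4,5) by (auto simp: hgt_def intro: order_trans)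
 then have *: "8 * Suc K * Suc (length (fst s j)) <= unit_cost B'" by (rule unit_cost_ge)
 show ?case
 proof (cases "fst s j")
  case Nil
  have "ev R (k + unit_cost B' * ops f (F None) s) Q (C (b + poplen K j + boff ?l None) (enc K (fst s)) 0 i (snd s) ou)"
   by (rule Case.IH[OF rangeI hx, where B = B]) (use Case.prems Nil in auto)
  from ev_popc_Nil[OF h j Nil this] show ?thesis
   by (rule ev_mono) (use * Nil in simp)
 next
  case (Cons a w)
  have "ev R (k + unit_cost B' * ops f (F (Some a)) (upd j w s)) Q
    (C (b + poplen K j + boff ?l (Some a)) (enc K (fst (upd j w s))) 0 i (snd (upd j w s)) ou)"
   by (rule Case.IH[OF rangeI hx, where B = B]) (use Case.prems Cons hgt_upd_tl[OF _ Cons] in auto)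
  then have "ev R (k + unit_cost B' * ops f (F (Some a)) (upd j w s)) Q
    (C (b + poplen K j + boff ?l (Some a)) (enc K ((fst s)(j := w))) 0 i (snd s) ou)" by simp
  from ev_popc_Cons[OF h j Cons this] show ?thesis
   by (rule ev_mono) (use * Cons in simp)
 qed
next
 case (For j F)
 let ?l = "case_option 0 (%a. clen K (F a))"
 let ?G = "%a. sem f (F a)" let ?H = "%a. ops f (F a)"
 have h: "has b (popc K j b (%x. case x of None => e | Some a => b + poplen K j + boff ?l x))"
  and hb: "has (b + poplen K j) (blk (%x b'. case x of None => [] | Some a => comp K n (F a) b' b) ?l (b + poplen K j))"
  using For.prems(1) by (auto simp: has_append)
 have hx: "has (b + poplen K j + boff ?l (Some a)) (comp K n (F a) (b + poplen K j + boff ?l (Some a)) b)" for a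
  using has_blk[OF hb, of "Some a"] by (simp split: option.split)
 have j: "j < K" and okF: "ok ({..<K} - {j}) (F a)" for a using For.prems(2) by auto
 have okF': "ok {..<K} (F a)" for a using okF by (rule ok_mono) auto
 have fr: "fst (sem f (F a) s) j = fst s j" for a s using sem_frame[OF okF] by simp
 \<comment> \<open>Induction on the contents of the loop stack: the body ends with a jump to
   \<open>b\<close>, where the next pop finds the remaining word.\<close>
 have "ev R (k + unit_cost B' * fops j ?G ?H w s) Q (C b (enc K (fst s)) 0 i (snd s) ou)"
  if "fst s j = w" "qfin s" "hgt B s" "B + fops j ?G ?H w s <= B'"
   "ev R k Q (C e (enc K (fst (floop j ?G w s))) 0 i (snd (floop j ?G w s)) ou)" for w s B
  using that
 proof (induction w arbitrary: s B)
  case Nil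
  have l: "fst s j = []" "upd j [] s = s" using Nil.prems(1) by (simp_all add: upd_def fun_upd_idem)
  have "ev R (k + 8 * Suc K * Suc (length (fst s j))) Q (C b (enc K (fst s)) 0 i (snd s) ou)"
   by (rule ev_popc_Nil[OF h j, of "fst s"]) (use Nil.prems l in auto)
  then show ?case by (rule ev_mono) (simp add: l unit_cost_def)
 next
  case (Cons a w)
  let ?s = "upd j w s"
  have hg: "hgt B ?s" by (rule hgt_upd_tl[OF Cons.prems(3,1)])
  have "length (fst s j) <= B'" using Cons.prems(3,4) by (auto simp: hgt_def intro: order_trans)
  then have *: "8 * Suc K * Suc (length (fst s j)) <= unit_cost B'" by (rule unit_cost_ge)
  have "ev R (k + unit_cost B' * fops j ?G ?H w (?G a ?s)) Q (C b (enc K (fst (?G a ?s))) 0 i (snd (?G a ?s)) ou)"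
   by (rule Cons.IH[where B = "B + ?H a ?s"]) (use Cons.prems hg sem_qfin[of ?s f "F a"] sem_hgt[OF okF' hg] in \<open>auto simp: fr\<close>)
  then have "ev R (k + unit_cost B' * fops j ?G ?H w (?G a ?s) + unit_cost B' * ?H a ?s) Q
    (C (b + poplen K j + boff ?l (Some a)) (enc K (fst ?s)) 0 i (snd ?s) ou)"
   by (intro For.IH[OF rangeI hx, where B = B]) (use Cons.prems hg okF' in auto)
  then have "ev R (k + unit_cost B' * fops j ?G ?H w (?G a ?s) + unit_cost B' * ?H a ?s) Q
    (C (case Some a of None => e | Some x => b + poplen K j + boff ?l (Some a)) (enc K ((fst s)(j := w))) 0 i (snd s) ou)" by simp
  from ev_popc_Cons[OF h j Cons.prems(1) this] show ?case
   by (rule ev_mono) (use * in \<open>simp add: add_mult_distrib2 del: mult_Suc\<close>)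
 qed
 from this[of s "fst s j" B] show ?case using For.prems by simp
next
 case (QWr x d)
 have d: "delta M b = (%i w q. {(e, w, Stay, x, d, Stay, None)})" "b ~= n" using QWr.prems(1) by (auto simp: has_Cons)
 have "ev R (Suc k) Q (C b (enc K (fst s)) 0 i (snd s) ou)"
  using QWr.prems(6) by (rule ev_step[rotated]) (use d qry in \<open>auto simp: step_def\<close>)
 then show ?case by (rule ev_mono) (simp add: unit_cost_def)
next
 case (QCase F)
 let ?l = "%x. clen K (F x)" let ?x = "fst (snd s) (snd (snd s))"
 have d: "delta M b = (%i w q. {(Suc b + boff ?l q, w, Stay, q, Stay, Stay, None)})" "b ~= n"
  and hb: "has (Suc b) (blk (%x b'. comp K n (F x) b' e) ?l (Suc b))"
  using QCase.prems(1) by (auto simp: has_Cons)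
 have hx: "has (Suc b + boff ?l x) (comp K n (F x) (Suc b + boff ?l x) e)" for x
  by (rule has_blk[OF hb]) simp
 have "ev R (k + unit_cost B' * ops f (F ?x) s) Q (C (Suc b + boff ?l ?x) (enc K (fst s)) 0 i (snd s) ou)"
  by (rule QCase.IH[OF rangeI hx, where B = B]) (use QCase.prems in auto)
 then have "ev R (Suc (k + unit_cost B' * ops f (F ?x) s)) Q (C b (enc K (fst s)) 0 i (snd s) ou)"
  by (rule ev_step[rotated]) (use d qry in \<open>auto simp: step_def\<close>)
 then show ?case by (rule ev_mono) (simp add: unit_cost_def)
next
 case QAsk
 have "ev R (k + (2 * n * Suc K + 4)) Q (C b (enc K (fst s)) 0 i (snd s) ou)"
  by (rule ev_ask[OF QAsk.prems(1)]) (use QAsk.prems(6) in simp)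
 then show ?case by (rule ev_mono) (simp add: unit_cost_def)
next
 case (QLen j)
 have d: "delta M b = (%i w q. case q of None => {(e, w, Stay, q, Stay, Stay, None)}
   | Some _ => {(Suc b, w, Stay, q, Rgt, Stay, None)})" "b ~= n"
  and hp: "has (Suc b) (pushc K j S1 (Suc b) b)" and j: "j < K"
  using QLen.prems(1,2) by (auto simp: has_Cons)
 obtain t p where sd: "snd s = (t, p)" by (cases "snd s")
 have "ev R (k + unit_cost B' * Suc l) Q (C b (enc K ss) 0 i (t, p) ou)"
  if "l = qlen t p" "length (ss j) + l <= B'"
   "ev R k Q (C e (enc K (ss(j := replicate l S1 @ ss j))) 0 i (t, p + l) ou)" "\<exists>m. \<forall>i\<ge>m. t i = None" for l ss p
  using that
 proof (induction l arbitrary: ss p)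
  case 0
  obtain m where "\<forall>i\<ge>m. t i = None" using 0 by blast
  then have "t (p + m) = None" by simp
  then have "t (p + qlen t p) = None" unfolding qlen_def by (rule LeastI)
  then have "t p = None" using 0 by simp
  have "ev R (Suc k) Q (C b (enc K ss) 0 i (t, p) ou)"
   using 0(3) by (rule ev_step[rotated]) (use d qry \<open>t p = None\<close> in \<open>auto simp: step_def fun_upd_idem\<close>)
  then show ?case by (rule ev_mono) (simp add: unit_cost_def)
 next
  case (Suc l)
  obtain m where "\<forall>i\<ge>m. t i = None" using Suc.prems by blast
  then have ex: "\<exists>i. t (p + i) = None" by (meson le_add2)
  have np: "t p ~= None"
  proof
   assume "t p = None"
   then have "qlen t p = 0" unfolding qlen_def by (intro Least_eq_0) simp
   then show False using Suc.prems by simp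
  qed
  then have l: "l = qlen t (Suc p)" using qlen_step[OF np ex] Suc.prems by simp
  have eq: "replicate l S1 @ S1 # ss j = replicate (Suc l) S1 @ ss j" by (simp add: replicate_app_Cons_same)
  have "ev R (k + unit_cost B' * Suc l) Q (C b (enc K (ss(j := S1 # ss j))) 0 i (t, Suc p) ou)"
  proof (rule Suc.IH[OF l])
   show "ev R k Q (C e (enc K ((ss(j := S1 # ss j))(j := replicate l S1 @ (ss(j := S1 # ss j)) j))) 0 i (t, Suc p + l) ou)"
    unfolding fun_upd_upd fun_upd_same eq using Suc.prems(3) by (simp add: fun_upd_def)
  qed (use Suc.prems in auto)
  then have "ev R (k + unit_cost B' * Suc l + 8 * Suc K * Suc (length (ss j))) Q (C (Suc b) (enc K ss) 0 i (t, Suc p) ou)"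
   by (rule ev_pushc[OF hp j])
  then have "ev R (Suc (k + unit_cost B' * Suc l + 8 * Suc K * Suc (length (ss j)))) Q (C b (enc K ss) 0 i (t, p) ou)"
   by (rule ev_step[rotated]) (use d qry np in \<open>auto simp: step_def fun_upd_idem\<close>)
  then show ?case
  proof (rule ev_mono)
   have "8 * Suc K * Suc (length (ss j)) <= 8 * Suc K * Suc B'" using Suc.prems(2) by (intro mult_le_mono2) simp
   then show "Suc (k + unit_cost B' * Suc l + 8 * Suc K * Suc (length (ss j))) <= k + unit_cost B' * Suc (Suc l)"
    unfolding mult_Suc_right[of "unit_cost B'" "Suc l"] by (simp only: unit_cost_def)
  qed
 qed
 moreover have "length (fst s j) + qlen t p <= B'"
  using QLen.prems(4,5) sd by (auto simp: hgt_def intro: le_trans[OF add_le_mono1])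
 moreover have "ev R k Q (C e (enc K ((fst s)(j := replicate (qlen t p) S1 @ fst s j))) 0 i (t, p + qlen t p) ou)"
  using QLen.prems(6) sd by (simp add: Let_def fun_upd_def)
 moreover have "\<exists>m. \<forall>i\<ge>m. t i = None" using QLen.prems(3) sd by (simp add: qfin_def)
 ultimately have "ev R (k + unit_cost B' * Suc (qlen t p)) Q (C b (enc K (fst s)) 0 i (t, p) ou)" by blast
 then show ?case using sd by simp
qed

end

text \<open>If every path runs into \<open>Q\<close>, a path that has come to a halt has halted in
  \<open>Q\<close>. This is how an accepting path is shown to stem from a guess.\<close>

lemma ev_halt:
 assumes "ev R n Q c" "(R ^^ k) c d" "\<And>x. \<not> R d x" "\<And>x y. Q x ==> \<not> R x y"
 shows "Q d"
 using assms(1,2)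
proof (induction n arbitrary: c k)
 case 0
 show ?case
 proof (cases k)
  case 0
  then show ?thesis using "0.prems" by simp
 next
  case (Suc k')
  then show ?thesis using 0 assms(4) relpowp_Suc_D2[of k' R c d] by auto
 qed
next
 case (Suc n)
 show ?case
 proof (cases k)
  case 0
  then show ?thesis using Suc.prems assms(3) by (auto simp: ev.simps(2))
 next
  case (Suc k')
  then obtain e where e: "R c e" "(R ^^ k') e d" using Suc.prems(2) relpowp_Suc_D2[of k' R c d] by blast
  then show ?thesis using Suc.IH[of e k'] Suc.prems(1) assms(4) by (auto simp: ev.simps(2))
 qed
qed

definition tapply :: "trans => config => config" where
 "tapply = (%(q, ww, wm, qw, qm, im, ob) c. \<lparr>st = q, ipos = move im (ipos c),
   wtape = (wtape c)(wpos c := ww), wpos = move wm (wpos c),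
   qtape = (qtape c)(qpos c := qw), qpos = move qm (qpos c),
   outp = outp c @ (case ob of None => [] | Some a => [a])\<rparr>)"

lemma step_iff:
 "st c ~= qry M ==> step M f u c d \<longleftrightarrow>
  (\<exists>t\<in>delta M (st c) (input_cell u (ipos c)) (wtape c (wpos c)) (qtape c (qpos c)). d = tapply t c)"
 unfolding step_def tapply_def Bex_def split_paired_Ex by simp

lemma ev_rtc: "ev R n (%x. x = d) c ==> R\<^sup>*\<^sup>* c d"
 by (drule ev_path) (auto dest: relpowp_imp_rtranclp)

section \<open>Finiteness and single-valuedness of transition rows\<close>

lemma finite_cell: "finite (UNIV :: cell set)"
proof -
 have "(UNIV :: sym set) = {S0, S1, SPlus, SMinus, SSlash}" by (auto intro: sym.exhaust)
 then have "finite (UNIV :: sym set)" by (metis finite.simps)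
 then show ?thesis by (simp add: finite_option_UNIV)
qed

definition one :: "'a set => bool" where "one A \<longleftrightarrow> (\<exists>t. A = {t})"

lemma one_sing [simp]: "one {t}" by (simp add: one_def)

definition sing :: "row list => bool" where
 "sing xs \<longleftrightarrow> (\<forall>r\<in>set xs. \<forall>a b c. one (r a b c))"

lemma sing_append [simp]: "sing (xs @ ys) \<longleftrightarrow> sing xs \<and> sing ys" by (auto simp: sing_def)
lemma sing_Cons: "sing (x # xs) \<longleftrightarrow> (\<forall>a b c. one (x a b c)) \<and> sing xs" by (auto simp: sing_def)
lemma sing_Nil [simp]: "sing []" by (simp add: sing_def)
lemma wr_sing [simp]: "one (wr g a b c)" by (simp add: wr_def)
lemma sing_mvt [simp]: "sing (mvt d m b e)" by (auto simp: mvt_def sing_def)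
lemma sing_scan [simp]: "sing (scan K d g b)" by (simp add: scan_def sing_Cons)
lemma sing_retc [simp]: "sing (retc K j b e)" by (simp add: retc_def)
lemma sing_pushc [simp]: "sing (pushc K j a b e)" by (simp add: pushc_def)
lemma sing_popc [simp]: "sing (popc K j b ex)" by (simp add: popc_def Let_def sing_Cons)
lemma goto_sing [simp]: "one (goto e a b c)" by (simp add: goto_def)
lemma sing_blk: "(\<And>x b. sing (h x b)) ==> sing (blk h l b)" by (simp add: blk_def)

lemma sing_comp [simp]: "sing (comp K n c b e)"
proof (induction c arbitrary: b e)
 case (Case j F)
 have "sing (comp K n (F x) b e)" for x b e using Case[OF rangeI] by blast
 then show ?case by (simp add: sing_blk)
next
 case (For j F)
 have "sing (comp K n (F x) b e)" for x b e using For[OF rangeI] by blast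
 then have "sing (case x of None => [] | Some a => comp K n (F a) b' b)" for x b'
  by (simp split: option.split)
 then show ?case by (simp add: sing_blk)
next
 case (QCase F)
 have "sing (comp K n (F x) b e)" for x b e using QCase[OF rangeI] by blast
 then show ?case by (simp add: sing_blk sing_Cons)
next
 case (QLen j)
 then show ?case by (auto simp: sing_Cons split: option.split)
qed (auto simp: sing_Cons)

section \<open>The machine around two programs: loading, guessing, and output\<close>

definition L1 :: "nat => nat" where "L1 K = 4 + 5 * pushlen K 0"
definition Lg :: "nat => com => nat" where "Lg K c1 = L1 K + clen K c1"
definition Lc :: "nat => com => nat" where "Lc K c1 = Lg K c1 + poplen K 1"
definition L2 :: "nat => com => nat" where "L2 K c1 = Suc (Lc K c1) + 2 * pushlen K 2"
definition Lo :: "nat => com => com => nat" where "Lo K c1 c2 = L2 K c1 + clen K c2"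
definition plen :: "nat => com => com => nat" where "plen K c1 c2 = Lo K c1 c2 + poplen K 0 + 5"

definition load_row :: "nat => row" where
 "load_row K = (%a b c. {case a of None => (L1 K, b, Stay, c, Stay, Stay, None)
   | Some x => (4 + sidx x * pushlen K 0, b, Stay, c, Stay, Rgt, None)})"

text \<open>Without nondeterminism only the branch that pushes \<open>S0\<close> remains, and the
  row is single-valued.\<close>

definition guess_row :: "nat => bool => com => row" where
 "guess_row K nd c1 = (%a b c. insert (Suc (Lc K c1), b, Stay, c, Stay, Stay, None)
   (if nd then {(Suc (Lc K c1) + pushlen K 2, b, Stay, c, Stay, Stay, None)} else {}))"

definition out_row :: "nat => bool => com => com => sym => row" where
 "out_row K nd c1 c2 a = (if nd then goto (if a = S1 then 1 else 0)
   else (%i b c. {(Lo K c1 c2, b, Stay, c, Stay, Stay, Some a)}))"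

text \<open>States 0 and 1 halt, 1 accepting; state 2 writes the ruler mark and state 3 dispatches
  on the input symbol. Then follow five pushes for loading, the program \<open>c1\<close> and the
  pop that drives the guessing loop.\<close>

definition prog1 :: "nat => com => com => row list" where
 "prog1 K c1 c2 =
   [goto 0, goto 0, wr (%x. (3, Some S1, Stay)), load_row K] @
   pushc K 0 S0 (4 + sidx S0 * pushlen K 0) 3 @ pushc K 0 S1 (4 + sidx S1 * pushlen K 0) 3 @
   pushc K 0 SPlus (4 + sidx SPlus * pushlen K 0) 3 @ pushc K 0 SMinus (4 + sidx SMinus * pushlen K 0) 3 @
   pushc K 0 SSlash (4 + sidx SSlash * pushlen K 0) 3 @
   comp K (plen K c1 c2) c1 (L1 K) (Lg K c1) @
   popc K 1 (Lg K c1) (%x. case x of None => L2 K c1 | Some _ => Lc K c1)"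

definition prog2 :: "nat => bool => com => com => row list" where
 "prog2 K nd c1 c2 =
   pushc K 2 S0 (Suc (Lc K c1)) (Lg K c1) @ pushc K 2 S1 (Suc (Lc K c1) + pushlen K 2) (Lg K c1) @
   comp K (plen K c1 c2) c2 (L2 K c1) (Lo K c1 c2) @
   popc K 0 (Lo K c1 c2) (%x. case x of None => 0 | Some a => Lo K c1 c2 + poplen K 0 + sidx a) @
   [out_row K nd c1 c2 S0, out_row K nd c1 c2 S1, out_row K nd c1 c2 SPlus, out_row K nd c1 c2 SMinus, out_row K nd c1 c2 SSlash]"

definition prog :: "nat => bool => com => com => row list" where
 "prog K nd c1 c2 = prog1 K c1 c2 @ guess_row K nd c1 # prog2 K nd c1 c2"

lemma length_prog1: "length (prog1 K c1 c2) = Lc K c1"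
 by (simp add: prog1_def Lc_def Lg_def L1_def)

lemma length_prog: "length (prog K nd c1 c2) = plen K c1 c2"
 by (simp add: prog_def prog2_def length_prog1 plen_def Lo_def L2_def)

lemma sing_prog12: "sing (prog1 K c1 c2)" "sing (prog2 K nd c1 c2)"
 by (simp_all add: prog1_def prog2_def sing_Cons out_row_def load_row_def)

definition targets :: "row list => nat set" where
 "targets xs = (\<Union>r\<in>set xs. \<Union>a. \<Union>b. \<Union>c. fst ` r a b c)"

text \<open>A maximum over the actual jump targets makes the bound on successor states independent
  of the layout.\<close>

definition bigst :: "nat => bool => com => com => nat" where
 "bigst K nd c1 c2 = Suc (Max (insert (plen K c1 c2 + 2 * (plen K c1 c2 * Suc K) + 2) (targets (prog K nd c1 c2))))"

definition back_row :: "nat => nat => nat => row" where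
 "back_row K q p = wr (%x. if p mod Suc K = 0 \<and> x ~= None then (Suc (p div Suc K), x, Stay) else (Suc q, x, Lft))"

text \<open>Well-formedness asks for a transition from every non-final state other than the query
  state, hence the default row \<open>goto 0\<close>.\<close>

definition mach :: "nat => bool => com => com => otm" where
 "mach K nd c1 c2 = (let n = plen K c1 c2; A = n + n * Suc K + 1 in
  \<lparr>nstates = bigst K nd c1 c2, start = 2, qry = n, ans = A, final = {0, 1}, acc = {1},
   delta = (%q. if q < 2 then (%_ _ _. {}) else if q < n then prog K nd c1 c2 ! q
    else if n < q \<and> q < A then wr (%x. (q - 1, x, Rgt))
    else if A <= q \<and> q <= A + n * Suc K then back_row K q (q - A)
    else goto 0)\<rparr>)"

lemma finite_targets: "(\<And>r a b c. r \<in> set xs ==> finite (r a b c)) ==> finite (targets xs)"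
 unfolding targets_def by (intro finite_UN_I finite_cell) auto

lemma prog_fin:
 assumes "r \<in> set (prog K nd c1 c2)"
 shows "finite (r a b c) \<and> r a b c ~= {} \<and> (\<not> nd \<longrightarrow> one (r a b c))"
proof (cases "r = guess_row K nd c1")
 case True
 then show ?thesis by (simp add: guess_row_def)
next
 case False
 then have "r \<in> set (prog1 K c1 c2) \<union> set (prog2 K nd c1 c2)" using assms by (auto simp: prog_def)
 then have "one (r a b c)" using sing_prog12 unfolding sing_def by blast
 then show ?thesis by (auto simp: one_def)
qed

lemma mach_simps [simp]:
 "start (mach K nd c1 c2) = 2" "final (mach K nd c1 c2) = {0, 1}" "acc (mach K nd c1 c2) = {1}"
 "qry (mach K nd c1 c2) = plen K c1 c2"
 "ans (mach K nd c1 c2) = plen K c1 c2 + plen K c1 c2 * Suc K + 1"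
 "nstates (mach K nd c1 c2) = bigst K nd c1 c2"
 by (simp_all add: mach_def Let_def)

lemma plen_ge: "4 <= plen K c1 c2" by (simp add: plen_def Lo_def L2_def Lc_def Lg_def L1_def)

lemma delta_final: "q < 2 ==> delta (mach K nd c1 c2) q a b c = {}"
 by (simp add: mach_def Let_def)

lemma delta_prog: "2 <= q ==> q < plen K c1 c2 ==> delta (mach K nd c1 c2) q = prog K nd c1 c2 ! q"
 by (simp add: mach_def Let_def)

lemma delta_out: "plen K c1 c2 < q ==> q < plen K c1 c2 + plen K c1 c2 * Suc K + 1 ==>
  delta (mach K nd c1 c2) q = wr (%x. (q - 1, x, Rgt))"
 using plen_ge[of K c1 c2] by (simp add: mach_def Let_def)

lemma delta_back: "plen K c1 c2 + plen K c1 c2 * Suc K + 1 <= q ==>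
  q <= plen K c1 c2 + plen K c1 c2 * Suc K + 1 + plen K c1 c2 * Suc K ==>
  delta (mach K nd c1 c2) q = back_row K q (q - (plen K c1 c2 + plen K c1 c2 * Suc K + 1))"
 using plen_ge[of K c1 c2] by (simp add: mach_def Let_def)

lemma delta_else: "q = plen K c1 c2 \<or> q > plen K c1 c2 + plen K c1 c2 * Suc K + 1 + plen K c1 c2 * Suc K ==>
  delta (mach K nd c1 c2) q = goto 0"
 using plen_ge[of K c1 c2] by (auto simp: mach_def Let_def)

lemma delta_cases:
 obtains "q < 2" | "2 <= q" "q < plen K c d"
  | "plen K c d < q" "q < plen K c d + plen K c d * Suc K + 1"
  | "plen K c d + plen K c d * Suc K + 1 <= q" "q <= plen K c d + plen K c d * Suc K + 1 + plen K c d * Suc K"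
  | "q = plen K c d \<or> q > plen K c d + plen K c d * Suc K + 1 + plen K c d * Suc K" "2 <= q"
proof -
 let ?n = "plen K c d" let ?w = "?n * Suc K"
 have "q < 2 \<or> (2 <= q \<and> q < ?n) \<or> (?n < q \<and> q < ?n + ?w + 1) \<or> (?n + ?w + 1 <= q \<and> q <= ?n + ?w + 1 + ?w)
  \<or> ((q = ?n \<or> q > ?n + ?w + 1 + ?w) \<and> 2 <= q)" using plen_ge[of K c d] by linarith
 then show thesis using that by blast
qed

lemma mach_fin:
 assumes q: "q \<ge> 2"
 shows "delta (mach K nd c1 c2) q a b c ~= {} \<and> (\<not> nd \<longrightarrow> one (delta (mach K nd c1 c2) q a b c))"
proof -
 have o: "one A ==> A ~= {}" for A :: "trans set" by (auto simp: one_def)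
 show ?thesis
 proof (cases rule: delta_cases[where q = q and K = K and c = c1 and d = c2])
  case 2
  then show ?thesis using prog_fin[OF nth_mem, of q K nd c1 c2 a b c] by (simp add: delta_prog length_prog)
 next
  case 4
  show ?thesis unfolding delta_back[OF 4] back_row_def using o by simp
 next
  case 3
  show ?thesis unfolding delta_out[OF 3] using o by simp
 next
  case 5
  show ?thesis unfolding delta_else[OF 5(1)] using o by simp
 qed (use q in simp)
qed

lemma wf_mach: "wf_otm (mach K nd c1 c2)"
proof -
 define n where "n = plen K c1 c2"
 let ?M = "mach K nd c1 c2" let ?S = "insert (n + 2 * (n * Suc K) + 2) (targets (prog K nd c1 c2))"
 have fin: "finite ?S" using finite_targets prog_fin by blast
 have le: "x \<in> ?S ==> x < bigst K nd c1 c2" for x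
  unfolding bigst_def using Max_ge[OF fin, of x] by (simp add: n_def)
 have N: "n + 2 * (n * Suc K) + 2 < bigst K nd c1 c2" by (rule le) simp
 have N4: "4 <= n" unfolding n_def by (rule plen_ge)
 have "fst t < bigst K nd c1 c2" if t: "t \<in> delta ?M q a b c" for q a b c t
 proof (cases rule: delta_cases[where q = q and K = K and c = c1 and d = c2])
  case 1
  then show ?thesis using t by (simp add: delta_final)
 next
  case 2
  then have "t \<in> (prog K nd c1 c2 ! q) a b c" using t by (simp add: delta_prog)
  moreover have "prog K nd c1 c2 ! q \<in> set (prog K nd c1 c2)" using 2 by (simp add: length_prog)
  ultimately have "fst t \<in> targets (prog K nd c1 c2)" unfolding targets_def by blast
  then show ?thesis by (intro le) simp
 next
  case 3
  then have "fst t = q - 1" using t unfolding delta_out[OF 3] by (simp add: wr_def)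
  then show ?thesis using 3 N unfolding n_def by linarith
 next
  case 4
  let ?A = "n + n * Suc K + 1"
  have "(q - ?A) div Suc K <= (n * Suc K) div Suc K" by (rule div_le_mono) (use 4 in \<open>simp add: n_def\<close>)
  then have d: "(q - ?A) div Suc K <= n" by (simp del: mult_Suc_right)
  have "fst t = Suc ((q - ?A) div Suc K) \<or> fst t = Suc q"
   using t unfolding delta_back[OF 4, folded n_def] back_row_def wr_def by (simp only: singleton_iff split: if_splits) auto
  then show ?thesis using d 4 N unfolding n_def[symmetric] by linarith
 next
  case 5
  then have "fst t = 0" using t delta_else[of q K c1 c2 nd] by (simp add: goto_def wr_def)
  then show ?thesis using N by linarith
 qed
 then show ?thesis
  unfolding wf_otm_def mach_simps n_def[symmetric] using N N4 mach_fin[of _ K nd c1 c2] delta_final[of _ K nd c1 c2]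
  by auto
qed

lemma det_mach: "deterministic (mach K False c1 c2)"
 unfolding deterministic_def
proof (intro conjI allI impI wf_mach)
 fix q a b c x y
 assume xy: "x \<in> delta (mach K False c1 c2) q a b c \<and> y \<in> delta (mach K False c1 c2) q a b c"
 show "x = y"
 proof (cases "q < 2")
  case True
  then show ?thesis using xy by (simp add: delta_final)
 next
  case False
  then have "one (delta (mach K False c1 c2) q a b c)" using mach_fin[of q K False c1 c2 a b c] by simp
  then obtain t where "delta (mach K False c1 c2) q a b c = {t}" unfolding one_def by blast
  then show ?thesis using xy by simp
 qed
qed

definition s0 :: "word => store" where
 "s0 u = ((%_. [])(0 := rev u), (%_. None), 0)"

text \<open>The height of stack 1 prescribes how many bits are guessed; one symbol is popped there
  for each bit pushed on stack 2.\<close>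

definition guessed :: "word => store => store" where
 "guessed g s = upd 2 (g @ fst s 2) (upd 1 [] s)"

definition bits :: "word => bool" where
 "bits g \<longleftrightarrow> set g \<subseteq> {S0, S1}"

interpretation cm: compiled "mach K nd c1 c2" f u K "plen K c1 c2" for K nd c1 c2 f u
proof
 fix p assume "0 < p" "p <= plen K c1 c2 * Suc K"
 then show "delta (mach K nd c1 c2) (plen K c1 c2 + p) = wr (%x. (plen K c1 c2 + p - 1, x, Rgt))"
  by (intro delta_out) linarith+
next
 fix p assume p: "p <= plen K c1 c2 * Suc K"
 let ?A = "plen K c1 c2 + plen K c1 c2 * Suc K + 1"
 have "delta (mach K nd c1 c2) (?A + p) = back_row K (?A + p) (?A + p - ?A)"
  by (rule delta_back) (use p in linarith)+
 also have "?A + p - ?A = p" by (rule diff_add_inverse)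
 finally show "delta (mach K nd c1 c2) (?A + p) = wr (%x. if p mod Suc K = 0 \<and> x ~= None then (Suc (p div Suc K), x, Stay) else (Suc (?A + p), x, Lft))"
  unfolding back_row_def .
qed simp_all

section \<open>Runs of the whole machine\<close>

context
 fixes K :: nat and nd :: bool and c1 c2 :: com and f :: fn and u :: word
 assumes K3: "3 <= K" and ok1: "ok {..<K} c1" and ok2: "ok {..<K} c2"
begin

abbreviation "RR \<equiv> step (mach K nd c1 c2) f u"
abbreviation "hs \<equiv> cm.has K nd c1 c2"

lemma has_prog_tail: "hs 2 (drop 2 (prog K nd c1 c2))"
 unfolding cm.has_def using plen_ge[of K c1 c2] by (auto simp: length_prog delta_prog)

lemma has_parts:
 "hs 2 [wr (%x. (3, Some S1, Stay)), load_row K]"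
 "hs (4 + sidx a * pushlen K 0) (pushc K 0 a (4 + sidx a * pushlen K 0) 3)"
 "hs (L1 K) (comp K (plen K c1 c2) c1 (L1 K) (Lg K c1))"
 "hs (Lg K c1) (popc K 1 (Lg K c1) (%x. case x of None => L2 K c1 | Some _ => Lc K c1))"
 "hs (Lc K c1) [guess_row K nd c1]"
 "hs (Suc (Lc K c1)) (pushc K 2 S0 (Suc (Lc K c1)) (Lg K c1))"
 "hs (Suc (Lc K c1) + pushlen K 2) (pushc K 2 S1 (Suc (Lc K c1) + pushlen K 2) (Lg K c1))"
 "hs (L2 K c1) (comp K (plen K c1 c2) c2 (L2 K c1) (Lo K c1 c2))"
 "hs (Lo K c1 c2) (popc K 0 (Lo K c1 c2) (%x. case x of None => 0 | Some a => Lo K c1 c2 + poplen K 0 + sidx a))"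
 "hs (Lo K c1 c2 + poplen K 0 + sidx a) [out_row K nd c1 c2 a]"
proof -
 let ?x = "[wr (%x. (3, Some S1, Stay)), load_row K]"
 let ?p = "%a. pushc K 0 a (4 + sidx a * pushlen K 0) 3"
 let ?c = "comp K (plen K c1 c2) c1 (L1 K) (Lg K c1)"
 let ?g = "popc K 1 (Lg K c1) (%x. case x of None => L2 K c1 | Some _ => Lc K c1)"
 have d: "drop 2 (prog K nd c1 c2) = ?x @ ?p S0 @ ?p S1 @ ?p SPlus @ ?p SMinus @ ?p SSlash @ ?c @ ?g @
   [guess_row K nd c1] @ prog2 K nd c1 c2"
  by (simp add: prog_def prog1_def)
 have r: "4 + sidx S0 * L = (4::nat)" "4 + sidx S1 * L = 4 + L" "4 + sidx SPlus * L = 4 + L + L"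
   "4 + sidx SMinus * L = 4 + L + L + L" "4 + sidx SSlash * L = 4 + L + L + L + L" for L :: nat by simp_all
 have l1: "2 + length ?x = 4" by simp
 have l2: "4 + pushlen K 0 + pushlen K 0 + pushlen K 0 + pushlen K 0 + pushlen K 0 = L1 K" by (simp add: L1_def)
 have l3: "L1 K + clen K c1 = Lg K c1" "Lg K c1 + poplen K 1 = Lc K c1" "Lc K c1 + length [guess_row K nd c1] = Suc (Lc K c1)"
  by (simp_all add: Lg_def Lc_def)
 note h = has_prog_tail[unfolded d cm.has_append l1 length_pushc length_comp length_popc l2 l3]
 have l4: "Suc (Lc K c1) + pushlen K 2 + pushlen K 2 = L2 K c1" "L2 K c1 + clen K c2 = Lo K c1 c2" by (simp_all add: L2_def Lo_def)
 have h2: "hs (Suc (Lc K c1)) (prog2 K nd c1 c2)" using h by blast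
 note h2' = h2[unfolded prog2_def cm.has_append length_pushc length_comp length_popc l4]
 show "hs 2 ?x" "hs (L1 K) ?c" "hs (Lg K c1) ?g" "hs (Lc K c1) [guess_row K nd c1]" using h by blast+
 show "hs (4 + sidx a * pushlen K 0) (?p a)"
  by (cases a; hypsubst; unfold r) (use h[unfolded r] in blast)+
 show "hs (Suc (Lc K c1)) (pushc K 2 S0 (Suc (Lc K c1)) (Lg K c1))"
  "hs (Suc (Lc K c1) + pushlen K 2) (pushc K 2 S1 (Suc (Lc K c1) + pushlen K 2) (Lg K c1))"
  "hs (L2 K c1) (comp K (plen K c1 c2) c2 (L2 K c1) (Lo K c1 c2))"
  "hs (Lo K c1 c2) (popc K 0 (Lo K c1 c2) (%x. case x of None => 0 | Some a => Lo K c1 c2 + poplen K 0 + sidx a))"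
  using h2' by blast+
 show "hs (Lo K c1 c2 + poplen K 0 + sidx a) [out_row K nd c1 c2 a]"
  using h2' by (cases a) (auto simp: cm.has_Cons numeral_eq_Suc)
qed

lemma enc_empty: "(%_. None)(0 := Some S1) = enc K (%_. [])"
proof (rule ext)
 fix x
 show "((%_. None)(0 := Some S1)) x = enc K (%_. []) x"
  using div_mult_mod_eq[of x "Suc K"] by (auto simp: enc_def Let_def)
qed

abbreviation "UU \<equiv> cm.unit_cost K c1 c2"

lemma UU_mono: "a <= b ==> UU a <= UU b"
 unfolding cm.unit_cost_def by (intro add_mono mult_le_mono order_refl) simp

lemma ev_load:
 assumes "ev RR k Q (C (L1 K) (enc K (fst (s0 u))) 0 (length u) (%_. None, 0) [])"
 shows "ev RR (k + 2 * (length u + 2) * UU (length u)) Q (init_config (mach K nd c1 c2))"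
proof -
 let ?z = "(%_. None, 0)" let ?U = "UU (length u)"
 have h3: "delta (mach K nd c1 c2) 3 = load_row K" "3 ~= plen K c1 c2"
  and h2: "delta (mach K nd c1 c2) 2 = wr (%x. (3, Some S1, Stay))" "2 ~= plen K c1 c2"
  using has_parts(1) by (auto simp: cm.has_Cons numeral_eq_Suc)
 have "l <= length u ==> ev RR (k + 1 + l * (2 * ?U))
   Q (C 3 (enc K ((%_. [])(0 := rev (take (length u - l) u)))) 0 (length u - l) ?z [])" for l
 proof (induction l)
  case 0
  have "ev RR (Suc k) Q (C 3 (enc K ((%_. [])(0 := rev (take (length u - 0) u)))) 0 (length u - 0) ?z [])"
   using assms by (rule ev_step[rotated]) (use h3 in \<open>auto simp: step_def load_row_def input_cell_def s0_def\<close>)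
  then show ?case by (simp add: fun_upd_def)
 next
  case (Suc l)
  let ?i = "length u - Suc l" let ?w = "rev (take ?i u)"
  have i: "?i < length u" "Suc ?i = length u - l" using Suc.prems by auto
  have t: "rev (take (length u - l) u) = u ! ?i # ?w"
   using i(1) unfolding i(2)[symmetric] by (simp add: take_Suc_conv_app_nth)
  have "ev RR (k + 1 + l * (2 * ?U) + 8 * Suc K * Suc (length (((%_. [])(0 := ?w)) (0::nat)))) Q
    (C (4 + sidx (u ! ?i) * pushlen K 0) (enc K ((%_. [])(0 := ?w))) 0 (Suc ?i) ?z [])"
  proof (rule cm.ev_pushc[OF has_parts(2), where ss = "(%_. [])(0 := ?w)"])
   have e: "((%_. [])(0 := ?w))(0 := u ! ?i # ((%_. [])(0 := ?w)) 0) = (%_. [])(0 := rev (take (length u - l) u))"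
    unfolding t by simp
   show "ev RR (k + 1 + l * (2 * ?U)) Q (C 3 (enc K (((%_. [])(0 := ?w))(0 := u ! ?i # ((%_. [])(0 := ?w)) 0))) 0 (Suc ?i) ?z [])"
    unfolding e i(2) by (rule Suc.IH) (use Suc.prems in simp)
  qed (use K3 in simp)
  then have "ev RR (Suc (k + 1 + l * (2 * ?U) + 8 * Suc K * Suc (length (((%_. [])(0 := ?w)) (0::nat))))) Q
    (C 3 (enc K ((%_. [])(0 := ?w))) 0 ?i ?z [])"
   by (rule ev_step[rotated]) (use h3 i(1) in \<open>auto simp: step_def load_row_def input_cell_def\<close>)
  moreover have "8 * Suc K * Suc (length (((%_. [])(0 := ?w)) (0::nat))) <= ?U"
   by (rule cm.unit_cost_ge) simp
  moreover have "1 <= ?U" by (simp add: cm.unit_cost_def)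
  ultimately show ?case by (elim ev_mono) simp
 qed
 from this[of "length u"]
 have "ev RR (k + 1 + length u * (2 * ?U)) Q (C 3 (enc K (%_. [])) 0 0 ?z [])" by (simp add: fun_upd_idem)
 then have "ev RR (Suc (k + 1 + length u * (2 * ?U))) Q (C 2 (%_. None) 0 0 ?z [])"
  by (intro cm.ev_wr[OF h2, where q' = 3 and w = "Some S1" and d = Stay]) (auto simp: enc_empty)
 moreover have "1 <= ?U" by (simp add: cm.unit_cost_def)
 ultimately show ?thesis unfolding init_config_def by (simp, elim ev_mono) (simp add: algebra_simps)
qed

lemma guess_row_simps:
 "delta (mach K nd c1 c2) (Lc K c1) = guess_row K nd c1" "Lc K c1 ~= plen K c1 c2"
 using has_parts(5) by (auto simp: cm.has_Cons)

text \<open>Inevitability concerns all paths, so the continuation is assumed for every possible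
  guess; both branches of a guessing step then follow from the induction hypothesis.\<close>

lemma ev_guess:
 assumes "\<And>g. bits g ==> length g = length (fst s 1) ==>
   ev RR k Q (C (L2 K c1) (enc K (fst (guessed g s))) 0 i (snd s) ou)"
  and "length (fst s 1) + length (fst s 2) <= B"
 shows "ev RR (k + Suc (length (fst s 1)) * (3 * UU B)) Q (C (Lg K c1) (enc K (fst s)) 0 i (snd s) ou)"
proof -
 have U: "8 * Suc K * Suc l <= UU B" if "l <= B" for l by (rule cm.unit_cost_ge[OF that])
 have U1: "1 <= UU B" by (simp add: cm.unit_cost_def)
 have "ev RR (k + Suc (length (ss 1)) * (3 * UU B)) Q (C (Lg K c1) (enc K ss) 0 i z ou)"
  if "\<And>g. bits g ==> length g = length (ss 1) ==>
   ev RR k Q (C (L2 K c1) (enc K (ss(1 := [], 2 := g @ ss 2))) 0 i z ou)"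
   "length (ss 1) + length (ss 2) <= B" for ss z
  using that
 proof (induction "length (ss 1)" arbitrary: ss)
  case 0
  have n: "ss(1 := [], 2 := [] @ ss 2) = ss" using 0(1) by (auto simp: fun_eq_iff)
  have l: "length ([] :: word) = length (ss 1)" using 0(1) by simp
  have "ev RR k Q (C (L2 K c1) (enc K ss) 0 i z ou)"
   using 0(2)[OF _ l] unfolding n by (simp add: bits_def)
  then have "ev RR (k + 8 * Suc K * Suc (length (ss 1))) Q (C (Lg K c1) (enc K ss) 0 i z ou)"
   by (intro cm.ev_popc_Nil[OF has_parts(4)]) (use 0 K3 in auto)
  then show ?case by (rule ev_mono) (use U[of "length (ss 1)"] 0 in simp)
 next
  case (Suc l)
  then obtain a w where w: "ss 1 = a # w" by (cases "ss 1") auto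
  define ss1 where "ss1 = ss(1 := w)"
  have pb: "ev RR (k + Suc l * (3 * UU B)) Q (C (Lg K c1) (enc K (ss1(2 := b # ss1 2))) 0 i z ou)" if b: "b \<in> {S0, S1}" for b
  proof -
   let ?s = "ss1(2 := b # ss1 2)"
   have l: "l = length (?s 1)" using Suc.hyps(2) w by (simp add: ss1_def)
   have "ev RR k Q (C (L2 K c1) (enc K (?s(1 := [], 2 := g @ ?s 2))) 0 i z ou)" if "bits g" "length g = length (?s 1)" for g
   proof -
    have e: "?s(1 := [], 2 := g @ ?s 2) = ss(1 := [], 2 := (g @ [b]) @ ss 2)" by (auto simp: ss1_def fun_eq_iff)
    show ?thesis unfolding e by (rule Suc.prems(1)) (use that b w in \<open>auto simp: bits_def ss1_def\<close>)
   qed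
   from Suc.hyps(1)[OF l this] show ?thesis using Suc.prems(2) w l by (simp add: ss1_def)
  qed
  have b2: "length (ss1 2) <= B" using Suc.prems(2) by (simp add: ss1_def)
  have p0: "ev RR (k + Suc l * (3 * UU B) + UU B) Q (C (Suc (Lc K c1)) (enc K ss1) 0 i z ou)"
   by (rule ev_mono[OF cm.ev_pushc[OF has_parts(6) _ pb[of S0]]]) (use U[OF b2] K3 in auto)
  have p1: "ev RR (k + Suc l * (3 * UU B) + UU B) Q (C (Suc (Lc K c1) + pushlen K 2) (enc K ss1) 0 i z ou)"
   by (rule ev_mono[OF cm.ev_pushc[OF has_parts(7) _ pb[of S1]]]) (use U[OF b2] K3 in auto)
  have "ev RR (Suc (k + Suc l * (3 * UU B) + UU B)) Q (C (Lc K c1) (enc K ss1) 0 i z ou)"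
  proof -
   have st: "RR (C (Lc K c1) (enc K ss1) 0 i z ou) d \<longleftrightarrow> d = C (Suc (Lc K c1)) (enc K ss1) 0 i z ou \<or>
     (nd \<and> d = C (Suc (Lc K c1) + pushlen K 2) (enc K ss1) 0 i z ou)" for d
    using guess_row_simps by (cases nd) (simp_all add: step_iff guess_row_def tapply_def)
   show ?thesis unfolding ev.simps(2)
   proof (intro disjI2 conjI allI impI)
    show "\<exists>d. RR (C (Lc K c1) (enc K ss1) 0 i z ou) d" using st by blast
    fix d assume "RR (C (Lc K c1) (enc K ss1) 0 i z ou) d"
    then show "ev RR (k + Suc l * (3 * UU B) + UU B) Q d"
     unfolding st by (elim disjE conjE; hypsubst) (rule p0 p1)+
   qed
  qed
  then have "ev RR (Suc (k + Suc l * (3 * UU B) + UU B) + 8 * Suc K * Suc (length (ss 1))) Q (C (Lg K c1) (enc K ss) 0 i z ou)"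
   by (intro cm.ev_popc_Cons[OF has_parts(4), where ss = ss and a = a and w = w]) (use K3 w in \<open>auto simp: ss1_def\<close>)
  then show ?case
  proof (rule ev_mono)
   have "8 * Suc K * Suc (length (ss 1)) <= UU B" by (rule U) (use Suc.prems(2) in simp)
   then show "Suc (k + Suc l * (3 * UU B) + UU B) + 8 * Suc K * Suc (length (ss 1)) <= k + Suc (length (ss 1)) * (3 * UU B)"
    unfolding Suc.hyps(2)[symmetric] mult_Suc[of "Suc l"] using U1 by linarith
  qed
 qed
 from this[of "fst s" "snd s"] show ?thesis using assms by (simp add: guessed_def)
qed

lemma out_row_simps:
 "delta (mach K nd c1 c2) (Lo K c1 c2 + poplen K 0 + sidx a) = out_row K nd c1 c2 a"
 "Lo K c1 c2 + poplen K 0 + sidx a ~= plen K c1 c2"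
 using has_parts(10)[of a] by (auto simp: cm.has_Cons)

lemma ev_output:
 assumes "\<not> nd" "ev RR k Q (C 0 (enc K (ss(0 := []))) 0 i z (ou @ ss 0))" "length (ss 0) <= B"
 shows "ev RR (k + Suc (length (ss 0)) * (2 * UU B)) Q (C (Lo K c1 c2) (enc K ss) 0 i z ou)"
 using assms(2,3)
proof (induction "ss 0" arbitrary: ss ou)
 case Nil
 have "ss(0 := []) = ss" using Nil(1) by (auto simp: fun_eq_iff)
 then have "ev RR (k + 8 * Suc K * Suc (length (ss 0))) Q (C (Lo K c1 c2) (enc K ss) 0 i z ou)"
  by (intro cm.ev_popc_Nil[OF has_parts(9), where ss = ss]) (use Nil K3 in auto)
 then show ?case by (rule ev_mono) (use cm.unit_cost_ge[OF Nil(3), of K c1 c2] Nil in simp)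
next
 case (Cons a w)
 have "ev RR (k + Suc (length w) * (2 * UU B)) Q (C (Lo K c1 c2) (enc K (ss(0 := w))) 0 i z (ou @ [a]))"
 proof -
  have e: "ss 0 = a # w" using Cons(2) by simp
  have "ev RR (k + Suc (length ((ss(0 := w)) 0)) * (2 * UU B)) Q (C (Lo K c1 c2) (enc K (ss(0 := w))) 0 i z (ou @ [a]))"
  proof (rule Cons(1))
   show "ev RR k Q (C 0 (enc K ((ss(0 := w))(0 := []))) 0 i z ((ou @ [a]) @ (ss(0 := w)) 0))"
    using Cons(3) unfolding fun_upd_upd fun_upd_same e by simp
  qed (use Cons(4) e in simp_all)
  then show ?thesis by simp
 qed
 then have "ev RR (Suc (k + Suc (length w) * (2 * UU B))) Q (C (Lo K c1 c2 + poplen K 0 + sidx a) (enc K (ss(0 := w))) 0 i z ou)"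
  by (rule ev_step[rotated]) (use out_row_simps[of a] assms(1) in \<open>simp add: step_iff out_row_def tapply_def\<close>)
 then have "ev RR (Suc (k + Suc (length w) * (2 * UU B)) + 8 * Suc K * Suc (length (ss 0))) Q (C (Lo K c1 c2) (enc K ss) 0 i z ou)"
  by (intro cm.ev_popc_Cons[OF has_parts(9), where ss = ss and a = a and w = w]) (use Cons(2)[symmetric] K3 in auto)
 then show ?case
 proof (rule ev_mono)
  have "1 <= UU B" by (simp add: cm.unit_cost_def)
  then show "Suc (k + Suc (length w) * (2 * UU B)) + 8 * Suc K * Suc (length (ss 0)) <= k + Suc (length (ss 0)) * (2 * UU B)"
   using cm.unit_cost_ge[OF Cons(4), of K c1 c2] unfolding Cons(2)[symmetric] by simp
 qed
qed

lemma ev_accept: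
 assumes "nd" "ev RR k Q (C (if ss 0 ~= [] \<and> hd (ss 0) = S1 then 1 else 0) (enc K (ss(0 := tl (ss 0)))) 0 i z ou)" "length (ss 0) <= B"
 shows "ev RR (k + 2 * UU B) Q (C (Lo K c1 c2) (enc K ss) 0 i z ou)"
proof (cases "ss 0")
 case Nil
 have "ss(0 := []) = ss" using Nil(1) by (auto simp: fun_eq_iff)
 then have "ev RR (k + 8 * Suc K * Suc (length (ss 0))) Q (C (Lo K c1 c2) (enc K ss) 0 i z ou)"
  by (intro cm.ev_popc_Nil[OF has_parts(9), where ss = ss]) (use Nil K3 assms(2) in auto)
 then show ?thesis by (rule ev_mono) (use cm.unit_cost_ge[OF assms(3), of K c1 c2] Nil in simp)
next
 case (Cons a w)
 have "ev RR (Suc k) Q (C (Lo K c1 c2 + poplen K 0 + sidx a) (enc K (ss(0 := w))) 0 i z ou)"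
  using assms(2) by (rule ev_step[rotated]) (use out_row_simps[of a] assms(1) Cons in \<open>simp add: step_iff out_row_def tapply_def goto_def wr_def\<close>)
 then have "ev RR (Suc k + 8 * Suc K * Suc (length (ss 0))) Q (C (Lo K c1 c2) (enc K ss) 0 i z ou)"
  by (intro cm.ev_popc_Cons[OF has_parts(9), where ss = ss and a = a and w = w]) (use Cons K3 in auto)
 moreover have "1 <= UU B" by (simp add: cm.unit_cost_def)
 ultimately show ?thesis using cm.unit_cost_ge[OF assms(3), of K c1 c2] by (elim ev_mono) simp
qed

text \<open>The counterpart of \<open>ev_guess\<close>: a prescribed guess is realised by some path.
  The induction is from the right because the last symbol of \<open>g\<close> is pushed
  first.\<close>

lemma guess_path:
 assumes nd "bits g"
 shows "length g = length (ss 1) ==> RR\<^sup>*\<^sup>* (C (Lg K c1) (enc K ss) 0 i z ou) (C (L2 K c1) (enc K (ss(1 := [], 2 := g @ ss 2))) 0 i z ou)"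
 using assms(2)
proof (induction g arbitrary: ss rule: rev_induct)
 case Nil
 have "ss(1 := [], 2 := [] @ ss 2) = ss" using Nil(1) by (auto simp: fun_eq_iff)
 moreover have "ev RR (0 + 8 * Suc K * Suc (length (ss 1))) (%x. x = C (L2 K c1) (enc K ss) 0 i z ou) (C (Lg K c1) (enc K ss) 0 i z ou)"
  by (intro cm.ev_popc_Nil[OF has_parts(4), where ss = ss]) (use Nil K3 in auto)
 ultimately show ?case using ev_rtc by metis
next
 case (snoc b g)
 then obtain a w where w: "ss 1 = a # w" by (cases "ss 1") auto
 define ss1 where "ss1 = ss(1 := w)"
 let ?s = "ss1(2 := b # ss1 2)"
 have e: "?s(1 := [], 2 := g @ ?s 2) = ss(1 := [], 2 := (g @ [b]) @ ss 2)" by (auto simp: ss1_def fun_eq_iff)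
 have p1: "RR\<^sup>*\<^sup>* (C (Lg K c1) (enc K ?s) 0 i z ou) (C (L2 K c1) (enc K (?s(1 := [], 2 := g @ ?s 2))) 0 i z ou)"
  by (rule snoc.IH) (use snoc.prems w in \<open>auto simp: bits_def ss1_def\<close>)
 let ?q = "if b = S0 then Suc (Lc K c1) else Suc (Lc K c1) + pushlen K 2"
 have b: "b = S0 \<or> b = S1" using snoc.prems by (auto simp: bits_def)
 have "ev RR (0 + 8 * Suc K * Suc (length (ss1 2))) (%x. x = C (Lg K c1) (enc K ?s) 0 i z ou) (C ?q (enc K ss1) 0 i z ou)"
  using b
 proof
  assume "b = S0"
  then show ?thesis by (intro cm.ev_pushc[where ss = ss1 and j = 2 and a = b and e = "Lg K c1"]) (use has_parts(6) K3 in auto)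
 next
  assume "b = S1"
  then show ?thesis by (intro cm.ev_pushc[where ss = ss1 and j = 2 and a = b and e = "Lg K c1"]) (use has_parts(7) K3 in auto)
 qed
 then have p2: "RR\<^sup>*\<^sup>* (C ?q (enc K ss1) 0 i z ou) (C (Lg K c1) (enc K ?s) 0 i z ou)" by (rule ev_rtc)
 have p3: "RR (C (Lc K c1) (enc K ss1) 0 i z ou) (C ?q (enc K ss1) 0 i z ou)"
  using guess_row_simps b assms(1) by (auto simp: step_iff guess_row_def tapply_def)
 have "ev RR (0 + 8 * Suc K * Suc (length (ss 1))) (%x. x = C (Lc K c1) (enc K ss1) 0 i z ou) (C (Lg K c1) (enc K ss) 0 i z ou)"
  by (intro cm.ev_popc_Cons[OF has_parts(4), where ss = ss and a = a and w = w]) (use K3 w in \<open>auto simp: ss1_def\<close>)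
 then have p4: "RR\<^sup>*\<^sup>* (C (Lg K c1) (enc K ss) 0 i z ou) (C (Lc K c1) (enc K ss1) 0 i z ou)" by (rule ev_rtc)
 show ?case using p4 p3 p2 p1 unfolding e by (meson rtranclp_trans rtranclp.rtrancl_into_rtrancl)
qed

definition fin :: "word => config" where
 "fin g = (let s = sem f c2 (guessed g (sem f c1 (s0 u))); w = fst s 0 in
   if nd then C (if w ~= [] \<and> hd w = S1 then 1 else 0) (enc K ((fst s)(0 := tl w))) 0 (length u) (snd s) []
   else C 0 (enc K ((fst s)(0 := []))) 0 (length u) (snd s) w)"

lemma qfin_s0: "qfin (s0 u)" by (simp add: qfin_def s0_def)
lemma hgt_s0: "hgt (length u) (s0 u)" by (simp add: hgt_def s0_def)

lemma hgt_mono: "hgt a s ==> a <= b ==> hgt b s" by (auto simp: hgt_def intro: order_trans)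

lemma hgt_guessed: "hgt a s ==> length g <= a ==> hgt (2 * a) (guessed g s)"
 unfolding hgt_def guessed_def by (auto intro: order_trans add_le_mono simp: mult_2 trans_le_add1)

lemma ev_finish:
 assumes g: "length g = length (fst (sem f c1 (s0 u)) 1)"
  and X: "length u + ops f c1 (s0 u) + ops f c2 (guessed g (sem f c1 (s0 u))) <= X"
  and Q: "Q (fin g)"
 shows "ev RR (UU (2 * X) * (2 * (2 * X + 1)) + UU (2 * X) * X) Q
  (C (L2 K c1) (enc K (fst (guessed g (sem f c1 (s0 u))))) 0 (length u) (snd (sem f c1 (s0 u))) [])"
proof -
 let ?s1 = "sem f c1 (s0 u)" let ?s2 = "guessed g ?s1" let ?s3 = "sem f c2 ?s2" let ?U = "UU (2 * X)"
 have h1: "hgt (length u + ops f c1 (s0 u)) ?s1" by (rule sem_hgt[OF ok1 hgt_s0])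
 have h2: "hgt (2 * (length u + ops f c1 (s0 u))) ?s2" by (rule hgt_guessed[OF h1]) (use g h1 in \<open>simp add: hgt_def\<close>)
 have h3: "hgt (2 * X) ?s3" by (rule hgt_mono[OF sem_hgt[OF ok2 h2]]) (use X in simp)
 then have l: "length (fst ?s3 0) <= 2 * X" by (simp add: hgt_def)
 have q1: "qfin ?s2" using sem_qfin[OF qfin_s0] by (simp add: guessed_def)
 have "ev RR (?U * (2 * (2 * X + 1))) Q (C (Lo K c1 c2) (enc K (fst ?s3)) 0 (length u) (snd ?s3) [])"
 proof (cases nd)
  case True
  have "ev RR (0 + 2 * ?U) Q (C (Lo K c1 c2) (enc K (fst ?s3)) 0 (length u) (snd ?s3) [])"
   using Q unfolding fin_def Let_def by (intro ev_accept[where ss = "fst ?s3"] True l) (use True in simp)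
  then show ?thesis by (rule ev_mono) simp
 next
  case False
  have "ev RR (0 + Suc (length (fst ?s3 0)) * (2 * ?U)) Q (C (Lo K c1 c2) (enc K (fst ?s3)) 0 (length u) (snd ?s3) [])"
   using Q unfolding fin_def Let_def by (intro ev_output[where ss = "fst ?s3"] False l) (use False in simp)
  then show ?thesis
  proof (rule ev_mono)
   have "Suc (length (fst ?s3 0)) * (2 * ?U) <= (2 * X + 1) * (2 * ?U)" using l by (intro mult_le_mono) simp_all
   then show "0 + Suc (length (fst ?s3 0)) * (2 * ?U) <= ?U * (2 * (2 * X + 1))" by (simp add: algebra_simps)
  qed
 qed
 then have "ev RR (?U * (2 * (2 * X + 1)) + ?U * ops f c2 ?s2) Q (C (L2 K c1) (enc K (fst ?s2)) 0 (length u) (snd ?s2) [])"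
  by (intro cm.ev_comp[OF has_parts(8) ok2 q1 h2]) (use X in auto)
 then have "ev RR (?U * (2 * (2 * X + 1)) + ?U * ops f c2 ?s2) Q (C (L2 K c1) (enc K (fst ?s2)) 0 (length u) (snd ?s1) [])"
  by (simp add: guessed_def)
 then show ?thesis by (rule ev_mono) (use X in simp)
qed

lemma ev_prefix:
 assumes "ev RR k Q (C (Lg K c1) (enc K (fst (sem f c1 (s0 u)))) 0 (length u) (snd (sem f c1 (s0 u))) [])"
  "length u + ops f c1 (s0 u) <= B"
 shows "ev RR (k + UU B * ops f c1 (s0 u) + 2 * (length u + 2) * UU (length u)) Q (init_config (mach K nd c1 c2))"
proof -
 have "ev RR (k + UU B * ops f c1 (s0 u)) Q (C (L1 K) (enc K (fst (s0 u))) 0 (length u) (snd (s0 u)) [])"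
  by (rule cm.ev_comp[OF has_parts(3) ok1 qfin_s0 hgt_s0]) (use assms in auto)
 then show ?thesis by (intro ev_load) (simp add: s0_def)
qed

lemma ev_total:
 assumes X: "\<And>g. bits g ==> length g = length (fst (sem f c1 (s0 u)) 1) ==>
   length u + ops f c1 (s0 u) + ops f c2 (guessed g (sem f c1 (s0 u))) <= X"
  and Q: "\<And>g. bits g ==> length g = length (fst (sem f c1 (s0 u)) 1) ==> Q (fin g)"
 shows "ev RR (15 * (16 * Suc K + 2 * plen K c1 c2 * Suc K + 4) * (X + 1) * (X + 1)) Q (init_config (mach K nd c1 c2))"
proof -
 let ?s1 = "sem f c1 (s0 u)" let ?l = "length (fst ?s1 1)" let ?U = "UU (2 * X)"
 have X1: "length u + ops f c1 (s0 u) <= X"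
 proof -
  have "bits (replicate ?l S0)" by (auto simp: bits_def)
  from X[OF this] show ?thesis by simp
 qed
 have h1: "hgt X ?s1" by (rule hgt_mono[OF sem_hgt[OF ok1 hgt_s0] X1])
 have "ev RR (?U * (2 * (2 * X + 1)) + ?U * X + Suc ?l * (3 * ?U)) Q (C (Lg K c1) (enc K (fst ?s1)) 0 (length u) (snd ?s1) [])"
 proof (rule ev_guess)
  show "ev RR (?U * (2 * (2 * X + 1)) + ?U * X) Q (C (L2 K c1) (enc K (fst (guessed g ?s1))) 0 (length u) (snd ?s1) [])"
   if "bits g" "length g = length (fst ?s1 1)" for g
   by (rule ev_finish) (use X Q that in auto)
  have "length (fst ?s1 1) <= X" "length (fst ?s1 2) <= X" using h1 unfolding hgt_def by blast+
  then show "length (fst ?s1 1) + length (fst ?s1 2) <= 2 * X" by simp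
 qed
 then have "ev RR (?U * (2 * (2 * X + 1)) + ?U * X + Suc ?l * (3 * ?U) + UU X * ops f c1 (s0 u) + 2 * (length u + 2) * UU (length u))
   Q (init_config (mach K nd c1 c2))" by (rule ev_prefix[OF _ X1])
 then show ?thesis
 proof (rule ev_mono)
  have a: "UU X * ops f c1 (s0 u) <= ?U * X" by (intro mult_le_mono UU_mono) (use X1 in simp_all)
  have b: "2 * (length u + 2) * UU (length u) <= 2 * (X + 2) * ?U" by (intro mult_le_mono UU_mono) (use X1 in simp_all)
  have c: "Suc ?l * (3 * ?U) <= (X + 1) * (3 * ?U)" using h1 by (intro mult_le_mono) (simp_all add: hgt_def)
  have U: "?U <= (16 * Suc K + 2 * plen K c1 c2 * Suc K + 4) * (X + 1)"
   unfolding cm.unit_cost_def by (simp add: algebra_simps)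
  have "?U * (2 * (2 * X + 1)) + ?U * X + Suc ?l * (3 * ?U) + UU X * ops f c1 (s0 u) + 2 * (length u + 2) * UU (length u)
   <= ?U * (2 * (2 * X + 1)) + ?U * X + (X + 1) * (3 * ?U) + ?U * X + 2 * (X + 2) * ?U" using a b c by linarith
  \<comment> \<open>The factors of \<open>?U\<close> add up to \<open>11 * X + 9\<close>.\<close>
  also have "\<dots> <= ?U * (15 * (X + 1))" by (simp add: algebra_simps)
  also have "\<dots> <= (16 * Suc K + 2 * plen K c1 c2 * Suc K + 4) * (X + 1) * (15 * (X + 1))" using U by (rule mult_le_mono1)
  also have "\<dots> = 15 * (16 * Suc K + 2 * plen K c1 c2 * Suc K + 4) * (X + 1) * (X + 1)" by (simp only: mult_ac)
  finally show "?U * (2 * (2 * X + 1)) + ?U * X + Suc ?l * (3 * ?U) + UU X * ops f c1 (s0 u) + 2 * (length u + 2) * UU (length u)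
   <= 15 * (16 * Suc K + 2 * plen K c1 c2 * Suc K + 4) * (X + 1) * (X + 1)" .
 qed
qed

lemma final_stuck: "st c < 2 ==> \<not> RR c d"
 using plen_ge[of K c1 c2] by (simp add: step_iff delta_final)

lemma fin_stuck: "\<not> RR (fin g) d"
 by (rule final_stuck) (simp add: fin_def Let_def)

lemma mach_accepts:
 assumes nd
 shows "accepts (mach K nd c1 c2) f u \<longleftrightarrow> (\<exists>g w. bits g \<and> length g = length (fst (sem f c1 (s0 u)) 1) \<and>
  fst (sem f c2 (guessed g (sem f c1 (s0 u)))) 0 = S1 # w)"
proof -
 let ?s1 = "sem f c1 (s0 u)" let ?l = "length (fst ?s1 1)" let ?I = "init_config (mach K nd c1 c2)"
 let ?c = "%g. ops f c2 (guessed g ?s1)"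
 have "finite {g. bits g \<and> length g = ?l}"
  by (rule finite_subset[OF _ finite_lists_length_eq[of "{S0, S1}" ?l]]) (auto simp: bits_def)
 then have fi: "finite (?c ` {g. bits g \<and> length g = ?l})" by simp
 \<comment> \<open>No polynomial bound is assumed here; there are finitely many guesses, so the
   largest of their costs bounds every run.\<close>
 define X where "X = length u + ops f c1 (s0 u) + Max (insert 0 (?c ` {g. bits g \<and> length g = ?l}))"
 have X: "length u + ops f c1 (s0 u) + ?c g <= X" if "bits g" "length g = ?l" for g
  unfolding X_def using that fi by (intro add_left_mono Max_ge) auto
 have ac: "st (fin g) = 1 \<longleftrightarrow> (\<exists>w. fst (sem f c2 (guessed g ?s1)) 0 = S1 # w)" for g
  unfolding fin_def Let_def using assms by (cases "fst (sem f c2 (guessed g ?s1)) 0") auto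
 show ?thesis
 proof
  assume "accepts (mach K nd c1 c2) f u"
  then obtain k c where c: "(RR ^^ k) ?I c" "st c = 1" by (auto simp: accepts_def reach_def)
  have "ev RR (15 * (16 * Suc K + 2 * plen K c1 c2 * Suc K + 4) * (X + 1) * (X + 1)) (%d. \<exists>g. bits g \<and> length g = ?l \<and> d = fin g) ?I"
   by (rule ev_total[OF X]) auto
  then have "\<exists>g. bits g \<and> length g = ?l \<and> c = fin g"
   by (rule ev_halt[OF _ c(1)]) (use c(2) final_stuck fin_stuck in auto)
  then show "\<exists>g w. bits g \<and> length g = ?l \<and> fst (sem f c2 (guessed g ?s1)) 0 = S1 # w" using ac c(2) by blast
 next
  assume "\<exists>g w. bits g \<and> length g = ?l \<and> fst (sem f c2 (guessed g ?s1)) 0 = S1 # w"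
  then obtain g where g: "bits g" "length g = ?l" "st (fin g) = 1" using ac by blast
  let ?z = "snd ?s1"
  have e1: "RR\<^sup>*\<^sup>* ?I (C (Lg K c1) (enc K (fst ?s1)) 0 (length u) ?z [])"
   by (rule ev_rtc[OF ev_prefix[where k = 0]]) auto
  have "RR\<^sup>*\<^sup>* (C (Lg K c1) (enc K (fst ?s1)) 0 (length u) ?z []) (C (L2 K c1) (enc K ((fst ?s1)(1 := [], 2 := g @ fst ?s1 2))) 0 (length u) ?z [])"
   by (rule guess_path) (use assms g in auto)
  then have e2: "RR\<^sup>*\<^sup>* (C (Lg K c1) (enc K (fst ?s1)) 0 (length u) ?z []) (C (L2 K c1) (enc K (fst (guessed g ?s1))) 0 (length u) ?z [])"
   by (simp add: guessed_def)
  have e3: "RR\<^sup>*\<^sup>* (C (L2 K c1) (enc K (fst (guessed g ?s1))) 0 (length u) ?z []) (fin g)"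
   by (rule ev_rtc[OF ev_finish[OF g(2) X]]) (use g in auto)
  have "RR\<^sup>*\<^sup>* ?I (fin g)" using e1 e2 e3 by (meson rtranclp_trans)
  then obtain k where "(RR ^^ k) ?I (fin g)" by (meson rtranclp_imp_relpowp)
  then show "accepts (mach K nd c1 c2) f u" unfolding accepts_def reach_def using g(3) by auto
 qed
qed

lemma mach_outputs:
 assumes "\<not> nd" "fst (sem f c1 (s0 u)) 1 = []"
 shows "outputs (mach K nd c1 c2) f u (fst (sem f c2 (guessed [] (sem f c1 (s0 u)))) 0)"
proof -
 let ?s1 = "sem f c1 (s0 u)"
 have "ev RR (15 * (16 * Suc K + 2 * plen K c1 c2 * Suc K + 4) * ((length u + ops f c1 (s0 u) + ops f c2 (guessed [] ?s1)) + 1) *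
   ((length u + ops f c1 (s0 u) + ops f c2 (guessed [] ?s1)) + 1)) (%d. d = fin []) (init_config (mach K nd c1 c2))"
  by (rule ev_total) (use assms(2) in auto)
 from ev_path[OF this] obtain k where k: "(RR ^^ k) (init_config (mach K nd c1 c2)) (fin [])" by auto
 have "st (fin []) = 0" "outp (fin []) = fst (sem f c2 (guessed [] ?s1)) 0"
  unfolding fin_def Let_def using assms(1) by simp_all
 then show ?thesis unfolding outputs_def reach_def using k by auto
qed

lemma mach_time:
 assumes X: "\<And>g. bits g ==> length g = length (fst (sem f c1 (s0 u)) 1) ==>
   length u + ops f c1 (s0 u) + ops f c2 (guessed g (sem f c1 (s0 u))) <= X"
 shows "time_bounded (mach K nd c1 c2) f u (15 * (16 * Suc K + 2 * plen K c1 c2 * Suc K + 4) * (X + 1) * (X + 1))"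
 unfolding time_bounded_def reach_def
proof (intro allI impI)
 fix k c assume c: "(RR ^^ k) (init_config (mach K nd c1 c2)) c"
 have "ev RR (15 * (16 * Suc K + 2 * plen K c1 c2 * Suc K + 4) * (X + 1) * (X + 1)) (%d. \<exists>g. d = fin g) (init_config (mach K nd c1 c2))"
  by (rule ev_total[OF X]) auto
 then show "k <= 15 * (16 * Suc K + 2 * plen K c1 c2 * Suc K + 4) * (X + 1) * (X + 1)"
  by (rule ev_bound[OF _ _ c]) (use fin_stuck in auto)
qed

end

section \<open>The machine model as seen from stack programs\<close>

lemma poly_time_mach:
 assumes K: "3 <= K" "ok {..<K} c1" "ok {..<K} c2" and P: "sp_ok P"
  and X: "\<And>f u g. f \<in> Reg ==> bits g ==> length g = length (fst (sem f c1 (s0 u)) 1) ==>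
   length u + ops f c1 (s0 u) + ops f c2 (guessed g (sem f c1 (s0 u))) <= sp_eval P (regsize f) (length u)"
 shows "poly_time (mach K nd c1 c2)"
proof -
 let ?A = "15 * (16 * Suc K + 2 * plen K c1 c2 * Suc K + 4)" let ?P = "PAdd P (PConst 1)"
 have "sp_ok (PMul (PMul (PConst ?A) ?P) ?P)" using P by simp
 moreover have "time_bounded (mach K nd c1 c2) f u (sp_eval (PMul (PMul (PConst ?A) ?P) ?P) (regsize f) (length u))" if "f \<in> Reg" for f u
  using mach_time[OF K X[OF that]] by (simp only: sp_eval.simps)
 ultimately show ?thesis unfolding poly_time_def by blast
qed

text \<open>The first program decides how many bits are guessed by what it leaves on stack 1; the
  second finds the bits on stack 2 and accepts by leaving \<open>S1\<close> on top of stack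
  0.\<close>

theorem NP_machine:
 assumes "3 <= K" "ok {..<K} c1" "ok {..<K} c2" "sp_ok P"
  "\<And>f u g. f \<in> Reg ==> bits g ==> length g = length (fst (sem f c1 (s0 u)) 1) ==>
   length u + ops f c1 (s0 u) + ops f c2 (guessed g (sem f c1 (s0 u))) <= sp_eval P (regsize f) (length u)"
 shows "\<exists>M. wf_otm M \<and> poly_time M \<and> (\<forall>f u. accepts M f u \<longleftrightarrow>
  (\<exists>g w. bits g \<and> length g = length (fst (sem f c1 (s0 u)) 1) \<and> fst (sem f c2 (guessed g (sem f c1 (s0 u)))) 0 = S1 # w))"
proof (intro exI conjI allI)
 show "wf_otm (mach K True c1 c2)" by (rule wf_mach)
 show "poly_time (mach K True c1 c2)" by (rule poly_time_mach[OF assms])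
 show "accepts (mach K True c1 c2) f u \<longleftrightarrow> (\<exists>g w. bits g \<and> length g = length (fst (sem f c1 (s0 u)) 1) \<and>
  fst (sem f c2 (guessed g (sem f c1 (s0 u)))) 0 = S1 # w)" for f u
  by (rule mach_accepts[OF assms(1-3)]) simp
qed

lemma fst_s0 [simp]: "fst (s0 u) = (%_. [])(0 := rev u)" by (simp add: s0_def)
lemma snd_s0 [simp]: "snd (s0 u) = (%_. None, 0)" by (simp add: s0_def)

text \<open>With \<open>Skip\<close> as the first program stack 1 is empty, so nothing is
  guessed.\<close>

theorem FP_machine:
 assumes "3 <= K" "ok {..<K} c" "sp_ok P"
  "\<And>f u. f \<in> Reg ==> ops f c (s0 u) <= sp_eval P (regsize f) (length u)"
 shows "\<exists>M. deterministic M \<and> poly_time M \<and> (\<forall>f u. outputs M f u (fst (sem f c (s0 u)) 0))"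
proof (intro exI conjI allI)
 have g: "guessed [] (s0 u) = s0 u" for u by (auto simp: guessed_def s0_def upd_def fun_eq_iff)
 show "deterministic (mach K False Skip c)" by (rule det_mach)
 show "poly_time (mach K False Skip c)"
 proof (rule poly_time_mach[where P = "PAdd (PAdd PVar (PConst 1)) P"])
  fix f and u g' :: word assume "f \<in> Reg" "length g' = length (fst (sem f Skip (s0 u)) 1)"
  then show "length u + ops f Skip (s0 u) + ops f c (guessed g' (sem f Skip (s0 u)))
    <= sp_eval (PAdd (PAdd PVar (PConst 1)) P) (regsize f) (length u)" using assms(4) g by simp
 qed (use assms(1-3) in simp_all)
 show "outputs (mach K False Skip c) f u (fst (sem f c (s0 u)) 0)" for f u
  using mach_outputs[OF assms(1) _ assms(2), of Skip False f u] by (simp add: g)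
qed

subsection \<open>Operation counts\<close>

definition tsize :: "nat => store => nat" where
 "tsize K s = (\<Sum>j<K. length (fst s j))"

lemma size_upd: "j < K ==> tsize K (upd j w s) + length (fst s j) = tsize K s + length w"
proof -
 assume j: "j < K"
 have "tsize K s = length (fst s j) + (\<Sum>i\<in>{..<K} - {j}. length (fst s i))"
  unfolding tsize_def using j by (simp add: sum.remove)
 moreover have "tsize K (upd j w s) = length w + (\<Sum>i\<in>{..<K} - {j}. length (fst s i))"
  unfolding tsize_def using j by (subst sum.remove[of _ j]) auto
 ultimately show ?thesis by simp
qed

lemma size_upd_out: "\<not> j < K ==> tsize K (upd j w s) = tsize K s"
 unfolding tsize_def by (intro sum.cong) auto

lemma size_push: "tsize K (upd j (w @ fst s j) s) <= tsize K s + length w"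
 using size_upd[of j K "w @ fst s j" s] size_upd_out[of j K "w @ fst s j" s] by (cases "j < K") auto

lemma size_cong: "fst s = fst s' ==> tsize K s = tsize K s'" by (simp add: tsize_def)

lemma size_sem:
 assumes "ok {..<K} c"
 shows "tsize K (sem f c s) <= tsize K s + ops f c s"
 using assms
proof (induction c arbitrary: s)
 case (Push j a)
 then show ?case using size_push[of K j "[a]" s] by simp
next
 case (Seq c d)
 then have "tsize K (sem f c s) <= tsize K s + ops f c s"
  "tsize K (sem f d (sem f c s)) <= tsize K (sem f c s) + ops f d (sem f c s)" by auto
 then show ?case by simp
next
 case (Case j F)
 show ?case
 proof (cases "fst s j")
  case Nil
  then show ?thesis using Case.IH[OF rangeI, of None s] Case.prems by simp
 next
  case (Cons a w)
  have "tsize K (sem f (F (Some a)) (upd j w s)) <= tsize K (upd j w s) + ops f (F (Some a)) (upd j w s)"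
   using Case.IH[OF rangeI, of "Some a" "upd j w s"] Case.prems by simp
  then show ?thesis using Cons size_upd[of j K w s] Case.prems by simp
 qed
next
 case (For j F)
 have j: "j < K" using For.prems by simp
 have okF: "ok ({..<K} - {j}) (F a)" for a using For.prems by simp
 have okF': "ok {..<K} (F a)" for a using okF by (rule ok_mono) auto
 have fr: "fst (sem f (F a) s) j = fst s j" for a s using sem_frame[OF okF] by simp
 have "fst s j = w ==> tsize K (floop j (%a. sem f (F a)) w s) <= tsize K s + fops j (%a. sem f (F a)) (%a. ops f (F a)) w s" for w s
 proof (induction w arbitrary: s)
  case Nil
  then show ?case using size_upd[OF j, of "[]" s] by simp
 next
  case (Cons a w)
  let ?s = "upd j w s"
  have "tsize K (sem f (F a) ?s) <= tsize K ?s + ops f (F a) ?s"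
   using For.IH[OF rangeI, of a ?s] okF' by simp
  moreover have "tsize K ?s <= tsize K s" using size_upd[OF j, of w s] Cons.prems by simp
  moreover have "tsize K (floop j (%a. sem f (F a)) w (sem f (F a) ?s)) <= tsize K (sem f (F a) ?s) + fops j (%a. sem f (F a)) (%a. ops f (F a)) w (sem f (F a) ?s)"
   by (rule Cons.IH) (simp add: fr)
  ultimately show ?case by simp
 qed
 then show ?case by simp
next
 case (QCase F)
 have "ok {..<K} (F (fst (snd s) (snd (snd s))))" using QCase.prems by simp
 from QCase.IH[OF rangeI this, of s] show ?case by simp
next
 case (QLen j)
 have "tsize K (sem f (QLen j) s) = tsize K (upd j (replicate (qlen (fst (snd s)) (snd (snd s))) S1 @ fst s j) s)"
  by (rule size_cong) (simp add: Let_def)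
 then show ?case using size_push[of K j "replicate (qlen (fst (snd s)) (snd (snd s))) S1" s] by simp
qed (auto simp: tsize_def)

text \<open>Growth bounded by a constant, uniformly in the store and the oracle. A loop whose body
  has it keeps the store linear in the size on entry, which is what polynomial bounds for loops rest
  on.\<close>

definition gr :: "nat => nat => com => bool" where
 "gr K k c \<longleftrightarrow> (\<forall>f s. tsize K (sem f c s) <= tsize K s + k)"

lemma grD: "gr K k c ==> tsize K (sem f c s) <= tsize K s + k"
 unfolding gr_def by blast

lemma grI: "(\<And>f s. tsize K (sem f c s) <= tsize K s + k) ==> gr K k c"
 unfolding gr_def by blast

lemma gr_mono: "gr K k c ==> k <= l ==> gr K l c"
 by (rule grI) (meson grD add_le_cancel_left order_trans)

lemma gr_Skip: "gr K k Skip" by (simp add: gr_def)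

lemma gr_Push: "1 <= k ==> gr K k (Push j a)"
proof (rule grI)
 fix f s assume "1 <= k"
 then show "tsize K (sem f (Push j a) s) <= tsize K s + k" using size_push[of K j "[a]" s] by simp
qed

lemma gr_Seq: "gr K a c ==> gr K b d ==> a + b <= k ==> gr K k (Seq c d)"
proof (rule grI)
 fix f s assume h: "gr K a c" "gr K b d" "a + b <= k"
 show "tsize K (sem f (Seq c d) s) <= tsize K s + k"
  using grD[OF h(2), of f "sem f c s"] grD[OF h(1), of f s] h(3) by simp
qed

text \<open>In the nonempty case one symbol has been popped, so the branch may add one more.\<close>

lemma gr_Case: "j < K ==> gr K k (F None) ==> (\<And>a. gr K (Suc k) (F (Some a))) ==> gr K k (Case j F)"
proof (rule grI)
 fix f s assume j: "j < K" and N: "gr K k (F None)" and S: "\<And>a. gr K (Suc k) (F (Some a))"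
 show "tsize K (sem f (Case j F) s) <= tsize K s + k"
 proof (cases "fst s j")
  case (Cons a w)
  then show ?thesis using grD[OF S, of f a "upd j w s"] size_upd[OF j, of w s] by simp
 qed (use grD[OF N, of f s] in simp)
qed

lemma gr_QWr: "gr K k (QWr x d)" by (simp add: gr_def tsize_def)
lemma gr_QAsk: "gr K k QAsk" by (simp add: gr_def tsize_def)
lemma gr_QCase: "(\<And>x. gr K k (F x)) ==> gr K k (QCase F)"
 by (rule grI) (simp add: grD)

text \<open>Each round pops a symbol, which pays for the one symbol that the body may add; the total
  size does not grow at all.\<close>

lemma gr_For:
 assumes j: "j < K" and okF: "\<And>a. ok (- {j}) (F a)" and g: "\<And>a. gr K 1 (F a)"
 shows "gr K k (For j F)"
proof -
 have fr: "fst (sem f (F a) s) j = fst s j" for a s f using sem_frame[OF okF] by simp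
 have "tsize K (floop j (%a. sem f (F a)) w s) <= tsize K s" if "fst s j = w" for f w s
  using that
 proof (induction w arbitrary: s)
  case Nil
  then show ?case using size_upd[OF j, of "[]" s] by simp
 next
  case (Cons a w)
  let ?s = "upd j w s"
  have "tsize K (sem f (F a) ?s) <= tsize K ?s + 1" using g unfolding gr_def by blast
  moreover have "tsize K (floop j (%a. sem f (F a)) w (sem f (F a) ?s)) <= tsize K (sem f (F a) ?s)"
   by (rule Cons.IH) (simp add: fr)
  ultimately show ?case using size_upd[OF j, of w s] Cons.prems by simp
 qed
 then show ?thesis unfolding gr_def by (simp add: trans_le_add1)
qed

section \<open>Polynomial bounds in the total size of the stacks\<close>

definition pbd :: "nat => (fn => store => nat) => bool" where
 "pbd K g \<longleftrightarrow> (\<exists>C d. \<forall>f s. g f s <= C * (tsize K s + 1) ^ d)"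

lemma pbd_le: "pbd K h ==> (\<And>f s. g f s <= h f s) ==> pbd K g"
 unfolding pbd_def by (meson order_trans)

lemma pbd_const: "pbd K (%f s. c)"
 unfolding pbd_def by (rule exI[of _ c], rule exI[of _ 0]) simp

lemma pbd_size: "pbd K (%f s. tsize K s)"
 unfolding pbd_def by (rule exI[of _ 1], rule exI[of _ 1]) simp

lemma pbd_add: "pbd K g ==> pbd K h ==> pbd K (%f s. g f s + h f s)"
proof -
 assume "pbd K g" "pbd K h"
 then obtain C d C' d' where h: "\<And>f s. g f s <= C * (tsize K s + 1) ^ d" "\<And>f s. h f s <= C' * (tsize K s + 1) ^ d'"
  unfolding pbd_def by blast
 have "g f s + h f s <= (C + C') * (tsize K s + 1) ^ (d + d')" for f s
 proof -
  have "C * (tsize K s + 1) ^ d <= C * (tsize K s + 1) ^ (d + d')" "C' * (tsize K s + 1) ^ d' <= C' * (tsize K s + 1) ^ (d + d')"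
   by (intro mult_le_mono2 power_increasing; simp)+
  then show ?thesis using h(1)[of f s] h(2)[of f s] unfolding add_mult_distrib by linarith
 qed
 then show ?thesis unfolding pbd_def by blast
qed

lemma pbd_mult: "pbd K g ==> pbd K h ==> pbd K (%f s. g f s * h f s)"
proof -
 assume "pbd K g" "pbd K h"
 then obtain C d C' d' where h: "\<And>f s. g f s <= C * (tsize K s + 1) ^ d" "\<And>f s. h f s <= C' * (tsize K s + 1) ^ d'"
  unfolding pbd_def by blast
 have "g f s * h f s <= (C * C') * (tsize K s + 1) ^ (d + d')" for f s
  using mult_le_mono[OF h(1)[of f s] h(2)[of f s]] by (simp add: power_add mult_ac)
 then show ?thesis unfolding pbd_def by blast
qed

lemma pbd_pow: "pbd K g ==> pbd K (%f s. g f s ^ d)"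
 by (induction d) (simp_all add: pbd_const pbd_mult)

definition pb :: "nat => com => bool" where
 "pb K c \<longleftrightarrow> pbd K (%f. ops f c)"

lemma pb_basic: "pb K Skip" "pb K (Push j a)" "pb K (QWr x d)" "pb K QAsk"
 unfolding pb_def ops.simps by (rule pbd_const)+

lemma pb_Seq:
 assumes "pb K c" "pb K d" "ok {..<K} c"
 shows "pb K (Seq c d)"
proof -
 obtain C e where d: "\<And>f s. ops f d s <= C * (tsize K s + 1) ^ e" using assms(2) unfolding pb_def pbd_def by blast
 have "ops f d (sem f c s) <= C * (tsize K s + ops f c s + 1) ^ e" for f s
 proof -
  have "tsize K (sem f c s) + 1 <= tsize K s + ops f c s + 1" using size_sem[OF assms(3), of f s] by simp
  then have "C * (tsize K (sem f c s) + 1) ^ e <= C * (tsize K s + ops f c s + 1) ^ e"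
   by (intro mult_le_mono2 power_mono) simp_all
  then show ?thesis using d[of f "sem f c s"] by (rule order_trans[rotated])
 qed
 moreover have "pbd K (%f s. C * (tsize K s + ops f c s + 1) ^ e)"
  using assms(1) unfolding pb_def by (intro pbd_mult pbd_const pbd_pow pbd_add pbd_size)
 ultimately have "pbd K (%f s. ops f d (sem f c s))" by (rule pbd_le[rotated])
 then show ?thesis using assms(1) unfolding pb_def ops.simps by (rule pbd_add[rotated])
qed

text \<open>The alphabet is finite, so the bounds for the branches have a common polynomial: their
  sum.\<close>

lemma pbd_sym:
 assumes "\<And>a :: sym. pbd K (g a)"
 shows "\<exists>C d. \<forall>a f s. g a f s <= C * (tsize K s + 1) ^ d"
proof -
 have "pbd K (%f s. g S0 f s + (g S1 f s + (g SPlus f s + (g SMinus f s + g SSlash f s))))"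
  by (intro pbd_add assms)
 then obtain C d where h: "\<And>f s. g S0 f s + (g S1 f s + (g SPlus f s + (g SMinus f s + g SSlash f s))) <= C * (tsize K s + 1) ^ d"
  unfolding pbd_def by blast
 have "g a f s <= C * (tsize K s + 1) ^ d" for a f s using h[of f s] by (cases a) simp_all
 then show ?thesis by blast
qed

lemma pb_Case:
 assumes "j < K" "pb K (F None)" "\<And>a. pb K (F (Some a))"
 shows "pb K (Case j F)"
proof -
 obtain C d where N: "\<And>f s. ops f (F None) s <= C * (tsize K s + 1) ^ d" using assms(2) unfolding pb_def pbd_def by blast
 obtain C' d' where S: "\<And>a f s. ops f (F (Some a)) s <= C' * (tsize K s + 1) ^ d'"
  using pbd_sym[of K "%a f. ops f (F (Some a))"] assms(3) unfolding pb_def by blast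
 have "ops f (Case j F) s <= 1 + (C * (tsize K s + 1) ^ d + C' * (tsize K s + 1) ^ d')" for f s
 proof (cases "fst s j")
  case Nil
  then show ?thesis using N[of f s] by simp
 next
  case (Cons a w)
  have "tsize K (upd j w s) <= tsize K s" using size_upd[OF assms(1), of w s] Cons by simp
  then have "C' * (tsize K (upd j w s) + 1) ^ d' <= C' * (tsize K s + 1) ^ d'" by (intro mult_le_mono2 power_mono) simp_all
  then have "ops f (F (Some a)) (upd j w s) <= C' * (tsize K s + 1) ^ d'" using S[of f a "upd j w s"] by (rule order_trans[rotated])
  then show ?thesis using Cons by simp
 qed
 moreover have "pbd K (%f s. 1 + (C * (tsize K s + 1) ^ d + C' * (tsize K s + 1) ^ d'))"
  by (intro pbd_add pbd_const pbd_mult pbd_pow pbd_size)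
 ultimately show ?thesis unfolding pb_def by (rule pbd_le[rotated])
qed

lemma pb_QCase:
 assumes "pb K (F None)" "\<And>a. pb K (F (Some a))"
 shows "pb K (QCase F)"
proof -
 obtain C' d' where S: "\<And>a f s. ops f (F (Some a)) s <= C' * (tsize K s + 1) ^ d'"
  using pbd_sym[of K "%a f. ops f (F (Some a))"] assms(2) unfolding pb_def by blast
 have "ops f (F x) s <= ops f (F None) s + C' * (tsize K s + 1) ^ d'" for f s x
  using S[of f _ s] by (cases x) (auto intro: trans_le_add2)
 then have "ops f (QCase F) s <= 1 + (ops f (F None) s + C' * (tsize K s + 1) ^ d')" for f s by simp
 moreover have "pbd K (%f s. 1 + (ops f (F None) s + C' * (tsize K s + 1) ^ d'))"
  using assms(1) unfolding pb_def by (intro pbd_add pbd_const pbd_mult pbd_pow pbd_size)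
 ultimately show ?thesis unfolding pb_def by (rule pbd_le[rotated])
qed

text \<open>With \<open>l\<close> rounds the size stays below the initial size plus
  \<open>l * k\<close>, and \<open>l\<close> is at most the initial size. Every round therefore
  costs at most one and the same polynomial.\<close>

lemma pb_For:
 assumes j: "j < K" and okF: "\<And>a. ok (- {j}) (F a)" and p: "\<And>a. pb K (F a)" and g: "\<And>a. gr K k (F a)"
 shows "pb K (For j F)"
proof -
 obtain C d where C: "\<And>a f s. ops f (F a) s <= C * (tsize K s + 1) ^ d"
  using pbd_sym[of K "%a f. ops f (F a)"] p unfolding pb_def by blast
 have fr: "fst (sem f (F a) s) j = fst s j" for a s f using sem_frame[OF okF] by simp
 have b: "fops j (%a. sem f (F a)) (%a. ops f (F a)) w s <= 1 + length w * (1 + C * (B + 1) ^ d)"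
  if "fst s j = w" "tsize K s + length w * k <= B" for f w s B
  using that
 proof (induction w arbitrary: s)
  case (Cons a w)
  let ?s = "upd j w s"
  have z: "tsize K ?s <= tsize K s" using size_upd[OF j, of w s] Cons.prems(1) by simp
  have "tsize K (sem f (F a) ?s) <= tsize K ?s + k" using g unfolding gr_def by blast
  then have "fops j (%a. sem f (F a)) (%a. ops f (F a)) w (sem f (F a) ?s) <= 1 + length w * (1 + C * (B + 1) ^ d)"
   using Cons.prems z by (intro Cons.IH) (auto simp: fr)
  moreover have "ops f (F a) ?s <= C * (B + 1) ^ d"
  proof -
   have "C * (tsize K ?s + 1) ^ d <= C * (B + 1) ^ d" using z Cons.prems by (intro mult_le_mono2 power_mono) auto
   then show ?thesis using C[of f a ?s] by (rule order_trans[rotated])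
  qed
  ultimately show ?case by simp
 qed simp
 have "ops f (For j F) s <= 1 + tsize K s * (1 + C * (tsize K s + tsize K s * k + 1) ^ d)" for f s
 proof -
  have l: "length (fst s j) <= tsize K s" using size_upd[OF j, of "[]" s] by simp
  have "ops f (For j F) s <= 1 + length (fst s j) * (1 + C * (tsize K s + tsize K s * k + 1) ^ d)"
   using b[of s "fst s j" "tsize K s + tsize K s * k" f] l by simp
  also have "\<dots> <= 1 + tsize K s * (1 + C * (tsize K s + tsize K s * k + 1) ^ d)"
   using l by (intro add_left_mono mult_le_mono1)
  finally show ?thesis .
 qed
 moreover have "pbd K (%f s. 1 + tsize K s * (1 + C * (tsize K s + tsize K s * k + 1) ^ d))"
  by (intro pbd_add pbd_mult pbd_pow pbd_const pbd_size)
 ultimately show ?thesis unfolding pb_def by (rule pbd_le[rotated])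
qed

subsection \<open>Loops as folds\<close>

lemma sem_upd_commute:
 assumes "ok A c" "j \<notin> A"
 shows "sem f c (upd j w s) = upd j w (sem f c s)"
 using assms
proof (induction c arbitrary: A s)
 case (Push i a)
 then have "i ~= j" by auto
 then show ?case by (simp add: upd_def fun_upd_twist)
next
 case (Seq c d)
 then show ?case by (metis ok.simps(3) sem.simps(3))
next
 case (Case i F)
 have ij: "i ~= j" and okF: "ok A (F x)" for x using Case.prems by auto
 have c: "sem f (F x) (upd j w s) = upd j w (sem f (F x) s)" for x s
  using Case.IH[OF rangeI okF Case.prems(2)] .
 have tw: "upd i v (upd j w s) = upd j w (upd i v s)" for v s using ij by (simp add: upd_def fun_upd_twist)
 show ?case using ij by (simp add: c tw split: list.split)
next
 case (For i F)
 have ij: "i ~= j" and okF: "ok (A - {i}) (F x)" for x using For.prems by auto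
 have c: "sem f (F x) (upd j w s) = upd j w (sem f (F x) s)" for x s
  using For.IH[OF rangeI okF] For.prems(2) by blast
 have tw: "upd i v (upd j w s) = upd j w (upd i v s)" for v s using ij by (simp add: upd_def fun_upd_twist)
 have "floop i (%a. sem f (F a)) v (upd j w s) = upd j w (floop i (%a. sem f (F a)) v s)" for v s
  by (induction v arbitrary: s) (simp_all add: tw c)
 then show ?case using ij by simp
next
 case (QCase F)
 have okF: "ok A (F x)" for x using QCase.prems by auto
 show ?case using QCase.IH[OF rangeI okF QCase.prems(2)] by simp
next
 case (QLen i)
 then have "i ~= j" by auto
 then show ?case by (simp add: Let_def upd_def fun_upd_twist)
qed (auto simp: upd_def)

text \<open>The body commutes with updates of the loop stack, so the pops can be postponed: the loop
  is a fold over the initial contents followed by clearing the stack.\<close>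

lemma sem_For:
 assumes "\<And>a. ok (- {j}) (F a)"
 shows "sem f (For j F) s = upd j [] (fold (%a. sem f (F a)) (fst s j) s)"
proof -
 have c: "sem f (F a) (upd j w s) = upd j w (sem f (F a) s)" for a w s by (rule sem_upd_commute[OF assms]) simp
 have uu: "upd j v (upd j w s) = upd j v s" for v w s by (simp add: upd_def)
 have "floop j (%a. sem f (F a)) w (upd j v s) = upd j [] (fold (%a. sem f (F a)) w s)" for w v s
  by (induction w arbitrary: s v) (simp_all add: c uu)
 moreover have "upd j (fst s j) s = s" by (simp add: upd_def fun_upd_idem)
 ultimately show ?thesis by (metis sem.simps(5))
qed

subsection \<open>Macros\<close>

definition Mv :: "nat => nat => com" where "Mv i j = For i (Push j)"
definition Clr :: "nat => com" where "Clr i = For i (%_. Skip)"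
definition Pop :: "nat => com" where "Pop i = Case i (%_. Skip)"
definition Dup :: "nat => nat => nat => com" where
 "Dup i t j = Seq (Mv i t) (For t (%a. Seq (Push i a) (Push j a)))"
text \<open>A loop that leaves its stack intact: the popped symbols are collected on
  \<open>t\<close> and moved back. Stacks holding numbers in unary are used repeatedly in this
  way.\<close>

definition Each :: "nat => nat => (sym => com) => com" where
 "Each i t G = Seq (For i (%a. Seq (G a) (Push t a))) (Mv t i)"
primrec PushW :: "nat => word => com" where
 "PushW j [] = Skip" | "PushW j (a # w) = Seq (PushW j w) (Push j a)"
primrec PopN :: "nat => nat => com" where
 "PopN j 0 = Skip" | "PopN j (Suc n) = Seq (Pop j) (PopN j n)"
text \<open>A stack with at most \<open>n\<close> symbols serves as a finite control in unary; the
  test empties it, and the selected branch pushes the next state.\<close>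

primrec CaseN :: "nat => nat => (nat => com) => com" where
 "CaseN j 0 F = F 0"
| "CaseN j (Suc n) F = Case j (%x. case x of None => F 0 | Some _ => CaseN j n (%i. F (Suc i)))"

lemma ok_Mv [simp]: "ok A (Mv i j) \<longleftrightarrow> i \<in> A \<and> j \<in> A \<and> i ~= j" by (auto simp: Mv_def)
lemma ok_Clr [simp]: "ok A (Clr i) \<longleftrightarrow> i \<in> A" by (auto simp: Clr_def)
lemma ok_Pop [simp]: "ok A (Pop i) \<longleftrightarrow> i \<in> A" by (auto simp: Pop_def)
lemma ok_Dup [simp]: "ok A (Dup i t j) \<longleftrightarrow> i \<in> A \<and> j \<in> A \<and> t \<in> A \<and> i ~= t \<and> t ~= j" by (auto simp: Dup_def)
lemma ok_PushW [simp]: "j \<in> A ==> ok A (PushW j w)" by (induction w) auto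
lemma ok_PopN [simp]: "j \<in> A ==> ok A (PopN j n)" by (induction n) auto
lemma ok_CaseN: "j \<in> A ==> (\<And>i. i <= n ==> ok A (F i)) ==> ok A (CaseN j n F)"
 by (induction n arbitrary: F) (auto split: option.split)
lemma ok_Each [simp]: "ok A (Each i t G) \<longleftrightarrow> i \<in> A \<and> t \<in> A \<and> i ~= t \<and> (\<forall>a. ok (A - {i}) (G a))" by (auto simp: Each_def)

lemma gr_Mv: "i < K ==> i ~= j ==> gr K k (Mv i j)" unfolding Mv_def by (rule gr_For) (auto intro: gr_Push)
lemma gr_Clr: "i < K ==> gr K k (Clr i)" unfolding Clr_def by (rule gr_For) (auto intro: gr_Skip)
lemma gr_Pop: "i < K ==> gr K k (Pop i)" unfolding Pop_def by (rule gr_Case) (auto intro: gr_Skip)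
lemma gr_PushW: "length w <= k ==> gr K k (PushW j w)"
proof (induction w arbitrary: k)
 case (Cons a w)
 then show ?case using gr_Seq[OF Cons.IH[of "length w"] gr_Push[of 1]] by simp
qed (simp add: gr_Skip)
lemma gr_PopN: "j < K ==> gr K k (PopN j n)"
proof (induction n arbitrary: k)
 case (Suc n)
 then show ?case using gr_Seq[OF gr_Pop[of j K 0] Suc.IH[of 0], of k] by simp
qed (simp add: gr_Skip)
lemma gr_CaseN: "j < K ==> (\<And>i. i <= n ==> gr K (k + i) (F i)) ==> gr K k (CaseN j n F)"
proof (induction n arbitrary: F k)
 case (Suc n)
 have "gr K (Suc k) (CaseN j n (%i. F (Suc i)))"
  by (rule Suc.IH) (use Suc.prems(2)[of "Suc _"] Suc.prems(1) in auto)
 moreover have "gr K k (F 0)" using Suc.prems(2)[of 0] by simp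
 ultimately show ?case using Suc.prems(1) by (auto intro!: gr_Case)
qed simp

lemma pb_Mv: "i < K ==> i ~= j ==> pb K (Mv i j)"
 unfolding Mv_def by (rule pb_For[where k = 1]) (auto intro: gr_Push pb_basic)
lemma pb_Clr: "i < K ==> pb K (Clr i)"
 unfolding Clr_def by (rule pb_For[where k = 0]) (auto intro: gr_Skip pb_basic)
lemma pb_Pop: "i < K ==> pb K (Pop i)"
 unfolding Pop_def by (rule pb_Case) (auto intro: pb_basic)
lemma pb_Dup: "i < K ==> t < K ==> j < K ==> i ~= t ==> t ~= j ==> pb K (Dup i t j)"
 unfolding Dup_def by (intro pb_Seq pb_Mv pb_For[where k = 2])
  (auto intro: gr_Push pb_basic pb_Seq gr_Seq[where a = 1 and b = 1])
lemma pb_PushW: "j < K ==> pb K (PushW j w)"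
 by (induction w) (auto intro: pb_basic pb_Seq)
lemma pb_PopN: "j < K ==> pb K (PopN j n)"
 by (induction n) (auto intro: pb_basic pb_Seq pb_Pop)
lemma pb_CaseN: "j < K ==> (\<And>i. i <= n ==> pb K (F i)) ==> pb K (CaseN j n F)"
 by (induction n arbitrary: F) (auto intro!: pb_Case)
lemma pb_Each: "i < K ==> t < K ==> i ~= t ==> (\<And>a. ok ({..<K} - {i}) (G a)) ==> (\<And>a. pb K (G a)) ==> (\<And>a. gr K k (G a)) ==> pb K (Each i t G)"
proof -
 assume h: "i < K" "t < K" "i ~= t" "\<And>a. ok ({..<K} - {i}) (G a)" "\<And>a. pb K (G a)" "\<And>a. gr K k (G a)"
 have o: "ok (- {i}) (G a)" "ok {..<K} (G a)" for a using h(4)[of a] by (auto elim!: ok_mono)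
 show ?thesis unfolding Each_def
  by (intro pb_Seq pb_Mv pb_For[where k = "k + 1"] pb_basic gr_Seq[OF h(6) gr_Push]) (use h o in auto)
qed
lemma gr_Each: "i < K ==> t < K ==> i ~= t ==> (\<And>a. ok ({..<K} - {i}) (G a)) ==> (\<And>a. gr K 0 (G a)) ==> gr K k (Each i t G)"
proof -
 assume h: "i < K" "t < K" "i ~= t" "\<And>a. ok ({..<K} - {i}) (G a)" "\<And>a. gr K 0 (G a)"
 have o: "ok (- {i}) (G a)" for a using h(4)[of a] by (auto elim!: ok_mono)
 show ?thesis unfolding Each_def
  by (intro gr_Seq[where a = 0 and b = k] gr_Mv gr_For gr_Seq[OF h(5) gr_Push]) (use h o in auto)
qed

lemma fold_push: "fold (%a. sem f (Push j a)) w (ss, q) = (ss(j := rev w @ ss j), q)"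
 by (induction w arbitrary: ss) auto

lemma sem_Mv [simp]: "i ~= j ==> sem f (Mv i j) (ss, q) = (ss(j := rev (ss i) @ ss j, i := []), q)"
 unfolding Mv_def by (subst sem_For) (simp_all add: fold_push del: sem.simps)

lemma sem_Clr [simp]: "sem f (Clr i) (ss, q) = (ss(i := []), q)"
proof -
 have "fold (%a. sem f Skip) w s = s" for w :: word and s :: store by (induction w) auto
 then show ?thesis unfolding Clr_def by (subst sem_For) (auto simp del: sem.simps)
qed

lemma sem_Pop [simp]: "sem f (Pop i) (ss, q) = (ss(i := tl (ss i)), q)"
 by (cases "ss i") (auto simp: Pop_def fun_upd_idem)

lemma fold_push2: "i ~= j ==> fold (%a. sem f (Seq (Push i a) (Push j a))) w (ss, q) = (ss(i := rev w @ ss i, j := rev w @ ss j), q)"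
 by (induction w arbitrary: ss) (auto simp: fun_upd_twist)

lemma sem_Dup [simp]: "i ~= j ==> i ~= t ==> j ~= t ==> ss t = [] ==> sem f (Dup i t j) (ss, q) = (ss(j := ss i @ ss j), q)"
 unfolding Dup_def sem.simps(3) sem_Mv
 by (subst sem_For) (auto simp: fold_push2 fun_eq_iff simp del: sem.simps)

lemma sem_PushW [simp]: "sem f (PushW j w) (ss, q) = (ss(j := w @ ss j), q)"
 by (induction w) auto

lemma sem_PopN [simp]: "sem f (PopN j n) (ss, q) = (ss(j := drop n (ss j)), q)"
 by (induction n arbitrary: ss) (auto simp: drop_Suc)

lemma sem_CaseN: "length (ss j) <= n ==> sem f (CaseN j n F) (ss, q) = sem f (F (length (ss j))) (ss(j := []), q)"
proof (induction n arbitrary: F ss)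
 case 0
 then show ?case by (simp add: fun_upd_idem)
next
 case (Suc n)
 show ?case
 proof (cases "ss j")
  case (Cons a w)
  have "sem f (CaseN j (Suc n) F) (ss, q) = sem f (CaseN j n (%i. F (Suc i))) (ss(j := w), q)"
   using Cons by simp
  also have "\<dots> = sem f (F (Suc (length ((ss(j := w)) j)))) ((ss(j := w))(j := []), q)"
   by (rule Suc.IH) (use Suc.prems Cons in simp)
  finally show ?thesis using Cons by (simp only: fun_upd_upd fun_upd_same list.size(4) add_Suc_right add_0_right)
 qed (simp add: fun_upd_idem)
qed

lemma sem_Each:
 assumes "\<And>a. ok (- {i, t}) (G a)" "i ~= t" "ss t = []"
 shows "sem f (Each i t G) (ss, q) = fold (%a. sem f (G a)) (ss i) (ss, q)"
proof -
 have c: "sem f (G a) (upd t w s) = upd t w (sem f (G a) s)" for a w s by (rule sem_upd_commute[OF assms(1)]) simp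
 have oi: "ok (- {i}) (Seq (G a) (Push t a))" for a using assms(1)[of a] assms(2) by (auto elim: ok_mono)
 have fi: "fst (sem f (G a) s) i = fst s i" and ft: "fst (sem f (G a) s) t = fst s t" for a s
  using sem_frame[OF assms(1)] by auto
 have F: "fold (%a. sem f (Seq (G a) (Push t a))) w (upd t v s) = upd t (rev w @ v) (fold (%a. sem f (G a)) w s)" for w v s
 proof (induction w arbitrary: v s)
  case (Cons a w)
  have "sem f (Seq (G a) (Push t a)) (upd t v s) = upd t (a # v) (sem f (G a) s)"
   unfolding sem.simps(2,3) c by (simp add: upd_def)
  then show ?case using Cons by simp
 qed simp
 have f1: "fst (fold (%a. sem f (G a)) w s) i = fst s i" "fst (fold (%a. sem f (G a)) w s) t = fst s t" for w s
  by (induction w arbitrary: s) (simp_all add: fi ft)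
 have e: "upd t [] (ss, q) = (ss, q)" using assms(3) by (simp add: fun_upd_idem)
 let ?s = "fold (%a. sem f (G a)) (ss i) (ss, q)"
 have "sem f (For i (%a. Seq (G a) (Push t a))) (ss, q) = upd i [] (upd t (rev (ss i)) ?s)"
  using F[of "ss i" "[]" "(ss, q)"] unfolding e sem_For[OF oi] by simp
 then have "sem f (Each i t G) (ss, q) = sem f (Mv t i) (upd i [] (upd t (rev (ss i)) ?s))"
  by (simp add: Each_def)
 also have "\<dots> = ?s"
 proof -
  obtain ss' q' where s: "?s = (ss', q')" by (cases ?s)
  have "ss' i = ss i" "ss' t = []" using f1[of "ss i" "(ss, q)"] s assms(3) by auto
  then show ?thesis unfolding s using assms(2) by (auto simp: fun_eq_iff)
 qed
 finally show ?thesis .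
qed

lemma fold_const_push: "fold (%a. sem f (Push j x)) w (ss, q) = (ss(j := replicate (length w) x @ ss j), q)"
 by (induction w arbitrary: ss) (auto simp: replicate_app_Cons_same)

lemma sem_Each_push [simp]: "i ~= t ==> j ~= i ==> j ~= t ==> ss t = [] ==>
  sem f (Each i t (%_. Push j x)) (ss, q) = (ss(j := replicate (length (ss i)) x @ ss j), q)"
 by (subst sem_Each) (auto simp: fold_const_push simp del: sem.simps)

subsection \<open>Binary arithmetic, least significant digit first\<close>

primrec val :: "word => nat" where
 "val [] = 0" | "val (x # xs) = (if x = S1 then 1 else 0) + 2 * val xs"

lemma val_append: "val (xs @ ys) = val xs + 2 ^ length xs * val ys"
 by (induction xs) (auto simp: algebra_simps)

lemma val_lt: "val xs < 2 ^ length xs"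
 by (induction xs) auto

lemma val_zeros [simp]: "val (replicate n S0) = 0"
 by (induction n) auto

lemma val_drop: "val (drop k xs) = val xs div 2 ^ k"
proof (induction k arbitrary: xs)
 case (Suc k)
 show ?case
 proof (cases xs)
  case (Cons a list)
  have "val xs div 2 ^ Suc k = (val xs div 2) div 2 ^ k" by (simp add: div_mult2_eq)
  then show ?thesis using Cons Suc[of list] by simp
 qed simp
qed simp

lemma bin_val_append: "foldl (%a b. 2 * a + (if b = S1 then 1 else 0)) a x = a * 2 ^ length x + val (rev x)"
 by (induction x rule: rev_induct) (auto simp: algebra_simps)

lemma bin_val_val: "bin_val x = val (rev x)"
 unfolding bin_val_def by (subst bin_val_append) simp

definition hb :: "word => bool" where "hb ys \<longleftrightarrow> ys ~= [] \<and> hd ys = S1"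

text \<open>The result keeps the width of the first summand and a final carry is lost; hence the
  hypothesis of \<open>val_addw\<close>. The second summand is padded by zeros or cut off.\<close>

primrec addw :: "word => word => bool => word" where
 "addw [] ys k = []"
| "addw (x # xs) ys k = (if ((x = S1) ~= hb ys) ~= k then S1 else S0) #
   addw xs (tl ys) ((x = S1 \<and> hb ys) \<or> (x = S1 \<and> k) \<or> (hb ys \<and> k))"

primrec cout :: "word => word => bool => bool" where
 "cout [] ys k = k"
| "cout (x # xs) ys k = cout xs (tl ys) ((x = S1 \<and> hb ys) \<or> (x = S1 \<and> k) \<or> (hb ys \<and> k))"

lemma length_addw [simp]: "length (addw xs ys k) = length xs"
 by (induction xs arbitrary: ys k) auto

lemma val_hb: "val ys = (if hb ys then 1 else 0) + 2 * val (tl ys)"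
 by (cases ys) (auto simp: hb_def)

lemma val_addw: "val xs + val ys + (if k then 1 else 0) < 2 ^ length xs ==>
  val (addw xs ys k) = val xs + val ys + (if k then 1 else 0)"
proof (induction xs arbitrary: ys k)
 case (Cons x xs)
 let ?k = "(x = S1 \<and> hb ys) \<or> (x = S1 \<and> k) \<or> (hb ys \<and> k)"
 have v: "val ys = (if hb ys then 1 else 0) + 2 * val (tl ys)" by (rule val_hb)
 have "val xs + val (tl ys) + (if ?k then 1 else 0) < 2 ^ length xs"
  using Cons.prems v by (auto split: if_splits)
 from Cons.IH[OF this] show ?case using v by (auto split: if_splits)
qed simp

definition bsym :: "bool => sym" where "bsym b = (if b then S1 else S0)"

lemma bsym_S1 [simp]: "bsym b = S1 \<longleftrightarrow> b" by (simp add: bsym_def)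

text \<open>The carry is always stored as one digit, so that an iteration of the addition loop pushes as
 many symbols as it pops.\<close>

definition AddBit :: "nat => nat => bool => bool => com" where
 "AddBit t1 c x y = Case c (%k. case k of None => Push t1 (bsym (x ~= y))
   | Some b => Seq (Push t1 (bsym ((x ~= y) ~= (b = S1)))) (Push c (bsym ((x \<and> y) \<or> (x \<and> b = S1) \<or> (y \<and> b = S1)))))"

definition AddLoop :: "nat => nat => nat => nat => nat => com" where
 "AddLoop a x t1 t2 c = For a (%d. Case x (%y. case y of None => AddBit t1 c (d = S1) False
   | Some e => Seq (Push t2 e) (AddBit t1 c (d = S1) (e = S1))))"

definition AddTo :: "nat => nat => nat => nat => nat => com" where
 "AddTo a x t1 t2 c = Seq (Push c S0) (Seq (AddLoop a x t1 t2 c) (Seq (Clr c) (Seq (Mv t1 a) (Mv t2 x))))"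

lemma ok_AddBit [simp]: "t1 \<in> A ==> c \<in> A ==> ok A (AddBit t1 c x y)"
 by (auto simp: AddBit_def split: option.split)

lemma ok_AddLoop [simp]: "distinct [a, x, t1, t2, c] ==> {a, x, t1, t2, c} \<subseteq> A ==> ok A (AddLoop a x t1 t2 c)"
 by (auto simp: AddLoop_def split: option.split)

lemma ok_AddTo [simp]: "distinct [a, x, t1, t2, c] ==> {a, x, t1, t2, c} \<subseteq> A ==> ok A (AddTo a x t1 t2 c)"
 by (auto simp: AddTo_def)

lemma gr_AddBit: "c < K ==> 1 <= k ==> gr K k (AddBit t1 c x y)"
 unfolding AddBit_def by (rule gr_Case) (auto intro!: gr_Seq[where a = 1 and b = 1] gr_Push)

lemma pb_AddBit: "c < K ==> t1 < K ==> pb K (AddBit t1 c x y)"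
 unfolding AddBit_def by (rule pb_Case) (auto intro!: pb_Seq pb_basic)

lemma gr_AddLoop_body: "x < K ==> c < K ==> 1 <= k ==> gr K k (Case x (%y. case y of None => AddBit t1 c d False
   | Some e => Seq (Push t2 e) (AddBit t1 c d (e = S1))))"
 by (rule gr_Case) (auto intro!: gr_Seq[where a = 1 and b = 1] gr_Push gr_AddBit intro: gr_mono)

lemma gr_AddLoop: "a < K ==> x < K ==> c < K ==> distinct [a, x, t1, t2, c] ==> gr K k (AddLoop a x t1 t2 c)"
 unfolding AddLoop_def by (rule gr_For) (auto intro!: gr_AddLoop_body split: option.split)

lemma pb_AddLoop: "{a, x, t1, t2, c} \<subseteq> {..<K} ==> distinct [a, x, t1, t2, c] ==> pb K (AddLoop a x t1 t2 c)"
 unfolding AddLoop_def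
 by (rule pb_For[where k = 1]) (auto intro!: gr_AddLoop_body pb_Case pb_Seq pb_basic pb_AddBit split: option.split)

lemma gr_AddTo: "{a, x, t1, t2, c} \<subseteq> {..<K} ==> distinct [a, x, t1, t2, c] ==> 1 <= k ==> gr K k (AddTo a x t1 t2 c)"
 unfolding AddTo_def
 by (intro gr_Seq[OF gr_Push[of 1] gr_Seq[OF gr_AddLoop[where k = 0] gr_Seq[OF gr_Clr[where k = 0] gr_Seq[OF gr_Mv[where k = 0] gr_Mv[where k = 0]]]]]) auto

lemma pb_AddTo: "{a, x, t1, t2, c} \<subseteq> {..<K} ==> distinct [a, x, t1, t2, c] ==> pb K (AddTo a x t1 t2 c)"
 unfolding AddTo_def by (intro pb_Seq pb_basic pb_AddLoop pb_Clr pb_Mv) auto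

lemma fold_AddLoop:
 assumes d: "distinct [x, t1, t2, c]" and "ss c = [bsym k]"
 shows "fold (%d. sem f (Case x (%y. case y of None => AddBit t1 c (d = S1) False
   | Some e => Seq (Push t2 e) (AddBit t1 c (d = S1) (e = S1))))) w (ss, q) =
  (ss(t1 := rev (addw w (ss x) k) @ ss t1, t2 := rev (take (length w) (ss x)) @ ss t2,
    x := drop (length w) (ss x), c := [bsym (cout w (ss x) k)]), q)"
 using assms(2)
proof (induction w arbitrary: ss k)
 case Nil
 then show ?case using d by (auto simp: fun_eq_iff)
next
 case (Cons a w)
 let ?k = "(a = S1 \<and> hb (ss x)) \<or> (a = S1 \<and> k) \<or> (hb (ss x) \<and> k)"
 let ?ss = "ss(t1 := bsym (((a = S1) ~= hb (ss x)) ~= k) # ss t1, t2 := rev (take 1 (ss x)) @ ss t2, x := tl (ss x), c := [bsym ?k])"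
 have 1: "sem f (Case x (%y. case y of None => AddBit t1 c (a = S1) False
   | Some e => Seq (Push t2 e) (AddBit t1 c (a = S1) (e = S1)))) (ss, q) = (?ss, q)"
  using d Cons.prems by (cases "ss x") (auto simp: AddBit_def hb_def fun_eq_iff)
 have 2: "?ss c = [bsym ?k]" by simp
 show ?case unfolding fold.simps o_apply 1 Cons.IH[of ?ss ?k, OF 2]
  using d by (cases "ss x") (auto simp: fun_eq_iff bsym_def hb_def)
qed

lemma sem_AddTo [simp]:
 assumes "distinct [a, x, t1, t2, c]" "ss t1 = []" "ss t2 = []" "ss c = []"
 shows "sem f (AddTo a x t1 t2 c) (ss, q) = (ss(a := addw (ss a) (ss x) False), q)"
proof -
 have l: "sem f (AddLoop a x t1 t2 c) (ss(c := [S0]), q) =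
   (ss(t1 := rev (addw (ss a) (ss x) False), t2 := rev (take (length (ss a)) (ss x)),
    x := drop (length (ss a)) (ss x), c := [bsym (cout (ss a) (ss x) False)], a := []), q)"
 proof -
  have o: "\<And>d. ok (- {a}) (Case x (%y. case y of None => AddBit t1 c (d = S1) False
   | Some e => Seq (Push t2 e) (AddBit t1 c (d = S1) (e = S1))))" using assms(1) by (auto split: option.split)
  have k: "(ss(c := [S0])) c = [bsym False]" by (simp add: bsym_def)
  have d: "distinct [x, t1, t2, c]" using assms(1) by simp
  show ?thesis unfolding AddLoop_def sem_For[OF o] fold_AddLoop[where ss = "ss(c := [S0])", OF d k] fst_conv
   using assms by (auto simp: fun_eq_iff)
 qed
 have p: "sem f (Push c S0) (ss, q) = (ss(c := [S0]), q)" using assms(4) by simp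
 show ?thesis unfolding AddTo_def sem.simps(3) p l using assms by (auto simp: fun_eq_iff simp del: sem.simps)
qed

text \<open>\<open>Cmp a b r\<close> consumes \<open>a\<close> and \<open>b\<close> and leaves the truth value of \<open>a <= b\<close> in \<open>r\<close>.\<close>

definition setT :: "nat => com" where "setT r = Seq (Pop r) (Push r S1)"

definition Cmp :: "nat => nat => nat => com" where
 "Cmp a b r = Seq (Push r S1) (Seq (For a (%x. Case b (%y.
   if x = S1 \<and> y ~= Some S1 then Pop r else if x ~= S1 \<and> y = Some S1 then setT r else Skip)))
   (For b (%y. if y = S1 then setT r else Skip)))"

lemma ok_setT [simp]: "ok A (setT r) \<longleftrightarrow> r \<in> A" by (auto simp: setT_def)

lemma ok_Cmp [simp]: "distinct [a, b, r] ==> {a, b, r} \<subseteq> A ==> ok A (Cmp a b r)"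
 by (auto simp: Cmp_def)

lemma gr_setT: "r < K ==> 1 <= k ==> gr K k (setT r)"
 unfolding setT_def by (rule gr_Seq[OF gr_Pop[where k = 0] gr_Push[of 1]]) auto

lemma pb_setT: "r < K ==> pb K (setT r)"
 unfolding setT_def by (intro pb_Seq pb_Pop pb_basic) auto

lemma pb_Cmp: "{a, b, r} \<subseteq> {..<K} ==> distinct [a, b, r] ==> pb K (Cmp a b r)"
 unfolding Cmp_def
 by (intro pb_Seq pb_For[where k = 1] pb_basic pb_Case)
  (auto intro!: gr_Case gr_Pop gr_setT gr_Skip pb_Pop pb_setT pb_basic)

text \<open>Digits arrive least significant first, so a later difference overrides the earlier
  verdict.\<close>

definition cmp_upd :: "bool => bool => bool => bool" where
 "cmp_upd x y r = (if x \<and> \<not> y then False else if \<not> x \<and> y then True else r)"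

primrec lew :: "word => word => bool => bool" where
 "lew [] ys r = (r \<or> val ys > 0)"
| "lew (x # xs) ys r = lew xs (tl ys) (cmp_upd (x = S1) (hb ys) r)"

lemma lew_val: "lew xs ys r \<longleftrightarrow> val xs < val ys \<or> (val xs = val ys \<and> r)"
proof (induction xs arbitrary: ys r)
 case (Cons x xs)
 show ?case unfolding lew.simps Cons.IH using val_hb[of ys] by (auto simp: cmp_upd_def)
qed auto

definition flag :: "bool => word" where "flag b = (if b then [S1] else [])"

lemma fold_Cmp1:
 assumes "b ~= r" "ss r = flag k"
 shows "\<exists>k'. fold (%x. sem f (Case b (%y. if x = S1 \<and> y ~= Some S1 then Pop r else if x ~= S1 \<and> y = Some S1 then setT r else Skip))) w (ss, q) =
  (ss(b := drop (length w) (ss b), r := flag k'), q) \<and> lew w (ss b) k = lew [] (drop (length w) (ss b)) k'"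
 using assms(2)
proof (induction w arbitrary: ss k)
 case Nil
 then show ?case using assms(1) by (intro exI[of _ k]) (auto simp: fun_eq_iff)
next
 case (Cons a w)
 let ?k = "cmp_upd (a = S1) (hb (ss b)) k" let ?ss = "ss(b := tl (ss b), r := flag ?k)"
 have 1: "sem f (Case b (%y. if a = S1 \<and> y ~= Some S1 then Pop r else if a ~= S1 \<and> y = Some S1 then setT r else Skip)) (ss, q) = (?ss, q)"
  using assms(1) Cons.prems by (cases "ss b") (auto simp: cmp_upd_def hb_def flag_def setT_def fun_eq_iff)
 have "?ss r = flag ?k" by simp
 from Cons.IH[of ?ss ?k, OF this] obtain k' where
  k': "fold (%x. sem f (Case b (%y. if x = S1 \<and> y ~= Some S1 then Pop r else if x ~= S1 \<and> y = Some S1 then setT r else Skip))) w (?ss, q) =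
   (?ss(b := drop (length w) (?ss b), r := flag k'), q)" "lew w (?ss b) ?k = lew [] (drop (length w) (?ss b)) k'" by blast
 show ?case
 proof (intro exI[of _ k'] conjI)
  show "fold (%x. sem f (Case b (%y. if x = S1 \<and> y ~= Some S1 then Pop r else if x ~= S1 \<and> y = Some S1 then setT r else Skip))) (a # w) (ss, q) =
   (ss(b := drop (length (a # w)) (ss b), r := flag k'), q)"
   unfolding fold.simps o_apply 1 k'(1) using assms(1) by (auto simp: fun_eq_iff drop_Suc)
  show "lew (a # w) (ss b) k = lew [] (drop (length (a # w)) (ss b)) k'" using k'(2) assms(1) by (simp add: drop_Suc)
 qed
qed

lemma fold_Cmp2:
 "ss r = flag k ==> fold (%y. sem f (if y = S1 then setT r else Skip)) w (ss, q) = (ss(r := flag (k \<or> val w > 0)), q)"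
proof (induction w arbitrary: ss k)
 case (Cons a w)
 have 1: "sem f (if a = S1 then setT r else Skip) (ss, q) = (ss(r := flag (k \<or> a = S1)), q)"
  using Cons.prems by (auto simp: setT_def flag_def fun_eq_iff)
 show ?case unfolding fold.simps o_apply 1 by (subst Cons.IH[of _ "k \<or> a = S1"]) (auto simp: fun_eq_iff)
qed (auto simp: fun_eq_iff)

lemma sem_Cmp [simp]:
 assumes "distinct [a, b, r]" "ss r = []"
 shows "sem f (Cmp a b r) (ss, q) = (ss(a := [], b := [], r := flag (val (ss a) <= val (ss b))), q)"
proof -
 let ?ss = "ss(r := [S1])"
 have p: "sem f (Push r S1) (ss, q) = (?ss, q)" using assms(2) by simp
 have o1: "ok (- {a}) (Case b (%y. if x = S1 \<and> y ~= Some S1 then Pop r else if x ~= S1 \<and> y = Some S1 then setT r else Skip))" for x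
  using assms(1) by auto
 have o2: "ok (- {b}) (if y = S1 then setT r else Skip)" for y using assms(1) by auto
 have br: "b ~= r" and k: "?ss r = flag True" using assms(1) by (auto simp: flag_def)
 obtain k' where k': "fold (%x. sem f (Case b (%y. if x = S1 \<and> y ~= Some S1 then Pop r else if x ~= S1 \<and> y = Some S1 then setT r else Skip))) (ss a) (?ss, q) =
  (?ss(b := drop (length (ss a)) (?ss b), r := flag k'), q)" "lew (ss a) (?ss b) True = lew [] (drop (length (ss a)) (?ss b)) k'"
  using fold_Cmp1[where ss = ?ss, OF br k] by blast
 have s1: "sem f (For a (%x. Case b (%y. if x = S1 \<and> y ~= Some S1 then Pop r else if x ~= S1 \<and> y = Some S1 then setT r else Skip))) (?ss, q)
   = (?ss(b := drop (length (ss a)) (ss b), r := flag k', a := []), q)"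
  unfolding sem_For[OF o1] fst_conv using assms(1) k'(1) by simp
 let ?s2 = "?ss(b := drop (length (ss a)) (ss b), r := flag k', a := [])"
 have r2: "?s2 r = flag k'" using assms(1) by simp
 have s2: "sem f (For b (%y. if y = S1 then setT r else Skip)) (?s2, q) =
   (?s2(r := flag (k' \<or> val (?s2 b) > 0), b := []), q)"
  unfolding sem_For[OF o2] fst_conv fold_Cmp2[where ss = ?s2, OF r2] by simp
 have "k' \<or> val (?s2 b) > 0 \<longleftrightarrow> val (ss a) <= val (ss b)"
  using k'(2) assms(1) by (auto simp: lew_val)
 then show ?thesis unfolding Cmp_def sem.simps(3) p s1 s2 using assms by (auto simp: fun_eq_iff)
qed

text \<open>Horner's scheme: \<open>xm\<close> delivers the digits of the multiplier from the most
  significant one, each doubling \<open>z\<close> and possibly adding \<open>x\<close>. The zeros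
  pushed on \<open>z\<close> at the start provide the width of \<open>x\<close>.\<close>

definition Sq :: "nat => nat => nat => nat => nat => nat => com" where
 "Sq x z xm t1 t2 c = Seq (For x (%d. Seq (Push xm d) (Push z S0))) (Seq (For xm (%d. Seq (Push x d) (Push t1 d)))
   (Seq (Mv t1 xm) (For xm (%d. Seq (Push z S0) (if d = S1 then AddTo z x t1 t2 c else Skip)))))"

lemma ok_Sq [simp]: "distinct [x, z, xm, t1, t2, c] ==> {x, z, xm, t1, t2, c} \<subseteq> A ==> ok A (Sq x z xm t1 t2 c)"
 by (auto simp: Sq_def)

lemma pb_Sq: "{x, z, xm, t1, t2, c} \<subseteq> {..<K} ==> distinct [x, z, xm, t1, t2, c] ==> pb K (Sq x z xm t1 t2 c)"
 unfolding Sq_def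
 by (intro pb_Seq pb_For[where k = 2] pb_basic pb_Mv gr_Seq[where a = 1 and b = 1] gr_Push)
  (auto intro!: gr_AddTo gr_Skip pb_AddTo pb_basic)

text \<open>Here \<open>m\<close> is the number formed by the \<open>n\<close> multiplier digits
  read so far; \<open>m < 2 ^ n\<close> together with the width \<open>length (ss x) + n\<close> of
  the accumulator excludes overflow.\<close>

lemma fold_Sq:
 assumes d: "distinct [x, z, t1, t2, c]" "ss t1 = []" "ss t2 = []" "ss c = []"
  and "length (ss z) = length (ss x) + n" "val (ss z) = val (ss x) * m" "m < 2 ^ n"
 shows "\<exists>v. fold (%d. sem f (Seq (Push z S0) (if d = S1 then AddTo z x t1 t2 c else Skip))) w (ss, q) = (ss(z := v), q)
  \<and> length v = length (ss x) + n + length w \<and> val v = val (ss x) * (m * 2 ^ length w + val (rev w))"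
 using assms
proof (induction w arbitrary: ss n m)
 case Nil
 then show ?case by (intro exI[of _ "ss z"]) simp
next
 case (Cons a w)
 define v0 where "v0 = (if a = S1 then addw (S0 # ss z) (ss x) False else S0 # ss z)"
 define m0 where "m0 = 2 * m + (if a = S1 then 1 else 0)"
 have 1: "sem f (Seq (Push z S0) (if a = S1 then AddTo z x t1 t2 c else Skip)) (ss, q) = (ss(z := v0), q)"
  using Cons.prems by (auto simp: v0_def)
 have m1: "m0 < 2 ^ Suc n" using Cons.prems(7) by (auto simp: m0_def)
 have "val (ss x) * m0 < 2 ^ length (ss x) * 2 ^ Suc n"
  by (rule mult_strict_mono) (use val_lt[of "ss x"] m1 in auto)
 then have lt: "val (ss x) * m0 < 2 ^ Suc (length (ss z))" using Cons.prems(5) by (simp add: power_add)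
 have v: "val v0 = val (ss x) * m0"
 proof (cases "a = S1")
  case True
  then have "val (S0 # ss z) + val (ss x) + 0 < 2 ^ length (S0 # ss z)" using lt Cons.prems(6) by (simp add: algebra_simps m0_def)
  then show ?thesis using True val_addw[of "S0 # ss z" "ss x" False] Cons.prems(6) by (simp add: algebra_simps m0_def v0_def)
 qed (use Cons.prems(6) in \<open>simp add: v0_def m0_def\<close>)
 have l: "length v0 = length (ss x) + Suc n" using Cons.prems(5) by (simp add: v0_def)
 have h: "(ss(z := v0)) x = ss x" using Cons.prems(1) by simp
 obtain v where v': "fold (%d. sem f (Seq (Push z S0) (if d = S1 then AddTo z x t1 t2 c else Skip))) w (ss(z := v0), q) = ((ss(z := v0))(z := v), q)"
  "length v = length (ss x) + Suc n + length w" "val v = val (ss x) * (m0 * 2 ^ length w + val (rev w))"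
 proof -
  have "\<exists>v. fold (%d. sem f (Seq (Push z S0) (if d = S1 then AddTo z x t1 t2 c else Skip))) w (ss(z := v0), q) = ((ss(z := v0))(z := v), q)
   \<and> length v = length ((ss(z := v0)) x) + Suc n + length w \<and> val v = val ((ss(z := v0)) x) * (m0 * 2 ^ length w + val (rev w))"
   by (rule Cons.IH) (use Cons.prems v l m1 in auto)
  then show thesis unfolding h using that by blast
 qed
 show ?case
 proof (intro exI[of _ v] conjI)
  show "fold (%d. sem f (Seq (Push z S0) (if d = S1 then AddTo z x t1 t2 c else Skip))) (a # w) (ss, q) = (ss(z := v), q)"
   unfolding fold.simps o_apply 1 v'(1) by simp
  show "length v = length (ss x) + n + length (a # w)" using v'(2) by simp
  have "m0 * 2 ^ length w + val (rev w) = m * 2 ^ length (a # w) + val (rev (a # w))"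
   by (simp add: val_append algebra_simps m0_def)
  then show "val v = val (ss x) * (m * 2 ^ length (a # w) + val (rev (a # w)))" using v'(3) by simp
 qed
qed

lemma sem_Sq:
 assumes d: "distinct [x, z, xm, t1, t2, c]" and e: "ss z = []" "ss xm = []" "ss t1 = []" "ss t2 = []" "ss c = []"
 shows "\<exists>v. sem f (Sq x z xm t1 t2 c) (ss, q) = (ss(z := v), q) \<and> length v = 2 * length (ss x) \<and> val v = val (ss x) ^ 2"
proof -
 have f1: "fold (%d. sem f (Seq (Push xm d) (Push z S0))) w (ss, q) = (ss(xm := rev w @ ss xm, z := replicate (length w) S0 @ ss z), q)" for w ss
  using d by (induction w arbitrary: ss) (auto simp: fun_eq_iff replicate_app_Cons_same)
 have o1: "ok (- {x}) (Seq (Push xm d) (Push z S0))" for d using d by auto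
 have s1: "sem f (For x (%d. Seq (Push xm d) (Push z S0))) (ss, q) = (ss(xm := rev (ss x), z := replicate (length (ss x)) S0, x := []), q)"
  unfolding sem_For[OF o1] fst_conv f1 using e by simp
 let ?ss1 = "ss(xm := rev (ss x), z := replicate (length (ss x)) S0, x := [])"
 have o2: "ok (- {xm}) (Seq (Push x d) (Push t1 d))" for d using d by auto
 have xt: "x ~= t1" using d by auto
 have s2: "sem f (For xm (%d. Seq (Push x d) (Push t1 d))) (?ss1, q) = (ss(z := replicate (length (ss x)) S0, t1 := ss x), q)"
  unfolding sem_For[OF o2] fst_conv fold_push2[OF xt] using d e by (auto simp: fun_eq_iff)
 let ?ss3 = "ss(z := replicate (length (ss x)) S0, xm := rev (ss x))"
 have s3: "sem f (Mv t1 xm) (ss(z := replicate (length (ss x)) S0, t1 := ss x), q) = (?ss3, q)"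
  using d e by (auto simp: fun_eq_iff)
 have o4: "ok (- {xm}) (Seq (Push z S0) (if d = S1 then AddTo z x t1 t2 c else Skip))" for d using assms(1) by auto
 have d': "distinct [x, z, t1, t2, c]" using d by auto
 obtain v where v: "fold (%d. sem f (Seq (Push z S0) (if d = S1 then AddTo z x t1 t2 c else Skip))) (rev (ss x)) (?ss3, q) = (?ss3(z := v), q)"
   "length v = length (ss x) + 0 + length (rev (ss x))" "val v = val (ss x) * (0 * 2 ^ length (rev (ss x)) + val (rev (rev (ss x))))"
  using fold_Sq[OF d', of ?ss3 0 0 f "rev (ss x)" q] d e by auto
 have s4: "sem f (For xm (%d. Seq (Push z S0) (if d = S1 then AddTo z x t1 t2 c else Skip))) (?ss3, q) = (ss(z := v), q)"
  unfolding sem_For[OF o4] fst_conv using v(1) d e by (auto simp: fun_eq_iff)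
 have "sem f (Sq x z xm t1 t2 c) (ss, q) = (ss(z := v), q)"
  unfolding Sq_def sem.simps(3) s1 s2 s3 s4 ..
 then show ?thesis using v(2,3) by (auto simp: power2_eq_square)
qed

notation Seq (infixr ";;" 60)

subsection \<open>Reading a query\<close>

definition Goto :: "nat => com" where "Goto q = PushW 3 (replicate q S1)"

text \<open>Length headers are skipped without counting: a slash ends the digits, and the first
  \<open>S1\<close> after the zeros of an exponent already belongs to the next header. The header of
  the last component is counted, as its length is the precision.\<close>

definition pact :: "nat => sym => com" where
 "pact q a = (if q = 0 then Goto (if a = S1 then 0 else 1)
  else if q = 1 then Push 4 a ;; Goto 2
  else if q = 2 then (if a = SSlash then Goto 3 else Push 5 a ;; Goto 2)
  else if q = 3 then Goto 4
  else if q = 4 then (if a = S0 then Push 6 S0 ;; Goto 4 else Goto 5)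
  else if q = 5 then Goto (if a = S1 then 5 else 6)
  else if q = 6 then Push 7 a ;; Goto 7
  else if q = 7 then (if a = SSlash then Goto 8 else Push 8 a ;; Goto 7)
  else if q = 8 then Goto 9
  else if q = 9 then (if a = S0 then Push 9 S0 ;; Goto 9 else Push 10 S1 ;; Goto 10)
  else if q = 10 then (if a = S1 then Push 10 S1 ;; Goto 10 else Goto 11)
  else Goto 11)"

text \<open>For \<open>n = 0\<close> the last component contributes a single zero, which the automaton books on the
 exponent of the second coordinate; the final test takes it back.\<close>

definition Parse :: com where
 "Parse = Mv 0 11 ;; For 11 (%a. CaseN 3 11 (%q. pact q a)) ;; Clr 3 ;;
   Case 10 (%x. case x of None => Pop 9 | Some a => Push 10 a)"

lemma sem_Goto [simp]: "sem f (Goto q) (ss, z) = (ss(3 := replicate q S1 @ ss 3), z)" by (simp add: Goto_def)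
lemma ok_Goto [simp]: "3 \<in> A ==> ok A (Goto q)" by (simp add: Goto_def)
lemma gr_Goto: "q <= k ==> gr K k (Goto q)" by (simp add: Goto_def gr_PushW)
lemma pb_Goto: "3 < K ==> pb K (Goto q)" by (simp add: Goto_def pb_PushW)

lemma ok_pact: "{3..10} \<subseteq> A ==> ok A (pact q a)"
proof -
 assume A: "{3..10} \<subseteq> A"
 have "3 \<in> A" "4 \<in> A" "5 \<in> A" "6 \<in> A" "7 \<in> A" "8 \<in> A" "9 \<in> A" "10 \<in> A" by (rule subsetD[OF A], simp)+
 then show ?thesis by (simp add: pact_def)
qed

lemma gr_pact: "gr K 12 (pact q a)"
 unfolding pact_def by (auto intro!: gr_Goto gr_Seq[where a = 1 and b = 11] gr_Push)

lemma pb_pact: "11 < K ==> pb K (pact q a)"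
 unfolding pact_def by (auto intro!: pb_Goto pb_Seq pb_basic)

lemma ok_Parse: "{0..11} \<subseteq> A ==> ok A Parse"
 unfolding Parse_def by (auto intro!: ok_CaseN ok_pact split: option.split)

lemma pb_Parse: "11 < K ==> pb K Parse"
 unfolding Parse_def
 by (intro pb_Seq pb_Mv pb_For[where k = 12] pb_CaseN pb_pact pb_Clr gr_CaseN pb_Case)
  (auto intro!: ok_CaseN ok_pact pb_Pop pb_basic gr_mono[OF gr_pact])

definition pstep :: "fn => sym => store => store" where
 "pstep f a = sem f (CaseN 3 11 (%q. pact q a))"

definition PS :: "nat => word => word => word => word => word => word => word => (nat => word) => nat => word" where
 "PS q sx x kx sy y ky nn ss = ss(3 := replicate q S1, 4 := sx, 5 := x, 6 := kx, 7 := sy, 8 := y, 9 := ky, 10 := nn)"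

lemma pstep_PS: "q <= 11 ==> pstep f a (PS q sx x kx sy y ky nn ss, z) =
  (if q = 0 then (PS (if a = S1 then 0 else 1) sx x kx sy y ky nn ss, z)
  else if q = 1 then (PS 2 (a # sx) x kx sy y ky nn ss, z)
  else if q = 2 then (if a = SSlash then (PS 3 sx x kx sy y ky nn ss, z) else (PS 2 sx (a # x) kx sy y ky nn ss, z))
  else if q = 3 then (PS 4 sx x kx sy y ky nn ss, z)
  else if q = 4 then (if a = S0 then (PS 4 sx x (S0 # kx) sy y ky nn ss, z) else (PS 5 sx x kx sy y ky nn ss, z))
  else if q = 5 then (PS (if a = S1 then 5 else 6) sx x kx sy y ky nn ss, z)
  else if q = 6 then (PS 7 sx x kx (a # sy) y ky nn ss, z)
  else if q = 7 then (if a = SSlash then (PS 8 sx x kx sy y ky nn ss, z) else (PS 7 sx x kx sy (a # y) ky nn ss, z))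
  else if q = 8 then (PS 9 sx x kx sy y ky nn ss, z)
  else if q = 9 then (if a = S0 then (PS 9 sx x kx sy y (S0 # ky) nn ss, z) else (PS 10 sx x kx sy y ky (S1 # nn) ss, z))
  else if q = 10 then (if a = S1 then (PS 10 sx x kx sy y ky (S1 # nn) ss, z) else (PS 11 sx x kx sy y ky nn ss, z))
  else (PS 11 sx x kx sy y ky nn ss, z))"
proof -
 assume q: "q <= 11"
 have "pstep f a (PS q sx x kx sy y ky nn ss, z) = sem f (pact q a) ((PS q sx x kx sy y ky nn ss)(3 := []), z)"
  unfolding pstep_def by (subst sem_CaseN) (use q in \<open>simp_all add: PS_def\<close>)
 then show ?thesis using q
  by (simp add: pact_def PS_def, auto simp: fun_eq_iff simp del: replicate.simps)
qed

lemma fold_ones: "q = 0 \<or> q = 5 ==> fold (pstep f) (replicate m S1) (PS q sx x kx sy y ky nn ss, z) = (PS q sx x kx sy y ky nn ss, z)"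
 by (induction m) (auto simp: pstep_PS)

lemma fold_zeros4: "fold (pstep f) (replicate m S0) (PS 4 sx x kx sy y ky nn ss, z) = (PS 4 sx x (replicate m S0 @ kx) sy y ky nn ss, z)"
 by (induction m arbitrary: kx) (auto simp: pstep_PS replicate_app_Cons_same)

lemma fold_zeros9: "fold (pstep f) (replicate m S0) (PS 9 sx x kx sy y ky nn ss, z) = (PS 9 sx x kx sy y (replicate m S0 @ ky) nn ss, z)"
 by (induction m arbitrary: ky) (auto simp: pstep_PS replicate_app_Cons_same)

lemma fold_ones10: "fold (pstep f) (replicate m S1) (PS 10 sx x kx sy y ky nn ss, z) = (PS 10 sx x kx sy y ky (replicate m S1 @ nn) ss, z)"
 by (induction m arbitrary: nn) (auto simp: pstep_PS replicate_app_Cons_same)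

lemma fold_any11: "fold (pstep f) w (PS 11 sx x kx sy y ky nn ss, z) = (PS 11 sx x kx sy y ky nn ss, z)"
 by (induction w) (auto simp: pstep_PS)

lemma fold_dig2: "set w \<subseteq> {S0, S1} ==> fold (pstep f) w (PS 2 sx x kx sy y ky nn ss, z) = (PS 2 sx (rev w @ x) kx sy y ky nn ss, z)"
 by (induction w arbitrary: x) (auto simp: pstep_PS)

lemma fold_dig7: "set w \<subseteq> {S0, S1} ==> fold (pstep f) w (PS 7 sx x kx sy y ky nn ss, z) = (PS 7 sx x kx sy (rev w @ y) ky nn ss, z)"
 by (induction w arbitrary: y) (auto simp: pstep_PS)

definition dstr :: "sym => word => nat => word" where
 "dstr s x k = [s] @ x @ [SSlash, S1] @ replicate k S0"

lemma D_dstr: "u \<in> D \<longleftrightarrow> (\<exists>s x k. u = dstr s x k \<and> s \<in> {SPlus, SMinus} \<and> set x \<subseteq> {S0, S1})"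
 unfolding D_def dstr_def by blast

lemma length_dstr [simp]: "length (dstr s x k) = length x + k + 3" by (simp add: dstr_def)

lemma dyad_val_dstr:
 assumes "set x \<subseteq> {S0, S1}"
 shows "dyad_val (dstr s x k) = (if s = SMinus then -1 else 1) * real (bin_val x) / 2 ^ k"
proof -
 have "takeWhile (%c. c ~= SSlash) (x @ SSlash # S1 # replicate k S0) = x"
  using assms by (subst takeWhile_append2) auto
 then show ?thesis by (simp add: dyad_val_def dstr_def Let_def)
qed

lemma fold_parse:
 assumes x: "set x \<subseteq> {S0, S1}" "set x' \<subseteq> {S0, S1}"
 shows "fold (pstep f) (tuple [dstr s x k, dstr s' x' k', replicate n S0]) (PS 0 [] [] [] [] [] [] [] ss, z) =
  (PS (if n = 0 then 9 else 11) [s] (rev x) (replicate k S0) [s'] (rev x')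
    ((if n = 0 then [S0] else []) @ replicate k' S0) (replicate n S1) ss, z)"
proof -
 \<comment> \<open>A dyadic string is nonempty, so the header of the second one begins with
   \<open>S1\<close> and ends the zeros of the first exponent.\<close>
 obtain l where l: "length (dstr s' x' k') = Suc l" by (auto simp: dstr_def)
 have sp: "tuple [dstr s x k, dstr s' x' k', replicate n S0] =
   replicate (length (dstr s x k)) S1 @ [S0, s] @ x @ [SSlash, S1] @ replicate k S0 @ [S1] @ replicate l S1 @ [S0, s'] @ x' @
   [SSlash, S1] @ replicate k' S0 @ replicate n S1 @ [S0] @ replicate n S0"
  unfolding tuple_def using l by (simp add: dstr_def)
 show ?thesis
 proof (cases n)
  case 0
  then show ?thesis unfolding sp
   by (simp add: fold_ones pstep_PS fold_dig2 fold_dig7 fold_zeros4 fold_zeros9 x del: length_dstr fold_replicate)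
 next
  case (Suc m)
  then show ?thesis unfolding sp
   by (simp add: fold_ones pstep_PS fold_dig2 fold_dig7 fold_zeros4 fold_zeros9 fold_ones10 fold_any11 x replicate_app_Cons_same del: length_dstr fold_replicate)
 qed
qed

lemma sem_Parse:
 assumes x: "set x \<subseteq> {S0, S1}" "set x' \<subseteq> {S0, S1}"
  and s0: "ss 0 = rev (tuple [dstr s x k, dstr s' x' k', replicate n S0])"
  and e: "\<And>j. 3 <= j ==> j <= 11 ==> ss j = []"
 shows "sem f Parse (ss, z) = (ss(0 := [], 4 := [s], 5 := rev x, 6 := replicate k S0, 7 := [s'], 8 := rev x',
   9 := replicate k' S0, 10 := replicate n S1), z)"
proof -
 let ?w = "tuple [dstr s x k, dstr s' x' k', replicate n S0]"
 let ?ss1 = "ss(0 := [], 11 := ?w)"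
 have m: "sem f (Mv 0 11) (ss, z) = (?ss1, z)" using s0 e[of 11] by (auto simp: fun_eq_iff)
 have p: "?ss1 = PS 0 [] [] [] [] [] [] [] ?ss1" using e by (auto simp: PS_def fun_eq_iff)
 have o: "ok (- {11}) (CaseN 3 11 (%q. pact q a))" for a by (intro ok_CaseN ok_pact) auto
 have fo: "sem f (For 11 (%a. CaseN 3 11 (%q. pact q a))) (?ss1, z) = upd 11 [] (fold (pstep f) ?w (?ss1, z))"
  unfolding sem_For[OF o] pstep_def by simp
 have fo': "fold (pstep f) ?w (?ss1, z) = (PS (if n = 0 then 9 else 11) [s] (rev x) (replicate k S0) [s'] (rev x')
    ((if n = 0 then [S0] else []) @ replicate k' S0) (replicate n S1) ?ss1, z)"
  by (subst p) (rule fold_parse[OF x])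
 show ?thesis unfolding Parse_def sem.simps(3) m fo fo' upd_pair sem_Clr
  using e by (cases n) (auto simp: PS_def fun_eq_iff)
qed

subsection \<open>Scaling to a fixed precision\<close>

text \<open>Both magnitudes are truncated to the grid of mesh \<open>1 / 2 ^ N\<close>, where
  \<open>N = n + c0\<close> is left in unary on stack 12: \<open>N\<close> low zeros multiply by
  \<open>2 ^ N\<close>, and dropping as many digits as the exponent has zeros divides. The constant
  \<open>c0\<close> is the number of guard digits.\<close>

definition Scale :: "nat => com" where
 "Scale c0 = Each 10 13 (%_. Push 12 S1) ;; PushW 12 (replicate c0 S1) ;;
   Each 12 13 (%_. Push 5 S0) ;; For 6 (%_. Pop 5) ;; Each 12 13 (%_. Push 8 S0) ;; For 9 (%_. Pop 8)"

lemma pb_Each_Push: "i < K ==> t < K ==> j < K ==> distinct [i, t, j] ==> pb K (Each i t (%_. Push j a))"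
 by (rule pb_Each[where k = 1]) (auto intro: pb_basic gr_Push)

lemma ok_Scale: "{5..13} \<subseteq> A ==> ok A (Scale c0)"
proof -
 assume A: "{5..13} \<subseteq> A"
 have "5 \<in> A" "6 \<in> A" "8 \<in> A" "9 \<in> A" "10 \<in> A" "12 \<in> A" "13 \<in> A" by (rule subsetD[OF A], simp)+
 then show ?thesis by (simp add: Scale_def)
qed

lemma pb_Scale: "13 < K ==> pb K (Scale c0)"
 unfolding Scale_def
 by (intro pb_Seq pb_Each_Push pb_PushW pb_For[where k = 0] pb_Pop gr_Pop) auto

lemma sem_For_Pop: "i ~= j ==> sem f (For i (%_. Pop j)) (ss, z) = (ss(j := drop (length (ss i)) (ss j), i := []), z)"
proof -
 assume ij: "i ~= j"
 have "fold (%a. sem f (Pop j)) w (ss, z) = (ss(j := drop (length w) (ss j)), z)" for w :: word and ss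
  by (induction w arbitrary: ss) (auto simp: drop_Suc)
 then show ?thesis using ij by (subst sem_For) simp_all
qed

lemma sem_Scale:
 assumes "ss 12 = []" "ss 13 = []"
 shows "sem f (Scale c0) (ss, z) = (let N = length (ss 10) + c0 in
  (ss(12 := replicate N S1, 5 := drop (length (ss 6)) (replicate N S0 @ ss 5), 6 := [],
   8 := drop (length (ss 9)) (replicate N S0 @ ss 8), 9 := []), z))"
proof -
 have r: "replicate c0 S1 @ replicate n S1 = replicate (n + c0) S1" for n by (simp add: replicate_add[symmetric] add.commute)
 show ?thesis using assms unfolding Scale_def Let_def
  by (auto simp: sem_For_Pop r fun_eq_iff simp del: sem.simps(5))
qed

definition scaled :: "word => nat => nat => word" where
 "scaled x k N = drop k (replicate N S0 @ rev x)"

lemma val_scaled: "val (scaled x k N) = bin_val x * 2 ^ N div 2 ^ k"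
 by (simp only: scaled_def val_drop val_append bin_val_val val_zeros length_replicate add_0 mult.commute)

subsection \<open>The guess-and-check program for the convex hull\<close>

text \<open>To the right of the word just written the old contents \<open>t\<close> survive, for
  instance those of an earlier answer. A query is therefore closed by an explicit blank before it is
  asked.\<close>

definition ww :: "(nat => cell) => word => (nat => cell) \<times> nat" where
 "ww t w = ((%i. if i < length w then Some (w ! i) else t i), length w)"

lemma sem_QWr_ww [simp]: "sem f (QWr (Some a) Rgt) (ss, ww t w) = (ss, ww t (w @ [a]))"
 by (auto simp: ww_def fun_eq_iff nth_append)

lemma fold_write: "fold (%_. sem f (QWr (Some a) Rgt)) v (ss, ww t w) = (ss, ww t (w @ replicate (length v) a))"
 by (induction v arbitrary: w) (simp_all del: sem.simps)

lemma sem_Each_write [simp]: "i ~= j ==> ss j = [] ==>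
  sem f (Each i j (%_. QWr (Some a) Rgt)) (ss, ww t w) = (ss, ww t (w @ replicate (length (ss i)) a))"
 by (subst sem_Each) (simp_all add: fold_write del: sem.simps)

primrec Wr :: "word => com" where
 "Wr [] = Skip" | "Wr (a # w) = QWr (Some a) Rgt ;; Wr w"

lemma sem_Wr [simp]: "sem f (Wr v) (ss, ww t w) = (ss, ww t (w @ v))"
 by (induction v arbitrary: w) (simp_all del: sem.simps add: sem.simps(1,3))

lemma ok_Wr [simp]: "ok A (Wr v)" by (induction v) auto
lemma gr_Wr: "gr K k (Wr v)"
proof -
 have "gr K 0 (Wr v)" by (induction v) (auto intro: gr_Skip gr_Seq[OF gr_QWr[where k = 0]])
 then show ?thesis by (rule gr_mono) simp
qed
lemma pb_Wr: "pb K (Wr v)" by (induction v) (auto intro!: pb_basic pb_Seq)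

lemma sem_ask: "sem f (QWr None Stay ;; QAsk) (ss, ww t w) = (ss, ww (word_tape (f w)) [])"
proof -
 have "query_word ((fst (ww t w))(length w := None)) = w"
 proof -
  let ?t = "(fst (ww t w))(length w := None)"
  have "(LEAST i. ?t i = None) = length w"
   by (rule Least_equality) (auto simp: ww_def split: if_splits)
  then show ?thesis unfolding query_word_def by (auto simp: ww_def intro!: nth_equalityI)
 qed
 then show ?thesis by (simp add: ww_def)
qed

text \<open>The digits go to the query most significant first; piled up on stack \<open>j\<close>,
  they have the least significant one on top, which is the order of the adder.\<close>

definition GuessCoord :: "nat => com" where
 "GuessCoord j = Each 12 13 (%_. Case 2 (%x. case x of None => Skip
   | Some a => QWr (Some a) Rgt ;; Push j a))"

definition PutCoord :: "nat => com" where
 "PutCoord j = Each 12 13 (%_. QWr (Some S1) Rgt) ;; Each 12 13 (%_. QWr (Some S1) Rgt) ;;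
   Wr [S1, S1, S1, S0, SPlus] ;; GuessCoord j ;; Wr [SSlash, S1] ;; Each 12 13 (%_. QWr (Some S0) Rgt)"

text \<open>The guessed grid point is submitted at precision \<open>n + 6\<close>. Failures are
  collected on stack 22, so that the program continues in the same way whatever the answer.\<close>

definition Point :: com where
 "Point = PutCoord 19 ;; PutCoord 20 ;;
   Each 10 13 (%_. QWr (Some S1) Rgt) ;; Wr (replicate 6 S1 @ [S0]) ;;
   Each 10 13 (%_. QWr (Some S0) Rgt) ;; Wr (replicate 6 S0) ;;
   (QWr None Stay ;; QAsk) ;; QCase (%x. if x = Some S1 then Skip else Push 22 S1) ;;
   AddTo 17 19 14 15 16 ;; Clr 19 ;; AddTo 18 20 14 15 16 ;; Clr 20"

definition HullBody :: com where
 "HullBody = Push 17 S0 ;; Push 18 S0 ;; Point ;; Point ;; PopN 17 2 ;; PopN 18 2"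

text \<open>Each of the \<open>N\<close> rounds prepends one digit to an accumulator and drops two,
  and a round needs width \<open>N + 2\<close>. Starting with \<open>2 * N + 2\<close> digits covers
  the loss.\<close>

definition HullLoop :: com where
 "HullLoop = Each 12 13 (%_. PushW 17 [S0, S0]) ;; PushW 17 [S0, S0] ;;
   Each 12 13 (%_. PushW 18 [S0, S0]) ;; PushW 18 [S0, S0] ;;
   Each 12 13 (%_. Push 21 S1) ;; For 21 (%_. HullBody)"

text \<open>The accumulator is so wide that adding \<open>x\<close> and \<open>y\<close> cannot overflow.\<close>

definition Wide :: "word => nat => nat => com" where
 "Wide w x y = Each x 13 (%_. Push 23 S0) ;; Each y 13 (%_. Push 23 S0) ;; PushW 23 w"

definition Check :: com where
 "Check = Case 25 (%k. if k = None then Push 22 S1 else Skip)"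

text \<open>Closeness is tested without subtraction: \<open>- x\<close> is within the tolerance of a
  nonnegative \<open>y\<close> iff the sum of \<open>x\<close> and \<open>y\<close> is small, and
  for the other sign two comparisons of sums are made.\<close>

definition Near :: "word => nat => nat => nat => com" where
 "Near w s x y = Case s (%a. if a = Some SMinus then
    Wide (replicate (length w) S0) x y ;; AddTo 23 x 14 15 16 ;; AddTo 23 y 14 15 16 ;; PushW 24 w ;; Cmp 23 24 25 ;; Check
   else Wide w x y ;; AddTo 23 y 14 15 16 ;; Dup x 13 24 ;; Cmp 24 23 25 ;; Check ;;
    Wide w x y ;; AddTo 23 x 14 15 16 ;; Dup y 13 24 ;; Cmp 24 23 25 ;; Check)"

definition Verdict :: com where
 "Verdict = Clr 0 ;; Case 22 (%k. if k = None then Push 0 S1 else Push 0 S0)"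

text \<open>In grid units \<open>(1/2) ^ n\<close> is 256, since \<open>N = n + 8\<close>. Points of
  the hull at distance below 256 must pass although rounding may add 4 more. Conversely the test
  admits 289 per coordinate and the average is off by at most 15; a distance of 304 in both
  coordinates stays below 512 in the Euclidean norm. The number 288 satisfies both demands.\<close>

definition w288 :: word where "w288 = [S0, S0, S0, S0, S0, S1, S0, S0, S1]"

definition Hull :: com where
 "Hull = Parse ;; Scale 8 ;; HullLoop ;; Near w288 4 5 17 ;; Near w288 7 8 18 ;; Verdict"

text \<open>Each of the \<open>N\<close> rounds uses four coordinates of \<open>N\<close> digits,
  and \<open>N = n + 8\<close> is at most the length of the input plus 8.\<close>

definition GuessLen :: com where
 "GuessLen = Each 0 13 (%_. Push 20 S1) ;; PushW 20 (replicate 8 S1) ;; Each 0 13 (%_. Push 21 S1) ;; PushW 21 (replicate 8 S1) ;;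
   For 20 (%_. Each 21 13 (%_. PushW 1 [S1, S1, S1, S1])) ;; Clr 21"

lemma ok_GuessLen: "ok {..<30} GuessLen" by (simp add: GuessLen_def)

lemma ok_GuessCoord: "j ~= 12 ==> j < 30 ==> 10 < j ==> ok ({..<30} - {21}) (GuessCoord j)" if "j ~= 21"
 using that by (auto simp: GuessCoord_def split: option.split)

lemma ok_Point: "ok ({..<30} - {21}) Point"
 by (simp add: Point_def PutCoord_def ok_GuessCoord)

lemma ok_HullLoop: "ok {..<30} HullLoop"
 using ok_Point by (simp add: HullLoop_def HullBody_def)

lemma ok_Near: "x \<in> {5, 8} ==> y \<in> {17, 18} ==> s \<in> {4, 7} ==> ok {..<30} (Near w s x y)"
 by (auto simp: Near_def Wide_def Check_def)

lemma ok_Hull: "ok {..<30} Hull"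
 by (auto simp: Hull_def ok_HullLoop ok_Near Verdict_def intro!: ok_Parse ok_Scale)

lemma pb_Each0: "i < K ==> t < K ==> i ~= t ==> pb K (Each i t (%_. QWr x d))"
 by (rule pb_Each[where k = 0]) (auto intro: pb_basic gr_QWr)

lemma gr_Each0: "i < K ==> t < K ==> i ~= t ==> gr K k (Each i t (%_. QWr x d))"
 by (rule gr_Each) (auto intro: gr_QWr)

lemma GuessCoord_body:
 "gr 30 0 (Case 2 (%x. case x of None => Skip | Some a => QWr (Some a) Rgt ;; Push j a))"
 "pb 30 (Case 2 (%x. case x of None => Skip | Some a => QWr (Some a) Rgt ;; Push j a))"
 by (auto intro!: gr_Case gr_Skip gr_Seq[where a = 0 and b = 1] gr_QWr gr_Push pb_Case pb_basic pb_Seq)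

lemma gr_GuessCoord: "j \<in> {19, 20} ==> gr 30 k (GuessCoord j)"
 unfolding GuessCoord_def by (rule gr_Each) (auto intro: GuessCoord_body split: option.split)

lemma pb_GuessCoord: "j \<in> {19, 20} ==> pb 30 (GuessCoord j)"
 unfolding GuessCoord_def by (rule pb_Each[where k = 0]) (auto intro: GuessCoord_body split: option.split)

lemma gr_PutCoord: "j \<in> {19, 20} ==> gr 30 0 (PutCoord j)"
 unfolding PutCoord_def
 by (intro gr_Seq[where a = 0 and b = 0 and k = 0] gr_Each0 gr_Wr gr_GuessCoord) auto

lemma pb_PutCoord: "j \<in> {19, 20} ==> pb 30 (PutCoord j)"
 unfolding PutCoord_def
 by (intro pb_Seq pb_Each0 pb_Wr pb_GuessCoord) (auto simp: GuessCoord_def split: option.split)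

lemma ok_PutCoord: "j \<in> {19, 20} ==> ok {..<30} (PutCoord j)"
 by (auto simp: PutCoord_def GuessCoord_def split: option.split)

lemma gr_Ask: "gr K 1 (QCase (%x. if x = Some S1 then Skip else Push 22 S1))"
 by (rule gr_QCase) (auto intro: gr_Skip gr_Push)

lemma gr_Point: "gr 30 3 Point"
 unfolding Point_def
 by (rule gr_Seq[OF gr_PutCoord gr_Seq[OF gr_PutCoord gr_Seq[OF gr_Each0[where k = 0] gr_Seq[OF gr_Wr[where k = 0]
   gr_Seq[OF gr_Each0[where k = 0] gr_Seq[OF gr_Wr[where k = 0] gr_Seq[OF gr_Seq[OF gr_QWr[where k = 0] gr_QAsk[where k = 0]]
   gr_Seq[OF gr_Ask gr_Seq[OF gr_AddTo[where k = 1] gr_Seq[OF gr_Clr[where k = 0] gr_Seq[OF gr_AddTo[where k = 1] gr_Clr[where k = 0]]]]]]]]]]]]) auto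

lemma pb_Point: "pb 30 Point"
 unfolding Point_def
 by (intro pb_Seq pb_PutCoord pb_Each0 pb_Wr pb_basic pb_QCase pb_AddTo pb_Clr)
  (auto intro: pb_basic ok_PutCoord)

lemma gr_HullBody: "gr 30 8 HullBody"
 unfolding HullBody_def
 by (rule gr_Seq[OF gr_Push[of 1] gr_Seq[OF gr_Push[of 1] gr_Seq[OF gr_Point gr_Seq[OF gr_Point gr_Seq[OF gr_PopN[where k = 0] gr_PopN[where k = 0]]]]]]) auto

lemma ok_Point': "ok {..<30} Point" using ok_Point by (rule ok_mono) auto

lemma pb_HullBody: "pb 30 HullBody"
 unfolding HullBody_def by (intro pb_Seq pb_basic pb_Point pb_PopN) (auto simp: ok_Point')

lemma ok_HullBody: "ok ({..<30} - {21}) HullBody" using ok_Point by (simp add: HullBody_def)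

lemma ok_HullBody': "ok (- {21}) HullBody" using ok_HullBody by (rule ok_mono) auto

lemma pb_HullLoop: "pb 30 HullLoop"
 unfolding HullLoop_def
 by (intro pb_Seq pb_Each[where k = 2] pb_PushW gr_PushW pb_Each_Push pb_For[where k = 8] pb_HullBody gr_HullBody ok_HullBody') auto

lemma pb_Wide: "x < 13 \<or> 16 < x \<and> x < 23 ==> y < 13 \<or> 16 < y \<and> y < 23 ==> pb 30 (Wide w x y)"
 unfolding Wide_def by (intro pb_Seq pb_Each_Push pb_PushW) auto

lemma pb_Check: "pb 30 Check"
 unfolding Check_def by (intro pb_Case) (auto intro: pb_basic)

lemma ok_Wide: "x < 13 \<or> 16 < x \<and> x < 23 ==> y < 13 \<or> 16 < y \<and> y < 23 ==> ok {..<30} (Wide w x y)"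
 by (auto simp: Wide_def)

lemma ok_Check: "ok {..<30} Check" by (simp add: Check_def)

lemma pb_Near: assumes "x \<in> {5, 8}" "y \<in> {17, 18}" "s \<in> {4, 7}" shows "pb 30 (Near w s x y)"
proof -
 have b: "x < 13" "16 < y" "y < 23" "x \<notin> {23, 14, 15, 16, 13, 24}" "y \<notin> {23, 14, 15, 16, 13, 24}" "x < 30" "y < 30" "s < 30" using assms by auto
 have W: "pb 30 (Wide w x y)" "ok {..<30} (Wide w x y)" for w using b by (auto intro: pb_Wide ok_Wide)
 have A: "pb 30 (AddTo 23 x 14 15 16)" "ok {..<30} (AddTo 23 x 14 15 16)" "pb 30 (AddTo 23 y 14 15 16)" "ok {..<30} (AddTo 23 y 14 15 16)"
  using b by (auto intro!: pb_AddTo)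
 have D: "pb 30 (Dup x 13 24)" "ok {..<30} (Dup x 13 24)" "pb 30 (Dup y 13 24)" "ok {..<30} (Dup y 13 24)"
  using b by (auto intro!: pb_Dup)
 have M: "pb 30 (Cmp 23 24 25)" "ok {..<30} (Cmp 23 24 25)" "pb 30 (Cmp 24 23 25)" "ok {..<30} (Cmp 24 23 25)"
  by (auto intro!: pb_Cmp)
 have P: "pb 30 (PushW 24 w)" "ok {..<30} (PushW 24 w)" by (auto intro: pb_PushW)
 have m: "pb 30 (Wide (replicate (length w) S0) x y ;; AddTo 23 x 14 15 16 ;; AddTo 23 y 14 15 16 ;; PushW 24 w ;; Cmp 23 24 25 ;; Check)"
  by (intro pb_Seq W A D M P pb_Check)
 have p: "pb 30 (Wide w x y ;; AddTo 23 y 14 15 16 ;; Dup x 13 24 ;; Cmp 24 23 25 ;; Check ;;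
    Wide w x y ;; AddTo 23 x 14 15 16 ;; Dup y 13 24 ;; Cmp 24 23 25 ;; Check)"
  by (intro pb_Seq W A D M P pb_Check ok_Check)
 show ?thesis unfolding Near_def by (rule pb_Case) (use b m p in auto)
qed

lemma pb_Verdict: "pb 30 Verdict"
 unfolding Verdict_def by (intro pb_Seq pb_Clr pb_Case) (auto intro: pb_basic)

lemma pb_Hull: "pb 30 Hull"
 unfolding Hull_def
 by (intro pb_Seq pb_Parse pb_Scale pb_HullLoop pb_Near pb_Verdict)
  (auto intro!: ok_Parse ok_Scale ok_HullLoop ok_Near)

section \<open>Semantics of the hull program\<close>

lemma fold_GuessCoord:
 "length a = length v ==> ss 2 = a @ rest ==> j ~= 2 ==>
  fold (%_. sem f (Case 2 (%x. case x of None => Skip | Some a => QWr (Some a) Rgt ;; Push j a))) v (ss, ww t w) =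
  (ss(2 := rest, j := rev a @ ss j), ww t (w @ a))"
proof (induction v arbitrary: a ss w)
 case Nil
 then show ?case by (auto simp: fun_eq_iff)
next
 case (Cons c v)
 then obtain b a' where a: "a = b # a'" by (cases a) auto
 let ?ss = "ss(2 := a' @ rest, j := b # ss j)"
 have 1: "sem f (Case 2 (%x. case x of None => Skip | Some a => QWr (Some a) Rgt ;; Push j a)) (ss, ww t w) = (?ss, ww t (w @ [b]))"
  using Cons.prems a by (simp del: sem.simps add: sem.simps(1,2,3,4))
 have 2: "?ss 2 = a' @ rest" "length a' = length v" using Cons.prems a by auto
 show ?case unfolding fold.simps o_apply 1 Cons.IH[where ss = ?ss, OF 2(2,1) Cons.prems(3)] using Cons.prems a by (auto simp: fun_eq_iff)
qed

lemma sem_GuessCoord: "length a = length (ss 12) ==> ss 2 = a @ rest ==> j \<in> {19, 20} ==> ss 13 = [] ==>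
  sem f (GuessCoord j) (ss, ww t w) = (ss(2 := rest, j := rev a @ ss j), ww t (w @ a))"
 unfolding GuessCoord_def
 by (subst sem_Each) (auto simp: fold_GuessCoord simp del: sem.simps split: option.split)

lemma sem_PutCoord:
 assumes "length a = length (ss 12)" "ss 2 = a @ rest" "j \<in> {19, 20}" "ss 13 = []"
 shows "sem f (PutCoord j) (ss, ww t w) = (ss(2 := rest, j := rev a @ ss j),
  ww t (w @ replicate (length (dstr SPlus a (length (ss 12)))) S1 @ [S0] @ dstr SPlus a (length (ss 12))))"
proof -
 have j: "j ~= 12" "j ~= 13" using assms(3) by auto
 let ?ss = "ss(2 := rest, j := rev a @ ss j)" let ?N = "length (ss 12)"
 have e: "sem f (Each 12 13 (%_. QWr (Some x) Rgt)) (ss, ww t v) = (ss, ww t (v @ replicate ?N x))" for x v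
  by (subst sem_Each_write) (simp_all add: assms(4))
 have e': "sem f (Each 12 13 (%_. QWr (Some x) Rgt)) (?ss, ww t v) = (?ss, ww t (v @ replicate ?N x))" for x v
  by (subst sem_Each_write) (use j in \<open>simp_all add: assms(4)\<close>)
 have R: "replicate (?N + ?N + 3) S1 = replicate ?N S1 @ replicate ?N S1 @ [S1, S1, S1]"
  by (simp only: replicate_add append_assoc) (simp add: numeral_eq_Suc)
 have W: "(((((w @ replicate ?N S1) @ replicate ?N S1) @ [S1, S1, S1, S0, SPlus]) @ a) @ [SSlash, S1]) @ replicate ?N S0 =
   w @ replicate (length (dstr SPlus a ?N)) S1 @ [S0] @ dstr SPlus a ?N"
 proof -
  have l: "length (dstr SPlus a ?N) = ?N + ?N + 3" using assms(1) by simp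
  show ?thesis unfolding l R by (simp add: dstr_def)
 qed
 show ?thesis unfolding PutCoord_def sem.simps(3) e sem_Wr sem_GuessCoord[OF assms(1,2,3,4)] e'
  unfolding W ..
qed

definition ptq :: "nat => nat => word => word => word" where
 "ptq n N a b = tuple [dstr SPlus a N, dstr SPlus b N, replicate (n + 6) S0]"

lemma sem_Point:
 assumes "length a = length (ss 12)" "length b = length (ss 12)" "ss 2 = a @ b @ rest"
  and e: "\<And>j. j \<in> {13, 14, 15, 16, 19, 20} ==> ss j = []"
 shows "sem f Point (ss, ww t []) =
  (ss(2 := rest, 17 := addw (ss 17) (rev a) False, 18 := addw (ss 18) (rev b) False,
    22 := (if hb (f (ptq (length (ss 10)) (length (ss 12)) a b)) then [] else [S1]) @ ss 22),
   ww (word_tape (f (ptq (length (ss 10)) (length (ss 12)) a b))) [])"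
proof -
 let ?N = "length (ss 12)" let ?n = "length (ss 10)" let ?q = "ptq ?n ?N a b"
 let ?A = "replicate (length (dstr SPlus a ?N)) S1 @ [S0] @ dstr SPlus a ?N"
 let ?B = "replicate (length (dstr SPlus b ?N)) S1 @ [S0] @ dstr SPlus b ?N"
 let ?ss1 = "ss(2 := b @ rest, 19 := rev a)" let ?ss2 = "ss(2 := rest, 19 := rev a, 20 := rev b)"
 have e': "ss 13 = []" "ss 14 = []" "ss 15 = []" "ss 16 = []" "ss 19 = []" "ss 20 = []" using e by auto
 have p1: "sem f (PutCoord 19) (ss, ww t []) = (?ss1, ww t ?A)"
  using sem_PutCoord[of a ss "b @ rest" 19 f t "[]"] assms e' by simp
 have p2: "sem f (PutCoord 20) (?ss1, ww t ?A) = (?ss2, ww t (?A @ ?B))"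
  using sem_PutCoord[of b ?ss1 rest 20 f t ?A] assms(1-3) e' by (simp add: fun_upd_twist)
 have q: "?A @ ?B @ replicate ?n S1 @ replicate 6 S1 @ [S0] @ replicate ?n S0 @ replicate 6 S0 = ?q"
  unfolding ptq_def tuple_def by (simp add: replicate_add)
 have q': "(((((?A @ ?B) @ replicate ?n S1) @ (replicate 6 S1 @ [S0])) @ replicate ?n S0) @ replicate 6 S0) = ?q"
  unfolding q[symmetric] by simp
 have w: "sem f (Each 10 13 (%_. QWr (Some S1) Rgt)) (?ss2, ww t (?A @ ?B)) = (?ss2, ww t ((?A @ ?B) @ replicate ?n S1))"
  "sem f (Each 10 13 (%_. QWr (Some S0) Rgt)) (?ss2, ww t v) = (?ss2, ww t (v @ replicate ?n S0))" for v
  by (subst sem_Each_write; simp add: e')+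
 let ?ss3 = "?ss2(22 := (if hb (f ?q) then [] else [S1]) @ ss 22)"
 have c: "sem f (QCase (%x. if x = Some S1 then Skip else Push 22 S1)) (?ss2, ww (word_tape (f ?q)) []) = (?ss3, ww (word_tape (f ?q)) [])"
  by (cases "f ?q") (auto simp: ww_def word_tape_def hb_def fun_eq_iff)
 show ?thesis unfolding Point_def sem.simps(3)[of f "PutCoord 19"] p1 sem.simps(3)[of f "PutCoord 20"] p2
   sem.simps(3)[of f "Each _ _ _"] w sem.simps(3)[of f "Wr _"] sem_Wr q' sem.simps(3)[of f "Seq _ _"] sem_ask sem.simps(3)[of f "QCase _"] c
  using e' by (auto simp: fun_eq_iff)
qed

type_synonym quad = "word \<times> word \<times> word \<times> word"

definition qconc :: "quad list => word" where
 "qconc ps = concat (map (%(a, b, a', b'). a @ b @ a' @ b') ps)"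

definition qok :: "nat => quad => bool" where
 "qok N = (%(a, b, a', b'). length a = N \<and> length b = N \<and> length a' = N \<and> length b' = N)"

definition qhit :: "fn => nat => nat => quad => bool" where
 "qhit f n N = (%(a, b, a', b'). hb (f (ptq n N a b)) \<and> hb (f (ptq n N a' b')))"

definition qx :: "quad list => nat => nat" where
 "qx ps q = fold (%(a, b, a', b') q. (2 * q + bin_val a + bin_val a') div 4) ps q"

definition qy :: "quad list => nat => nat" where
 "qy ps q = fold (%(a, b, a', b') q. (2 * q + bin_val b + bin_val b') div 4) ps q"

text \<open>The sum \<open>2 v + a + b\<close> of numbers below \<open>2 ^ N\<close> is below
  \<open>4 * 2 ^ N\<close>; so \<open>N + 2\<close> digits suffice and the quarter is again below
  \<open>2 ^ N\<close>.\<close>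

lemma avg_width:
 assumes "length v \<ge> N + Suc m" "val v < 2 ^ N" "length a = N" "length b = N"
 shows "let v' = drop 2 (addw (addw (S0 # v) (rev a) False) (rev b) False) in
  val v' = (2 * val v + bin_val a + bin_val b) div 4 \<and> length v' \<ge> N + m \<and> val v' < 2 ^ N"
proof -
 have ab: "bin_val a < 2 ^ N" "bin_val b < 2 ^ N" using val_lt[of "rev a"] val_lt[of "rev b"] assms by (simp_all add: bin_val_val)
 have "(2::nat) ^ (N + 2) <= 2 ^ length (S0 # v)" using assms(1) by (intro power_increasing) auto
 then have l: "4 * (2::nat) ^ N <= 2 ^ length (S0 # v)" by (simp add: power_add)
 have 1: "val (addw (S0 # v) (rev a) False) = 2 * val v + bin_val a"
  by (subst val_addw) (use l ab assms(2) in \<open>auto simp: bin_val_val\<close>)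
 have 2: "val (addw (addw (S0 # v) (rev a) False) (rev b) False) = 2 * val v + bin_val a + bin_val b"
  by (subst val_addw) (use l ab assms(2) 1 in \<open>auto simp: bin_val_val\<close>)
 have "(2 * val v + bin_val a + bin_val b) div 4 < 2 ^ N" using ab assms(2) by simp
 then show ?thesis unfolding Let_def val_drop 2 using assms(1) by simp
qed

lemma fold_HullBody:
 assumes "\<forall>p\<in>set ps. qok N p" "length (ss 12) = N" "ss 2 = qconc ps @ rest" "length v = length ps"
  "length (ss 17) \<ge> N + Suc (length ps)" "val (ss 17) < 2 ^ N" "length (ss 18) \<ge> N + Suc (length ps)" "val (ss 18) < 2 ^ N"
  "\<And>j. j \<in> {13, 14, 15, 16, 19, 20} ==> ss j = []"
 shows "\<exists>x y b t'. fold (%_. sem f HullBody) v (ss, ww t []) = (ss(2 := rest, 17 := x, 18 := y, 22 := b @ ss 22), ww t' [])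
  \<and> val x = qx ps (val (ss 17)) \<and> val y = qy ps (val (ss 18)) \<and> (b = [] \<longleftrightarrow> (\<forall>p\<in>set ps. qhit f (length (ss 10)) N p))"
 using assms
proof (induction ps arbitrary: ss v t)
 case Nil
 then have i: "ss(2 := rest, 17 := ss 17, 18 := ss 18, 22 := [] @ ss 22) = ss" by (simp add: qconc_def fun_upd_idem)
 have v: "v = []" using Nil.prems(4) by simp
 show ?case
  by (rule exI[of _ "ss 17"], rule exI[of _ "ss 18"], rule exI[of _ "[]"], rule exI[of _ t])
   (unfold i v, simp add: qx_def qy_def)
next
 case (Cons p ps)
 obtain a b a' b' where p: "p = (a, b, a', b')" by (cases p)
 have l: "length a = N" "length b = N" "length a' = N" "length b' = N" using Cons.prems(1) p by (auto simp: qok_def)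
 obtain c v' where v: "v = c # v'" using Cons.prems(4) by (cases v) auto
 have s2: "ss 2 = a @ b @ a' @ b' @ qconc ps @ rest" using Cons.prems(3) p by (simp add: qconc_def)
 have e': "ss 13 = []" "ss 14 = []" "ss 15 = []" "ss 16 = []" "ss 19 = []" "ss 20 = []"
  by (rule Cons.prems(9), simp)+
 let ?n = "length (ss 10)"
 let ?f1 = "if hb (f (ptq ?n N a b)) then [] else [S1]" let ?f2 = "if hb (f (ptq ?n N a' b')) then [] else [S1]"
 let ?ss0 = "ss(17 := S0 # ss 17, 18 := S0 # ss 18)"
 let ?ss1 = "?ss0(2 := a' @ b' @ qconc ps @ rest, 17 := addw (?ss0 17) (rev a) False, 18 := addw (?ss0 18) (rev b) False, 22 := ?f1 @ ss 22)"
 let ?ss2 = "?ss1(2 := qconc ps @ rest, 17 := addw (?ss1 17) (rev a') False, 18 := addw (?ss1 18) (rev b') False, 22 := ?f2 @ ?f1 @ ss 22)"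
 define x where "x = drop 2 (addw (addw (S0 # ss 17) (rev a) False) (rev a') False)"
 define y where "y = drop 2 (addw (addw (S0 # ss 18) (rev b) False) (rev b') False)"
 let ?t = "word_tape (f (ptq ?n N a' b'))"
 let ?ss3 = "ss(2 := qconc ps @ rest, 17 := x, 18 := y, 22 := (?f2 @ ?f1) @ ss 22)"
 have P1: "sem f Point (?ss0, ww t []) = (?ss1, ww (word_tape (f (ptq ?n N a b))) [])"
 proof -
  have 1: "length a = length (?ss0 12)" "length b = length (?ss0 12)" "?ss0 2 = a @ b @ a' @ b' @ qconc ps @ rest"
   using l Cons.prems(2) s2 by simp_all
  have 2: "?ss0 j = []" if "j \<in> {13, 14, 15, 16, 19, 20}" for j using that e' by auto
  show ?thesis using sem_Point[where ss = ?ss0 and f = f and t = t, OF 1 2] Cons.prems(2) by (simp del: addw.simps)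
 qed
 have P2: "sem f Point (?ss1, ww (word_tape (f (ptq ?n N a b))) []) = (?ss2, ww ?t [])"
 proof -
  have 1: "length a' = length (?ss1 12)" "length b' = length (?ss1 12)" "?ss1 2 = a' @ b' @ qconc ps @ rest"
   using l Cons.prems(2) by simp_all
  have 2: "?ss1 j = []" if "j \<in> {13, 14, 15, 16, 19, 20}" for j using that e' by auto
  show ?thesis using sem_Point[where ss = ?ss1 and f = f and t = "word_tape (f (ptq ?n N a b))", OF 1 2] Cons.prems(2) by (simp del: addw.simps)
 qed
 have B: "sem f HullBody (ss, ww t []) = (?ss3, ww ?t [])"
 proof -
  have "sem f HullBody (ss, ww t []) = sem f (PopN 17 2 ;; PopN 18 2) (sem f Point (sem f Point (?ss0, ww t [])))"
   by (simp add: HullBody_def)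
  also have "\<dots> = (?ss3, ww ?t [])" unfolding P1 P2 by (auto simp: fun_eq_iff x_def y_def simp del: addw.simps)
  finally show ?thesis .
 qed
 have wx: "val x = (2 * val (ss 17) + bin_val a + bin_val a') div 4 \<and> length x \<ge> N + length (p # ps) \<and> val x < 2 ^ N"
  using avg_width[of N "length (p # ps)" "ss 17" a a'] Cons.prems l unfolding x_def Let_def by simp
 have wy: "val y = (2 * val (ss 18) + bin_val b + bin_val b') div 4 \<and> length y \<ge> N + length (p # ps) \<and> val y < 2 ^ N"
  using avg_width[of N "length (p # ps)" "ss 18" b b'] Cons.prems l unfolding y_def Let_def by simp
 have "\<exists>x' y' b'' t'. fold (%_. sem f HullBody) v' (?ss3, ww ?t []) = (?ss3(2 := rest, 17 := x', 18 := y', 22 := b'' @ ?ss3 22), ww t' [])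
  \<and> val x' = qx ps (val (?ss3 17)) \<and> val y' = qy ps (val (?ss3 18)) \<and> (b'' = [] \<longleftrightarrow> (\<forall>p\<in>set ps. qhit f (length (?ss3 10)) N p))"
 proof (rule Cons.IH)
  show "\<forall>p\<in>set ps. qok N p" using Cons.prems(1) by simp
  show "length (?ss3 12) = N" using Cons.prems(2) by simp
  show "length v' = length ps" using Cons.prems(4) v by simp
  show "length (?ss3 17) \<ge> N + Suc (length ps)" "val (?ss3 17) < 2 ^ N" "length (?ss3 18) \<ge> N + Suc (length ps)" "val (?ss3 18) < 2 ^ N"
   using wx wy by simp_all
  show "?ss3 j = []" if "j \<in> {13, 14, 15, 16, 19, 20}" for j using that Cons.prems(9)[OF that] by auto
 qed simp
 note ih = this
 have n3: "?ss3 17 = x" "?ss3 18 = y" "?ss3 10 = ss 10" by simp_all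
 from ih[unfolded n3] obtain x' y' b'' t' where r: "fold (%_. sem f HullBody) v' (?ss3, ww ?t []) = (?ss3(2 := rest, 17 := x', 18 := y', 22 := b'' @ ?ss3 22), ww t' [])"
  "val x' = qx ps (val x)" "val y' = qy ps (val y)" "b'' = [] \<longleftrightarrow> (\<forall>p\<in>set ps. qhit f ?n N p)" by blast
 show ?case
 proof (rule exI[of _ x'], rule exI[of _ y'], rule exI[of _ "b'' @ ?f2 @ ?f1"], rule exI[of _ t'], intro conjI)
  show "fold (%_. sem f HullBody) v (ss, ww t []) = (ss(2 := rest, 17 := x', 18 := y', 22 := (b'' @ ?f2 @ ?f1) @ ss 22), ww t' [])"
   unfolding v fold.simps o_apply B r(1) by (auto simp: fun_eq_iff)
  show "val x' = qx (p # ps) (val (ss 17))" using r(2) wx p by (simp add: qx_def)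
  show "val y' = qy (p # ps) (val (ss 18))" using r(3) wy p by (simp add: qy_def)
  show "(b'' @ ?f2 @ ?f1 = []) \<longleftrightarrow> (\<forall>p\<in>set (p # ps). qhit f ?n N p)" using r(4) p by (auto simp: qhit_def)
 qed
qed

lemma sem_HullLoop:
 assumes "\<forall>p\<in>set ps. qok N p" "ss 12 = replicate N S1" "ss 2 = qconc ps @ rest" "length ps = N"
  and e: "\<And>j. 13 <= j ==> j <= 21 ==> ss j = []"
 shows "\<exists>x y b t'. sem f HullLoop (ss, ww t []) = (ss(2 := rest, 17 := x, 18 := y, 22 := b @ ss 22), ww t' [])
  \<and> val x = qx ps 0 \<and> val y = qy ps 0 \<and> (b = [] \<longleftrightarrow> (\<forall>p\<in>set ps. qhit f (length (ss 10)) N p))"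
proof -
 have e': "ss 13 = []" "ss 14 = []" "ss 15 = []" "ss 16 = []" "ss 17 = []" "ss 18 = []" "ss 19 = []" "ss 20 = []" "ss 21 = []"
  by (rule e; simp)+
 have fz: "fold (%_. sem f (PushW j [S0, S0])) w (ss, q) = (ss(j := replicate (2 * length w) S0 @ ss j), q)" for j and w :: word and ss q
  by (induction w arbitrary: ss) (simp_all add: replicate_app_Cons_same del: PushW.simps)
 have z: "sem f (Each 12 13 (%_. PushW j [S0, S0])) (ss, q) = (ss(j := replicate (2 * N) S0 @ ss j), q)"
  if "ss 12 = replicate N S1" "ss 13 = []" "j ~= 12" "j ~= 13" for ss q j
  by (subst sem_Each) (use that in \<open>simp_all add: fz del: PushW.simps fold_replicate\<close>)
 let ?z = "S0 # S0 # replicate (2 * N) S0"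
 let ?ss = "ss(17 := ?z, 18 := ?z, 21 := replicate N S1)"
 have s1: "sem f HullLoop (ss, ww t []) = sem f (For 21 (%_. HullBody)) (?ss, ww t [])"
  unfolding HullLoop_def using assms(2) e' by (simp add: z del: sem.simps(5) PushW.simps)
 have "\<exists>x y b t'. fold (%_. sem f HullBody) (replicate N S1) (?ss, ww t []) = (?ss(2 := rest, 17 := x, 18 := y, 22 := b @ ?ss 22), ww t' [])
  \<and> val x = qx ps (val (?ss 17)) \<and> val y = qy ps (val (?ss 18)) \<and> (b = [] \<longleftrightarrow> (\<forall>p\<in>set ps. qhit f (length (?ss 10)) N p))"
 proof (rule fold_HullBody)
  show "?ss j = []" if "j \<in> {13, 14, 15, 16, 19, 20}" for j using that e' by auto
 qed (use assms in simp_all)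
 note ih = this
 have n: "val (?ss 17) = 0" "val (?ss 18) = 0" "?ss 10 = ss 10" "?ss 22 = ss 22" by simp_all
 from ih[unfolded n] obtain x y b t' where r: "fold (%_. sem f HullBody) (replicate N S1) (?ss, ww t []) = (?ss(2 := rest, 17 := x, 18 := y, 22 := b @ ss 22), ww t' [])"
  "val x = qx ps 0" "val y = qy ps 0" "b = [] \<longleftrightarrow> (\<forall>p\<in>set ps. qhit f (length (ss 10)) N p)" by blast
 have s2: "sem f (For 21 (%_. HullBody)) (?ss, ww t []) = (ss(2 := rest, 17 := x, 18 := y, 22 := b @ ss 22), ww t' [])"
 proof -
  have i: "(?ss(2 := rest, 17 := x, 18 := y, 22 := b @ ss 22))(21 := []) = ss(2 := rest, 17 := x, 18 := y, 22 := b @ ss 22)"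
   using e' by (auto simp: fun_eq_iff)
  have "?ss 21 = replicate N S1" by simp
  then have "sem f (For 21 (%_. HullBody)) (?ss, ww t []) = upd 21 [] (fold (%_. sem f HullBody) (replicate N S1) (?ss, ww t []))"
   unfolding sem_For[OF ok_HullBody'] fst_conv by (simp only:)
  then show ?thesis unfolding r(1) upd_pair i .
 qed
 show ?thesis unfolding s1 s2 using r(2-4) by blast
qed

definition nearby :: "sym => nat => nat => nat => bool" where
 "nearby s x y w = (if s = SMinus then x + y <= w else x <= w + y \<and> y <= w + x)"

lemma val_wide: "val w + 2 <= 2 ^ length w ==> val w + val x + val y < 2 ^ (length w + length x + length y)"
proof -
 assume w: "val w + 2 <= 2 ^ length w"
 let ?a = "(2::nat) ^ length x" let ?b = "(2::nat) ^ length y"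
 have x: "val x < ?a" "val y < ?b" by (rule val_lt)+
 have 1: "val w * 1 <= val w * (?a * ?b)" by (rule mult_le_mono2) simp
 have 2: "?a * 1 <= ?a * ?b" "1 * ?b <= ?a * ?b" by (intro mult_le_mono; simp)+
 have "val w + val x + val y < val w * (?a * ?b) + ?a * ?b + ?a * ?b" using x 1 2 by linarith
 also have "\<dots> = (val w + 2) * (?a * ?b)" by (simp add: algebra_simps)
 also have "\<dots> <= 2 ^ length w * (?a * ?b)" using w by (rule mult_le_mono1)
 finally show ?thesis by (simp add: power_add mult.assoc)
qed

lemma sem_Near:
 assumes b: "x \<in> {5, 8}" "y \<in> {17, 18}" "s \<in> {4, 7}" and e: "\<And>j. j \<in> {13, 14, 15, 16, 23, 24, 25} ==> ss j = []"
  and w: "val w + 2 <= 2 ^ length w" and sg: "ss s = [sg]"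
 shows "\<exists>b. sem f (Near w s x y) (ss, q) = (ss(s := [], 22 := b @ ss 22), q) \<and> (b = [] \<longleftrightarrow> nearby sg (val (ss x)) (val (ss y)) (val w))"
proof -
 have e': "ss 13 = []" "ss 14 = []" "ss 15 = []" "ss 16 = []" "ss 23 = []" "ss 24 = []" "ss 25 = []" by (rule e; simp)+
 have d: "x ~= 13" "x ~= 14" "x ~= 15" "x ~= 16" "x ~= 23" "x ~= 24" "x ~= 25" "x ~= 22" "y ~= 13" "y ~= 14" "y ~= 15" "y ~= 16" "y ~= 23" "y ~= 24" "y ~= 25" "y ~= 22"
  "s ~= 13" "s ~= 14" "s ~= 15" "s ~= 16" "s ~= 23" "s ~= 24" "s ~= 25" "s ~= 22" "x ~= s" "y ~= s" "x ~= y" using b by auto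
 have wd: "sem f (Wide v x y) (\<tau>, q) = (\<tau>(23 := v @ replicate (length (\<tau> x) + length (\<tau> y)) S0), q)" if "\<tau> 13 = []" "\<tau> 23 = []" for v \<tau>
  unfolding Wide_def using that d by (simp add: replicate_add[symmetric] add.commute)
 have ad: "val (addw (v @ replicate (length a + length c) S0) a False) = val v + val a"
  "val (addw (v @ replicate (length a + length c) S0) c False) = val v + val c"
  "val (addw (addw (v @ replicate (length a + length c) S0) a False) c False) = val v + val a + val c"
  if "val v + 2 <= 2 ^ length v" for v a c
 proof -
  have l: "val v + val a + val c < 2 ^ (length v + length a + length c)" by (rule val_wide[OF that])
  then show 1: "val (addw (v @ replicate (length a + length c) S0) a False) = val v + val a"
   "val (addw (v @ replicate (length a + length c) S0) c False) = val v + val c"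
   by (subst val_addw; simp add: val_append add.assoc)+
  show "val (addw (addw (v @ replicate (length a + length c) S0) a False) c False) = val v + val a + val c"
   using l by (subst val_addw) (simp_all add: 1 val_append add.assoc)
 qed
 have ck: "sem f Check (\<tau>, q) = (\<tau>(25 := [], 22 := (if k then [] else [S1]) @ \<tau> 22), q)" if "\<tau> 25 = flag k" for \<tau> k
  using that by (cases k) (auto simp: Check_def flag_def fun_eq_iff)
 have z: "val (replicate (length w) S0) + 2 <= 2 ^ length (replicate (length w) S0)"
  using w by simp
 let ?ss = "ss(s := [])"
 show ?thesis
 proof (cases "sg = SMinus")
  case True
  let ?k = "val (ss x) + val (ss y) <= val w"
  have "sem f (Near w s x y) (ss, q) = sem f (Wide (replicate (length w) S0) x y ;; AddTo 23 x 14 15 16 ;; AddTo 23 y 14 15 16 ;; PushW 24 w ;; Cmp 23 24 25 ;; Check) (?ss, q)"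
   unfolding Near_def using sg True by simp
  also have "\<dots> = (?ss(22 := (if ?k then [] else [S1]) @ ss 22), q)"
   using d e' ad(3)[OF z, of "ss x" "ss y"] by (simp add: wd ck[where k = ?k], auto simp: fun_eq_iff)
  finally show ?thesis using True by (intro exI[of _ "if ?k then [] else [S1]"]) (simp add: nearby_def)
 next
  case False
  let ?k1 = "val (ss x) <= val w + val (ss y)" let ?k2 = "val (ss y) <= val w + val (ss x)"
  have "sem f (Near w s x y) (ss, q) = sem f (Wide w x y ;; AddTo 23 y 14 15 16 ;; Dup x 13 24 ;; Cmp 24 23 25 ;; Check ;;
    Wide w x y ;; AddTo 23 x 14 15 16 ;; Dup y 13 24 ;; Cmp 24 23 25 ;; Check) (?ss, q)"
   unfolding Near_def using sg False by simp
  also have "\<dots> = (?ss(22 := (if ?k2 then [] else [S1]) @ (if ?k1 then [] else [S1]) @ ss 22), q)"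
   using d e' ad(1)[OF w, of "ss x" "ss y"] ad(2)[OF w, of "ss x" "ss y"]
   by (simp add: wd ck[where k = ?k1] ck[where k = ?k2], auto simp: fun_eq_iff)
  finally show ?thesis using False
   by (intro exI[of _ "(if ?k2 then [] else [S1]) @ (if ?k1 then [] else [S1])"]) (simp add: nearby_def)
 qed
qed

lemma val_w288: "val w288 = 288" by (simp add: w288_def)

lemma sem_Hull:
 assumes x: "set x \<subseteq> {S0, S1}" "set x' \<subseteq> {S0, S1}" and N: "N = n + 8"
  and s0: "ss 0 = rev (tuple [dstr s x k, dstr s' x' k', replicate n S0])"
  and e: "\<And>j. 3 <= j ==> ss j = []"
  and ps: "\<forall>p\<in>set ps. qok N p" "length ps = N" "ss 2 = qconc ps @ rest"
 shows "(\<exists>w. fst (sem f Hull (ss, ww t [])) 0 = S1 # w) \<longleftrightarrow> (\<forall>p\<in>set ps. qhit f n N p) \<and>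
   nearby s (bin_val x * 2 ^ N div 2 ^ k) (qx ps 0) 288 \<and> nearby s' (bin_val x' * 2 ^ N div 2 ^ k') (qy ps 0) 288"
proof -
 let ?ss1 = "ss(0 := [], 4 := [s], 5 := rev x, 6 := replicate k S0, 7 := [s'], 8 := rev x', 9 := replicate k' S0, 10 := replicate n S1)"
 have p1: "sem f Parse (ss, ww t []) = (?ss1, ww t [])" by (rule sem_Parse[where ss = ss, OF x s0]) (use e in simp)
 have e1: "?ss1 12 = []" "?ss1 13 = []" using e[of 12] e[of 13] by simp_all
 let ?ss2 = "?ss1(12 := replicate N S1, 5 := scaled x k N, 6 := [], 8 := scaled x' k' N, 9 := [])"
 have p2: "sem f (Scale 8) (?ss1, ww t []) = (?ss2, ww t [])"
  unfolding sem_Scale[where ss = ?ss1, OF e1] Let_def N scaled_def by simp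
 have s2: "?ss2 12 = replicate N S1" "?ss2 2 = qconc ps @ rest" using ps by simp_all
 have e2: "?ss2 j = []" if "13 <= j" for j using e[of j] that by simp
 obtain X Y b t' where p3: "sem f HullLoop (?ss2, ww t []) = (?ss2(2 := rest, 17 := X, 18 := Y, 22 := b @ ?ss2 22), ww t' [])"
  "val X = qx ps 0" "val Y = qy ps 0" "b = [] \<longleftrightarrow> (\<forall>p\<in>set ps. qhit f (length (?ss2 10)) N p)"
  using sem_HullLoop[where ss = ?ss2 and f = f and t = t, OF ps(1) s2 ps(2) e2] by blast
 let ?ss3 = "?ss2(2 := rest, 17 := X, 18 := Y, 22 := b @ ?ss2 22)"
 have e3: "?ss3 j = []" if "j \<in> {13, 14, 15, 16, 23, 24, 25}" for j using e2[of j] that by auto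
 have w: "val w288 + 2 <= 2 ^ length w288" by (simp add: val_w288, simp add: w288_def)
 have b22: "?ss3 22 = b" using e[of 22] by simp
 obtain b1 where p4: "sem f (Near w288 4 5 17) (?ss3, ww t' []) = (?ss3(4 := [], 22 := b1 @ ?ss3 22), ww t' [])"
   "b1 = [] \<longleftrightarrow> nearby s (val (?ss3 5)) (val (?ss3 17)) (val w288)"
  using sem_Near[where ss = ?ss3 and x = 5 and y = 17 and s = 4 and sg = s and f = f and q = "ww t' []" and w = w288, OF _ _ _ e3 w] by auto
 let ?ss4 = "?ss3(4 := [], 22 := b1 @ ?ss3 22)"
 have e4: "?ss4 j = []" if "j \<in> {13, 14, 15, 16, 23, 24, 25}" for j using e3[of j] that by auto
 obtain b2 where p5: "sem f (Near w288 7 8 18) (?ss4, ww t' []) = (?ss4(7 := [], 22 := b2 @ ?ss4 22), ww t' [])"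
   "b2 = [] \<longleftrightarrow> nearby s' (val (?ss4 8)) (val (?ss4 18)) (val w288)"
  using sem_Near[where ss = ?ss4 and x = 8 and y = 18 and s = 7 and sg = s' and f = f and q = "ww t' []" and w = w288, OF _ _ _ e4 w] by auto
 let ?ss5 = "?ss4(7 := [], 22 := b2 @ ?ss4 22)"
 have c22: "?ss5 22 = b2 @ b1 @ b" using b22 by simp
 have "sem f Hull (ss, ww t []) = sem f Verdict (?ss5, ww t' [])"
  unfolding Hull_def sem.simps(3) p1 p2 p3(1) p4(1) p5(1) ..
 moreover have "(\<exists>w. fst (sem f Verdict (?ss5, ww t' [])) 0 = S1 # w) \<longleftrightarrow> ?ss5 22 = []"
  unfolding Verdict_def by (cases "?ss5 22") (simp_all del: fun_upd_apply add: fun_upd_other, simp_all)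
 ultimately show ?thesis unfolding c22 using p3(2-4) p4(2) p5(2) by (auto simp: val_scaled val_w288)
qed

section \<open>The cost of fixing the length of the guess\<close>

lemma ops_For_inv:
 assumes "\<And>s w. I s ==> I (upd j w s)" "\<And>a s. I s ==> I (sem f (F a) s)" "\<And>a s. I s ==> ops f (F a) s <= X" "I s"
 shows "ops f (For j F) s <= 1 + length (fst s j) * (1 + X)"
proof -
 have "I s ==> fops j (%a. sem f (F a)) (%a. ops f (F a)) w s <= 1 + length w * (1 + X)" for w s
 proof (induction w arbitrary: s)
  case (Cons a w)
  have "I (upd j w s)" using assms(1) Cons.prems .
  then show ?case using Cons.IH[of "sem f (F a) (upd j w s)"] assms(2)[of "upd j w s" a] assms(3)[of "upd j w s" a] by simp
 qed simp
 then show ?thesis using assms(4) by simp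
qed

lemma ops_Mv: "i ~= j ==> ops f (Mv i j) s <= 1 + 2 * length (fst s i)"
 unfolding Mv_def using ops_For_inv[where I = "%_. True" and j = i and F = "Push j" and X = 1 and f = f and s = s] by simp

lemma ops_PushW: "ops f (PushW j w) s = 1 + length w"
 by (induction w) auto

lemma ops_Each:
 assumes "\<And>a s. ops f (G a) s <= X" "i ~= t" "fst s t = []" "\<And>a. ok (- {i, t}) (G a)"
 shows "ops f (Each i t G) s <= 2 + length (fst s i) * (4 + X)"
proof -
 have 1: "ops f (For i (%a. G a ;; Push t a)) s <= 1 + length (fst s i) * (1 + (X + 1))"
  by (rule ops_For_inv[where I = "%_. True"]) (use assms(1) in auto)
 have oi: "ok (- {i}) (G a ;; Push t a)" for a using assms(4)[of a] assms(2) by (auto elim: ok_mono)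
 have l: "length (fst (fold (%a. sem f (G a ;; Push t a)) w s) t) = length w + length (fst s t)" for w s
  by (induction w arbitrary: s) (simp_all add: sem_frame[OF assms(4)])
 have "length (fst (sem f (For i (%a. G a ;; Push t a)) s) t) = length (fst s i)"
  unfolding sem_For[OF oi] using l[of "fst s i" s] assms(2,3) by simp
 then have "ops f (Mv t i) (sem f (For i (%a. G a ;; Push t a)) s) <= 1 + 2 * length (fst s i)"
  using ops_Mv[of t i f "sem f (For i (%a. G a ;; Push t a)) s"] assms(2) by simp
 then show ?thesis unfolding Each_def ops.simps(3) using 1 by (simp add: algebra_simps)
qed

lemma ops_Clr: "ops f (Clr i) s <= 1 + 2 * length (fst s i)"
 unfolding Clr_def using ops_For_inv[where I = "%_. True" and j = i and F = "%_. Skip" and X = 1 and f = f and s = s] by simp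

lemma sem_quadruple:
 assumes "ss 13 = []"
 shows "sem f (Each 21 13 (%_. PushW 1 [S1, S1, S1, S1])) (ss, q) = (ss(1 := replicate (4 * length (ss 21)) S1 @ ss 1), q)"
proof -
 have "fold (%_. sem f (PushW 1 [S1, S1, S1, S1])) w (ss, q) = (ss(1 := replicate (4 * length w) S1 @ ss 1), q)" for w :: word and ss
  by (induction w arbitrary: ss) (simp_all add: replicate_app_Cons_same numeral_eq_Suc del: PushW.simps)
 then show ?thesis using assms by (subst sem_Each) (simp_all del: PushW.simps)
qed

lemma sem_GuessLen:
 "sem f GuessLen (s0 u) = ((%_. [])(0 := rev u, 1 := replicate (4 * (length u + 8) * (length u + 8)) S1), %_. None, 0)"
proof -
 let ?z = "(%_. None, 0)" let ?m = "length u + 8"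
 let ?ss = "(%_::nat. [])(0 := rev u, 20 := replicate ?m S1, 21 := replicate ?m S1)"
 have r: "replicate 8 S1 @ replicate n S1 = replicate (n + 8) S1" for n by (simp add: replicate_add[symmetric] add.commute)
 have 1: "sem f GuessLen (s0 u) = sem f (For 20 (%_. Each 21 13 (%_. PushW 1 [S1, S1, S1, S1])) ;; Clr 21) (?ss, ?z)"
  unfolding GuessLen_def s0_def by (simp add: r fun_upd_twist del: sem.simps(5) PushW.simps)
 have 2: "fold (%_. sem f (Each 21 13 (%_. PushW 1 [S1, S1, S1, S1]))) w (ss, q) = (ss(1 := replicate (4 * length (ss 21) * length w) S1 @ ss 1), q)"
  if "ss 13 = []" for w :: word and ss q
  using that
 proof (induction w arbitrary: ss)
  case (Cons a w)
  let ?ss' = "ss(1 := replicate (4 * length (ss 21)) S1 @ ss 1)"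
  have e: "?ss' 13 = []" using Cons.prems by simp
  have rr: "replicate (a * b) S1 @ replicate a S1 @ c = replicate (a * Suc b) S1 @ c" for a b and c :: word by (simp add: replicate_add[symmetric] add.commute flip: append_assoc)
  show ?case unfolding fold.simps o_apply sem_quadruple[where ss = ss, OF Cons.prems] Cons.IH[of ?ss', OF e]
   by (simp add: rr fun_eq_iff del: mult_Suc_right)
 qed simp
 have o: "ok (- {20}) (Each 21 13 (%_. PushW 1 [S1, S1, S1, S1]))" by simp
 have "?ss 13 = []" by simp
 note f2 = 2[of ?ss, OF this]
 show ?thesis unfolding 1 sem.simps(3) sem_For[OF o] fst_conv f2 upd_pair sem_Clr
  by (auto simp: fun_eq_iff algebra_simps)
qed

text \<open>Counted by hand: the inner loop pushes a number of symbols that depends on the input, so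
  the outer loop does not fall under \<open>pb_For\<close>, which wants constant growth of the
  body.\<close>

lemma ops_GuessLen: "ops f GuessLen (s0 u) <= 40 * ((length u + 8) * (length u + 8))"
proof -
 let ?m = "length u + 8" let ?E = "Each 21 13 (%_. PushW 1 [S1, S1, S1, S1])"
 let ?z = "(%_. None, 0) :: (nat => cell) \<times> nat"
 let ?a = "(%_::nat. [])(0 := rev u)" let ?b = "?a(20 := replicate (length u) S1)" let ?c = "?a(20 := replicate ?m S1)"
 let ?d = "?c(21 := replicate (length u) S1)" let ?ss = "?c(21 := replicate ?m S1)"
 have r: "replicate 8 S1 @ replicate n S1 = replicate (n + 8) S1" for n by (simp add: replicate_add[symmetric] add.commute)
 have s: "sem f (Each 0 13 (%_. Push 20 S1)) (?a, ?z) = (?b, ?z)" "sem f (PushW 20 (replicate 8 S1)) (?b, ?z) = (?c, ?z)"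
  "sem f (Each 0 13 (%_. Push 21 S1)) (?c, ?z) = (?d, ?z)" "sem f (PushW 21 (replicate 8 S1)) (?d, ?z) = (?ss, ?z)"
  by (simp_all add: r)
 have o1: "ops f (Each 0 13 (%_. Push 20 S1)) (?a, ?z) <= 2 + length u * 5"
  using ops_Each[of f "%_. Push 20 S1" 1 0 13 "(?a, ?z)"] by simp
 have o2: "ops f (Each 0 13 (%_. Push 21 S1)) (?c, ?z) <= 2 + length u * 5"
  using ops_Each[of f "%_. Push 21 S1" 1 0 13 "(?c, ?z)"] by simp
 let ?I = "%s. fst s 13 = [] \<and> length (fst s 21) = ?m"
 have o3: "ops f (For 20 (%_. ?E)) (?ss, ?z) <= 1 + length (fst (?ss, ?z) 20) * (1 + (2 + ?m * 9))"
 proof -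
  have fo: "fops 20 (%_. sem f ?E) (%_. ops f ?E) w s <= 1 + length w * (1 + (2 + ?m * 9))" if "?I s" for w :: word and s
   using that
  proof (induction w arbitrary: s)
   case (Cons a w)
   obtain ss q where sq: "s = (ss, q)" by (cases s)
   have e: "(ss(20 := w)) 13 = []" using Cons.prems sq by simp
   have i: "?I (sem f ?E (upd 20 w s))" unfolding sq upd_pair sem_quadruple[where ss = "ss(20 := w)", OF e] using Cons.prems sq by simp
   have "ops f ?E (upd 20 w s) <= 2 + length (fst (upd 20 w s) 21) * (4 + 5)"
    by (rule ops_Each) (use Cons.prems in \<open>simp_all add: ops_PushW del: PushW.simps\<close>)
   then have "ops f ?E (upd 20 w s) <= 2 + ?m * 9" using Cons.prems by simp
   then show ?case using Cons.IH[OF i] by simp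
  qed simp
  show ?thesis unfolding ops.simps(5) by (rule fo) simp
 qed
 have c: "ops f (Clr 21) (sem f (For 20 (%_. ?E)) (?ss, ?z)) <= 1 + 2 * ?m"
 proof -
  have "length (fst (sem f (For 20 (%_. ?E)) (?ss, ?z)) 21) = ?m"
  proof -
   have fo: "length (fst (fold (%_. sem f ?E) w s) 21) = ?m" if "?I s" for w :: word and s
    using that
   proof (induction w arbitrary: s)
    case (Cons a w)
    obtain ss q where sq: "s = (ss, q)" by (cases s)
    have e: "ss 13 = []" using Cons.prems sq by simp
    have i: "?I (sem f ?E s)" unfolding sq sem_quadruple[where ss = ss, OF e] using Cons.prems sq by simp
    show ?case using Cons.IH[OF i] by simp
   qed simp
   have o: "ok (- {20}) ?E" by simp
   show ?thesis unfolding sem_For[OF o] using fo[of "(?ss, ?z)" "fst (?ss, ?z) 20"] by simp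
  qed
  then show ?thesis using ops_Clr[of f 21 "sem f (For 20 (%_. ?E)) (?ss, ?z)"] by simp
 qed
 have "ops f GuessLen (s0 u) <= (2 + length u * 5) + (9 + ((2 + length u * 5) + (9 + ((1 + ?m * (1 + (2 + ?m * 9))) + (1 + 2 * ?m)))))"
  unfolding GuessLen_def s0_def ops.simps(3) s ops_PushW
  using o1 o2 o3 c by simp
 also have "\<dots> <= 40 * (?m * ?m)"
  by (simp add: algebra_simps)
 finally show ?thesis .
qed

subsection \<open>Names\<close>

lemma setdist_less: "setdist_e p S < ereal r \<longleftrightarrow> (\<exists>q\<in>S. dist p q < r)"
 unfolding setdist_e_def by (simp add: INF_less_iff)

lemma setdist_le: "q \<in> S ==> dist p q <= r ==> \<not> setdist_e p S > ereal r"
proof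
 assume "q \<in> S" "dist p q <= r" "setdist_e p S > ereal r"
 moreover have "setdist_e p S <= ereal (dist p q)" unfolding setdist_e_def by (rule INF_lower) fact
 ultimately show False by (meson ereal_less_eq(3) leD order_trans)
qed

lemma setdist_not_gt: "\<not> setdist_e p S > ereal r ==> r < r' ==> \<exists>q\<in>S. dist p q < r'"
proof -
 assume "\<not> setdist_e p S > ereal r" "r < r'"
 then have "setdist_e p S < ereal r'" by (metis ereal_less(2) ereal_less_eq(3) less_ereal.simps(1) linorder_not_less order_le_less_trans)
 then show ?thesis unfolding setdist_less .
qed

lemma dist_le_sum: "dist (p :: real \<times> real) q <= \<bar>fst p - fst q\<bar> + \<bar>snd p - snd q\<bar>"
 unfolding dist_prod_def dist_real_def by (metis real_sqrt_abs real_sqrt_sum_squares_triangle_ineq[of "fst p - fst q" 0 0 "snd p - snd q"] power2_abs sqrt_sum_squares_le_sum_abs abs_abs)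

lemma word_of_nat: "A < 2 ^ N ==> \<exists>w. length w = N \<and> set w \<subseteq> {S0, S1} \<and> bin_val w = A"
proof -
 have "A < 2 ^ N ==> \<exists>w. length w = N \<and> set w \<subseteq> {S0, S1} \<and> val w = A"
 proof (induction N arbitrary: A)
  case (Suc N)
  have "A div 2 < 2 ^ N" using Suc.prems by auto
  from Suc.IH[OF this] obtain w where w: "length w = N" "set w \<subseteq> {S0, S1}" "val w = A div 2" by blast
  show ?case by (rule exI[of _ "(if odd A then S1 else S0) # w"]) (use w in \<open>auto elim: oddE\<close>)
 qed auto
 moreover assume "A < 2 ^ N"
 ultimately obtain w where "length w = N" "set w \<subseteq> {S0, S1}" "val w = A" by blast
 then show ?thesis by (intro exI[of _ "rev w"]) (auto simp: bin_val_val)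
qed

lemma dyadic_approx:
 fixes x :: real
 obtains u where "u \<in> D" "dist (dyad_val u) x < (1/2) ^ n"
proof -
 define A where "A = nat \<lfloor>\<bar>x\<bar> * 2 ^ n\<rfloor>"
 have "A < 2 ^ A" by (rule less_exp)
 then obtain w where w: "set w \<subseteq> {S0, S1}" "bin_val w = A" using word_of_nat by blast
 let ?s = "if x < 0 then SMinus else SPlus"
 have "real A <= \<bar>x\<bar> * 2 ^ n" "\<bar>x\<bar> * 2 ^ n < real A + 1" unfolding A_def by (simp_all add: of_nat_floor)
 then have "real A / 2 ^ n <= \<bar>x\<bar>" "\<bar>x\<bar> < real A / 2 ^ n + 1 / 2 ^ n" by (simp_all add: field_simps)
 then have "dist (dyad_val (dstr ?s w n)) x < (1/2) ^ n"
  unfolding dyad_val_dstr[OF w(1)] w(2) dist_real_def by (auto simp: power_divide)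
 moreover have "dstr ?s w n \<in> D" unfolding D_dstr using w by auto
 ultimately show thesis using that by blast
qed

text \<open>Close to a point of \<open>S\<close> every query of sufficient precision is answered by
  \<open>S1\<close>, which forbids that \<open>T\<close> is far away; and \<open>T\<close> is
  closed. By symmetry a name determines its set, which justifies the \<open>THE\<close> in
  \<open>psi_circ\<close>.\<close>

lemma psi_name_subset:
 assumes "is_psi_name f S" "is_psi_name f T"
 shows "S \<subseteq> T"
proof
 fix p assume p: "p \<in> S"
 have cl: "closed T" using assms(2) by (simp add: is_psi_name_def Acal_def)
 have "\<exists>q\<in>T. dist q p < e" if "e > 0" for e
 proof -
  have "e / 8 > 0" using that by simp
  then obtain n where n: "(1/2::real) ^ n < e / 8" using real_arch_pow_inv[of "e / 8" "1/2"] by auto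
  obtain u where u: "u \<in> D" "dist (dyad_val u) (fst p) < (1/2) ^ Suc n" using dyadic_approx by blast
  obtain v where v: "v \<in> D" "dist (dyad_val v) (snd p) < (1/2) ^ Suc n" using dyadic_approx by blast
  let ?q = "(dyad_val u, dyad_val v)"
  have "dist ?q p <= dist (dyad_val u) (fst p) + dist (dyad_val v) (snd p)"
   using dist_le_sum[of ?q p] by (simp add: dist_real_def)
  then have d: "dist ?q p < (1/2) ^ n" using u(2) v(2) by simp
  then have "setdist_e ?q S < ereal ((1/2) ^ n)" unfolding setdist_less using p by blast
  then have "f (tuple [u, v, replicate n S0]) = [S1]" using assms(1) u(1) v(1) unfolding is_psi_name_def by blast
  then have "\<not> setdist_e ?q T > ereal (2 * (1/2) ^ n)" using assms(2) u(1) v(1) unfolding is_psi_name_def by force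
  then obtain q where q: "q \<in> T" "dist ?q q < 3 * (1/2) ^ n" using setdist_not_gt[of "2 * (1/2) ^ n" ?q T "3 * (1/2) ^ n"] by auto
  have "dist q p <= dist ?q q + dist ?q p" by (metis dist_commute dist_triangle)
  then have "dist q p < e" using d q(2) n that by linarith
  then show ?thesis using q(1) by blast
 qed
 then show "p \<in> T" using closed_approachable[OF cl] by blast
qed

lemma psi_circ_name: "is_psi_name f S ==> psi_circ f = Some S"
 unfolding psi_circ_def using psi_name_subset[of f] by (auto intro!: the_equality equalityI)

lemma psi_circ_Some: "psi_circ f = Some S ==> is_psi_name f S"
proof -
 assume a: "psi_circ f = Some S"
 then obtain T where T: "is_psi_name f T" by (auto simp: psi_circ_def split: if_splits)
 then show ?thesis using psi_circ_name[OF T] a by simp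
qed

subsection \<open>Convex combinations by repeated averaging\<close>

text \<open>Among three weights with sum at least 3/4 one is at least 1/4 and can give away 1/4.
  Starting from sum 1 this works twice; the remaining weights have sum 1/2, and doubled they define
  \<open>c'\<close>.\<close>

lemma hull_halve:
 fixes a b d :: "'a::real_vector"
 assumes "c \<in> convex hull {a, b, d}"
 obtains c' s s' where "c' \<in> convex hull {a, b, d}" "s \<in> {a, b, d}" "s' \<in> {a, b, d}" "c = (1/4) *\<^sub>R (2 *\<^sub>R c' + s + s')"
proof -
 have quarter: "\<exists>s l' m' n'. s \<in> {a, b, d} \<and> 0 <= l' \<and> 0 <= m' \<and> 0 <= n' \<and> l' + m' + n' = l + m + n - 1/4 \<and>
   l *\<^sub>R a + m *\<^sub>R b + n *\<^sub>R d = l' *\<^sub>R a + m' *\<^sub>R b + n' *\<^sub>R d + (1/4) *\<^sub>R s"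
  if "0 <= l" "0 <= m" "0 <= n" "l + m + n \<ge> 3/4" for l m n :: real
 proof -
  have "l \<ge> 1/4 \<or> m \<ge> 1/4 \<or> n \<ge> 1/4" using that by linarith
  then consider "l \<ge> 1/4" | "m \<ge> 1/4" | "n \<ge> 1/4" by blast
  then show ?thesis
  proof cases
   case 1
   show ?thesis by (rule exI[of _ a], rule exI[of _ "l - 1/4"], rule exI[of _ m], rule exI[of _ n]) (use that 1 in \<open>auto simp: algebra_simps\<close>)
  next
   case 2
   show ?thesis by (rule exI[of _ b], rule exI[of _ l], rule exI[of _ "m - 1/4"], rule exI[of _ n]) (use that 2 in \<open>auto simp: algebra_simps\<close>)
  next
   case 3
   show ?thesis by (rule exI[of _ d], rule exI[of _ l], rule exI[of _ m], rule exI[of _ "n - 1/4"]) (use that 3 in \<open>auto simp: algebra_simps\<close>)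
  qed
 qed
 obtain l m n where c: "c = l *\<^sub>R a + m *\<^sub>R b + n *\<^sub>R d" "0 <= l" "0 <= m" "0 <= n" "l + m + n = 1"
  using assms unfolding convex_hull_3 by auto
 obtain s l1 m1 n1 where 1: "s \<in> {a, b, d}" "0 <= l1" "0 <= m1" "0 <= n1" "l1 + m1 + n1 = 3/4"
  "c = l1 *\<^sub>R a + m1 *\<^sub>R b + n1 *\<^sub>R d + (1/4) *\<^sub>R s" using quarter[of l m n] c by auto
 obtain s' l2 m2 n2 where 2: "s' \<in> {a, b, d}" "0 <= l2" "0 <= m2" "0 <= n2" "l2 + m2 + n2 = 1/2"
  "l1 *\<^sub>R a + m1 *\<^sub>R b + n1 *\<^sub>R d = l2 *\<^sub>R a + m2 *\<^sub>R b + n2 *\<^sub>R d + (1/4) *\<^sub>R s'" using quarter[of l1 m1 n1] 1 by auto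
 let ?c = "(2 * l2) *\<^sub>R a + (2 * m2) *\<^sub>R b + (2 * n2) *\<^sub>R d"
 have "?c \<in> convex hull {a, b, d}" unfolding convex_hull_3 using 2 by force
 moreover have "c = (1/4) *\<^sub>R (2 *\<^sub>R ?c + s + s')" unfolding 1(6) 2(6) by (simp add: algebra_simps)
 ultimately show thesis using that 1(1) 2(1) by blast
qed

text \<open>Caratheodory's theorem in dimension at most two; if fewer points are enough, one of them
  is repeated.\<close>

lemma hull_three:
 fixes S :: "('a::euclidean_space) set"
 assumes "c \<in> convex hull S" "DIM('a) <= 2"
 obtains a b d where "a \<in> S" "b \<in> S" "d \<in> S" "c \<in> convex hull {a, b, d}"
proof -
 obtain T where T: "finite T" "T \<subseteq> S" "card T <= 3" "c \<in> convex hull T"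
  using assms unfolding caratheodory[of S] by force
 have ne: "T ~= {}" using T(4) by auto
 obtain xs where xs: "set xs = T" "length xs = card T" using finite_distinct_list[OF T(1)] distinct_card by metis
 have "\<exists>a b d. T = {a, b, d}"
 proof -
  have l: "length xs <= 3" using xs(2) T(3) by simp
  show ?thesis
  proof (cases xs)
   case Nil
   then show ?thesis using ne xs(1) by simp
  next
   case (Cons a ys)
   note a = this
   show ?thesis
   proof (cases ys)
    case Nil
    then have "T = {a, a, a}" using a xs(1)[symmetric] by simp
    then show ?thesis by blast
   next
    case (Cons b zs)
    note b = this
    show ?thesis
    proof (cases zs)
     case Nil
     then have "T = {a, b, b}" using a b xs(1)[symmetric] by simp
     then show ?thesis by blast
    next
     case (Cons d us)
     then have "us = []" using a b l by simp
     then have "T = {a, b, d}" using a b Cons xs(1)[symmetric] by simp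
     then show ?thesis by blast
    qed
   qed
  qed
 qed
 then show thesis using that T by blast
qed

lemma grid_point:
 fixes x :: real
 assumes "0 <= x" "x <= 1"
 obtains a where "length a = N" "set a \<subseteq> {S0, S1}" "\<bar>real (bin_val a) / 2 ^ N - x\<bar> <= 1 / 2 ^ N"
proof -
 define F where "F = nat \<lfloor>x * 2 ^ N\<rfloor>"
 \<comment> \<open>The minimum concerns only \<open>x = 1\<close>, whose numerator
   \<open>2 ^ N\<close> has too many digits.\<close>
 define A where "A = min F (2 ^ N - 1)"
 have fl: "real F <= x * 2 ^ N" "x * 2 ^ N < real F + 1"
  using assms unfolding F_def by (simp_all add: of_nat_floor)
 have "A < 2 ^ N" unfolding A_def by (rule min.strict_coboundedI2) simp
 then obtain a where a: "length a = N" "set a \<subseteq> {S0, S1}" "bin_val a = A" using word_of_nat by blast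
 have x: "x * 2 ^ N <= 2 ^ N" using assms by simp
 have m: "real (2 ^ N - 1) = 2 ^ N - 1" by (simp add: of_nat_diff)
 have "\<bar>real A - x * 2 ^ N\<bar> <= 1"
 proof (cases "F <= 2 ^ N - 1")
  case True
  then have "A = F" unfolding A_def by simp
  then show ?thesis using fl by linarith
 next
  case False
  then have "A = 2 ^ N - 1" "2 ^ N - 1 < F" unfolding A_def by simp_all
  then have "real A = 2 ^ N - 1" "real (2 ^ N - 1) < real F" using m by (simp only:, simp only: of_nat_less_iff)
  then show ?thesis using fl x m by linarith
 qed
 then have "\<bar>(real A - x * 2 ^ N) / 2 ^ N\<bar> <= 1 / 2 ^ N" unfolding abs_divide by (simp add: divide_right_mono)
 then have "\<bar>real A / 2 ^ N - x\<bar> <= 1 / 2 ^ N" by (simp add: diff_divide_distrib)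
 then show thesis using that a by simp
qed

lemma Acal_box: "S \<in> Acal ==> p \<in> S ==> 0 <= fst p \<and> fst p <= 1 \<and> 0 <= snd p \<and> snd p <= 1"
 unfolding Acal_def by (cases p) auto

lemma Acal_hull: "S \<in> Acal ==> convex hull S \<in> Acal"
proof -
 assume S: "S \<in> Acal"
 have b: "compact ({0..1} \<times> {0..1} :: (real \<times> real) set)" by (intro compact_Times) auto
 have "{0..1} \<times> {0..1} \<inter> S = S" "closed S" using S unfolding Acal_def by auto
 then have "compact S" using compact_Int_closed[OF b, of S] by simp
 then have "closed (convex hull S)" by (intro compact_imp_closed compact_convex_hull)
 moreover have "convex hull S \<subseteq> {0..1} \<times> {0..1}" using S unfolding Acal_def
  by (intro hull_minimal convex_Times) auto
 ultimately show ?thesis unfolding Acal_def by simp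
qed

lemma div4_real: "real (m div 4) <= real m / 4" "real m / 4 < real (m div 4) + 1"
 by linarith+

lemma hit_iff:
 assumes "is_psi_name f S" "set a \<subseteq> {S0, S1}" "set b \<subseteq> {S0, S1}"
 shows "setdist_e (real (bin_val a) / 2 ^ N, real (bin_val b) / 2 ^ N) S < ereal ((1/2) ^ (n + 6)) ==> hb (f (ptq n N a b))"
  "hb (f (ptq n N a b)) ==> \<not> setdist_e (real (bin_val a) / 2 ^ N, real (bin_val b) / 2 ^ N) S > ereal (2 * (1/2) ^ (n + 6))"
proof -
 have d: "dstr SPlus a N \<in> D" "dstr SPlus b N \<in> D" using assms(2,3) unfolding D_dstr by blast+
 have v: "dyad_val (dstr SPlus a N) = real (bin_val a) / 2 ^ N" "dyad_val (dstr SPlus b N) = real (bin_val b) / 2 ^ N"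
  using dyad_val_dstr[OF assms(2), of SPlus N] dyad_val_dstr[OF assms(3), of SPlus N] by simp_all
 note h = assms(1)[unfolded is_psi_name_def, THEN conjunct2, THEN conjunct2, rule_format, OF conjI[OF d], of "n + 6", unfolded v]
 show "setdist_e (real (bin_val a) / 2 ^ N, real (bin_val b) / 2 ^ N) S < ereal ((1/2) ^ (n + 6)) ==> hb (f (ptq n N a b))"
  using h unfolding ptq_def by (auto simp: hb_def)
 show "hb (f (ptq n N a b)) ==> \<not> setdist_e (real (bin_val a) / 2 ^ N, real (bin_val b) / 2 ^ N) S > ereal (2 * (1/2) ^ (n + 6))"
  using h unfolding ptq_def by (auto simp: hb_def)
qed

definition qbits :: "quad => bool" where
 "qbits = (%(a, b, a', b'). set a \<subseteq> {S0, S1} \<and> set b \<subseteq> {S0, S1} \<and> set a' \<subseteq> {S0, S1} \<and> set b' \<subseteq> {S0, S1})"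

text \<open>The old error is halved, the two sample errors enter with weight 1/4 each, and the
  truncating division loses less than one grid unit.\<close>

lemma avg_error:
 fixes q :: nat
 assumes "\<bar>real q / 2 ^ N - c\<bar> <= E" "\<bar>real A / 2 ^ N - s\<bar> <= e" "\<bar>real A' / 2 ^ N - s'\<bar> <= e"
 shows "\<bar>real ((2 * q + A + A') div 4) / 2 ^ N - (2 * c + s + s') / 4\<bar> <= E / 2 + e / 2 + 1 / 2 ^ N"
proof -
 define m where "m = 2 * q + A + A'"
 define x a b d e1 where "x = real (m div 4) / 2 ^ N" "a = real q / 2 ^ N" "b = real A / 2 ^ N" "d = real A' / 2 ^ N" "e1 = 1 / (2::real) ^ N"
 have "x <= (real m / 4) / 2 ^ N" unfolding x_a_b_d_e1_def using div4_real(1)[of m] by (intro divide_right_mono) auto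
 moreover have "(real m / 4) / 2 ^ N <= (real (m div 4) + 1) / 2 ^ N" using div4_real(2)[of m] by (intro divide_right_mono) auto
 moreover have "(real m / 4) / 2 ^ N = (2 * a + b + d) / 4" unfolding x_a_b_d_e1_def m_def by (simp add: field_simps)
 moreover have "(real (m div 4) + 1) / 2 ^ N = x + e1" unfolding x_a_b_d_e1_def by (simp add: add_divide_distrib)
 ultimately have "x <= (2 * a + b + d) / 4" "(2 * a + b + d) / 4 <= x + e1" by simp_all
 moreover have "\<bar>a - c\<bar> <= E" "\<bar>b - s\<bar> <= e" "\<bar>d - s'\<bar> <= e" "e1 \<ge> 0" using assms unfolding x_a_b_d_e1_def by simp_all
 ultimately have "\<bar>x - (2 * c + s + s') / 4\<bar> <= E / 2 + e / 2 + e1" unfolding abs_le_iff by (auto simp: field_simps)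
 then show ?thesis unfolding x_a_b_d_e1_def m_def .
qed

text \<open>Samples are grid points at most one unit per coordinate away from points of
  \<open>S\<close>. The error 3 is the fixed point of \<open>E = E / 2 + 1 / 2 + 1\<close>; the
  remaining \<open>1 / 2 ^ k\<close> is the halved distance from the starting value 0. Rounds are
  chosen backwards: the last pair splits \<open>c\<close>, and the earlier ones serve
  \<open>c'\<close>.\<close>

lemma hull_approx:
 assumes nm: "is_psi_name f S" and N: "N = n + 8" and abd: "a \<in> S" "b \<in> S" "d \<in> S"
 shows "c \<in> convex hull {a, b, d} ==> \<exists>ps. length ps = k \<and> (\<forall>p\<in>set ps. qok N p \<and> qbits p \<and> qhit f n N p) \<and>
  \<bar>real (qx ps 0) / 2 ^ N - fst c\<bar> <= 1 / 2 ^ k + 3 / 2 ^ N \<and> \<bar>real (qy ps 0) / 2 ^ N - snd c\<bar> <= 1 / 2 ^ k + 3 / 2 ^ N"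
proof (induction k arbitrary: c)
 case 0
 have SA: "S \<in> Acal" using nm by (simp add: is_psi_name_def)
 have "convex hull {a, b, d} \<subseteq> convex hull S" using abd by (intro hull_mono) auto
 then have "c \<in> convex hull S" using 0 by auto
 then have "0 <= fst c \<and> fst c <= 1 \<and> 0 <= snd c \<and> snd c <= 1" using Acal_box[OF Acal_hull[OF SA]] by blast
 moreover have "0 <= 3 / (2::real) ^ N" by simp
 ultimately have "\<bar>0 - fst c\<bar> <= 1 + 3 / 2 ^ N" "\<bar>0 - snd c\<bar> <= 1 + 3 / 2 ^ N" by linarith+
 then show ?case by (intro exI[of _ "[]"]) (simp add: qx_def qy_def)
next
 case (Suc k)
 have SA: "S \<in> Acal" using nm by (simp add: is_psi_name_def)
 obtain c' s s' where c': "c' \<in> convex hull {a, b, d}" "s \<in> {a, b, d}" "s' \<in> {a, b, d}" "c = (1/4) *\<^sub>R (2 *\<^sub>R c' + s + s')"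
  using hull_halve[OF Suc.prems] by blast
 obtain ps where ps: "length ps = k" "\<forall>p\<in>set ps. qok N p \<and> qbits p \<and> qhit f n N p"
  "\<bar>real (qx ps 0) / 2 ^ N - fst c'\<bar> <= 1 / 2 ^ k + 3 / 2 ^ N" "\<bar>real (qy ps 0) / 2 ^ N - snd c'\<bar> <= 1 / 2 ^ k + 3 / 2 ^ N"
  using Suc.IH[OF c'(1)] by blast
 have pt: "\<exists>A B. length A = N \<and> length B = N \<and> set A \<subseteq> {S0, S1} \<and> set B \<subseteq> {S0, S1} \<and> hb (f (ptq n N A B)) \<and>
   \<bar>real (bin_val A) / 2 ^ N - fst s\<bar> <= 1 / 2 ^ N \<and> \<bar>real (bin_val B) / 2 ^ N - snd s\<bar> <= 1 / 2 ^ N" if s: "s \<in> S" for s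
 proof -
  have bx: "0 <= fst s" "fst s <= 1" "0 <= snd s" "snd s <= 1" using Acal_box[OF SA s] by auto
  obtain A where A: "length A = N" "set A \<subseteq> {S0, S1}" "\<bar>real (bin_val A) / 2 ^ N - fst s\<bar> <= 1 / 2 ^ N" using grid_point[OF bx(1,2)] by blast
  obtain B where B: "length B = N" "set B \<subseteq> {S0, S1}" "\<bar>real (bin_val B) / 2 ^ N - snd s\<bar> <= 1 / 2 ^ N" using grid_point[OF bx(3,4)] by blast
  let ?p = "(real (bin_val A) / 2 ^ N, real (bin_val B) / 2 ^ N)"
  have "dist ?p s <= dist (fst ?p) (fst s) + dist (snd ?p) (snd s)"
   using dist_le_sum[of ?p s] by (simp add: dist_real_def)
  also have "\<dots> <= 2 / 2 ^ N" using A(3) B(3) by (simp add: dist_real_def)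
  \<comment> \<open>This fixes the precision of the samples: \<open>(1/2) ^ (n + 6)\<close> is 4
    grid units, whereas rounding both coordinates costs at most 2.\<close>
  also have "\<dots> < (1/2) ^ (n + 6)" unfolding N by (simp add: power_add power_divide divide_simps)
  finally have "setdist_e ?p S < ereal ((1/2) ^ (n + 6))" unfolding setdist_less using s by blast
  then have "hb (f (ptq n N A B))" using hit_iff(1)[OF nm A(2) B(2)] by blast
  then show ?thesis using A B by blast
 qed
 have "s \<in> S" "s' \<in> S" using c'(2,3) abd by auto
 then obtain A B A' B' where AB: "length A = N" "length B = N" "set A \<subseteq> {S0, S1}" "set B \<subseteq> {S0, S1}" "hb (f (ptq n N A B))"
  "\<bar>real (bin_val A) / 2 ^ N - fst s\<bar> <= 1 / 2 ^ N" "\<bar>real (bin_val B) / 2 ^ N - snd s\<bar> <= 1 / 2 ^ N"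
  "length A' = N" "length B' = N" "set A' \<subseteq> {S0, S1}" "set B' \<subseteq> {S0, S1}" "hb (f (ptq n N A' B'))"
  "\<bar>real (bin_val A') / 2 ^ N - fst s'\<bar> <= 1 / 2 ^ N" "\<bar>real (bin_val B') / 2 ^ N - snd s'\<bar> <= 1 / 2 ^ N"
  using pt by meson
 let ?p = "(A, B, A', B')"
 have ex: "\<bar>real (qx (ps @ [?p]) 0) / 2 ^ N - fst c\<bar> <= (1 / 2 ^ k + 3 / 2 ^ N) / 2 + (1 / 2 ^ N) / 2 + 1 / 2 ^ N"
  using avg_error[OF ps(3) AB(6,13)] unfolding c'(4) by (simp add: qx_def add_divide_distrib)
 have ey: "\<bar>real (qy (ps @ [?p]) 0) / 2 ^ N - snd c\<bar> <= (1 / 2 ^ k + 3 / 2 ^ N) / 2 + (1 / 2 ^ N) / 2 + 1 / 2 ^ N"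
  using avg_error[OF ps(4) AB(7,14)] unfolding c'(4) by (simp add: qy_def add_divide_distrib)
 have E: "(1 / 2 ^ k + 3 / 2 ^ N) / 2 + (1 / 2 ^ N) / 2 + 1 / 2 ^ N = 1 / 2 ^ Suc k + 3 / (2::real) ^ N"
  by (simp add: field_simps)
 show ?case
  by (rule exI[of _ "ps @ [?p]"]) (use ps AB ex ey E in \<open>auto simp: qok_def qbits_def qhit_def\<close>)
qed

text \<open>A positive answer at precision \<open>n + 6\<close> certifies a point of
  \<open>S\<close> within 12 grid units, and 14 is the fixed point of
  \<open>E = E / 2 + 12 / 2 + 1\<close>. The point \<open>c0\<close> is compared with the starting
  value 0.\<close>

lemma hull_sound:
 assumes nm: "is_psi_name f S" and N: "N = n + 8" and c0: "c0 \<in> convex hull S"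
 shows "\<forall>p\<in>set ps. qbits p \<and> qhit f n N p ==> \<exists>c\<in>convex hull S.
  \<bar>real (qx ps 0) / 2 ^ N - fst c\<bar> <= 1 / 2 ^ length ps + 14 / 2 ^ N \<and> \<bar>real (qy ps 0) / 2 ^ N - snd c\<bar> <= 1 / 2 ^ length ps + 14 / 2 ^ N"
proof (induction ps rule: rev_induct)
 case Nil
 have SA: "S \<in> Acal" using nm by (simp add: is_psi_name_def)
 have "0 <= fst c0 \<and> fst c0 <= 1 \<and> 0 <= snd c0 \<and> snd c0 <= 1" using Acal_box[OF Acal_hull[OF SA] c0] by blast
 moreover have "0 <= 14 / (2::real) ^ N" by simp
 ultimately have "\<bar>0 - fst c0\<bar> <= 1 + 14 / 2 ^ N" "\<bar>0 - snd c0\<bar> <= 1 + 14 / 2 ^ N" by linarith+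
 then show ?case using c0 by (intro bexI[of _ c0]) (simp_all add: qx_def qy_def)
next
 case (snoc p ps)
 obtain A B A' B' where p: "p = (A, B, A', B')" by (cases p)
 obtain c where c: "c \<in> convex hull S" "\<bar>real (qx ps 0) / 2 ^ N - fst c\<bar> <= 1 / 2 ^ length ps + 14 / 2 ^ N"
  "\<bar>real (qy ps 0) / 2 ^ N - snd c\<bar> <= 1 / 2 ^ length ps + 14 / 2 ^ N" using snoc by auto
 have q: "qbits p" "qhit f n N p" using snoc.prems by auto
 have pt: "\<exists>s\<in>S. \<bar>real (bin_val A) / 2 ^ N - fst s\<bar> <= 12 / 2 ^ N \<and> \<bar>real (bin_val B) / 2 ^ N - snd s\<bar> <= 12 / 2 ^ N"
  if "set A \<subseteq> {S0, S1}" "set B \<subseteq> {S0, S1}" "hb (f (ptq n N A B))" for A B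
 proof -
  let ?p = "(real (bin_val A) / 2 ^ N, real (bin_val B) / 2 ^ N)"
  have "\<not> setdist_e ?p S > ereal (2 * (1/2) ^ (n + 6))" using hit_iff(2)[OF nm that(1,2)] that(3) by blast
  then obtain s where s: "s \<in> S" "dist ?p s < 3 * (1/2) ^ (n + 6)"
   using setdist_not_gt[of "2 * (1/2) ^ (n + 6)" ?p S "3 * (1/2) ^ (n + 6)"] by auto
  have "3 * (1/2) ^ (n + 6) = 12 / (2::real) ^ N" unfolding N by (simp add: power_add power_divide)
  moreover have "dist (fst ?p) (fst s) <= dist ?p s" "dist (snd ?p) (snd s) <= dist ?p s" by (rule dist_fst_le dist_snd_le)+
  ultimately show ?thesis using s by (intro bexI[of _ s]) (auto simp: dist_real_def)
 qed
 obtain s where s: "s \<in> S" "\<bar>real (bin_val A) / 2 ^ N - fst s\<bar> <= 12 / 2 ^ N" "\<bar>real (bin_val B) / 2 ^ N - snd s\<bar> <= 12 / 2 ^ N"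
  using pt[of A B] q p by (auto simp: qbits_def qhit_def)
 obtain s' where s': "s' \<in> S" "\<bar>real (bin_val A') / 2 ^ N - fst s'\<bar> <= 12 / 2 ^ N" "\<bar>real (bin_val B') / 2 ^ N - snd s'\<bar> <= 12 / 2 ^ N"
  using pt[of A' B'] q p by (auto simp: qbits_def qhit_def)
 let ?c = "(1/2) *\<^sub>R c + (1/2) *\<^sub>R ((1/2) *\<^sub>R s + (1/2) *\<^sub>R s')"
 have cv: "convex (convex hull S)" by (rule convex_convex_hull)
 have "(1/2) *\<^sub>R s + (1/2) *\<^sub>R s' \<in> convex hull S" using hull_inc[OF s(1), of convex] hull_inc[OF s'(1), of convex] by (intro convexD[OF cv]) auto
 then have "?c \<in> convex hull S" using c(1) by (intro convexD[OF cv, of c]) auto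
 moreover have "\<bar>real (qx (ps @ [p]) 0) / 2 ^ N - fst ?c\<bar> <= (1 / 2 ^ length ps + 14 / 2 ^ N) / 2 + (12 / 2 ^ N) / 2 + 1 / 2 ^ N"
  using avg_error[OF c(2) s(2) s'(2)] p by (simp add: qx_def field_simps)
 moreover have "\<bar>real (qy (ps @ [p]) 0) / 2 ^ N - snd ?c\<bar> <= (1 / 2 ^ length ps + 14 / 2 ^ N) / 2 + (12 / 2 ^ N) / 2 + 1 / 2 ^ N"
  using avg_error[OF c(3) s(3) s'(3)] p by (simp add: qy_def field_simps)
 moreover have "(1 / 2 ^ length ps + 14 / 2 ^ N) / 2 + (12 / 2 ^ N) / 2 + 1 / 2 ^ N = 1 / 2 ^ length (ps @ [p]) + 14 / (2::real) ^ N"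
  by (simp add: field_simps)
 ultimately show ?case by (intro bexI[of _ ?c]) (simp_all only:)
qed

text \<open>The test sees the coordinate truncated to the grid. This costs one unit in the first
  direction; in the second the strict inequality \<open>v < w\<close> pays for it.\<close>

lemma nearby_real:
 fixes b k :: nat
 assumes "s \<in> {SPlus, SMinus}"
 defines "X \<equiv> (if s = SMinus then -1 else 1) * real b / 2 ^ k"
 shows "nearby s (b * 2 ^ N div 2 ^ k) q w ==> \<bar>X - real q / 2 ^ N\<bar> <= (real w + 1) / 2 ^ N"
  "\<bar>X - real q / 2 ^ N\<bar> <= real v / 2 ^ N ==> v < w ==> nearby s (b * 2 ^ N div 2 ^ k) q w"
proof -
 let ?x = "b * 2 ^ N div 2 ^ k" let ?B = "real b / 2 ^ k * 2 ^ N"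
 have d: "real (m div 2 ^ k) <= real m / 2 ^ k" "real m / 2 ^ k < real (m div 2 ^ k) + 1" for m :: nat
  using floor_divide_of_nat_eq[of m "2 ^ k", where 'a = real] by (simp_all, linarith+)
 have x: "real ?x <= ?B" "?B < real ?x + 1" using d[of "b * 2 ^ N"] by simp_all
 have X: "X * 2 ^ N = (if s = SMinus then - ?B else ?B)" unfolding X_def by simp
 have a: "\<bar>X - real q / 2 ^ N\<bar> <= r / 2 ^ N \<longleftrightarrow> \<bar>X * 2 ^ N - real q\<bar> <= r" for r
 proof -
  have "X - real q / 2 ^ N = (X * 2 ^ N - real q) / 2 ^ N" by (simp add: diff_divide_distrib)
  then have "\<bar>X - real q / 2 ^ N\<bar> = \<bar>X * 2 ^ N - real q\<bar> / 2 ^ N" by (simp only: abs_divide) simp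
  then show ?thesis by (simp add: divide_le_cancel)
 qed
 show "nearby s ?x q w ==> \<bar>X - real q / 2 ^ N\<bar> <= (real w + 1) / 2 ^ N"
  unfolding a X nearby_def using x by (auto split: if_splits)
 show "\<bar>X - real q / 2 ^ N\<bar> <= real v / 2 ^ N ==> v < w ==> nearby s ?x q w"
  unfolding a X nearby_def using x assms(1) by (auto split: if_splits)
qed

lemma hull_soundness:
 assumes nm: "is_psi_name f S" and N: "N = n + 8"
  and u: "u = dstr s x k" "s \<in> {SPlus, SMinus}" "set x \<subseteq> {S0, S1}"
  and v: "v = dstr s' x' k'" "s' \<in> {SPlus, SMinus}" "set x' \<subseteq> {S0, S1}"
  and ps: "length ps = N" "\<forall>p\<in>set ps. qbits p \<and> qhit f n N p"
  and near: "nearby s (bin_val x * 2 ^ N div 2 ^ k) (qx ps 0) 288" "nearby s' (bin_val x' * 2 ^ N div 2 ^ k') (qy ps 0) 288"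
 shows "\<not> setdist_e (dyad_val u, dyad_val v) (convex hull S) > ereal (2 * (1/2) ^ n)"
proof -
 \<comment> \<open>There are at least 8 rounds, and a positive answer in one of them shows that
   \<open>S\<close> is nonempty.\<close>
 obtain p where p: "p \<in> set ps" using ps(1) N by (cases ps) auto
 obtain A B A' B' where q: "p = (A, B, A', B')" by (cases p)
 have "\<not> setdist_e (real (bin_val A) / 2 ^ N, real (bin_val B) / 2 ^ N) S > ereal (2 * (1/2) ^ (n + 6))"
  using ps(2) p q hit_iff(2)[OF nm] by (auto simp: qbits_def qhit_def)
 then obtain c1 where "c1 \<in> S"
  using setdist_not_gt[of "2 * (1/2) ^ (n + 6)" "(real (bin_val A) / 2 ^ N, real (bin_val B) / 2 ^ N)" S "3 * (1/2) ^ (n + 6)"] by force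
 from hull_sound[OF nm N hull_inc[OF this] ps(2)]
 obtain c where c: "c \<in> convex hull S" "\<bar>real (qx ps 0) / 2 ^ N - fst c\<bar> <= 1 / 2 ^ N + 14 / 2 ^ N"
  "\<bar>real (qy ps 0) / 2 ^ N - snd c\<bar> <= 1 / 2 ^ N + 14 / 2 ^ N" unfolding ps(1) by blast
 have "\<bar>dyad_val u - real (qx ps 0) / 2 ^ N\<bar> <= (real 288 + 1) / 2 ^ N" "\<bar>dyad_val v - real (qy ps 0) / 2 ^ N\<bar> <= (real 288 + 1) / 2 ^ N"
  unfolding u(1) v(1) dyad_val_dstr[OF u(3)] dyad_val_dstr[OF v(3)]
  using nearby_real(1)[OF u(2) near(1)] nearby_real(1)[OF v(2) near(2)] by blast+
 then have h: "\<bar>dyad_val u - fst c\<bar> <= 304 / 2 ^ N" "\<bar>dyad_val v - snd c\<bar> <= 304 / 2 ^ N" using c(2,3) by (simp_all add: field_simps abs_le_iff)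
 have "(dyad_val u - fst c)\<^sup>2 <= (304 / 2 ^ N)\<^sup>2" "(dyad_val v - snd c)\<^sup>2 <= (304 / 2 ^ N)\<^sup>2"
  using power_mono[OF h(1), of 2] power_mono[OF h(2), of 2] by (simp_all only: power2_abs abs_ge_zero simp_thms)
 then have "(dyad_val u - fst c)\<^sup>2 + (dyad_val v - snd c)\<^sup>2 <= 2 * (304 / 2 ^ N)\<^sup>2" by linarith
 then have "dist (dyad_val u, dyad_val v) c <= sqrt (2 * (304 / 2 ^ N)\<^sup>2)"
  unfolding dist_prod_def dist_real_def fst_conv snd_conv power2_abs by (rule real_sqrt_le_mono)
 also have "\<dots> <= sqrt ((512 / 2 ^ N)\<^sup>2)" by (simp add: power_divide divide_right_mono)
 also have "\<dots> = 512 / 2 ^ N" by (simp only: real_sqrt_abs) simp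
 also have "\<dots> = 2 * (1/2) ^ n" by (simp add: N power_add power_divide)
 finally show ?thesis using setdist_le[OF c(1)] by blast
qed

lemma hull_completeness:
 assumes nm: "is_psi_name f S" and N: "N = n + 8"
  and u: "u = dstr s x k" "s \<in> {SPlus, SMinus}" "set x \<subseteq> {S0, S1}"
  and v: "v = dstr s' x' k'" "s' \<in> {SPlus, SMinus}" "set x' \<subseteq> {S0, S1}"
  and near: "setdist_e (dyad_val u, dyad_val v) (convex hull S) < ereal ((1/2) ^ n)"
 shows "\<exists>ps. length ps = N \<and> (\<forall>p\<in>set ps. qok N p \<and> qbits p \<and> qhit f n N p) \<and>
  nearby s (bin_val x * 2 ^ N div 2 ^ k) (qx ps 0) 288 \<and> nearby s' (bin_val x' * 2 ^ N div 2 ^ k') (qy ps 0) 288"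
proof -
 obtain c where c: "c \<in> convex hull S" "dist (dyad_val u, dyad_val v) c < (1/2) ^ n" using near unfolding setdist_less by blast
 obtain a b d where abd: "a \<in> S" "b \<in> S" "d \<in> S" "c \<in> convex hull {a, b, d}" using hull_three[OF c(1)] by (metis DIM_real DIM_prod one_add_one order_refl)
 obtain ps where ps: "length ps = N" "\<forall>p\<in>set ps. qok N p \<and> qbits p \<and> qhit f n N p"
  "\<bar>real (qx ps 0) / 2 ^ N - fst c\<bar> <= 1 / 2 ^ N + 3 / 2 ^ N" "\<bar>real (qy ps 0) / 2 ^ N - snd c\<bar> <= 1 / 2 ^ N + 3 / 2 ^ N"
  using hull_approx[OF nm N abd] by blast
 have "(1/2) ^ n = 256 / (2::real) ^ N" by (simp add: N power_add power_divide)
 moreover have "\<bar>dyad_val u - fst c\<bar> <= dist (dyad_val u, dyad_val v) c" "\<bar>dyad_val v - snd c\<bar> <= dist (dyad_val u, dyad_val v) c"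
  using dist_fst_le[of "(dyad_val u, dyad_val v)" c] dist_snd_le[of "(dyad_val u, dyad_val v)" c] by (simp_all add: dist_real_def)
 ultimately have "\<bar>dyad_val u - fst c\<bar> <= 256 / 2 ^ N" "\<bar>dyad_val v - snd c\<bar> <= 256 / 2 ^ N" using c(2) by linarith+
 then have "\<bar>dyad_val u - real (qx ps 0) / 2 ^ N\<bar> <= real 260 / 2 ^ N" "\<bar>dyad_val v - real (qy ps 0) / 2 ^ N\<bar> <= real 260 / 2 ^ N"
  using ps(3,4) by (simp_all add: field_simps abs_le_iff)
 then have "nearby s (bin_val x * 2 ^ N div 2 ^ k) (qx ps 0) 288" "nearby s' (bin_val x' * 2 ^ N div 2 ^ k') (qy ps 0) 288"
  unfolding u(1) v(1) dyad_val_dstr[OF u(3)] dyad_val_dstr[OF v(3)]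
  using nearby_real(2)[OF u(2), of "bin_val x" k "qx ps 0" N 260 288] nearby_real(2)[OF v(2), of "bin_val x'" k' "qy ps 0" N 260 288] by simp_all
 then show ?thesis using ps by blast
qed

section \<open>The nondeterministic machine for the convex hull\<close>

lemma qconc_split:
 "bits g ==> 4 * N * k <= length g ==> \<exists>ps rest. g = qconc ps @ rest \<and> length ps = k \<and> (\<forall>p\<in>set ps. qok N p \<and> qbits p)"
proof (induction k arbitrary: g)
 case 0
 show ?case by (rule exI[of _ "[]"]) (simp add: qconc_def)
next
 case (Suc k)
 define h where "h = drop N (drop N (drop N (drop N g)))"
 define p :: quad where "p = (take N g, take N (drop N g), take N (drop N (drop N g)), take N (drop N (drop N (drop N g))))"
 have l: "length g \<ge> 4 * N + 4 * N * k" using Suc.prems by simp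
 have g: "g = take N g @ take N (drop N g) @ take N (drop N (drop N g)) @ take N (drop N (drop N (drop N g))) @ h" unfolding h_def by (simp only: append_take_drop_id)
 have "bits h" using Suc.prems(1) unfolding h_def bits_def by (metis set_drop_subset subset_trans)
 moreover have "4 * N * k <= length h" using l unfolding h_def by simp
 ultimately obtain ps rest where ps: "h = qconc ps @ rest" "length ps = k" "\<forall>p\<in>set ps. qok N p \<and> qbits p" using Suc.IH by blast
 have st: "set (take N x) \<subseteq> set x" "set (drop N x) \<subseteq> set x" for x :: word by (rule set_take_subset set_drop_subset)+
 have "qbits p" using Suc.prems(1) st unfolding qbits_def p_def bits_def by (auto dest: in_set_takeD in_set_dropD)
 moreover have "qok N p" using l unfolding qok_def p_def by auto
 moreover have "g = qconc (p # ps) @ rest" using g ps(1) by (simp add: qconc_def p_def)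
 ultimately show ?case using ps by (intro exI[of _ "p # ps"]) auto
qed

lemma qconc_bits: "\<forall>p\<in>set ps. qok N p \<and> qbits p ==> length (qconc ps) = 4 * N * length ps \<and> bits (qconc ps)"
 by (induction ps) (auto simp: qconc_def qok_def qbits_def bits_def)

fun ppow :: "sopoly => nat => sopoly" where
 "ppow p 0 = PConst 1"
| "ppow p (Suc n) = PMul p (ppow p n)"

lemma ppow_ok: "sp_ok p ==> sp_ok (ppow p n)" by (induction n) auto
lemma ppow_eval [simp]: "sp_eval (ppow p n) L k = sp_eval p L k ^ n" by (induction n) auto

lemma length_tuple3: "length (tuple [a, b, c]) = 2 * (length a + length b + length c) + 3"
 by (simp add: tuple_def)

text \<open>The witness \<open>g\<close> is acceptance itself: soundness and completeness fix it
  beyond the two thresholds of a name, and between the thresholds a name may answer either way. Its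
  existence also puts every name into the domain.\<close>

lemma hull_machine:
 "\<exists>M. wf_otm M \<and> poly_time M \<and> (\<forall>f S. psi_circ f = Some S \<longrightarrow>
   (\<exists>g\<in>mimg (rep_comp psi_circ CH psi_circ) f. \<forall>u. g u = [S1] \<longleftrightarrow> accepts M f u))"
proof -
 obtain C d where Cd: "\<And>f s. ops f Hull s <= C * (tsize 30 s + 1) ^ d" using pb_Hull unfolding pb_def pbd_def by blast
 define m where "m u = 4 * (length u + 8) * (length u + 8)" for u :: word
 let ?V = "PAdd PVar (PConst 8)"
 define P where "P = PAdd PVar (PAdd (PMul (PConst 40) (PMul ?V ?V)) (PMul (PConst (Suc C)) (ppow (PAdd (PAdd PVar (PMul (PMul (PConst 4) ?V) ?V)) (PConst 1)) d)))"
 have z: "(%_. None, 0) = ww (%_. None) []" by (simp add: ww_def fun_eq_iff)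
 have gs: "guessed g (sem f GuessLen (s0 u)) = ((%_. [])(0 := rev u, 2 := g), ww (%_. None) [])" for g :: word and f u
  unfolding guessed_def sem_GuessLen z upd_pair by (auto simp: fun_eq_iff)
 have l1: "length (fst (sem f GuessLen (s0 u)) 1) = m u" for f u unfolding sem_GuessLen m_def by simp
 have ts: "tsize 30 ((%_. [])(0 := rev u, 2 := g), q) = length u + length g" for u g :: word and q
  by (simp add: tsize_def lessThan_nat_numeral lessThan_Suc)
 have "\<exists>M. wf_otm M \<and> poly_time M \<and> (\<forall>f u. accepts M f u \<longleftrightarrow> (\<exists>g w. bits g \<and> length g = length (fst (sem f GuessLen (s0 u)) 1) \<and>
   fst (sem f Hull (guessed g (sem f GuessLen (s0 u)))) 0 = S1 # w))"
 proof (rule NP_machine[where K = 30 and P = P])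
  show "sp_ok P" unfolding P_def by (simp add: ppow_ok)
  fix f :: fn and u g :: word assume g: "length g = length (fst (sem f GuessLen (s0 u)) 1)"
  have "ops f Hull (guessed g (sem f GuessLen (s0 u))) <= C * (length u + m u + 1) ^ d"
   using Cd[of f "guessed g (sem f GuessLen (s0 u))"] unfolding gs ts g l1 .
  also have "\<dots> <= Suc C * (length u + m u + 1) ^ d" by simp
  finally show "length u + ops f GuessLen (s0 u) + ops f Hull (guessed g (sem f GuessLen (s0 u))) <= sp_eval P (regsize f) (length u)"
   using ops_GuessLen[of f u] unfolding P_def m_def sp_eval.simps ppow_eval by linarith
 qed (simp_all add: ok_Hull ok_GuessLen)
 then obtain M where M: "wf_otm M" "poly_time M" and acc: "\<And>f u. accepts M f u \<longleftrightarrow> (\<exists>g w. bits g \<and> length g = m u \<and>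
   fst (sem f Hull ((%_. [])(0 := rev u, 2 := g), ww (%_. None) [])) 0 = S1 # w)" unfolding gs l1 by blast
 have iff: "accepts M f (tuple [dstr s x k, dstr s' x' k', replicate n S0]) \<longleftrightarrow> (\<exists>ps. length ps = n + 8 \<and> (\<forall>p\<in>set ps. qok (n + 8) p \<and> qbits p \<and> qhit f n (n + 8) p) \<and>
  nearby s (bin_val x * 2 ^ (n + 8) div 2 ^ k) (qx ps 0) 288 \<and> nearby s' (bin_val x' * 2 ^ (n + 8) div 2 ^ k') (qy ps 0) 288)" (is "_ = ?R")
  if x: "set x \<subseteq> {S0, S1}" "set x' \<subseteq> {S0, S1}" for f s x k s' x' k' n
 proof -
  let ?u = "tuple [dstr s x k, dstr s' x' k', replicate n S0]" let ?N = "n + 8"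
  have ml: "4 * ?N * ?N <= m ?u" unfolding m_def by (intro mult_mono) (auto simp: length_tuple3)
  have H: "(\<exists>w. fst (sem f Hull ((%_. [])(0 := rev ?u, 2 := g), ww (%_. None) [])) 0 = S1 # w) \<longleftrightarrow> (\<forall>p\<in>set ps. qhit f n ?N p) \<and>
    nearby s (bin_val x * 2 ^ ?N div 2 ^ k) (qx ps 0) 288 \<and> nearby s' (bin_val x' * 2 ^ ?N div 2 ^ k') (qy ps 0) 288"
   if "\<forall>p\<in>set ps. qok ?N p" "length ps = ?N" "g = qconc ps @ rest" for g ps rest f
   by (rule sem_Hull[OF x refl]) (use that in simp_all)
  show ?thesis
  proof
   assume "accepts M f ?u"
   then obtain g w where g: "bits g" "length g = m ?u" "fst (sem f Hull ((%_. [])(0 := rev ?u, 2 := g), ww (%_. None) [])) 0 = S1 # w" unfolding acc by blast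
   have "4 * ?N * ?N <= length g" using g(2) ml by simp
   from qconc_split[OF g(1) this] obtain ps rest where ps: "g = qconc ps @ rest" "length ps = ?N" "\<forall>p\<in>set ps. qok ?N p \<and> qbits p" by blast
   show ?R using H[OF _ ps(2,1), of f] g(3) ps(2,3) by (intro exI[of _ ps]) blast
  next
   assume ?R
   then obtain ps where ps: "length ps = ?N" "\<forall>p\<in>set ps. qok ?N p \<and> qbits p \<and> qhit f n ?N p"
    "nearby s (bin_val x * 2 ^ ?N div 2 ^ k) (qx ps 0) 288" "nearby s' (bin_val x' * 2 ^ ?N div 2 ^ k') (qy ps 0) 288" by blast
   have q: "length (qconc ps) = 4 * ?N * ?N" "bits (qconc ps)" using qconc_bits[of ps ?N] ps by auto
   let ?r = "replicate (m ?u - 4 * ?N * ?N) S0"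
   have "bits (qconc ps @ ?r)" "length (qconc ps @ ?r) = m ?u" using q ml by (auto simp: bits_def)
   moreover have "\<exists>w. fst (sem f Hull ((%_. [])(0 := rev ?u, 2 := qconc ps @ ?r), ww (%_. None) [])) 0 = S1 # w"
    using H[OF _ ps(1) refl, of f] ps by blast
   ultimately show "accepts M f ?u" unfolding acc by blast
  qed
 qed
 have "\<exists>g\<in>mimg (rep_comp psi_circ CH psi_circ) f. \<forall>u. g u = [S1] \<longleftrightarrow> accepts M f u" if S: "psi_circ f = Some S" for f S
 proof -
  note nm = psi_circ_Some[OF S]
  define g where "g u = (if accepts M f u then [S1] else [S0])" for u
  have "g \<in> Pred" unfolding Pred_def regular_def g_def by auto
  moreover have "convex hull S \<in> Acal" using nm Acal_hull unfolding is_psi_name_def by blast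
  moreover have "(setdist_e (dyad_val u, dyad_val v) (convex hull S) < ereal ((1/2) ^ n) \<longrightarrow> g (tuple [u, v, replicate n S0]) = [S1]) \<and>
    (setdist_e (dyad_val u, dyad_val v) (convex hull S) > ereal (2 * (1/2) ^ n) \<longrightarrow> g (tuple [u, v, replicate n S0]) = [S0])"
   if uv: "u \<in> D" "v \<in> D" for n u v
  proof -
   obtain s x k where u: "u = dstr s x k" "s \<in> {SPlus, SMinus}" "set x \<subseteq> {S0, S1}" using uv(1) unfolding D_dstr by blast
   obtain s' x' k' where v: "v = dstr s' x' k'" "s' \<in> {SPlus, SMinus}" "set x' \<subseteq> {S0, S1}" using uv(2) unfolding D_dstr by blast
   note i = iff[OF u(3) v(3), of f s k s' k' n, folded u(1) v(1)]
   show ?thesis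
   proof (intro conjI impI)
    assume "setdist_e (dyad_val u, dyad_val v) (convex hull S) < ereal ((1/2) ^ n)"
    from hull_completeness[OF nm refl u v this] have "accepts M f (tuple [u, v, replicate n S0])" unfolding i .
    then show "g (tuple [u, v, replicate n S0]) = [S1]" by (simp add: g_def)
   next
    assume d: "setdist_e (dyad_val u, dyad_val v) (convex hull S) > ereal (2 * (1/2) ^ n)"
    have "\<not> accepts M f (tuple [u, v, replicate n S0])" unfolding i
    proof
     assume "\<exists>ps. length ps = n + 8 \<and> (\<forall>p\<in>set ps. qok (n + 8) p \<and> qbits p \<and> qhit f n (n + 8) p) \<and>
      nearby s (bin_val x * 2 ^ (n + 8) div 2 ^ k) (qx ps 0) 288 \<and> nearby s' (bin_val x' * 2 ^ (n + 8) div 2 ^ k') (qy ps 0) 288"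
     then obtain ps where "length ps = n + 8" "\<forall>p\<in>set ps. qbits p \<and> qhit f n (n + 8) p"
      "nearby s (bin_val x * 2 ^ (n + 8) div 2 ^ k) (qx ps 0) 288" "nearby s' (bin_val x' * 2 ^ (n + 8) div 2 ^ k') (qy ps 0) 288" by blast
     from hull_soundness[OF nm refl u v this] d show False by blast
    qed
    then show "g (tuple [u, v, replicate n S0]) = [S0]" by (simp add: g_def)
   qed
  qed
  ultimately have "is_psi_name g (convex hull S)" unfolding is_psi_name_def by blast
  from psi_circ_name[OF this] have "g \<in> mimg (rep_comp psi_circ CH psi_circ) f"
   using S unfolding mimg_def rep_comp_def CH_def mem_Collect_eq case_prod_conv singleton_iff by metis
  then show ?thesis by (rule bexI[rotated]) (simp add: g_def)
 qed
 then show ?thesis using M by blast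
qed

lemma hull_domain: "psi_circ f = Some S ==> f \<in> mdom (rep_comp psi_circ CH psi_circ)"
 using hull_machine unfolding mdom_def mimg_def by blast

theorem hull_NP: "rep_comp psi_circ CH psi_circ \<in> NP2"
proof -
 obtain M where M: "wf_otm M" "poly_time M" and g: "\<And>f S. psi_circ f = Some S ==> \<exists>g\<in>mimg (rep_comp psi_circ CH psi_circ) f. \<forall>u. g u = [S1] \<longleftrightarrow> accepts M f u"
  using hull_machine by blast
 have "\<exists>g\<in>mimg (rep_comp psi_circ CH psi_circ) f. \<forall>u. g u = [S1] \<longleftrightarrow> accepts M f u" if fd: "f \<in> mdom (rep_comp psi_circ CH psi_circ)" for f
 proof -
  obtain S where "psi_circ f = Some S" using fd unfolding mdom_def rep_comp_def mem_Collect_eq case_prod_conv by metis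
  then show ?thesis by (rule g)
 qed
 moreover have "rep_comp psi_circ CH psi_circ \<subseteq> Reg \<times> Pred"
  
 proof
  fix p assume "p \<in> rep_comp psi_circ CH psi_circ"
  then obtain f g x y where p: "p = (f, g)" "psi_circ f = Some x" "psi_circ g = Some y" unfolding rep_comp_def by blast
  have "f \<in> Pred" "g \<in> Pred" using psi_circ_Some[OF p(2)] psi_circ_Some[OF p(3)] by (simp_all only: is_psi_name_def)
  then show "p \<in> Reg \<times> Pred" unfolding p Reg_def Pred_def by simp
 qed
 ultimately show ?thesis unfolding NP2_def mem_Collect_eq using M by blast
qed

subsection \<open>Simulating a nondeterministic machine along given choices\<close>

text \<open>Stack symbols are never blank, so a flag distinguishes a blank cell from a symbol. The
  flag lies on top; an exhausted stack is read as a blank as well, which models the infinite blank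
  part of a tape.\<close>

definition ccode :: "cell => word" where
 "ccode x = (case x of None => [S0] | Some a => [S1, a])"

definition Rd :: "nat => (cell => com) => com" where
 "Rd r F = Case r (%x. if x = Some S1 then Case r F else F None)"

definition Go :: "dir => nat => nat => com" where
 "Go d l r = (case d of Stay => Skip | Rgt => Rd r (%x. PushW l (ccode x))
   | Lft => Case l (%x. if x = None then Skip else if x = Some S1 then Case l (%y. PushW r (ccode y)) else PushW r (ccode None)))"

text \<open>The left stack lists all \<open>p\<close> cells before the head, nearest first, so it is
  empty exactly at position 0, where a move to the left stays put. The right stack may omit trailing
  blanks.\<close>

definition tape :: "word => word => (nat => cell) => nat => bool" where
 "tape x y t p \<longleftrightarrow> (\<exists>R. x = concat (map ccode (rev (map t [0..<p]))) \<and> y = concat (map ccode R) \<and>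
   (\<forall>i. t (p + i) = (if i < length R then R ! i else None)))"

lemma sem_Rd:
 "ss r = concat (map ccode R) ==> sem f (Rd r F) (ss, q) =
   sem f (F (case R of [] => None | x # _ => x)) (ss(r := concat (map ccode (tl R))), q)"
 by (cases R) (auto simp: Rd_def ccode_def fun_upd_idem split: option.split)

lemma tape_read:
 assumes "tape (ss l) (ss r) t p"
 shows "\<exists>y. sem f (Rd r F) (ss, q) = sem f (F (t p)) (ss(r := y), q) \<and> (\<forall>c. tape (ss l) (ccode c @ y) (t(p := c)) p)"
proof -
 obtain R where R: "ss l = concat (map ccode (rev (map t [0..<p])))" "ss r = concat (map ccode R)"
  "\<And>i. t (p + i) = (if i < length R then R ! i else None)" using assms unfolding tape_def by blast
 have h: "(case R of [] => None | x # _ => x) = t p" using R(3)[of 0] by (cases R) auto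
 have "tape (ss l) (ccode c @ concat (map ccode (tl R))) (t(p := c)) p" for c
  unfolding tape_def
 proof (intro exI[of _ "c # tl R"] conjI allI)
  show "ss l = concat (map ccode (rev (map (t(p := c)) [0..<p])))" using R(1) by simp
  show "ccode c @ concat (map ccode (tl R)) = concat (map ccode (c # tl R))" by simp
  show "(t(p := c)) (p + i) = (if i < length (c # tl R) then (c # tl R) ! i else None)" for i
   using R(3)[of i] by (cases i; cases R) auto
 qed
 then show ?thesis using sem_Rd[where ss = ss, OF R(2), of f F q] unfolding h by blast
qed

lemma tape_go:
 assumes "tape (ss l) (ss r) t p" "l ~= r"
 shows "\<exists>x y. sem f (Go d l r) (ss, q) = (ss(l := x, r := y), q) \<and> tape x y t (move d p)"
proof (cases d)
 case Stay
 show ?thesis by (rule exI[of _ "ss l"], rule exI[of _ "ss r"]) (use Stay assms in \<open>simp add: Go_def\<close>)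
next
 case Rgt
 obtain R where R: "ss l = concat (map ccode (rev (map t [0..<p])))" "ss r = concat (map ccode R)"
  "\<And>i. t (p + i) = (if i < length R then R ! i else None)" using assms unfolding tape_def by blast
 have h: "(case R of [] => None | x # _ => x) = t p" using R(3)[of 0] by (cases R) auto
 have "tape (ccode (t p) @ ss l) (concat (map ccode (tl R))) t (Suc p)"
  unfolding tape_def
 proof (intro exI[of _ "tl R"] conjI allI)
  show "t (Suc p + i) = (if i < length (tl R) then tl R ! i else None)" for i
   using R(3)[of "Suc i"] by (cases R) auto
 qed (simp_all add: R(1))
 then show ?thesis
  by (intro exI[of _ "ccode (t p) @ ss l"] exI[of _ "concat (map ccode (tl R))"] conjI)
   (use Rgt assms(2) sem_Rd[where ss = ss, OF R(2), of f "%x. PushW l (ccode x)" q] in \<open>simp_all add: Go_def fun_upd_twist h\<close>)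
next
 case Lft
 obtain R where R: "ss l = concat (map ccode (rev (map t [0..<p])))" "ss r = concat (map ccode R)"
  "\<And>i. t (p + i) = (if i < length R then R ! i else None)" using assms unfolding tape_def by blast
 show ?thesis
 proof (cases p)
  case 0
  show ?thesis by (rule exI[of _ "ss l"], rule exI[of _ "ss r"]) (use 0 Lft assms R(1) in \<open>simp add: Go_def fun_upd_idem\<close>)
 next
  case (Suc p')
  let ?x = "concat (map ccode (rev (map t [0..<p'])))" let ?y = "ccode (t p') @ ss r"
  have l: "ss l = ccode (t p') @ ?x" using R(1) Suc by simp
  have "sem f (Go d l r) (ss, q) = (ss(l := ?x, r := ?y), q)"
   unfolding Go_def using Lft l assms(2) by (cases "t p'") (auto simp: ccode_def fun_eq_iff)
  moreover have "tape ?x ?y t p'"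
   unfolding tape_def
  proof (intro exI[of _ "t p' # R"] conjI allI)
   show "t (p' + i) = (if i < length (t p' # R) then (t p' # R) ! i else None)" for i
    using R(3)[of "i - 1"] Suc by (cases i) auto
  qed (simp_all add: R(2))
  ultimately show ?thesis using Lft Suc by auto
 qed
qed

lemma ok_Rd: "r \<in> A ==> (\<And>x. ok A (F x)) ==> ok A (Rd r F)" by (simp add: Rd_def)
lemma gr_Rd: "r < K ==> (\<And>x. gr K k (F x)) ==> gr K k (Rd r F)"
 unfolding Rd_def by (intro gr_Case) (auto intro!: gr_Case intro: gr_mono[of K k])
lemma pb_Rd: "r < K ==> (\<And>x. pb K (F x)) ==> pb K (Rd r F)"
 unfolding Rd_def by (intro pb_Case) (auto intro!: pb_Case)

lemma length_ccode: "length (ccode x) <= 2" by (simp add: ccode_def split: option.split)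

lemma ok_Go: "l \<in> A ==> r \<in> A ==> ok A (Go d l r)"
 by (cases d) (auto simp: Go_def intro!: ok_Rd)
lemma gr_Go: "l < K ==> r < K ==> gr K 2 (Go d l r)"
 by (cases d) (auto simp: Go_def intro!: gr_Rd gr_Case gr_Skip gr_PushW order_trans[OF length_ccode])
lemma pb_Go: "l < K ==> r < K ==> pb K (Go d l r)"
 by (cases d) (auto simp: Go_def intro!: pb_Rd pb_Case pb_basic pb_PushW)

abbreviation cnt :: "word => nat" where "cnt w \<equiv> length (filter (%a. a = S1) w)"

text \<open>A choice is the number of \<open>S1\<close> among the next \<open>n\<close> bits: every
  number up to \<open>n\<close> occurs and no bit pattern is malformed.\<close>

primrec Pick :: "nat => (nat => com) => nat => com" where
 "Pick 0 F k = F k"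
| "Pick (Suc n) F k = Case 38 (%x. Pick n F (if x = Some S1 then Suc k else k))"

lemma sem_Pick: "sem f (Pick n F k) (ss, q) = sem f (F (k + cnt (take n (ss 38)))) (ss(38 := drop n (ss 38)), q)"
proof (induction n arbitrary: k ss)
 case (Suc n)
 show ?case by (cases "ss 38") (simp_all add: Suc fun_upd_idem cong: if_cong)
qed (simp add: fun_upd_idem)

lemma ok_Pick: "38 \<in> A ==> (\<And>i. ok A (F i)) ==> ok A (Pick n F k)" by (induction n arbitrary: k) auto
lemma gr_Pick: "38 < K ==> (\<And>i. gr K g (F i)) ==> gr K g (Pick n F k)"
 by (induction n arbitrary: k) (auto intro!: gr_Case intro: gr_mono[of K g])
lemma pb_Pick: "38 < K ==> (\<And>i. pb K (F i)) ==> pb K (Pick n F k)"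
 by (induction n arbitrary: k) (auto intro!: pb_Case)

lemma finite_trans: "finite {t :: trans. fst t < n}"
proof -
 have s: "finite (UNIV :: sym set)" by (rule finite_subset[of _ "{S0, S1, SPlus, SMinus, SSlash}"]) (auto intro: sym.exhaust)
 have d: "finite (UNIV :: dir set)" by (rule finite_subset[of _ "{Lft, Rgt, Stay}"]) (auto intro: dir.exhaust)
 have "{t :: trans. fst t < n} \<subseteq> {..<n} \<times> UNIV" by auto
 moreover have "finite ({..<n} \<times> (UNIV :: (cell \<times> dir \<times> cell \<times> dir \<times> dir \<times> cell) set))"
  by (intro finite_SigmaI finite_lessThan finite_Prod_UNIV d) (simp_all add: finite_option_UNIV s)
 ultimately show ?thesis by (rule finite_subset)
qed

section \<open>Deterministic replay of a machine along given choices\<close>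

locale simulation =
 fixes M :: otm and zs :: "trans list"
 assumes wf: "wf_otm M" and zs: "delta M q a b c \<subseteq> set zs" and zs_ne: "zs ~= []"
begin

definition opts :: "nat => cell => cell => cell => trans list" where
 "opts q a b c = filter (%t. t \<in> delta M q a b c) zs"

text \<open>Too large an index falls back to the first option, so any choices describe a legal run
  and a winning word always proves acceptance.\<close>

definition pick :: "nat => trans list => trans" where
 "pick k xs = (if k < length xs then xs ! k else hd xs)"

text \<open>Final configurations repeat themselves, so a run may be continued beyond halting and the
  time bound may be generous.\<close>

definition nxt :: "fn => word => nat => config => config" where
 "nxt f u k c = (if st c \<in> final M then c
   else if st c = qry M then c\<lparr>st := ans M, qtape := word_tape (f (query_word (qtape c))), qpos := 0\<rparr>
   else (case pick k (opts (st c) (input_cell u (ipos c)) (wtape c (wpos c)) (qtape c (qpos c))) of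
    (q', w, wm, qw, qm, im, ob) => \<lparr>st = q', ipos = move im (ipos c),
         wtape = (wtape c)(wpos c := w), wpos = move wm (wpos c),
         qtape = (qtape c)(qpos c := qw), qpos = move qm (qpos c),
         outp = outp c @ (case ob of None => [] | Some a => [a])\<rparr>))"

definition Act :: "trans => cell => com" where
 "Act t a = (case t of (q', w, wm, qw, qm, im, ob) =>
   PushW 40 (replicate q' S1) ;; PushW 42 (ccode a) ;; Go im 41 42 ;; PushW 44 (ccode w) ;; Go wm 43 44 ;; QWr qw qm)"

definition SimStep :: com where
 "SimStep = Pick (length zs) (%k. CaseN 40 (nstates M) (%q.
   if q \<in> final M then PushW 40 (replicate q S1)
   else if q = qry M then QAsk ;; PushW 40 (replicate (ans M) S1)
   else Rd 42 (%a. Rd 44 (%b. QCase (%c. Act (pick k (opts q a b c)) a))))) 0"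

definition rep :: "word => config => store => bool" where
 "rep u c s \<longleftrightarrow> fst s 40 = replicate (st c) S1 \<and> st c < nstates M \<and> tape (fst s 41) (fst s 42) (input_cell u) (ipos c) \<and>
   tape (fst s 43) (fst s 44) (wtape c) (wpos c) \<and> snd s = (qtape c, qpos c)"

lemma opts_ne: "q < nstates M ==> q \<notin> final M ==> q ~= qry M ==> opts q a b c ~= []"
proof -
 assume q: "q < nstates M" "q \<notin> final M" "q ~= qry M"
 have "\<forall>q a b c. q < nstates M \<and> q \<notin> final M \<and> q ~= qry M \<longrightarrow> delta M q a b c ~= {}" using wf unfolding wf_otm_def by (elim conjE)
 then have "delta M q a b c ~= {}" using q by blast
 then obtain t where t: "t \<in> delta M q a b c" by blast
 have "t \<in> set (opts q a b c)" using t subsetD[OF zs t] by (simp add: opts_def)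
 then show ?thesis by auto
qed

lemma pick_in: "xs ~= [] ==> pick k xs \<in> set xs" by (auto simp: pick_def)

lemma pick_delta: "q < nstates M ==> q \<notin> final M ==> q ~= qry M ==> pick k (opts q a b c) \<in> delta M q a b c"
 using pick_in[OF opts_ne[of q a b c], of k] by (simp add: opts_def)

lemma sem_Act:
 assumes x: "tape (ss 41) (ccode a @ ss 42) ti pz" and y: "\<And>c. tape (ss 43) (ccode c @ ss 44) (tw(pw := c)) pw"
  and e: "ss 40 = []" and t: "t = (q', w, wm, qw, qm, im, ob)"
 shows "\<exists>ss'. sem f (Act t a) (ss, qt, qp) = (ss', qt(qp := qw), move qm qp) \<and> ss' 40 = replicate q' S1 \<and>
   tape (ss' 41) (ss' 42) ti (move im pz) \<and> tape (ss' 43) (ss' 44) (tw(pw := w)) (move wm pw) \<and> ss' 38 = ss 38"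
proof -
 let ?ss1 = "ss(40 := replicate q' S1, 42 := ccode a @ ss 42)"
 have "tape (?ss1 41) (?ss1 42) ti pz" using x by simp
 from tape_go[where ss = ?ss1 and f = f and d = im and q = "(qt, qp)", OF this] obtain x1 x2 where
  g1: "sem f (Go im 41 42) (?ss1, qt, qp) = (?ss1(41 := x1, 42 := x2), qt, qp)" "tape x1 x2 ti (move im pz)" by auto
 let ?ss2 = "(?ss1(41 := x1, 42 := x2))(44 := ccode w @ ss 44)"
 have "tape (?ss2 43) (?ss2 44) (tw(pw := w)) pw" using y by simp
 from tape_go[where ss = ?ss2 and f = f and d = wm and q = "(qt, qp)", OF this] obtain y1 y2 where
  g2: "sem f (Go wm 43 44) (?ss2, qt, qp) = (?ss2(43 := y1, 44 := y2), qt, qp)" "tape y1 y2 (tw(pw := w)) (move wm pw)" by auto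
 have "sem f (Act t a) (ss, qt, qp) = (?ss2(43 := y1, 44 := y2), qt(qp := qw), move qm qp)"
 proof -
  have p: "sem f (PushW 40 (replicate q' S1) ;; PushW 42 (ccode a)) (ss, qt, qp) = (?ss1, qt, qp)" using e by simp
  have p2: "sem f (PushW 44 (ccode w)) (?ss1(41 := x1, 42 := x2), qt, qp) = (?ss2, qt, qp)" by simp
  show ?thesis unfolding Act_def t prod.case sem.simps(3) using p unfolding sem.simps(3)
   by (simp only: g1(1) p2 g2(1)) (simp only: sem.simps(6) fst_conv snd_conv)
 qed
 then show ?thesis using g1(2) g2(2) by (intro exI[of _ "?ss2(43 := y1, 44 := y2)"]) simp
qed

lemma sem_SimStep:
 assumes "rep u c s"
 shows "rep u (nxt f u (cnt (take (length zs) (fst s 38))) c) (sem f SimStep s) \<and>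
  fst (sem f SimStep s) 38 = drop (length zs) (fst s 38)"
proof -
 obtain ss where s: "s = (ss, qtape c, qpos c)" using assms by (cases s) (auto simp: rep_def)
 have r: "ss 40 = replicate (st c) S1" "st c < nstates M" "tape (ss 41) (ss 42) (input_cell u) (ipos c)"
  "tape (ss 43) (ss 44) (wtape c) (wpos c)" using assms unfolding rep_def s by auto
 define k where "k = cnt (take (length zs) (ss 38))"
 define \<tau> where "\<tau> = ss(38 := drop (length zs) (ss 38), 40 := [])"
 have t: "\<tau> 40 = []" "\<tau> 38 = drop (length zs) (ss 38)" "\<tau> 41 = ss 41" "\<tau> 42 = ss 42" "\<tau> 43 = ss 43" "\<tau> 44 = ss 44" by (simp_all add: \<tau>_def)
 let ?F = "%q. if q \<in> final M then PushW 40 (replicate q S1)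
   else if q = qry M then QAsk ;; PushW 40 (replicate (ans M) S1)
   else Rd 42 (%a. Rd 44 (%b. QCase (%c. Act (pick k (opts q a b c)) a)))"
 have l: "length ((ss(38 := drop (length zs) (ss 38))) 40) <= nstates M" using r by simp
 have S: "sem f SimStep s = sem f (?F (st c)) (\<tau>, qtape c, qpos c)"
  unfolding SimStep_def s sem_Pick add_0 k_def[symmetric] using sem_CaseN[where ss = "ss(38 := drop (length zs) (ss 38))", OF l, of f ?F] r(1)
  by (simp add: \<tau>_def)
 have a: "ans M < nstates M" using wf by (simp add: wf_otm_def)
 show ?thesis
 proof (cases "st c \<in> final M")
  case True
  then have "sem f SimStep s = (\<tau>(40 := replicate (st c) S1), qtape c, qpos c)" unfolding S using t by simp
  then show ?thesis using True r t unfolding nxt_def rep_def s by simp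
 next
  case nf: False
  show ?thesis
  proof (cases "st c = qry M")
   case True
   then have "sem f SimStep s = (\<tau>(40 := replicate (ans M) S1), word_tape (f (query_word (qtape c))), 0)" unfolding S using t nf by simp
   then show ?thesis using True nf r t a unfolding nxt_def rep_def s by simp
  next
   case False
   let ?G = "%c' a. Rd 44 (%b. QCase (%c. Act (pick k (opts (st c') a b c)) a))"
   have "tape (\<tau> 41) (\<tau> 42) (input_cell u) (ipos c)" using r t by simp
   from tape_read[where ss = \<tau>, OF this] obtain x where
    x: "sem f (Rd 42 (?G c)) (\<tau>, qtape c, qpos c) = sem f (?G c (input_cell u (ipos c))) (\<tau>(42 := x), qtape c, qpos c)"
     "tape (\<tau> 41) (ccode (input_cell u (ipos c)) @ x) ((input_cell u)(ipos c := input_cell u (ipos c))) (ipos c)" by blast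
   have "tape ((\<tau>(42 := x)) 43) ((\<tau>(42 := x)) 44) (wtape c) (wpos c)" using r t by simp
   from tape_read[where ss = "\<tau>(42 := x)", OF this] obtain y where
    y: "sem f (?G c (input_cell u (ipos c))) (\<tau>(42 := x), qtape c, qpos c) =
     sem f (QCase (%d. Act (pick k (opts (st c) (input_cell u (ipos c)) (wtape c (wpos c)) d)) (input_cell u (ipos c)))) (\<tau>(42 := x, 44 := y), qtape c, qpos c)"
     "\<And>d. tape ((\<tau>(42 := x)) 43) (ccode d @ y) ((wtape c)(wpos c := d)) (wpos c)" by blast
   let ?t = "pick k (opts (st c) (input_cell u (ipos c)) (wtape c (wpos c)) (qtape c (qpos c)))"
   obtain q' w wm qw qm im ob where tr: "?t = (q', w, wm, qw, qm, im, ob)" by (cases ?t)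
   have "?t \<in> delta M (st c) (input_cell u (ipos c)) (wtape c (wpos c)) (qtape c (qpos c))" by (rule pick_delta[OF r(2) nf False])
   then have q': "q' < nstates M" using wf[unfolded wf_otm_def] unfolding tr by (metis fst_conv)
   let ?\<tau> = "\<tau>(42 := x, 44 := y)"
   have A: "tape (?\<tau> 41) (ccode (input_cell u (ipos c)) @ ?\<tau> 42) (input_cell u) (ipos c)" "\<And>d. tape (?\<tau> 43) (ccode d @ ?\<tau> 44) ((wtape c)(wpos c := d)) (wpos c)" "?\<tau> 40 = []"
    using x(2) y(2) t by simp_all
   obtain ss' where s': "sem f (Act ?t (input_cell u (ipos c))) (?\<tau>, qtape c, qpos c) = (ss', (qtape c)(qpos c := qw), move qm (qpos c))"
    "ss' 40 = replicate q' S1" "tape (ss' 41) (ss' 42) (input_cell u) (move im (ipos c))"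
    "tape (ss' 43) (ss' 44) ((wtape c)(wpos c := w)) (move wm (wpos c))" "ss' 38 = ?\<tau> 38"
    using sem_Act[where ss = ?\<tau> and f = f and qt = "qtape c" and qp = "qpos c", OF A tr] by blast
   have F: "?F (st c) = Rd 42 (?G c)" using nf False by simp
   have "sem f SimStep s = (ss', (qtape c)(qpos c := qw), move qm (qpos c))"
    unfolding S F x(1) y(1) sem.simps(7) fst_conv snd_conv using s'(1) by simp
   then show ?thesis using nf False q' s' t unfolding nxt_def rep_def s fst_conv k_def[symmetric] tr by simp
  qed
 qed
qed

primrec run :: "fn => word => nat => word => config => config" where
 "run f u 0 w c = c"
| "run f u (Suc n) w c = run f u n (drop (length zs) w) (nxt f u (cnt (take (length zs) w)) c)"

lemma fold_SimStep: "rep u c s ==> rep u (run f u (length v) (fst s 38) c) (fold (%_. sem f SimStep) v s)"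
proof (induction v arbitrary: c s)
 case (Cons a v)
 note h = sem_SimStep[OF Cons.prems, of f]
 show ?case using Cons.IH[OF conjunct1[OF h]] conjunct2[OF h] by simp
qed simp

lemma nxt_step: "st c < nstates M ==> (st c \<in> final M \<and> nxt f u k c = c) \<or> step M f u c (nxt f u k c)"
proof -
 assume c: "st c < nstates M"
 let ?t = "pick k (opts (st c) (input_cell u (ipos c)) (wtape c (wpos c)) (qtape c (qpos c)))"
 obtain q' w wm qw qm im ob where tr: "?t = (q', w, wm, qw, qm, im, ob)" by (cases ?t)
 show ?thesis
 proof (cases "st c \<in> final M \<or> st c = qry M")
  case False
  then have "?t \<in> delta M (st c) (input_cell u (ipos c)) (wtape c (wpos c)) (qtape c (qpos c))" using pick_delta[OF c] by blast
  then have "step M f u c (nxt f u k c)"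
  proof -
   assume "?t \<in> delta M (st c) (input_cell u (ipos c)) (wtape c (wpos c)) (qtape c (qpos c))"
   moreover have "st c ~= qry M" "st c \<notin> final M" using False by auto
   ultimately show ?thesis unfolding step_def nxt_def tr prod.case
    by (simp only: if_False simp_thms) (rule exI[of _ q'], rule exI[of _ w], rule exI[of _ wm], rule exI[of _ qw], rule exI[of _ qm], rule exI[of _ im], rule exI[of _ ob], simp only: simp_thms)
  qed
  then show ?thesis ..
 qed (auto simp: nxt_def step_def)
qed

lemma step_states: "step M f u c d ==> st d < nstates M"
proof (cases "st c = qry M")
 case True
 assume "step M f u c d"
 then have "st d = ans M" using True by (simp add: step_def)
 then show ?thesis using wf by (simp add: wf_otm_def)
next
 case False
 assume "step M f u c d"
 then obtain q' w wm qw qm im ob where "(q', w, wm, qw, qm, im, ob) \<in> delta M (st c) (input_cell u (ipos c)) (wtape c (wpos c)) (qtape c (qpos c))" "st d = q'"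
  using False unfolding step_def by auto
 moreover have "\<forall>q a b c t. t \<in> delta M q a b c \<longrightarrow> fst t < nstates M" using wf unfolding wf_otm_def by (elim conjE)
 ultimately show ?thesis by (metis fst_conv)
qed

lemma reach_states: "reach M f u k c ==> st c < nstates M"
proof (cases k)
 case 0
 assume "reach M f u k c"
 then have "c = init_config M" using 0 by (simp add: reach_def)
 then show ?thesis using wf by (simp add: init_config_def wf_otm_def)
next
 case (Suc j)
 assume "reach M f u k c"
 then obtain d where "step M f u d c" unfolding reach_def Suc by (meson relpowp_Suc_E)
 then show ?thesis by (rule step_states)
qed

lemma run_reach: "reach M f u k c ==> \<exists>j. reach M f u j (run f u n w c)"
proof (induction n arbitrary: w c k)
 case (Suc n)
 let ?c = "nxt f u (cnt (take (length zs) w)) c"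
 have "\<exists>j. reach M f u j ?c"
 proof (cases "st c \<in> final M \<and> ?c = c")
  case True
  then show ?thesis using Suc.prems by auto
 next
  case False
  then have "step M f u c ?c" using nxt_step[OF reach_states[OF Suc.prems]] by blast
  then have "reach M f u (Suc k) ?c" using Suc.prems unfolding reach_def by auto
  then show ?thesis ..
 qed
 then show ?case using Suc.IH by auto
qed auto

text \<open>The options form a sublist of \<open>zs\<close>, so the index of any of them can be
  written as a number of \<open>S1\<close> among \<open>length zs\<close> bits.\<close>

lemma nxt_surj:
 assumes "step M f u c d"
 shows "\<exists>w. bits w \<and> length w = length zs \<and> nxt f u (cnt w) c = d"
proof -
 have nf: "st c \<notin> final M" using wf assms unfolding wf_otm_def step_def by (auto split: if_splits)
 show ?thesis
 proof (cases "st c = qry M")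
  case True
  then show ?thesis using assms nf unfolding step_def nxt_def
   by (intro exI[of _ "replicate (length zs) S0"]) (auto simp: bits_def)
 next
  case False
  let ?o = "opts (st c) (input_cell u (ipos c)) (wtape c (wpos c)) (qtape c (qpos c))"
  obtain q' w wm qw qm im ob where t: "(q', w, wm, qw, qm, im, ob) \<in> delta M (st c) (input_cell u (ipos c)) (wtape c (wpos c)) (qtape c (qpos c))"
   and d: "d = \<lparr>st = q', ipos = move im (ipos c), wtape = (wtape c)(wpos c := w), wpos = move wm (wpos c),
         qtape = (qtape c)(qpos c := qw), qpos = move qm (qpos c),
         outp = outp c @ (case ob of None => [] | Some a => [a])\<rparr>"
   using assms False unfolding step_def by auto
  have "(q', w, wm, qw, qm, im, ob) \<in> set ?o" using t subsetD[OF zs t] unfolding opts_def by simp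
  then obtain k where k: "k < length ?o" "?o ! k = (q', w, wm, qw, qm, im, ob)" by (auto simp: in_set_conv_nth)
  have "k <= length zs" using k(1) unfolding opts_def by (meson length_filter_le less_imp_le order_trans)
  moreover have "nxt f u k c = d" unfolding nxt_def d pick_def using nf False k by simp
  ultimately show ?thesis by (intro exI[of _ "replicate k S1 @ replicate (length zs - k) S0"]) (auto simp: bits_def)
 qed
qed

lemma run_final: "st c \<in> final M ==> run f u n w c = c"
 by (induction n arbitrary: w) (simp_all add: nxt_def)

lemma run_surj: "(step M f u ^^ k) c d ==> st d \<in> final M ==>
  \<exists>w. bits w \<and> length w = length zs * k \<and> (\<forall>n\<ge>k. \<forall>w'. run f u n (w @ w') c = d)"
proof (induction k arbitrary: c)
 case 0
 then show ?case by (intro exI[of _ "[]"]) (auto simp: bits_def run_final)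
next
 case (Suc k)
 obtain c1 where c1: "step M f u c c1" "(step M f u ^^ k) c1 d" using Suc.prems(1) by (meson relpowp_Suc_D2)
 obtain w where w: "bits w" "length w = length zs * k" "\<And>n w'. n \<ge> k ==> run f u n (w @ w') c1 = d" using Suc.IH[OF c1(2) Suc.prems(2)] by blast
 obtain v where v: "bits v" "length v = length zs" "nxt f u (cnt v) c = c1" using nxt_surj[OF c1(1)] by blast
 have "run f u n ((v @ w) @ w') c = d" if "n \<ge> Suc k" for n w'
 proof -
  obtain n' where "n = Suc n'" "n' \<ge> k" using \<open>n \<ge> Suc k\<close> by (cases n) auto
  then show ?thesis using w(3) v by simp
 qed
 then show ?case using w v by (intro exI[of _ "v @ w"]) (auto simp: bits_def)
qed

definition wins :: "fn => word => nat => word => bool" where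
 "wins f u m w \<longleftrightarrow> st (run f u m w (init_config M)) \<in> acc M"

lemma wins_accepts: "wins f u m w ==> accepts M f u"
 unfolding wins_def accepts_def using run_reach[of f u 0 "init_config M" m w] by (auto simp: reach_def)

text \<open>The number \<open>m\<close> serves two ends: it is at least \<open>T\<close>, so enough
  rounds are replayed, and it counts the bits that \<open>T\<close> choices consume. The factor 3 is
  due to decoding digits in blocks of three; the surplus is padding.\<close>

lemma accepts_wins:
 assumes "accepts M f u" "time_bounded M f u T" "m = length zs * T"
 shows "\<exists>w. bits w \<and> length w = 3 * m \<and> wins f u m w"
proof -
 obtain k c where c: "reach M f u k c" "st c \<in> acc M" using assms(1) unfolding accepts_def by blast
 have k: "k <= T" using c(1) assms(2) unfolding time_bounded_def by blast
 have "st c \<in> final M" using c(2) wf unfolding wf_otm_def by blast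
 from run_surj[OF c(1)[unfolded reach_def] this] obtain w where
  w: "bits w" "length w = length zs * k" "\<And>n w'. n \<ge> k ==> run f u n (w @ w') (init_config M) = c" by blast
 have l: "length w <= 3 * m" unfolding w(2) assms(3) using k by (simp add: le_trans[OF mult_le_mono2])
 have "1 * T <= length zs * T" using zs_ne by (intro mult_le_mono1) (cases zs; simp)
 then have "k <= m" using k assms(3) by linarith
 then have "wins f u m (w @ replicate (3 * m - length w) S0)" using w(3) c(2) unfolding wins_def by simp
 then show ?thesis using w(1) l by (intro exI[of _ "w @ replicate (3 * m - length w) S0"]) (auto simp: bits_def)
qed

lemma ok_Act: "{40, 41, 42, 43, 44} \<subseteq> A ==> ok A (Act t a)"
 by (cases t) (auto simp: Act_def intro!: ok_Go)

lemma ok_SimStep: "{38, 40, 41, 42, 43, 44} \<subseteq> A ==> ok A SimStep"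
 unfolding SimStep_def by (intro ok_Pick ok_CaseN) (auto intro!: ok_Rd ok_Act)

lemma gr_Act: "gr 50 (fst t + 8) (Act t a)"
proof -
 obtain q' w wm qw qm im ob where t: "t = (q', w, wm, qw, qm, im, ob)" by (cases t)
 have c: "gr 50 2 (PushW j (ccode x))" for j x by (intro gr_PushW length_ccode)
 have "gr 50 q' (PushW 40 (replicate q' S1))" by (intro gr_PushW) simp
 then show ?thesis unfolding Act_def t prod.case
  by (rule gr_Seq[OF _ gr_Seq[OF c gr_Seq[OF gr_Go gr_Seq[OF c gr_Seq[OF gr_Go gr_QWr[where k = 0]]]]]]) auto
qed

lemma pb_Act: "pb 50 (Act t a)"
 by (cases t) (auto simp: Act_def ok_Go intro!: pb_Seq pb_PushW pb_Go pb_basic)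

lemma gr_SimStep: "\<exists>k. gr 50 k SimStep"
proof
 \<comment> \<open>On an empty option list \<open>pick\<close> returns \<open>hd []\<close>, whose
   state is unspecified but fixed, hence admissible in a constant bound.\<close>
 let ?k = "nstates M + fst (hd [] :: trans) + 8"
 have d: "fst (pick k (opts q a b c)) <= nstates M + fst (hd [] :: trans)" for k q a b c
 proof (cases "opts q a b c = []")
  case False
  then have "pick k (opts q a b c) \<in> delta M q a b c" using pick_in[OF False, of k] by (auto simp: opts_def)
  then show ?thesis using wf unfolding wf_otm_def by (meson less_imp_le trans_le_add1)
 qed (simp add: pick_def)
 have A: "gr 50 ?k (Act (pick k (opts q a b c)) x)" for k q a b c x
  by (rule gr_mono[OF gr_Act]) (use d[of k q a b c] in simp)
 have "ans M < nstates M" using wf by (simp add: wf_otm_def)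
 then have Q: "gr 50 ?k (QAsk ;; PushW 40 (replicate (ans M) S1))"
  by (intro gr_Seq[OF gr_QAsk[where k = 0] gr_PushW[where k = ?k]]) auto
 show "gr 50 ?k SimStep" unfolding SimStep_def
 proof (intro gr_Pick gr_CaseN)
  fix k i assume i: "i <= nstates M"
  have "gr 50 ?k (if i \<in> final M then PushW 40 (replicate i S1) else if i = qry M then QAsk ;; PushW 40 (replicate (ans M) S1)
   else Rd 42 (%a. Rd 44 (%b. QCase (%c. Act (pick k (opts i a b c)) a))))"
   using i Q by (auto intro!: gr_PushW gr_Rd gr_QCase A)
  then show "gr 50 (?k + i) (if i \<in> final M then PushW 40 (replicate i S1) else if i = qry M then QAsk ;; PushW 40 (replicate (ans M) S1)
   else Rd 42 (%a. Rd 44 (%b. QCase (%c. Act (pick k (opts i a b c)) a))))" by (rule gr_mono) simp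
 qed auto
qed

lemma pb_SimStep: "pb 50 SimStep"
 unfolding SimStep_def
 by (intro pb_Pick pb_CaseN) (auto intro!: pb_Rd pb_QCase pb_Act pb_Seq pb_basic pb_PushW)

end

lemma simulation_exists: "wf_otm M ==> \<exists>zs. simulation M zs"
proof -
 assume wf: "wf_otm M"
 obtain zs where zs: "set zs = {t :: trans. fst t < nstates M}" using finite_list[OF finite_trans] by blast
 have "(0, None, Stay, None, Stay, Stay, None) \<in> set zs" using wf unfolding zs wf_otm_def by auto
 then have "zs ~= []" by auto
 moreover have "delta M q a b c \<subseteq> set zs" for q a b c using wf unfolding zs wf_otm_def by blast
 ultimately show ?thesis using wf by (intro exI[of _ zs]) (simp add: simulation_def)
qed

subsection \<open>The parabola with spikes\<close>

definition fr :: "word => real" where "fr d = real (bin_val d) / 2 ^ length d"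

text \<open>\<open>Some a\<close> stands for an input symbol and \<open>None\<close> for one unit of
  the time bound. The block 110 is not the code of a letter and ends a code word.\<close>

primrec lcode :: "cell => word" where
 "lcode None = [S1, S0, S1]"
| "lcode (Some a) = (case a of S0 => [S0, S0, S0] | S1 => [S0, S0, S1] | SPlus => [S0, S1, S0] | SMinus => [S0, S1, S1] | SSlash => [S1, S0, S0])"

definition cwd :: "cell list => word" where "cwd ls = concat (map lcode ls) @ [S1, S1, S0]"

definition spike_x :: "word => word => real" where "spike_x e w = fr (e @ [S1, S0, S0, S0, S0, S0] @ w)"
definition spike_h :: "word => real" where "spike_h e = (1/2) ^ (2 * length e + 10)"
definition mid_x :: "word => real" where "mid_x e = fr (e @ [S1])"

definition arc :: "(real \<times> real) set" where "arc = {(x, x\<^sup>2 / 64) | x. 0 <= x \<and> x <= 1}"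
definition spike :: "word \<times> word => (real \<times> real) set" where
 "spike = (%(e, w). {(spike_x e w, y) | y. \<bar>y - (spike_x e w)\<^sup>2 / 64\<bar> <= spike_h e})"
definition shape :: "(word \<times> word) set => (real \<times> real) set" where "shape T = arc \<union> (\<Union>t\<in>T. spike t)"

text \<open>The bound on \<open>w\<close> leaves finitely many spikes for each length of
  \<open>e\<close>, and it makes every position a dyadic number with at most
  \<open>2 * length e + 3\<close> digits.\<close>

definition good :: "(word \<times> word) set => bool" where
 "good T \<longleftrightarrow> (\<forall>(e, w)\<in>T. (\<exists>ls. e = cwd ls) \<and> bits w \<and> length w + 3 <= length e)"

lemma goodD: "good T ==> (e, w) \<in> T ==> (\<exists>ls. e = cwd ls) \<and> bits w \<and> length w + 3 <= length e"
 unfolding good_def by blast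

lemma length_lcode [simp]: "length (lcode x) = 3" by (cases x) (auto split: sym.splits)
lemma bits_lcode: "bits (lcode x)" by (cases x) (auto simp: bits_def split: sym.splits)
lemma length_cwd [simp]: "length (cwd ls) = 3 * length ls + 3" by (induction ls) (auto simp: cwd_def)
lemma bits_cwd: "bits (cwd ls)"
 by (induction ls) (use bits_lcode in \<open>auto simp: cwd_def bits_def\<close>)

lemma lcode_inj: "lcode x = lcode y ==> x = y"
 by (cases x; cases y) (auto split: sym.splits)
lemma lcode_end: "lcode x ~= [S1, S1, S0]" by (cases x) (auto split: sym.splits)

lemma cwd_prefix: "cwd ls @ x = cwd ls' @ y ==> ls = ls'"
proof (induction ls arbitrary: ls')
 case Nil
 then show ?case
 proof (cases ls')
  case (Cons b ks)
  then have "[S1, S1, S0] @ x = lcode b @ (cwd ks @ y)" using Nil by (simp add: cwd_def)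
  then have "[S1, S1, S0] = lcode b" using append_eq_append_conv[of "[S1, S1, S0]" "lcode b" x "cwd ks @ y"] by simp
  then show ?thesis using lcode_end[of b] by simp
 qed simp
next
 case (Cons a ls)
 show ?case
 proof (cases ls')
  case Nil
  then have "lcode a @ (cwd ls @ x) = [S1, S1, S0] @ y" using Cons by (simp add: cwd_def)
  then have "lcode a = [S1, S1, S0]" using append_eq_append_conv[of "lcode a" "[S1, S1, S0]" "cwd ls @ x" y] by simp
  then show ?thesis using lcode_end[of a] by simp
 next
  case (Cons b ks)
  then have "lcode a @ (cwd ls @ x) = lcode b @ (cwd ks @ y)" using Cons.prems by (simp add: cwd_def)
  then have "lcode a = lcode b" "cwd ls @ x = cwd ks @ y" using append_eq_append_conv[of "lcode a" "lcode b" "cwd ls @ x" "cwd ks @ y"] by simp_all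
  then show ?thesis using lcode_inj Cons.IH Cons by blast
 qed
qed

lemma fr_append: "fr (a @ b) = fr a + fr b / 2 ^ length a"
proof -
 have "bin_val (a @ b) = bin_val a * 2 ^ length b + bin_val b"
  by (simp add: bin_val_val val_append)
 then show ?thesis unfolding fr_def by (simp add: power_add add_divide_distrib)
qed

lemma fr_bounds: "0 <= fr b" "fr b + 1 / 2 ^ length b <= 1"
proof -
 have "bin_val b < 2 ^ length b" using val_lt[of "rev b"] by (simp add: bin_val_val)
 then have "real (bin_val b + 1) <= real (2 ^ length b)" by (simp only: of_nat_le_iff)
 then have "(real (bin_val b) + 1) / 2 ^ length b <= 1" by simp
 then show "fr b + 1 / 2 ^ length b <= 1" unfolding fr_def by (simp add: add_divide_distrib)
qed (simp add: fr_def)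

lemma fr_nil [simp]: "fr [] = 0" by (simp add: fr_def bin_val_def)

lemma fr_zeros: "fr (a @ replicate k S0) = fr a"
 unfolding fr_append by (simp add: fr_def bin_val_val)

lemma val_inj: "bits a ==> bits b ==> length a = length b ==> val a = val b ==> a = b"
proof (induction a arbitrary: b)
 case (Cons x a)
 then obtain y b' where b: "b = y # b'" by (cases b) auto
 have xy: "x \<in> {S0, S1}" "y \<in> {S0, S1}" using Cons.prems b by (auto simp: bits_def)
 have "(if x = S1 then 1 else 0) + 2 * val a = (if y = S1 then 1 else 0) + 2 * val b'" using Cons.prems(4) b by simp
 note e = this
 then have "even ((if x = S1 then 1 else 0) + 2 * val a) = even ((if y = S1 then 1 else 0) + 2 * val b')" by (simp only:)
 then have "x = S1 \<longleftrightarrow> y = S1" by (auto split: if_splits)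
 then have "x = y \<and> val a = val b'" using xy e by auto
 then show ?case using Cons.IH[of b'] Cons.prems b by (auto simp: bits_def)
qed simp

lemma bin_val_inj: "bits a ==> bits b ==> length a = length b ==> bin_val a = bin_val b ==> a = b"
 using val_inj[of "rev a" "rev b"] by (simp add: bin_val_val bits_def)

lemma fr_inj: "bits a ==> bits b ==> length a = length b ==> fr a = fr b ==> a = b"
 by (rule bin_val_inj) (simp_all add: fr_def)

text \<open>As \<open>a\<close> is not a prefix of \<open>b\<close>, the truncation of
  \<open>b\<close> to the length of \<open>a\<close> has a different numerator, and the dyadic cells
  of the two words are disjoint.\<close>

lemma fr_disjoint_le:
 assumes "bits a" "bits b" "length a <= length b" "\<And>x y. a @ x ~= b @ y"
 shows "fr a + 1 / 2 ^ length a <= fr b \<or> fr b + 1 / 2 ^ length b <= fr a"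
proof -
 define p s where "p = take (length a) b" and "s = drop (length a) b"
 have b: "b = p @ s" and lp: "length p = length a" using assms(3) by (simp_all add: p_def s_def)
 have "bits p" using assms(2) b by (auto simp: bits_def)
 moreover have "p ~= a" using assms(4)[of s "[]"] b by auto
 ultimately have ne: "bin_val p ~= bin_val a" using bin_val_inj[of p a] assms(1) lp by auto
 have s: "fr b = fr p + fr s / 2 ^ length a" "2 ^ length b = 2 ^ length a * (2::real) ^ length s" using b lp by (simp_all add: fr_append power_add)
 have s0: "0 <= fr s / 2 ^ length a" using fr_bounds(1)[of s] by simp
 have "(fr s + 1 / 2 ^ length s) / 2 ^ length a <= 1 / 2 ^ length a" by (intro divide_right_mono fr_bounds) simp
 then have s1: "fr s / 2 ^ length a + 1 / 2 ^ length b <= 1 / 2 ^ length a" unfolding s(2) by (simp add: add_divide_distrib mult.commute)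
 consider "bin_val a + 1 <= bin_val p" | "bin_val p + 1 <= bin_val a" using ne by linarith
 then show ?thesis
 proof cases
  case 1
  then have "real (bin_val a + 1) <= real (bin_val p)" by (simp only: of_nat_le_iff)
  then have "(real (bin_val a) + 1) / 2 ^ length a <= real (bin_val p) / 2 ^ length a" by (intro divide_right_mono) auto
  then have "fr a + 1 / 2 ^ length a <= fr p" unfolding fr_def lp by (simp add: add_divide_distrib)
  then show ?thesis using s0 s(1) by simp
 next
  case 2
  then have "real (bin_val p + 1) <= real (bin_val a)" by (simp only: of_nat_le_iff)
  then have "(real (bin_val p) + 1) / 2 ^ length a <= real (bin_val a) / 2 ^ length a" by (intro divide_right_mono) auto
  then have "fr p + 1 / 2 ^ length a <= fr a" unfolding fr_def lp by (simp add: add_divide_distrib)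
  then show ?thesis using s1 s(1) by simp
 qed
qed

lemma fr_disjoint:
 assumes "bits a" "bits b" "\<And>x y. a @ x ~= b @ y"
 shows "fr a + 1 / 2 ^ length a <= fr b \<or> fr b + 1 / 2 ^ length b <= fr a"
proof (cases "length a <= length b")
 case False
 then show ?thesis using fr_disjoint_le[OF assms(2,1)] assms(3) by (metis nat_le_linear)
qed (use fr_disjoint_le[OF assms(1,2)] assms(3) in blast)

lemma mid_x_eq: "mid_x e = fr e + 1 / 2 ^ length e / 2"
 unfolding mid_x_def fr_append by (simp add: fr_def bin_val_def)

text \<open>The digit 1 leads to the midpoint of the cell of \<open>e\<close>; the five zeros after
  it keep all choices within 1/64 of the cell width, so all spikes for \<open>e\<close> dent the
  hull at nearly the same place.\<close>

lemma spike_x_bounds: "mid_x e <= spike_x e w" "spike_x e w <= mid_x e + 1 / 2 ^ length e / 64"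
proof -
 have a: "spike_x e w = fr e + fr ([S1, S0, S0, S0, S0, S0] @ w) / 2 ^ length e" unfolding spike_x_def by (rule fr_append)
 have b: "fr ([S1, S0, S0, S0, S0, S0] @ w) = 1/2 + fr w / 64" unfolding fr_append by (simp add: fr_def bin_val_def)
 have w: "0 <= fr w" "fr w <= 1" using fr_bounds[of w] by (auto intro: order_trans[of _ "fr w + 1 / 2 ^ length w"])
 have "spike_x e w = mid_x e + (fr w / 64) / 2 ^ length e" unfolding a b mid_x_eq by (simp add: add_divide_distrib)
 moreover have "0 <= (fr w / 64) / 2 ^ length e" "(fr w / 64) / 2 ^ length e <= (1 / 64) / 2 ^ length e"
  using w by (auto intro!: divide_right_mono)
 ultimately show "mid_x e <= spike_x e w" "spike_x e w <= mid_x e + 1 / 2 ^ length e / 64" by (simp_all add: mult.commute)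
qed

text \<open>The midpoint for \<open>e\<close> lies outside the cell of \<open>e'\<close>, while the
  spikes of \<open>e'\<close> lie between 1/2 and 1/2 + 1/64 of that cell, hence at least a quarter
  of its width away from either end.\<close>

lemma spike_sep:
 assumes "ls ~= ls'"
 shows "\<bar>spike_x (cwd ls') w - mid_x (cwd ls)\<bar> \<ge> 1 / 2 ^ length (cwd ls') / 4"
proof -
 let ?e = "cwd ls" let ?e' = "cwd ls'"
 have d: "fr ?e + 1 / 2 ^ length ?e <= fr ?e' \<or> fr ?e' + 1 / 2 ^ length ?e' <= fr ?e"
  by (rule fr_disjoint[OF bits_cwd bits_cwd]) (use cwd_prefix assms in blast)
 define s s' where "s = 1 / (2::real) ^ length ?e" and "s' = 1 / (2::real) ^ length ?e'"
 have p: "0 < s" "0 < s'" by (simp_all add: s_def s'_def)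
 show ?thesis using d spike_x_bounds[of ?e' w] p unfolding mid_x_eq s_def[symmetric] s'_def[symmetric] by linarith
qed

lemma spike_x_unique: "spike_x (cwd ls) w = spike_x (cwd ls') w' ==> ls = ls'"
proof (rule ccontr)
 assume e: "spike_x (cwd ls) w = spike_x (cwd ls') w'" and ne: "ls ~= ls'"
 define s s' where "s = 1 / (2::real) ^ length (cwd ls)" and "s' = 1 / (2::real) ^ length (cwd ls')"
 have p: "0 < s" "0 < s'" by (simp_all add: s_def s'_def)
 note a = spike_sep[OF ne, of w', folded s'_def] spike_sep[OF ne[symmetric], of w, folded s_def]
  spike_x_bounds[of "cwd ls" w, folded s_def] spike_x_bounds[of "cwd ls'" w', folded s'_def]
 show False using a p e by linarith
qed

text \<open>Here 1024 is 64 times 16: with \<open>s\<close> the width of the cell, the height equals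
  \<open>(s / 4)^2 / 64\<close>, the gap between the parabola and its tangent at distance
  \<open>s / 4\<close>. That is the distance granted by \<open>spike_sep\<close>.\<close>

lemma spike_h_eq: "spike_h e = (1 / 2 ^ length e)\<^sup>2 / 1024"
 by (simp add: spike_h_def power_add power_divide power_even_eq)

lemma spike_x_lower: "1 / 2 ^ length e / 2 <= spike_x e w" "spike_x e w <= 1"
proof -
 show "1 / 2 ^ length e / 2 <= spike_x e w" using spike_x_bounds(1)[of e w] fr_bounds(1)[of e] unfolding mid_x_eq by linarith
 show "spike_x e w <= 1" unfolding spike_x_def using fr_bounds(2) by (metis add_increasing2 divide_nonneg_nonneg le_add_same_cancel1 order_trans zero_le_numeral zero_le_one zero_le_power)
qed

section \<open>Closedness of the set, and its convex hull\<close>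

lemma finite_words: "finite {w :: word. length w <= n}"
proof -
 have "finite (UNIV :: sym set)" by (rule finite_subset[of _ "{S0, S1, SPlus, SMinus, SSlash}"]) (auto intro: sym.exhaust)
 from finite_lists_length_le[OF this, of n] show ?thesis by simp
qed

text \<open>A union of infinitely many spikes is not closed for free. It is an intersection over
  \<open>L\<close> of closed sets, each made of a band of width \<open>(1/2) ^ L\<close> around the
  parabola and the finitely many spikes with code words shorter than \<open>L\<close>; the other
  spikes are short enough to lie in the band.\<close>

lemma closed_shape:
 assumes "good T"
 shows "shape T \<in> Acal"
proof -
 define G where "G L = {p :: real \<times> real. 0 <= fst p \<and> fst p <= 1 \<and> \<bar>snd p - (fst p)\<^sup>2 / 64\<bar> <= (1/2) ^ L}" for L :: nat
 define U where "U L = (\<Union>t\<in>{t \<in> T. length (fst t) < L}. spike t)" for L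
 have cG: "closed (G L)" for L
 proof -
  have "closed {p :: real \<times> real. 0 <= fst p}" "closed {p :: real \<times> real. fst p <= 1}" "closed {p :: real \<times> real. \<bar>snd p - (fst p)\<^sup>2 / 64\<bar> <= (1/2) ^ L}"
   by (intro closed_Collect_le continuous_intros; simp)+
  moreover have "G L = {p. 0 <= fst p} \<inter> {p. fst p <= 1} \<inter> {p. \<bar>snd p - (fst p)\<^sup>2 / 64\<bar> <= (1/2) ^ L}" unfolding G_def by auto
  ultimately show ?thesis by (simp add: closed_Int)
 qed
 have cS: "closed (spike t)" for t
 proof -
  obtain e w where t: "t = (e, w)" by (cases t)
  have "spike t = {spike_x e w} \<times> {(spike_x e w)\<^sup>2 / 64 - spike_h e .. (spike_x e w)\<^sup>2 / 64 + spike_h e}"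
   unfolding spike_def t by (auto simp: abs_le_iff)
  then show ?thesis by (simp add: closed_Times)
 qed
 have fT: "finite {t \<in> T. length (fst t) < L}" for L
 proof (rule finite_subset)
  show "{t \<in> T. length (fst t) < L} \<subseteq> {w. length w <= L} \<times> {w. length w <= L}" using goodD[OF assms] by fastforce
 qed (intro finite_SigmaI finite_words)
 have eq: "shape T = (\<Inter>L. G L \<union> U L)"
 proof
  show "shape T \<subseteq> (\<Inter>L. G L \<union> U L)"
  proof
   fix p assume "p \<in> shape T"
   then consider x where "p = (x, x\<^sup>2 / 64)" "0 <= x" "x <= 1" | t where "t \<in> T" "p \<in> spike t" unfolding shape_def arc_def by blast
   then show "p \<in> (\<Inter>L. G L \<union> U L)"
   proof cases
    case 1
    then show ?thesis unfolding G_def by simp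
   next
    case 2
    show ?thesis
    proof
     fix L
     obtain e w where t: "t = (e, w)" by (cases t)
     show "p \<in> G L \<union> U L"
     proof (cases "length e < L")
      case True
      then show ?thesis using 2 t unfolding U_def by auto
     next
      case False
      obtain y where p: "p = (spike_x e w, y)" "\<bar>y - (spike_x e w)\<^sup>2 / 64\<bar> <= spike_h e" using 2(2) unfolding t spike_def by auto
      have "spike_h e <= (1/2) ^ L" unfolding spike_h_def using False by (intro power_decreasing) auto
      moreover have "0 <= spike_x e w" using spike_x_lower(1)[of e w] by (rule order_trans[rotated]) simp
      ultimately have "p \<in> G L" unfolding G_def p(1) using p(2) spike_x_lower(2)[of e w] by simp
      then show ?thesis ..
     qed
    qed
   qed
  qed
  show "(\<Inter>L. G L \<union> U L) \<subseteq> shape T"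
  proof
   fix p assume p: "p \<in> (\<Inter>L. G L \<union> U L)"
   show "p \<in> shape T"
   proof (cases "\<exists>L. p \<in> U L")
    case True
    then show ?thesis unfolding U_def shape_def by blast
   next
    case False
    then have g: "p \<in> G L" for L using p by blast
    have "\<bar>snd p - (fst p)\<^sup>2 / 64\<bar> <= 0"
    proof (rule ccontr)
     assume "\<not> \<bar>snd p - (fst p)\<^sup>2 / 64\<bar> <= 0"
     then obtain L where "(1/2) ^ L < \<bar>snd p - (fst p)\<^sup>2 / 64\<bar>" using real_arch_pow_inv[of "\<bar>snd p - (fst p)\<^sup>2 / 64\<bar>" "1/2"] by auto
     then show False using g[of L] unfolding G_def by simp
    qed
    then have "p = (fst p, (fst p)\<^sup>2 / 64)" by (cases p) auto
    then show ?thesis using g[of 0] unfolding shape_def arc_def G_def by blast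
   qed
  qed
 qed
 have "closed (shape T)" unfolding eq U_def by (intro closed_INT ballI closed_Un cG closed_UN fT cS)
 moreover have "shape T \<subseteq> {0..1} \<times> {0..1}"
 proof
  fix p assume "p \<in> shape T"
  then consider x where "p = (x, x\<^sup>2 / 64)" "0 <= x" "x <= 1" | e w where "p \<in> spike (e, w)" unfolding shape_def arc_def by auto
  then show "p \<in> {0..1} \<times> {0..1}"
  proof cases
   case 1
   then have "x\<^sup>2 <= 1" by (simp add: power_le_one)
   then show ?thesis using 1 by simp
  next
   case 2
   then obtain y where p: "p = (spike_x e w, y)" "\<bar>y - (spike_x e w)\<^sup>2 / 64\<bar> <= spike_h e" unfolding spike_def by auto
   define s where "s = 1 / (2::real) ^ length e"
   have s: "0 < s" "s <= 1" unfolding s_def by (simp_all add: divide_le_eq)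
   have b: "s / 2 <= spike_x e w" "spike_x e w <= 1" using spike_x_lower[of e w] unfolding s_def by auto
   \<comment> \<open>Spikes do not reach below 0: a code word containing any spike lies at abscissa
     at least \<open>s / 2\<close>, where the parabola has height at least \<open>s^2 / 256\<close>,
     and the spike has height \<open>s^2 / 1024\<close>.\<close>
   have "(s / 2)\<^sup>2 <= (spike_x e w)\<^sup>2" using b s by (intro power_mono) auto
   moreover have "(spike_x e w)\<^sup>2 <= 1" "s\<^sup>2 <= 1" using b s by (auto intro!: power_le_one)
   moreover have "spike_h e = s\<^sup>2 / 1024" unfolding s_def by (rule spike_h_eq)
   moreover have "(s / 2)\<^sup>2 = s\<^sup>2 / 4" "0 <= s\<^sup>2" by (simp_all add: power_divide)
   ultimately have "0 <= y" "y <= 1" using p(2) by (auto simp: abs_le_iff)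
   then show ?thesis using p(1) b s by simp
  qed
 qed
 ultimately show ?thesis unfolding Acal_def by simp
qed

text \<open>The half-plane above the tangent at \<open>mid_x e\<close> contains the arc, and by
  \<open>spike_sep\<close> also all spikes of other code words; being convex it contains the hull.
  The precision is chosen such that \<open>(1/2) ^ n\<close> is a quarter of the spike height
  \<open>h\<close>.\<close>

lemma hull_no_spike:
 assumes g: "good T" and e: "e = cwd ls" and no: "\<And>w. (e, w) \<notin> T" and n: "n = 2 * length e + 12"
 shows "setdist_e (mid_x e, (mid_x e)\<^sup>2 / 64 - spike_h e) (convex hull (shape T)) > ereal (2 * (1/2) ^ n)"
proof -
 define a h where "a = mid_x e" and "h = spike_h e"
 have a: "0 <= a" "a <= 1" using fr_bounds[of "e @ [S1]"] unfolding a_def mid_x_def by (auto intro: order_trans[of _ "fr (e @ [S1]) + 1 / 2 ^ length (e @ [S1])"])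
 have h: "0 < h" "2 * (1/2) ^ n = h / 2" unfolding h_def spike_h_def n by (simp_all add: power_add power_divide)
 define H where "H = {p :: real \<times> real. (- a / 32, 1) \<bullet> p \<ge> - (a\<^sup>2 / 64)}"
 have inH: "p \<in> H \<longleftrightarrow> snd p \<ge> a * fst p / 32 - a\<^sup>2 / 64" for p unfolding H_def by (cases p) (auto simp: inner_prod_def)
 have sq: "x\<^sup>2 / 64 - (a * x / 32 - a\<^sup>2 / 64) = (x - a)\<^sup>2 / 64" for x by (simp add: power2_eq_square algebra_simps add_divide_distrib diff_divide_distrib)
 have "shape T \<subseteq> H"
 proof
  fix p assume "p \<in> shape T"
  then consider x where "p = (x, x\<^sup>2 / 64)" | e' w where "(e', w) \<in> T" "p \<in> spike (e', w)" unfolding shape_def arc_def by auto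
  then show "p \<in> H"
  proof cases
   case 1
   have "0 <= (x - a)\<^sup>2 / 64" by simp
   then show ?thesis unfolding inH 1 fst_conv snd_conv using sq[of x] by linarith
  next
   case 2
   then obtain y where p: "p = (spike_x e' w, y)" "\<bar>y - (spike_x e' w)\<^sup>2 / 64\<bar> <= spike_h e'" unfolding spike_def by auto
   obtain ls' where e': "e' = cwd ls'" using goodD[OF g 2(1)] by blast
   have "ls ~= ls'" using 2(1) no e e' by blast
   from spike_sep[OF this, of w] have "1 / 2 ^ length e' / 4 <= \<bar>spike_x e' w - a\<bar>" unfolding a_def e e' .
   then have "(1 / 2 ^ length e' / 4)\<^sup>2 <= \<bar>spike_x e' w - a\<bar>\<^sup>2" by (intro power_mono) auto
   then have "spike_h e' <= (spike_x e' w - a)\<^sup>2 / 64" unfolding spike_h_eq by (simp add: power_divide)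
   then show ?thesis unfolding inH unfolding p fst_conv snd_conv using p(2) sq[of "spike_x e' w"] by linarith
  qed
 qed
 then have HH: "convex hull (shape T) \<subseteq> H" unfolding H_def by (intro hull_minimal convex_halfspace_ge)
 \<comment> \<open>The slope of the tangent is \<open>a / 32\<close>, at most 1/32. A point nearer
   than \<open>3 / 4 * h\<close> would be at least \<open>h / 4\<close> below the point of contact,
   but on that short distance the tangent descends by at most \<open>3 / 128 * h\<close>.\<close>
 have "3 / 4 * h <= dist (a, a\<^sup>2 / 64 - h) p" if "p \<in> convex hull (shape T)" for p
 proof (rule ccontr)
  assume "\<not> ?thesis"
  then have d: "dist (a, a\<^sup>2 / 64 - h) p < 3 / 4 * h" by simp
  have "dist a (fst p) <= dist (a, a\<^sup>2 / 64 - h) p" "dist (a\<^sup>2 / 64 - h) (snd p) <= dist (a, a\<^sup>2 / 64 - h) p"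
   using dist_fst_le[of "(a, a\<^sup>2 / 64 - h)" p] dist_snd_le[of "(a, a\<^sup>2 / 64 - h)" p] by simp_all
  then have c: "\<bar>a - fst p\<bar> < 3 / 4 * h" "\<bar>a\<^sup>2 / 64 - h - snd p\<bar> < 3 / 4 * h" using d by (simp_all add: dist_real_def)
  have "snd p \<ge> a * fst p / 32 - a\<^sup>2 / 64" using that HH inH by blast
  moreover have "a * fst p / 32 - a\<^sup>2 / 64 = a\<^sup>2 / 64 - a * (a - fst p) / 32" by (simp add: power2_eq_square field_simps)
  moreover have "a * (a - fst p) <= 1 * \<bar>a - fst p\<bar>"
  proof -
   have "a * (a - fst p) <= a * \<bar>a - fst p\<bar>" by (rule mult_left_mono[OF abs_ge_self a(1)])
   also have "\<dots> <= 1 * \<bar>a - fst p\<bar>" by (rule mult_right_mono[OF a(2) abs_ge_zero])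
   finally show ?thesis .
  qed
  moreover define k where "k = a * (a - fst p)"
  ultimately have "a\<^sup>2 / 64 - k / 32 <= snd p" "k <= \<bar>a - fst p\<bar>" by simp_all
  then show False using c h(1) by linarith
 qed
 then have "ereal (3 / 4 * h) <= setdist_e (a, a\<^sup>2 / 64 - h) (convex hull (shape T))" unfolding setdist_e_def by (intro INF_greatest) simp
 moreover have "ereal (h / 2) < ereal (3 / 4 * h)" using h(1) by simp
 ultimately show ?thesis unfolding h(2) a_def[symmetric] h_def[symmetric] by (metis less_le_trans)
qed

text \<open>The lower tip of the spike lies \<open>\<epsilon> <= s / 64\<close> to the right of
  \<open>a\<close>, so it is joined by a chord to the arc point over \<open>a - s / 4\<close>. Over
  \<open>a\<close> the arc point has weight \<open>l <= 1 / 16\<close>; the chord misses the target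
  by \<open>2 * (l * h) + (1 - l) * (\<epsilon>^2 / 64)\<close>, at most
  \<open>h / 8 + h / 256\<close>.\<close>

lemma hull_spike:
 assumes T: "(e, w) \<in> T" and n: "n = 2 * length e + 12"
 shows "setdist_e (mid_x e, (mid_x e)\<^sup>2 / 64 - spike_h e) (convex hull (shape T)) < ereal ((1/2) ^ n)"
proof -
 define a h X s where "a = mid_x e" and "h = spike_h e" and "X = spike_x e w" and "s = 1 / (2::real) ^ length e"
 have s: "0 < s" "s <= 1" unfolding s_def by (simp_all add: divide_le_eq)
 have h: "h = s\<^sup>2 / 1024" "(1/2) ^ n = h / 4" unfolding h_def s_def spike_h_eq n by (simp_all add: power_add power_divide power_even_eq)
 define \<epsilon> where "\<epsilon> = X - a"
 have ep: "0 <= \<epsilon>" "\<epsilon> <= s / 64" using spike_x_bounds[of e w] unfolding \<epsilon>_def X_def a_def s_def by auto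
 have a: "s / 2 <= a" "a <= 1" using spike_x_lower[of e w] spike_x_bounds(1)[of e w] fr_bounds(1)[of e] unfolding a_def mid_x_eq s_def by linarith+
 define l where "l = \<epsilon> / (\<epsilon> + s / 4)"
 have l: "0 <= l" "l <= 1 / 16" "l * (\<epsilon> + s / 4) = \<epsilon>" unfolding l_def using ep s by (auto simp: field_simps)
 let ?A = "(X, X\<^sup>2 / 64 - h)" let ?C = "(a - s / 4, (a - s / 4)\<^sup>2 / 64)"
 have "?A \<in> spike (e, w)" unfolding spike_def X_def h_def using s by (auto simp: spike_h_def)
 then have A: "?A \<in> shape T" unfolding shape_def using T by blast
 have C: "?C \<in> shape T" unfolding shape_def arc_def using a s by auto
 define P where "P = l *\<^sub>R ?C + (1 - l) *\<^sub>R ?A"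
 have P: "P \<in> convex hull (shape T)" unfolding P_def using hull_inc[OF A, of convex] hull_inc[OF C, of convex] l
  by (intro convexD[OF convex_convex_hull]) auto
 have X: "X = a + \<epsilon>" by (simp add: \<epsilon>_def)
 have f: "fst P = a"
 proof -
  have "fst P = a + \<epsilon> - l * (\<epsilon> + s / 4)" unfolding P_def X by (simp add: algebra_simps)
  then show ?thesis using l(3) by simp
 qed
 have "snd P - (a\<^sup>2 / 64 - h) = l * (s / 4)\<^sup>2 / 64 + (1 - l) * \<epsilon>\<^sup>2 / 64 + l * h + (a / 32) * (\<epsilon> - l * (\<epsilon> + s / 4))"
  unfolding P_def X by (simp add: power2_eq_square field_simps)
 also have "\<dots> = 2 * l * h + (1 - l) * \<epsilon>\<^sup>2 / 64" unfolding l(3) h(1) by (simp add: power_divide)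
 finally have d: "snd P - (a\<^sup>2 / 64 - h) = 2 * (l * h) + (1 - l) * (\<epsilon>\<^sup>2 / 64)" by simp
 have hp: "0 < h" using s unfolding h(1) by simp
 have "\<epsilon>\<^sup>2 <= (s / 64)\<^sup>2" using ep by (intro power_mono) auto
 then have "\<epsilon>\<^sup>2 / 64 <= h / 256" unfolding h(1) by (simp add: power_divide)
 moreover have "(1 - l) * (\<epsilon>\<^sup>2 / 64) <= 1 * (\<epsilon>\<^sup>2 / 64)" using l by (intro mult_right_mono) auto
 moreover have "l * h <= 1 / 16 * h" using l hp by (intro mult_right_mono) auto
 moreover have "0 <= l * h" "0 <= (1 - l) * (\<epsilon>\<^sup>2 / 64)" using l hp by auto
 ultimately have "\<bar>snd P - (a\<^sup>2 / 64 - h)\<bar> < h / 4" unfolding d using hp by linarith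
 then have "dist (a, a\<^sup>2 / 64 - h) P < h / 4" using dist_le_sum[of "(a, a\<^sup>2 / 64 - h)" P] f by (simp add: abs_minus_commute)
 then show ?thesis unfolding setdist_less h(2) a_def[symmetric] h_def[symmetric] using P by blast
qed

section \<open>Deciding the spiked parabola on a grid\<close>

definition hw_spec :: "(word \<times> word) set => nat => nat => nat => bool" where
 "hw_spec T N J v \<longleftrightarrow> (\<exists>e w. (e, w) \<in> T \<and> spike_x e w * 2 ^ N = 32 * real J \<and> v = 2 ^ N div 2 ^ (2 * length e + 10)) \<or>
   ((\<forall>e w. (e, w) \<in> T \<longrightarrow> spike_x e w * 2 ^ N ~= 32 * real J) \<and> v = 0)"

text \<open>For \<open>N = n + 4\<close> the tolerance \<open>(1/2) ^ n\<close> is 16 grid units; a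
  distance strictly below 16 truncates to at most 15.\<close>

definition in_range :: "sym => nat => nat => bool" where
 "in_range s N x \<longleftrightarrow> (if s = SMinus then x <= 15 else x <= 2 ^ N + 15)"

lemma div_real: "real (m div 2 ^ k) <= real m / 2 ^ k" "real m / 2 ^ k < real (m div 2 ^ k) + 1"
 using floor_divide_of_nat_eq[of m "2 ^ k", where 'a = real] by (simp_all, linarith+)

text \<open>One unit is lost because \<open>2 * \<xi> + 1 <= 64 * 2 ^ N\<close> for abscissas in
  range, the other by the truncating division.\<close>

lemma square_cell:
 fixes x :: real
 assumes "4 <= N" "real \<xi> <= \<bar>x\<bar> * 2 ^ N" "\<bar>x\<bar> * 2 ^ N < real \<xi> + 1" "\<xi> <= 2 ^ N + 15"
 shows "real (\<xi>\<^sup>2 div 2 ^ (N + 6)) <= x\<^sup>2 / 64 * 2 ^ N" "x\<^sup>2 / 64 * 2 ^ N < real (\<xi>\<^sup>2 div 2 ^ (N + 6)) + 2"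
proof -
 define P where "P = (2::real) ^ N"
 have P: "16 <= P" unfolding P_def using power_increasing[OF assms(1), of "2::real"] by simp
 define a where "a = \<bar>x\<bar> * P"
 have a: "real \<xi> <= a" "a < real \<xi> + 1" using assms unfolding a_def P_def by auto
 have A: "x\<^sup>2 / 64 * 2 ^ N = a\<^sup>2 / (64 * P)" unfolding a_def P_def[symmetric] using P by (simp add: power_mult_distrib power2_eq_square)
 have D: "(2::real) ^ (N + 6) = 64 * P" unfolding P_def by (simp add: power_add)
 note d = div_real[of "\<xi>\<^sup>2" "N + 6", unfolded D]
 have "(real \<xi>)\<^sup>2 <= a\<^sup>2" using a by (intro power_mono) auto
 then have "(real \<xi>)\<^sup>2 / (64 * P) <= a\<^sup>2 / (64 * P)" using P by (intro divide_right_mono) auto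
 then show "real (\<xi>\<^sup>2 div 2 ^ (N + 6)) <= x\<^sup>2 / 64 * 2 ^ N" unfolding A using d(1) by simp
 have "real \<xi> <= real (2 ^ N + 15)" using assms(4) by (simp only: of_nat_le_iff)
 then have x: "real \<xi> <= P + 15" unfolding P_def by simp
 have "a\<^sup>2 <= (real \<xi> + 1)\<^sup>2" using a by (intro power_mono) auto
 also have "\<dots> = (real \<xi>)\<^sup>2 + 2 * real \<xi> + 1" by (simp add: power2_eq_square algebra_simps)
 also have "\<dots> <= (real \<xi>)\<^sup>2 + 64 * P" using x P by linarith
 finally have "a\<^sup>2 / (64 * P) <= ((real \<xi>)\<^sup>2 + 64 * P) / (64 * P)" using P by (intro divide_right_mono) auto
 also have "\<dots> = (real \<xi>)\<^sup>2 / (64 * P) + 1" using P by (simp add: add_divide_distrib)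
 finally show "x\<^sup>2 / 64 * 2 ^ N < real (\<xi>\<^sup>2 div 2 ^ (N + 6)) + 2" unfolding A using d(2) by simp
qed

text \<open>The numerical fact is that 23/16 plus 3/64 times 17/16 is less than 3/2.\<close>

lemma error_budget:
 fixes a b c d h r :: real
 shows "a <= b + c ==> b <= 23 / 16 * r + h ==> c <= 3 / 64 * d ==> d <= 17 / 16 * r ==> 0 < r ==> a <= 3 / 2 * r + h"
 by linarith

text \<open>The numbers \<open>\<xi>\<close> and \<open>\<upsilon>\<close> are magnitudes truncated
  to units of \<open>1 / 2 ^ N\<close>, 16 of which make up \<open>(1/2) ^ n\<close>. Rounding
  \<open>\<xi>\<close> to the nearest multiple of 32 selects one point of the coarse grid on which
  spikes are looked up; \<open>v\<close> is the height found there, in grid units and rounded down,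
  or 0.\<close>

locale probe =
 fixes T :: "(word \<times> word) set" and n N \<xi> \<upsilon> v :: nat and sx sy :: sym and x y :: real
 assumes T: "good T" and N: "N = n + 4" and sx: "sx \<in> {SPlus, SMinus}" and sy: "sy \<in> {SPlus, SMinus}"
  and x: "x = (if sx = SMinus then -1 else 1) * \<bar>x\<bar>" "real \<xi> <= \<bar>x\<bar> * 2 ^ N" "\<bar>x\<bar> * 2 ^ N < real \<xi> + 1"
  and y: "y = (if sy = SMinus then -1 else 1) * \<bar>y\<bar>" "real \<upsilon> <= \<bar>y\<bar> * 2 ^ N" "\<bar>y\<bar> * 2 ^ N < real \<upsilon> + 1"
  and v: "hw_spec T N ((\<xi> + 16) div 32) v"
begin

abbreviation "Q \<equiv> \<xi>\<^sup>2 div 2 ^ (N + 6)"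
abbreviation "P \<equiv> (2::real) ^ N"
abbreviation "r \<equiv> (1/2::real) ^ n"

lemma P: "16 <= P" "r * P = 16" "0 < r" "r <= 1"
proof -
 show "16 <= P" using power_increasing[of 4 N "2::real"] N by simp
qed (simp_all add: N power_add power_divide power_le_one)

lemma range_upper: "in_range sx N \<xi> ==> \<xi> <= 2 ^ N + 15"
 by (auto simp: in_range_def split: if_splits)

lemma near_sound: "in_range sx N \<xi> ==> nearby sy \<upsilon> Q w ==> \<bar>y - x\<^sup>2 / 64\<bar> * P <= real w + 3"
proof -
 assume i: "in_range sx N \<xi>" and n: "nearby sy \<upsilon> Q w"
 define A B where "A = x\<^sup>2 / 64 * P" and "B = \<bar>y\<bar> * P"
 have A: "real Q <= A" "A < real Q + 2" unfolding A_def using square_cell[OF _ x(2,3) range_upper[OF i]] N by simp_all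
 have B: "real \<upsilon> <= B" "B < real \<upsilon> + 1" using y unfolding B_def by auto
 have e: "\<bar>y - x\<^sup>2 / 64\<bar> * P = \<bar>y * P - A\<bar>" unfolding A_def left_diff_distrib[symmetric] abs_mult by simp
 show ?thesis
 proof (cases "sy = SMinus")
  case True
  then have "y * P = - B" using y(1) unfolding B_def by simp
  moreover have "real \<upsilon> + real Q <= real w" using n True unfolding nearby_def by (simp flip: of_nat_add)
  ultimately show ?thesis unfolding e using A B by linarith
 next
  case False
  then have "y * P = B" using y(1) unfolding B_def by simp
  moreover have "real \<upsilon> <= real w + real Q" "real Q <= real w + real \<upsilon>" using n False unfolding nearby_def by (simp_all flip: of_nat_add)
  ultimately show ?thesis unfolding e using A B by linarith
 qed
qed

lemma near_complete: "in_range sx N \<xi> ==> \<bar>y - x\<^sup>2 / 64\<bar> * P + 2 <= real w ==> nearby sy \<upsilon> Q w"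
proof -
 assume i: "in_range sx N \<xi>" and w: "\<bar>y - x\<^sup>2 / 64\<bar> * P + 2 <= real w"
 define A B where "A = x\<^sup>2 / 64 * P" and "B = \<bar>y\<bar> * P"
 have A: "real Q <= A" "A < real Q + 2" unfolding A_def using square_cell[OF _ x(2,3) range_upper[OF i]] N by simp_all
 have B: "real \<upsilon> <= B" "B < real \<upsilon> + 1" using y unfolding B_def by auto
 have e: "\<bar>y - x\<^sup>2 / 64\<bar> * P = \<bar>y * P - A\<bar>" unfolding A_def left_diff_distrib[symmetric] abs_mult by simp
 show ?thesis
 proof (cases "sy = SMinus")
  case True
  then have "y * P = - B" using y(1) unfolding B_def by simp
  then have "real \<upsilon> + real Q <= real w" using w unfolding e using A B by linarith
  then show ?thesis unfolding nearby_def using True by (simp flip: of_nat_add)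
 next
  case False
  then have "y * P = B" using y(1) unfolding B_def by simp
  then have "real \<upsilon> <= real w + real Q" "real Q <= real w + real \<upsilon>" using w unfolding e using A B by linarith+
  then show ?thesis unfolding nearby_def using False by (simp flip: of_nat_add)
 qed
qed

lemma square_diff: "\<bar>x\<bar> <= 2 ==> 0 <= c ==> c <= 1 ==> \<bar>x\<^sup>2 / 64 - c\<^sup>2 / 64\<bar> <= 3 / 64 * \<bar>x - c\<bar>"
proof -
 assume h: "\<bar>x\<bar> <= 2" "0 <= c" "c <= 1"
 have "\<bar>x\<^sup>2 / 64 - c\<^sup>2 / 64\<bar> = \<bar>(x + c) * (x - c)\<bar> / 64" by (simp add: power2_eq_square algebra_simps diff_divide_distrib[symmetric])
 also have "\<dots> = \<bar>x + c\<bar> * \<bar>x - c\<bar> / 64" by (simp add: abs_mult)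
 also have "\<dots> <= 3 * \<bar>x - c\<bar> / 64" using h by (intro divide_right_mono mult_right_mono) auto
 finally show ?thesis by simp
qed

text \<open>The threshold is \<open>2 * length e + 3\<close>, the largest number of digits of a
  position. Below it the height is at most 1/8 of a grid unit. Above it the position is a point of
  the coarse grid, and being within 16 units of it forces the rounding to hit exactly this
  point.\<close>

lemma spike_h_cases:
 assumes "(e, w) \<in> T" "\<bar>x - spike_x e w\<bar> < r"
 shows "spike_h e * P <= real v + 1"
proof (cases "n <= 2 * length e + 3")
 case True
 have "spike_h e <= (1/2) ^ (n + 7)" unfolding spike_h_def using True by (intro power_decreasing) auto
 also have "\<dots> = r / 128" by (simp add: power_add power_divide)
 finally have "spike_h e * P <= r / 128 * P" by (intro mult_right_mono) auto
 then show ?thesis using P(2) by simp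
next
 case False
 define l where "l = length e"
 obtain ls where ls: "e = cwd ls" "length w + 3 <= length e" using goodD[OF T assms(1)] by blast
 let ?d = "e @ [S1, S0, S0, S0, S0, S0] @ w"
 have len: "length ?d + 1 <= n" using False ls(2) by simp
 define j where "j = bin_val ?d * 2 ^ (n - 1 - length ?d)"
 have sp: "spike_x e w * P = 32 * real j"
 proof -
  have N5: "N = length ?d + (n - 1 - length ?d) + 5" using len N by linarith
  have "P = 2 ^ (length ?d + (n - 1 - length ?d) + 5)" by (subst N5) (rule refl)
  then have "P = 2 ^ length ?d * 2 ^ (n - 1 - length ?d) * 32" unfolding power_add by simp
  then show ?thesis unfolding spike_x_def fr_def j_def by simp
 qed
 \<comment> \<open>Only the magnitude of \<open>x\<close> enters \<open>\<xi>\<close>, so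
   \<open>x\<close> has to be shown positive: the spike is further than \<open>(1/2) ^ n\<close>
   away from the vertical axis.\<close>
 have "(1/2::real) ^ n <= (1/2) ^ (2 * l + 4)" using False by (intro power_decreasing) (auto simp: l_def)
 also have "\<dots> <= (1/2) ^ (l + 1)" by (intro power_decreasing) auto
 also have "\<dots> = 1 / 2 ^ length e / 2" by (simp add: l_def power_divide)
 also have "\<dots> <= spike_x e w" by (rule spike_x_lower)
 finally have "0 < x" using assms(2) by linarith
 then have "\<bar>x\<bar> * P = x * P" by simp
 moreover have "\<bar>x - spike_x e w\<bar> * P < 16" using mult_strict_right_mono[OF assms(2), of P] P by simp
 then have "\<bar>x * P - 32 * real j\<bar> < 16" unfolding sp[symmetric] left_diff_distrib[symmetric] abs_mult by simp
 ultimately have "real \<xi> < 32 * real j + 16" "32 * real j < real \<xi> + 17" using x(2,3) by linarith+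
 then have "real \<xi> < real (32 * j + 16)" "real (32 * j) < real (\<xi> + 17)" by simp_all
 then have "\<xi> < 32 * j + 16" "32 * j < \<xi> + 17" by (simp_all only: of_nat_less_iff)
 then have "(\<xi> + 16) div 32 = j" by linarith
 then have "\<not> (\<forall>e w. (e, w) \<in> T \<longrightarrow> spike_x e w * 2 ^ N ~= 32 * real ((\<xi> + 16) div 32))" using sp assms(1) by blast
 then obtain e' w' where e': "(e', w') \<in> T" "spike_x e' w' * 2 ^ N = 32 * real j" "v = 2 ^ N div 2 ^ (2 * length e' + 10)"
  using v \<open>(\<xi> + 16) div 32 = j\<close> unfolding hw_spec_def by blast
 obtain ls' where ls': "e' = cwd ls'" using goodD[OF T e'(1)] by blast
 have "spike_x e' w' * P = spike_x e w * P" using e'(2) sp by (simp only:)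
 then have "spike_x e' w' = spike_x e w" by simp
 then have "e' = e" using spike_x_unique ls(1) ls' by blast
 then have "real (2 ^ N) / 2 ^ (2 * length e + 10) < real v + 1" using div_real(2)[of "2 ^ N" "2 * length e + 10"] e'(3) by simp
 then show ?thesis unfolding spike_h_def by (simp add: power_divide)
qed

text \<open>The tolerance 20 + \<open>v\<close> in grid units: 16 for the distance, 3/4 for the
  change of the parabola along it, \<open>v + 1\<close> for a spike of truncated height
  \<open>v\<close>, and 2 for the truncation of the square.\<close>

lemma probe_complete:
 assumes "setdist_e (x, y) (shape T) < ereal r"
 shows "in_range sx N \<xi> \<and> nearby sy \<upsilon> Q (20 + v)"
proof -
 obtain c where c: "c \<in> shape T" "dist (x, y) c < r" using assms unfolding setdist_less by blast
 have d: "\<bar>x - fst c\<bar> < r" "\<bar>y - snd c\<bar> < r" using dist_fst_le[of "(x, y)" c] dist_snd_le[of "(x, y)" c] c(2) by (simp_all add: dist_real_def)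
 have c01: "0 <= fst c" "fst c <= 1" using Acal_box[OF closed_shape[OF T] c(1)] by auto
 have x2: "\<bar>x\<bar> <= 2" using d(1) c01 P(4) by linarith
 have ir: "in_range sx N \<xi>"
 proof (cases "sx = SMinus")
  case True
  then have "\<bar>x\<bar> < r" using x(1) d(1) c01 by simp
  then have "\<bar>x\<bar> * P < 16" using mult_strict_right_mono[of "\<bar>x\<bar>" r P] P by simp
  then have "real \<xi> < real 16" using x(2) by simp
  then show ?thesis unfolding in_range_def using True by (simp only: of_nat_less_iff) simp
 next
  case False
  then have "\<bar>x\<bar> < 1 + r" using x(1) d(1) c01 by simp
  then have "\<bar>x\<bar> * P < (1 + r) * P" using P by (intro mult_strict_right_mono) auto
  then have "real \<xi> < real (2 ^ N + 16)" using x(2) P(2) by (simp add: distrib_right)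
  then have "\<xi> < 2 ^ N + 16" by (simp only: of_nat_less_iff)
  then show ?thesis unfolding in_range_def using False by simp
 qed
 have sd: "\<bar>x\<^sup>2 / 64 - (fst c)\<^sup>2 / 64\<bar> <= 3 / 64 * \<bar>x - fst c\<bar>" by (rule square_diff[OF x2 c01])
 have off: "\<bar>snd c - (fst c)\<^sup>2 / 64\<bar> * P <= real v + 1"
 proof -
  consider "c \<in> arc" | e w where "(e, w) \<in> T" "c \<in> spike (e, w)" using c(1) unfolding shape_def by auto
  then show ?thesis
  proof cases
   case 1
   then show ?thesis unfolding arc_def by auto
  next
   case 2
   then have f: "fst c = spike_x e w" "\<bar>snd c - (fst c)\<^sup>2 / 64\<bar> <= spike_h e" unfolding spike_def by auto
   have "\<bar>snd c - (fst c)\<^sup>2 / 64\<bar> * P <= spike_h e * P" using f(2) by (intro mult_right_mono) auto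
   also have "\<dots> <= real v + 1" by (rule spike_h_cases[OF 2(1)]) (use d(1) f(1) in simp)
   finally show ?thesis .
  qed
 qed
 have "\<bar>y - x\<^sup>2 / 64\<bar> <= \<bar>y - snd c\<bar> + \<bar>snd c - (fst c)\<^sup>2 / 64\<bar> + \<bar>x\<^sup>2 / 64 - (fst c)\<^sup>2 / 64\<bar>" by linarith
 then have "\<bar>y - x\<^sup>2 / 64\<bar> <= r + 3 / 64 * r + \<bar>snd c - (fst c)\<^sup>2 / 64\<bar>" using d sd by linarith
 then have "\<bar>y - x\<^sup>2 / 64\<bar> * P <= (r + 3 / 64 * r + \<bar>snd c - (fst c)\<^sup>2 / 64\<bar>) * P" by (intro mult_right_mono) auto
 also have "\<dots> = r * P + 3 / 64 * (r * P) + \<bar>snd c - (fst c)\<^sup>2 / 64\<bar> * P" by (simp add: algebra_simps)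
 finally have "\<bar>y - x\<^sup>2 / 64\<bar> * P + 2 <= real (20 + v)" using off P(2) by simp
 then show ?thesis using ir near_complete by blast
qed

text \<open>If a spike sits at the rounded abscissa, the witness is \<open>y\<close> clipped to that
  spike; otherwise it is the arc point over \<open>x\<close> clipped to the unit interval. Rounding
  to multiples of 32 and truncation make up 17 units, that is \<open>17 / 16 * r\<close>; the test
  itself guarantees \<open>v + 23\<close> units vertically.\<close>

lemma probe_sound:
 assumes "in_range sx N \<xi>" "nearby sy \<upsilon> Q (20 + v)"
 shows "\<not> setdist_e (x, y) (shape T) > ereal (2 * r)"
proof -
 \<comment> \<open>The offsets are compatible with \<open>2 * r\<close> since the squares of 17/16
   and 3/2 have sum 865/256, which is below 4.\<close>
 have dd: "\<not> setdist_e (x, y) (shape T) > ereal (2 * r)" if "(c, z) \<in> shape T" "\<bar>x - c\<bar> <= 17 / 16 * r" "\<bar>y - z\<bar> <= 3 / 2 * r" for c z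
 proof -
  have "(x - c)\<^sup>2 <= (17 / 16 * r)\<^sup>2" "(y - z)\<^sup>2 <= (3 / 2 * r)\<^sup>2"
   using power_mono[OF that(2), of 2] power_mono[OF that(3), of 2] by (simp_all only: power2_abs abs_ge_zero simp_thms)
  moreover have "(17 / 16 * r)\<^sup>2 = 289 / 256 * r\<^sup>2" "(3 / 2 * r)\<^sup>2 = 9 / 4 * r\<^sup>2" "(2 * r)\<^sup>2 = 4 * r\<^sup>2" "0 <= r\<^sup>2" by (simp_all add: power_mult_distrib power_divide)
  ultimately have "(x - c)\<^sup>2 + (y - z)\<^sup>2 <= (2 * r)\<^sup>2" by linarith
  then have "dist (x, y) (c, z) <= sqrt ((2 * r)\<^sup>2)" unfolding dist_prod_def dist_real_def fst_conv snd_conv power2_abs by (rule real_sqrt_le_mono)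
  also have "\<dots> = 2 * r" using P(3) by (simp only: real_sqrt_abs)
  finally show ?thesis using setdist_le[OF that(1)] by blast
 qed
 have b: "\<bar>y - x\<^sup>2 / 64\<bar> * P <= real v + 23" using near_sound[OF assms] by simp
 have unscale: "\<bar>z\<bar> <= w / 16 * r" if "\<bar>z\<bar> * P <= w" for z w
 proof -
  have "(w / 16 * r) * P = w" unfolding mult.assoc P(2) by simp
  then have "\<bar>z\<bar> * P <= (w / 16 * r) * P" using that by (simp only:)
  then show ?thesis by (rule mult_right_le_imp_le) simp
 qed
 show ?thesis
 proof (cases "\<exists>e w. (e, w) \<in> T \<and> spike_x e w * 2 ^ N = 32 * real ((\<xi> + 16) div 32)")
  case True
  then obtain e w where e: "(e, w) \<in> T" "spike_x e w * P = 32 * real ((\<xi> + 16) div 32)" "v = 2 ^ N div 2 ^ (2 * length e + 10)"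
   using v unfolding hw_spec_def by blast
  define X where "X = spike_x e w"
  have X: "0 < X" "X <= 1"
  proof -
   have "(0::real) < 1 / 2 ^ length e / 2" by simp
   then show "0 < X" unfolding X_def using spike_x_lower(1)[of e w] by linarith
  qed (simp add: X_def spike_x_lower)
  \<comment> \<open>Spikes have positive abscissa, so \<open>\<xi>\<close> is at least 16, which the
    range test rejects for a negative sign. Thus \<open>x\<close> is on the same side as the
    spike.\<close>
  have "(\<xi> + 16) div 32 ~= 0"
  proof
   assume "(\<xi> + 16) div 32 = 0"
   then have "spike_x e w * P = 0" using e(2) by (simp only: of_nat_0 mult_zero_right)
   then show False using X(1) unfolding X_def by simp
  qed
  then have "16 <= \<xi>" by (simp add: div_eq_0_iff)
  then have pl: "sx ~= SMinus" using assms(1) unfolding in_range_def by auto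
  then have xp: "x = \<bar>x\<bar>" using x(1) by simp
  have "32 * ((\<xi> + 16) div 32) <= \<xi> + 16" "\<xi> + 16 < 32 * ((\<xi> + 16) div 32) + 32" by linarith+
  then have "real (32 * ((\<xi> + 16) div 32)) <= real (\<xi> + 16)" "real (\<xi> + 16) < real (32 * ((\<xi> + 16) div 32) + 32)" by (simp_all only: of_nat_le_iff of_nat_less_iff)
  then have "X * P <= real \<xi> + 16" "real \<xi> < X * P + 16" using e(2) unfolding X_def by simp_all
  then have "\<bar>x * P - X * P\<bar> <= 17" using x(2,3) xp by simp
  then have "\<bar>x - X\<bar> * P <= 17" unfolding left_diff_distrib[symmetric] abs_mult by simp
  then have xX: "\<bar>x - X\<bar> <= 17 / 16 * r" by (rule unscale)
  have "\<bar>x\<bar> * P < P + 16"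
  proof -
   have "real \<xi> <= real (2 ^ N + 15)" using range_upper[OF assms(1)] by (simp only: of_nat_le_iff)
   then show ?thesis using x(3) by simp
  qed
  then have "\<bar>x\<bar> * P <= 2 * P" using P(1) by linarith
  then have x2: "\<bar>x\<bar> <= 2" by (rule mult_right_le_imp_le) simp
  have sd: "\<bar>x\<^sup>2 / 64 - X\<^sup>2 / 64\<bar> <= 3 / 64 * \<bar>x - X\<bar>" using X by (intro square_diff[OF x2]) auto
  define h where "h = spike_h e"
  have vh: "real v <= h * P" using div_real(1)[of "2 ^ N" "2 * length e + 10"] e(3) unfolding h_def spike_h_def by (simp add: power_divide)
  have h0: "0 <= h" unfolding h_def spike_h_def by simp
  have yx: "\<bar>y - x\<^sup>2 / 64\<bar> <= 23 / 16 * r + h"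
  proof -
   have "(23 / 16 * r + h) * P = 23 + h * P" unfolding distrib_right mult.assoc P(2) by simp
   then have "\<bar>y - x\<^sup>2 / 64\<bar> * P <= (23 / 16 * r + h) * P" using b vh by linarith
   then show ?thesis by (rule mult_right_le_imp_le) simp
  qed
  define z where "z = max (X\<^sup>2 / 64 - h) (min (X\<^sup>2 / 64 + h) y)"
  have "\<bar>z - X\<^sup>2 / 64\<bar> <= h" unfolding z_def using h0 by (auto simp: max_def min_def abs_le_iff)
  then have "(X, z) \<in> spike (e, w)" unfolding spike_def X_def h_def by auto
  then have z: "(X, z) \<in> shape T" unfolding shape_def using e(1) by blast
  have "\<bar>y - X\<^sup>2 / 64\<bar> <= \<bar>y - x\<^sup>2 / 64\<bar> + \<bar>x\<^sup>2 / 64 - X\<^sup>2 / 64\<bar>" by linarith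
  then have "\<bar>y - X\<^sup>2 / 64\<bar> <= 3 / 2 * r + h" by (rule error_budget[OF _ yx sd xX P(3)])
  then have "\<bar>y - z\<bar> <= 3 / 2 * r" unfolding z_def max_def min_def using P(3) h0 by (auto simp: abs_le_iff)
  then show ?thesis using dd[OF z xX] by blast
 next
  case False
  then have v0: "v = 0" using v unfolding hw_spec_def by blast
  define c where "c = max 0 (min 1 x)"
  have c: "0 <= c" "c <= 1" by (auto simp: c_def)
  have xc: "\<bar>x - c\<bar> <= r"
  proof (cases "sx = SMinus")
   case True
   then have "c = 0" "\<xi> <= 15" using x(1) assms(1) by (auto simp: c_def in_range_def)
   then have "real \<xi> <= real 15" by (simp only: of_nat_le_iff)
   then have "\<bar>x - c\<bar> * P <= 16" using x(3) \<open>c = 0\<close> by simp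
   then show ?thesis using unscale[of "x - c" 16] by simp
  next
   case xs: False
   then have xp: "x = \<bar>x\<bar>" using x(1) by simp
   have "real \<xi> <= real (2 ^ N + 15)" using range_upper[OF assms(1)] by (simp only: of_nat_le_iff)
   moreover have "(1 + r) * P = P + 16" unfolding distrib_right P(2) by simp
   ultimately have "\<bar>x\<bar> * P < (1 + r) * P" using x(3) by simp
   then have "\<bar>x\<bar> < 1 + r" by (rule mult_right_less_imp_less) simp
   then show ?thesis using xp P(3) by (auto simp: c_def max_def min_def)
  qed
  have x2: "\<bar>x\<bar> <= 2" using xc c P(4) by linarith
  have sd: "\<bar>x\<^sup>2 / 64 - c\<^sup>2 / 64\<bar> <= 3 / 64 * \<bar>x - c\<bar>" by (rule square_diff[OF x2 c])
  have yx: "\<bar>y - x\<^sup>2 / 64\<bar> <= 23 / 16 * r + 0" unfolding add_0_right by (rule unscale) (use b v0 in simp)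
  have xc': "\<bar>x - c\<bar> <= 17 / 16 * r" using xc P(3) by linarith
  have "\<bar>y - c\<^sup>2 / 64\<bar> <= \<bar>y - x\<^sup>2 / 64\<bar> + \<bar>x\<^sup>2 / 64 - c\<^sup>2 / 64\<bar>" by linarith
  then have "\<bar>y - c\<^sup>2 / 64\<bar> <= 3 / 2 * r" using error_budget[OF _ yx sd xc' P(3)] by simp
  moreover have "(c, c\<^sup>2 / 64) \<in> shape T" unfolding shape_def arc_def using c by blast
  ultimately show ?thesis using dd xc' by blast
 qed
qed

end

subsection \<open>Decoding a spike\<close>

abbreviation marks :: "cell list => nat" where "marks ls \<equiv> length (filter (%x. x = None) ls)"
abbreviation syms :: "cell list => word" where "syms ls \<equiv> map the (filter (%x. x ~= None) ls)"

type_synonym pstate = "nat \<times> cell list \<times> nat \<times> word \<times> nat"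

definition letter :: "word => cell option" where
 "letter b = (if b = lcode None then Some None else if b = lcode (Some S0) then Some (Some S0) else if b = lcode (Some S1) then Some (Some S1)
   else if b = lcode (Some SPlus) then Some (Some SPlus) else if b = lcode (Some SMinus) then Some (Some SMinus)
   else if b = lcode (Some SSlash) then Some (Some SSlash) else None)"

text \<open>Phase 0 reads letters, 1 and 2 expect the blocks 100 and 000 after the code word, 3
  takes \<open>k\<close> blocks of choices and then only zeros, and 4 is failure. The counter
  \<open>h\<close> includes the end block, so the code word has \<open>3 * h\<close> digits.\<close>

definition dstep :: "word => pstate => pstate" where
 "dstep b = (%(p, ls, k, w, h).
   if p = 0 then (case letter b of Some x => (0, x # ls, if x = None then Suc k else k, w, Suc h)
    | None => (if b = [S1, S1, S0] then 1 else 4, ls, k, w, Suc h))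
   else if p = 1 then (if b = [S1, S0, S0] then 2 else 4, ls, k, w, h)
   else if p = 2 then (if b = [S0, S0, S0] then 3 else 4, ls, k, w, h)
   else if p = 3 then (if k = 0 then (if b = [S0, S0, S0] then 3 else 4, ls, k, w, h) else (3, ls, k - 1, rev b @ w, h))
   else (4, ls, k, w, h))"

definition dinv :: "pstate => word => bool" where
 "dinv = (%(p, ls, k, w, h) d. p <= 4 \<and> (p < 3 \<longrightarrow> k = marks ls \<and> w = []) \<and> (p ~= 0 \<and> p ~= 4 \<longrightarrow> h = Suc (length ls)) \<and>
   (p = 0 \<longrightarrow> h = length ls \<and> d = concat (map lcode (rev ls))) \<and> (p = 1 \<longrightarrow> d = cwd (rev ls)) \<and> (p = 2 \<longrightarrow> d = cwd (rev ls) @ [S1, S0, S0]) \<and>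
   (p = 3 \<longrightarrow> (\<exists>j. d = cwd (rev ls) @ [S1, S0, S0, S0, S0, S0] @ rev w @ replicate j S0 \<and> (k > 0 \<longrightarrow> j = 0)) \<and> length w + 3 * k = 3 * marks ls \<and> bits w))"

lemma letter_Some: "letter b = Some x ==> b = lcode x" by (auto simp: letter_def split: if_splits)
lemma letter_lcode [simp]: "letter (lcode x) = Some x"
 by (cases x) (auto simp: letter_def split: sym.splits)
lemma letter_end [simp]: "letter [S1, S1, S0] = None" by (simp add: letter_def)

lemma rep3: "replicate j S0 @ [S0, S0, S0] = replicate (j + 3) S0"
 by (induction j) (auto simp: numeral_eq_Suc)

lemma dinv_step: "dinv s d ==> bits b ==> length b = 3 ==> dinv (dstep b s) (d @ b)"
proof -
 assume i: "dinv s d" and b: "bits b" "length b = 3"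
 obtain p ls k w h where s: "s = (p, ls, k, w, h)" by (cases s)
 have p: "p <= 4" using i by (simp add: s dinv_def)
 then consider "p = 0" | "p = 1" | "p = 2" | "p = 3" | "p = 4" by linarith
 then show ?thesis
 proof cases
  case 1
  then show ?thesis using i unfolding s dinv_def dstep_def
   by (cases "letter b") (auto simp: cwd_def dest: letter_Some)
 next
  case 2
  then show ?thesis using i unfolding s dinv_def dstep_def by auto
 next
  case 3
  then show ?thesis using i unfolding s dinv_def dstep_def by (auto simp: bits_def intro!: exI[of _ 0])
 next
  case 4
  then obtain j where j: "d = cwd (rev ls) @ [S1, S0, S0, S0, S0, S0] @ rev w @ replicate j S0" "k > 0 \<longrightarrow> j = 0" "length w + 3 * k = 3 * marks ls" "bits w" "h = Suc (length ls)"
   using i unfolding s dinv_def by auto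
  show ?thesis
  proof (cases "k = 0")
   case True
   then show ?thesis using 4 j unfolding s dinv_def dstep_def by (auto simp: rep3 intro!: exI[of _ "j + 3"])
  next
   case False
   then have "length (rev b @ w) + 3 * (k - 1) = 3 * marks ls" "bits (rev b @ w)" using j b by (auto simp: bits_def)
   moreover have "d @ b = cwd (rev ls) @ [S1, S0, S0, S0, S0, S0] @ rev (rev b @ w) @ replicate 0 S0" using j False by simp
   ultimately show ?thesis using 4 False j unfolding s dinv_def dstep_def by auto
  qed
 next
  case 5
  then show ?thesis using i unfolding s dinv_def dstep_def by auto
 qed
qed

lemma dinv_fold: "dinv s d ==> \<forall>b\<in>set bs. bits b \<and> length b = 3 ==> dinv (fold dstep bs s) (d @ concat bs)"
proof (induction bs arbitrary: s d)
 case (Cons b bs)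
 then have "dinv (dstep b s) (d @ b)" by (intro dinv_step) auto
 from Cons.IH[OF this] Cons.prems(2) show ?case by simp
qed simp

lemma fold_letters: "fold dstep (map lcode ls) (0, ls0, k, w, h) = (0, rev ls @ ls0, k + marks ls, w, h + length ls)"
 by (induction ls arbitrary: ls0 k h) (auto simp: dstep_def)

lemma fold_choices: "\<forall>b\<in>set bs. length b = 3 ==> fold dstep bs (3, ls, length bs, w, h) = (3, ls, 0, rev (concat bs) @ w, h)"
 by (induction bs arbitrary: w) (auto simp: dstep_def)

lemma fold_tail: "fold dstep (replicate j [S0, S0, S0]) (3, ls, 0, w, h) = (3, ls, 0, w, h)"
 by (induction j) (auto simp: dstep_def simp del: fold_replicate)

lemma blocks_exist: "length w = 3 * m ==> \<exists>bs. concat bs = w \<and> length bs = m \<and> (\<forall>b\<in>set bs. length b = 3)"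
proof (induction m arbitrary: w)
 case (Suc m)
 have "length (drop 3 w) = 3 * m" using Suc.prems by simp
 from Suc.IH[OF this] obtain bs where "concat bs = drop 3 w" "length bs = m" "\<forall>b\<in>set bs. length b = 3" by blast
 then show ?case using Suc.prems by (intro exI[of _ "take 3 w # bs"]) auto
qed auto

lemma blocks_unique: "concat xs = concat ys ==> \<forall>b\<in>set xs. length b = 3 ==> \<forall>b\<in>set ys. length b = 3 ==> xs = ys"
proof (induction xs arbitrary: ys)
 case Nil
 then show ?case by (cases ys) auto
next
 case (Cons x xs)
 then obtain y ys' where ys: "ys = y # ys'" by (cases ys) auto
 have "x = y \<and> concat xs = concat ys'" using Cons.prems ys append_eq_append_conv[of x y "concat xs" "concat ys'"] by auto
 then show ?case using Cons.IH[of ys'] Cons.prems ys by auto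
qed

text \<open>The padding is a multiple of three long because everything before it is, so the word
  splits into blocks in exactly one way, and these blocks take the decoder through its
  phases.\<close>

lemma decode_complete:
 assumes "concat bs = cwd ls @ [S1, S0, S0, S0, S0, S0] @ w @ replicate j S0" "\<forall>b\<in>set bs. length b = 3" "length w = 3 * marks ls"
 shows "fold dstep bs (0, [], 0, [], 0) = (3, rev ls, 0, rev w, Suc (length ls))"
proof -
 have l3: "length (concat bs) = 3 * length bs" using assms(2) by (induction bs) auto
 have "3 * length bs = 3 * length ls + 3 + 6 + 3 * marks ls + j" using l3 assms(1,3) by simp
 then have "3 dvd j" by presburger
 then obtain i where i: "j = 3 * i" by blast
 obtain ws where ws: "concat ws = w" "length ws = marks ls" "\<forall>b\<in>set ws. length b = 3" using blocks_exist[OF assms(3)] by blast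
 have z: "concat (replicate i [S0, S0, S0]) = replicate (3 * i) S0" by (induction i) (auto simp: numeral_eq_Suc)
 let ?bs = "map lcode ls @ [[S1, S1, S0], [S1, S0, S0], [S0, S0, S0]] @ ws @ replicate i [S0, S0, S0]"
 have "concat ?bs = concat bs" unfolding assms(1) cwd_def i using ws(1) z by simp
 then have bs: "bs = ?bs" using ws(3) assms(2) by (intro blocks_unique) auto
 have c: "fold dstep ws (3, rev ls, marks ls, [], Suc (length ls)) = (3, rev ls, 0, rev w, Suc (length ls))"
  using fold_choices[OF ws(3), of "rev ls" "[]" "Suc (length ls)"] ws(1,2) by simp
 show ?thesis unfolding bs fold_append o_apply fold_letters
  by (simp add: dstep_def[of "[S1, S1, S0]"] dstep_def[of "[S1, S0, S0]"] dstep_def[of "[S0, S0, S0]"] c fold_tail del: fold_replicate)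
qed

subsection \<open>The program recognising the spiked parabola\<close>

definition RangeTest :: com where
 "RangeTest = Dup 5 13 23 ;; Case 4 (%a. if a = Some SMinus then PushW 24 [S1, S1, S1, S1]
   else Push 24 S1 ;; Each 10 13 (%_. Push 24 S0) ;; PushW 24 [S1, S1, S1, S1]) ;; Cmp 23 24 25 ;; Check"

lemma sem_RangeTest:
 assumes "ss 4 = [s]" "ss 10 = replicate n S1" and e: "\<And>j. j \<in> {13, 23, 24, 25} ==> ss j = []"
 shows "sem f RangeTest (ss, q) = (ss(4 := [], 22 := (if in_range s (n + 4) (val (ss 5)) then [] else [S1]) @ ss 22), q)"
proof -
 have e': "ss 13 = []" "ss 23 = []" "ss 24 = []" "ss 25 = []" by (rule e; simp)+
 let ?b = "if s = SMinus then [S1, S1, S1, S1] else [S1, S1, S1, S1] @ replicate n S0 @ [S1]"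
 have v: "val ?b = (if s = SMinus then 15 else 2 ^ (n + 4) + 15)" by (simp add: val_append power_add)
 have c: "sem f (Dup 5 13 23 ;; Case 4 (%a. if a = Some SMinus then PushW 24 [S1, S1, S1, S1]
   else Push 24 S1 ;; Each 10 13 (%_. Push 24 S0) ;; PushW 24 [S1, S1, S1, S1])) (ss, q) = (ss(4 := [], 23 := ss 5, 24 := ?b), q)"
  using assms(1,2) e' by (auto simp: fun_eq_iff simp del: PushW.simps)
 let ?ss = "ss(4 := [], 23 := ss 5, 24 := ?b)"
 have m: "sem f (Cmp 23 24 25) (?ss, q) = (?ss(23 := [], 24 := [], 25 := flag (val (ss 5) <= val ?b)), q)"
  using e' by (subst sem_Cmp) simp_all
 have r: "in_range s (n + 4) (val (ss 5)) \<longleftrightarrow> val (ss 5) <= val ?b" unfolding in_range_def v by simp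
 have "sem f RangeTest (ss, q) = sem f Check (sem f (Cmp 23 24 25) (sem f (Dup 5 13 23 ;; Case 4 (%a. if a = Some SMinus then PushW 24 [S1, S1, S1, S1]
   else Push 24 S1 ;; Each 10 13 (%_. Push 24 S0) ;; PushW 24 [S1, S1, S1, S1])) (ss, q)))" unfolding RangeTest_def by simp
 also have "\<dots> = (ss(4 := [], 22 := (if val (ss 5) <= val ?b then [] else [S1]) @ ss 22), q)"
  unfolding c m Check_def flag_def using e' by (auto simp: fun_eq_iff)
 finally show ?thesis unfolding r .
qed

primrec ld :: "nat => word => word" where
 "ld 0 w = []" | "ld (Suc k) w = (if hb w then S1 else S0) # ld k (tl w)"

lemma length_ld [simp]: "length (ld k w) = k" by (induction k arbitrary: w) auto
lemma bits_ld: "bits (ld k w)" by (induction k arbitrary: w) (auto simp: bits_def)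
lemma val_ld: "val (ld k w) = val w mod 2 ^ k"
proof (induction k arbitrary: w)
 case (Suc k)
 have h: "val w = (if hb w then 1 else 0) + 2 * val (tl w)" by (rule val_hb)
 then have "val w div 2 = val (tl w)" "val w mod 2 = (if hb w then 1 else 0)" by (simp_all split: if_splits)
 then have "val w mod 2 ^ Suc k = (if hb w then 1 else 0) + 2 * (val (tl w) mod 2 ^ k)"
  using mod_mult2_eq[of "val w" 2 "2 ^ k"] by (simp only: power_Suc add.commute)
 then show ?case using Suc by simp
qed simp

text \<open>Adding 16 and dropping five digits rounds to the nearest multiple of 32. The lowest
  \<open>n - 1\<close> digits become the binary fraction on stack 30, most significant first; a
  nonzero digit beyond them means an abscissa of at least 1 and is recorded as a failure on stack
  32.\<close>

definition Digits :: com where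
 "Digits = Each 5 13 (%_. Push 23 S0) ;; PushW 23 [S0, S0, S0, S0, S1, S0] ;; AddTo 23 5 14 15 16 ;; PopN 23 5 ;;
   Dup 10 13 31 ;; Pop 31 ;; For 31 (%_. Case 23 (%x. Push 30 (if x = Some S1 then S1 else S0))) ;;
   For 23 (%a. if a = S1 then Push 32 S1 else Skip)"

lemma fold_ld: "fold (%_. sem f (Case 23 (%x. Push 30 (if x = Some S1 then S1 else S0)))) v (ss, q) =
  (ss(30 := rev (ld (length v) (ss 23)) @ ss 30, 23 := drop (length v) (ss 23)), q)"
proof (induction v arbitrary: ss)
 case (Cons a v)
 have 1: "sem f (Case 23 (%x. Push 30 (if x = Some S1 then S1 else S0))) (ss, q) =
   (ss(23 := tl (ss 23), 30 := (if hb (ss 23) then S1 else S0) # ss 30), q)"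
  by (cases "ss 23") (auto simp: hb_def fun_upd_idem)
 show ?case unfolding fold.simps o_apply 1 Cons.IH by (simp add: fun_eq_iff drop_Suc)
qed simp

lemma fold_rest: "fold (%a. sem f (if a = S1 then Push 32 S1 else Skip)) v (ss, q) = (ss(32 := replicate (cnt v) S1 @ ss 32), q)"
 by (induction v arbitrary: ss) (auto simp: replicate_app_Cons_same)

lemma cnt_val: "cnt w = 0 \<longleftrightarrow> val w = 0" by (induction w) auto

lemma sem_Digits:
 assumes "ss 10 = replicate n S1" and e: "\<And>j. j \<in> {13, 14, 15, 16, 23, 30, 31, 32} ==> ss j = []"
 defines "J \<equiv> (val (ss 5) + 16) div 32"
 shows "\<exists>d z. sem f Digits (ss, q) = (ss(30 := d, 32 := z), q) \<and> bits d \<and> length d = n - 1 \<and>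
  bin_val d = J mod 2 ^ (n - 1) \<and> (z = [] \<longleftrightarrow> J < 2 ^ (n - 1))"
proof -
 have e': "ss 13 = []" "ss 14 = []" "ss 15 = []" "ss 16 = []" "ss 23 = []" "ss 30 = []" "ss 31 = []" "ss 32 = []" by (rule e; simp)+
 let ?i = "[S0, S0, S0, S0, S1, S0] @ replicate (length (ss 5)) S0"
 define a where "a = drop 5 (addw ?i (ss 5) False)"
 have "val (ss 5) < 2 ^ length (ss 5)" by (rule val_lt)
 then have "val ?i + val (ss 5) < 2 ^ length ?i" by (simp add: val_append)
 then have va: "val a = J" unfolding a_def J_def val_drop by (subst val_addw) (simp_all add: val_append add.commute)
 let ?ss1 = "ss(23 := a, 31 := replicate (n - 1) S1)"
 have 1: "sem f Digits (ss, q) = sem f (For 31 (%_. Case 23 (%x. Push 30 (if x = Some S1 then S1 else S0))) ;;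
   For 23 (%a. if a = S1 then Push 32 S1 else Skip)) (?ss1, q)"
  unfolding Digits_def a_def using e' assms(1) by (simp add: fun_upd_twist del: sem.simps(5) PushW.simps addw.simps)
 let ?d = "rev (ld (n - 1) a)" let ?r = "drop (n - 1) a"
 have 2: "sem f (For 31 (%_. Case 23 (%x. Push 30 (if x = Some S1 then S1 else S0)))) (?ss1, q) = (ss(30 := ?d, 23 := ?r), q)"
  by (subst sem_For) (use e' in \<open>simp_all add: fold_ld fun_eq_iff del: fold_replicate\<close>)
 have 3: "sem f (For 23 (%a. if a = S1 then Push 32 S1 else Skip)) (ss(30 := ?d, 23 := ?r), q) = (ss(30 := ?d, 32 := replicate (cnt ?r) S1), q)"
  by (subst sem_For) (use e' in \<open>simp_all add: fold_rest fun_eq_iff\<close>)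
 have "cnt ?r = 0 \<longleftrightarrow> J < 2 ^ (n - 1)" unfolding cnt_val val_drop va by (simp add: div_eq_0_iff)
 then show ?thesis unfolding 1 sem.simps(3) 2 3 using bits_ld[of "n - 1" a]
  by (intro exI[of _ ?d] exI[of _ "replicate (cnt ?r) S1"]) (auto simp: bin_val_val val_ld va bits_def)
qed

text \<open>An exhausted digit stack yields zeros, so the fraction is read as if padded.\<close>

definition Bit :: "(sym => com) => com" where "Bit F = Case 30 (%x. F (if x = Some S1 then S1 else S0))"

text \<open>Stack 39 carries the height of the spike. A block of the code word makes
  \<open>e\<close> three digits longer and so divides the height by \<open>2 ^ 6\<close>, hence the
  six pops.\<close>

definition dact :: "nat => word => com" where
 "dact p b = (if p = 0 then PopN 39 6 ;; (case letter b of Some x => (case x of None => Push 36 S1 ;; Push 37 S1 | Some a => Push 35 a)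
    | None => PushW 33 (replicate (if b = [S1, S1, S0] then 1 else 4) S1))
   else if p = 1 then PushW 33 (replicate (if b = [S1, S0, S0] then 2 else 4) S1)
   else if p = 2 then PushW 33 (replicate (if b = [S0, S0, S0] then 3 else 4) S1)
   else if p = 3 then Case 37 (%x. if x = None then PushW 33 (replicate (if b = [S0, S0, S0] then 3 else 4) S1)
    else PushW 33 (replicate 3 S1) ;; PushW 45 (rev b))
   else PushW 33 (replicate 4 S1))"

definition Block :: com where
 "Block = Bit (%a. Bit (%b. Bit (%c. CaseN 33 4 (%p. dact p [a, b, c]))))"

definition dstore :: "pstate => word => word => (nat => word) => nat => word" where
 "dstore = (%(p, ls, k, w, h) d H ss. ss(30 := d, 33 := replicate p S1, 35 := syms ls, 36 := replicate (marks ls) S1, 37 := replicate k S1, 39 := drop (6 * h) H, 45 := w))"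

text \<open>A decodable position has \<open>length e\<close> at most \<open>n - 2\<close>, thus at
  most \<open>2 * n - 1\<close> digits, so \<open>n\<close> blocks of three digits cover it.\<close>

primrec bl :: "nat => word => word list" where
 "bl 0 d = []" | "bl (Suc n) d = take 3 (d @ [S0, S0, S0]) # bl n (drop 3 d)"

lemma concat_bl: "length d <= 3 * n ==> concat (bl n d) = d @ replicate (3 * n - length d) S0"
proof (induction n arbitrary: d)
 case (Suc n)
 have "concat (bl n (drop 3 d)) = drop 3 d @ replicate (3 * n - length (drop 3 d)) S0" using Suc.prems by (intro Suc.IH) simp
 moreover have "take 3 (d @ [S0, S0, S0]) @ drop 3 d @ replicate (3 * n - length (drop 3 d)) S0 = d @ replicate (3 * Suc n - length d) S0"
 proof (cases "length d \<ge> 3")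
  case True
  then show ?thesis by (simp add: append_assoc[symmetric] del: append_assoc)
 next
  case False
  then consider "length d = 0" | "length d = 1" | "length d = 2" by linarith
  then show ?thesis by cases (auto simp: numeral_eq_Suc)
 qed
 ultimately show ?case by simp
qed simp

lemma bl_bits: "bits d ==> b \<in> set (bl n d) ==> bits b \<and> length b = 3"
proof (induction n arbitrary: d)
 case (Suc n)
 have "bits (drop 3 d)" using Suc.prems(1) by (auto simp: bits_def dest: in_set_dropD)
 moreover have "bits (take 3 (d @ [S0, S0, S0]))" using Suc.prems(1) by (auto simp: bits_def dest: in_set_takeD)
 ultimately show ?case using Suc by auto
qed simp

lemma sem_Bit: "set d \<subseteq> {S0, S1} ==> ss 30 = d ==> sem f (Bit F) (ss, q) = sem f (F (hd (d @ [S0]))) (ss(30 := tl d), q)"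
 by (cases d) (auto simp: Bit_def fun_upd_idem)

lemma sem_Block:
 assumes d: "bits d" and s: "s = (p, ls, k, w, h)" "p <= 4"
 shows "sem f Block (dstore s d H ss, q) = (dstore (dstep (take 3 (d @ [S0, S0, S0])) s) (drop 3 d) H ss, q)"
proof -
 let ?ss = "dstore s d H ss"
 define a b c where "a = hd (d @ [S0])" and "b = hd (tl d @ [S0])" and "c = hd (tl (tl d) @ [S0])"
 have t3: "take 3 (d @ [S0, S0, S0]) = [a, b, c]" unfolding a_def b_def c_def
  by (cases d; cases "tl d"; cases "tl (tl d)") (auto simp: numeral_eq_Suc)
 have d3: "drop 3 d = tl (tl (tl d))" by (simp add: numeral_eq_Suc drop_Suc)
 have bt: "set d \<subseteq> {S0, S1}" "set (tl d) \<subseteq> {S0, S1}" "set (tl (tl d)) \<subseteq> {S0, S1}" using d unfolding bits_def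
  by (cases d; cases "tl d"; auto)+
 let ?\<tau> = "?ss(30 := tl (tl (tl d)))"
 have 30: "?ss 30 = d" by (simp add: dstore_def s)
 have "sem f Block (?ss, q) = sem f (CaseN 33 4 (%p. dact p [a, b, c])) (?\<tau>, q)"
  unfolding Block_def sem_Bit[where ss = ?ss, OF bt(1) 30]
   sem_Bit[where ss = "?ss(30 := tl d)", OF bt(2) fun_upd_same] sem_Bit[where ss = "?ss(30 := tl d, 30 := tl (tl d))", OF bt(3) fun_upd_same]
  by (simp only: a_def b_def c_def fun_upd_upd)
 also have "\<dots> = sem f (dact (length (?\<tau> 33)) [a, b, c]) (?\<tau>(33 := []), q)"
  by (rule sem_CaseN) (use s in \<open>simp add: dstore_def\<close>)
 also have "length (?\<tau> 33) = p" by (simp add: dstore_def s)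
 also have "sem f (dact p [a, b, c]) (?\<tau>(33 := []), q) = (dstore (dstep [a, b, c] s) (tl (tl (tl d))) H ss, q)"
 proof -
  consider "p = 0" | "p = 1" | "p = 2" | "p = 3" | "p = 4" using s(2) by linarith
  then show ?thesis
  proof cases
   case 1
   show ?thesis
   proof (cases "letter [a, b, c]")
    case None
    then show ?thesis using 1 unfolding s dstep_def dstore_def dact_def
     by (auto simp: fun_eq_iff add.commute simp del: PushW.simps PopN.simps)
   next
    case (Some x)
    then show ?thesis using 1 unfolding s dstep_def dstore_def dact_def
     by (cases x) (auto simp: fun_eq_iff add.commute simp del: PushW.simps PopN.simps)
   qed
  next
   case 4
   then show ?thesis unfolding s dstep_def dstore_def dact_def
    by (cases k) (auto simp: fun_eq_iff simp del: PushW.simps)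
  qed (auto simp: s dstep_def dstore_def dact_def fun_eq_iff simp del: PushW.simps)
 qed
 finally show ?thesis unfolding t3 d3 .
qed

lemma fold_Block:
 assumes "bits d" "dinv s d0"
 shows "fold (%_. sem f Block) v (dstore s d H ss, q) = (dstore (fold dstep (bl (length v) d) s) (drop (3 * length v) d) H ss, q)"
 using assms
proof (induction v arbitrary: d s d0)
 case (Cons a v)
 obtain p ls k w h where s: "s = (p, ls, k, w, h)" by (cases s)
 have p: "p <= 4" using Cons.prems(2) by (simp add: s dinv_def)
 let ?b = "take 3 (d @ [S0, S0, S0])"
 have b: "bits ?b" "length ?b = 3" using Cons.prems(1) by (auto simp: bits_def dest: in_set_takeD)
 have d: "bits (drop 3 d)" using Cons.prems(1) by (auto simp: bits_def dest: in_set_dropD)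
 show ?case unfolding fold.simps o_apply sem_Block[OF Cons.prems(1) s p] Cons.IH[OF d dinv_step[OF Cons.prems(2) b]]
  by (simp add: add.commute)
qed (simp add: dstore_def)

text \<open>The variant of \<open>Wide\<close> and \<open>Near\<close> in which the tolerance is a
  computed number, on stack 26.\<close>

definition WideV :: com where
 "WideV = Each 8 13 (%_. Push 23 S0) ;; Each 17 13 (%_. Push 23 S0) ;; Dup 26 13 23"

definition NearV :: com where
 "NearV = Case 7 (%a. if a = Some SMinus then
    Each 8 13 (%_. Push 23 S0) ;; Each 17 13 (%_. Push 23 S0) ;; Each 26 13 (%_. Push 23 S0) ;;
    AddTo 23 8 14 15 16 ;; AddTo 23 17 14 15 16 ;; Dup 26 13 24 ;; Cmp 23 24 25 ;; Check
   else WideV ;; AddTo 23 17 14 15 16 ;; Dup 8 13 24 ;; Cmp 24 23 25 ;; Check ;;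
    WideV ;; AddTo 23 8 14 15 16 ;; Dup 17 13 24 ;; Cmp 24 23 25 ;; Check)"

lemma sem_NearV:
 assumes e: "\<And>j. j \<in> {13, 14, 15, 16, 23, 24, 25} ==> ss j = []"
  and w: "val (ss 26) + 2 <= 2 ^ length (ss 26)" and sg: "ss 7 = [sg]"
 shows "\<exists>b. sem f NearV (ss, q) = (ss(7 := [], 22 := b @ ss 22), q) \<and> (b = [] \<longleftrightarrow> nearby sg (val (ss 8)) (val (ss 17)) (val (ss 26)))"
proof -
 have e': "ss 13 = []" "ss 14 = []" "ss 15 = []" "ss 16 = []" "ss 23 = []" "ss 24 = []" "ss 25 = []" by (rule e; simp)+
 have wd: "sem f WideV (\<tau>, q) = (\<tau>(23 := \<tau> 26 @ replicate (length (\<tau> 8) + length (\<tau> 17)) S0), q)" if "\<tau> 13 = []" "\<tau> 23 = []" for \<tau>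
  unfolding WideV_def using that by (simp add: replicate_add[symmetric] add.commute)
 have ad: "val (addw (v @ replicate (length a + length c) S0) a False) = val v + val a"
  "val (addw (v @ replicate (length a + length c) S0) c False) = val v + val c"
  "val (addw (addw (v @ replicate (length a + length c) S0) a False) c False) = val v + val a + val c"
  if "val v + 2 <= 2 ^ length v" for v a c
 proof -
  have l: "val v + val a + val c < 2 ^ (length v + length a + length c)" by (rule val_wide[OF that])
  then show 1: "val (addw (v @ replicate (length a + length c) S0) a False) = val v + val a"
   "val (addw (v @ replicate (length a + length c) S0) c False) = val v + val c"
   by (subst val_addw; simp add: val_append add.assoc)+
  show "val (addw (addw (v @ replicate (length a + length c) S0) a False) c False) = val v + val a + val c"
   using l by (subst val_addw) (simp_all add: 1 val_append add.assoc)
 qed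
 have ck: "sem f Check (\<tau>, q) = (\<tau>(25 := [], 22 := (if k then [] else [S1]) @ \<tau> 22), q)" if "\<tau> 25 = flag k" for \<tau> k
  using that by (cases k) (auto simp: Check_def flag_def fun_eq_iff)
 let ?z = "replicate (length (ss 26)) S0"
 have z: "val ?z + 2 <= 2 ^ length ?z" using w by simp
 let ?ss = "ss(7 := [])"
 show ?thesis
 proof (cases "sg = SMinus")
  case True
  let ?k = "val (ss 8) + val (ss 17) <= val (ss 26)"
  have rz: "replicate (length (ss 26)) S0 @ replicate (length (ss 17)) S0 @ replicate (length (ss 8)) S0 = ?z @ replicate (length (ss 8) + length (ss 17)) S0"
   by (simp add: replicate_add[symmetric] add.commute)
  have "sem f NearV (ss, q) = sem f (AddTo 23 8 14 15 16 ;; AddTo 23 17 14 15 16 ;; Dup 26 13 24 ;; Cmp 23 24 25 ;; Check)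
    (?ss(23 := ?z @ replicate (length (ss 8) + length (ss 17)) S0), q)"
   unfolding NearV_def using sg True e' by (simp add: rz)
  also have "\<dots> = (?ss(22 := (if ?k then [] else [S1]) @ ss 22), q)"
   using e' ad(3)[OF z, of "ss 8" "ss 17"] by (simp add: ck[where k = ?k] del: addw.simps, auto simp: fun_eq_iff)
  finally show ?thesis using True by (intro exI[of _ "if ?k then [] else [S1]"]) (simp add: nearby_def)
 next
  case False
  let ?k1 = "val (ss 8) <= val (ss 26) + val (ss 17)" let ?k2 = "val (ss 17) <= val (ss 26) + val (ss 8)"
  have "sem f NearV (ss, q) = sem f (WideV ;; AddTo 23 17 14 15 16 ;; Dup 8 13 24 ;; Cmp 24 23 25 ;; Check ;;
    WideV ;; AddTo 23 8 14 15 16 ;; Dup 17 13 24 ;; Cmp 24 23 25 ;; Check) (?ss, q)"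
   unfolding NearV_def using sg False by simp
  also have "\<dots> = (?ss(22 := (if ?k2 then [] else [S1]) @ (if ?k1 then [] else [S1]) @ ss 22), q)"
   using e' ad(1)[OF w, of "ss 8" "ss 17"] ad(2)[OF w, of "ss 8" "ss 17"]
   by (simp add: wd ck[where k = ?k1] ck[where k = ?k2] del: addw.simps, auto simp: fun_eq_iff)
  finally show ?thesis using False
   by (intro exI[of _ "(if ?k2 then [] else [S1]) @ (if ?k1 then [] else [S1])"]) (simp add: nearby_def)
 qed
qed

definition Arc :: com where
 "Arc = Sq 5 17 18 14 15 16 ;; Dup 12 13 23 ;; For 23 (%_. Pop 17) ;; PopN 17 6"

lemma sem_Arc:
 assumes "ss 12 = replicate N S1" and e: "\<And>j. j \<in> {13, 14, 15, 16, 17, 18, 23} ==> ss j = []"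
 shows "\<exists>a. sem f Arc (ss, q) = (ss(17 := a), q) \<and> val a = (val (ss 5))\<^sup>2 div 2 ^ (N + 6)"
proof -
 have e': "ss 13 = []" "ss 14 = []" "ss 15 = []" "ss 16 = []" "ss 17 = []" "ss 18 = []" "ss 23 = []" by (rule e; simp)+
 obtain v where v: "sem f (Sq 5 17 18 14 15 16) (ss, q) = (ss(17 := v), q)" "val v = (val (ss 5))\<^sup>2"
  using sem_Sq[of 5 17 18 14 15 16 ss f q] e' by auto
 have "sem f Arc (ss, q) = (ss(17 := drop 6 (drop N v)), q)"
  unfolding Arc_def sem.simps(3) v(1) using e' assms(1) by (simp add: sem_For_Pop del: sem.simps(5) PopN.simps) (auto simp: fun_eq_iff)
 then show ?thesis using v(2) by (intro exI[of _ "drop 6 (drop N v)"]) (simp add: val_drop div_mult2_eq power_add del: drop_drop)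
qed

lemma fold_input: "fold (%a. sem f (PushW 42 [S1, a])) v (ss, q) = (ss(42 := concat (map ccode (map Some (rev v))) @ ss 42), q)"
 by (induction v arbitrary: ss) (simp_all add: ccode_def)

context simulation
begin

definition Load :: com where
 "Load = For 35 (%a. PushW 42 [S1, a]) ;; Mv 45 38 ;; PushW 40 (replicate (start M) S1)"

text \<open>The digits pushed on stack 26 form the base tolerance 20, with enough zeros above for
  the sum. The height is added only if no failure has been recorded on stack 32: an abscissa out of
  range, a run that does not accept, or incomplete decoding.\<close>

definition Judge :: com where
 "Judge = CaseN 40 (nstates M) (%q. if q \<in> acc M then Skip else Push 32 S1) ;;
   CaseN 33 4 (%p. if p = 3 then Skip else Push 32 S1) ;; For 37 (%_. Push 32 S1) ;;
   Each 12 13 (%_. Push 26 S0) ;; PushW 26 [S0, S0, S1, S0, S1, S0, S0] ;;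
   Case 32 (%x. if x = None then AddTo 26 39 14 15 16 else Skip)"

text \<open>Stack 39 starts with \<open>2 ^ N div 2 ^ 10\<close>. The number of replayed steps is
  the number of marks found among the digits of the query, so the program is polynomial whatever the
  running time of the given machine is.\<close>

definition Tent :: com where
 "Tent = (Push 39 S1 ;; Each 12 13 (%_. Push 39 S0) ;; PopN 39 10 ;; Dup 10 13 34) ;; For 34 (%_. Block) ;; Load ;; For 36 (%_. SimStep) ;; Judge"

lemma sem_Judge:
 assumes "ss 40 = replicate a S1" "a <= nstates M" "ss 33 = replicate p S1" "p <= 4" "ss 37 = replicate k S1" "ss 12 = replicate N S1"
  "ss 32 = z" "val (ss 39) <= 2 ^ N" and e: "\<And>j. j \<in> {13, 14, 15, 16, 26} ==> ss j = []"
 defines "t \<equiv> z = [] \<and> a \<in> acc M \<and> p = 3 \<and> k = 0"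
 shows "\<exists>v z'. sem f Judge (ss, q) = (ss(40 := [], 33 := [], 37 := [], 26 := v, 32 := z'), q) \<and>
  val v = 20 + (if t then val (ss 39) else 0) \<and> val v + 2 <= 2 ^ length v"
proof -
 have e': "ss 13 = []" "ss 14 = []" "ss 15 = []" "ss 16 = []" "ss 26 = []" by (rule e; simp)+
 let ?z1 = "(if a \<in> acc M then [] else [S1]) @ z" let ?z2 = "(if p = 3 then [] else [S1]) @ ?z1" let ?z3 = "replicate k S1 @ ?z2"
 have 1: "sem f (CaseN 40 (nstates M) (%q. if q \<in> acc M then Skip else Push 32 S1)) (ss, q) = (ss(40 := [], 32 := ?z1), q)"
  by (subst sem_CaseN) (use assms(1,2,7) in \<open>auto simp: fun_eq_iff\<close>)
 have 2: "sem f (CaseN 33 4 (%p. if p = 3 then Skip else Push 32 S1)) (ss(40 := [], 32 := ?z1), q) = (ss(40 := [], 33 := [], 32 := ?z2), q)"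
  by (subst sem_CaseN) (use assms(3,4) in \<open>auto simp: fun_eq_iff\<close>)
 have 3: "sem f (For 37 (%_. Push 32 S1)) (ss(40 := [], 33 := [], 32 := ?z2), q) = (ss(40 := [], 33 := [], 37 := [], 32 := ?z3), q)"
  by (subst sem_For) (use assms(5) in \<open>auto simp: fold_const_push fun_eq_iff simp del: fold_replicate\<close>)
 let ?w = "[S0, S0, S1, S0, S1, S0, S0] @ replicate N S0"
 let ?\<tau> = "ss(40 := [], 33 := [], 37 := [], 32 := ?z3, 26 := ?w)"
 have 4: "sem f (Each 12 13 (%_. Push 26 S0) ;; PushW 26 [S0, S0, S1, S0, S1, S0, S0]) (ss(40 := [], 33 := [], 37 := [], 32 := ?z3), q) = (?\<tau>, q)"
  using e' assms(6) by (simp del: PushW.simps)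
 have w: "val ?w = 20" "length ?w = N + 7" by (simp_all add: val_append)
 have b: "val ?w + val (ss 39) < 2 ^ length ?w" "20 + val (ss 39) + 2 <= 2 ^ (N + 7)" "22 <= (2::nat) ^ (N + 7)"
 proof -
  have "(1::nat) <= 2 ^ N" by simp
  moreover have "(2::nat) ^ (N + 7) = 128 * 2 ^ N" by (simp add: power_add)
  ultimately show "val ?w + val (ss 39) < 2 ^ length ?w" "20 + val (ss 39) + 2 <= 2 ^ (N + 7)" "22 <= (2::nat) ^ (N + 7)" unfolding w using assms(8) by linarith+
 qed
 have J: "sem f Judge (ss, q) = sem f (Case 32 (%x. if x = None then AddTo 26 39 14 15 16 else Skip)) (?\<tau>, q)"
  unfolding Judge_def using 4 unfolding sem.simps(3) 1 2 3 by simp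
 show ?thesis
 proof (cases t)
  case True
  then have z3: "?z3 = []" unfolding t_def by simp
  have "sem f Judge (ss, q) = (ss(40 := [], 33 := [], 37 := [], 26 := addw ?w (ss 39) False, 32 := []), q)"
   unfolding J using z3 e' by (simp del: addw.simps add: fun_eq_iff)
  moreover have "val (addw ?w (ss 39) False) = 20 + val (ss 39)" using b(1) w(1) by (subst val_addw) auto
  moreover have "length (addw ?w (ss 39) False) = N + 7" using w(2) by (simp only: length_addw)
  ultimately show ?thesis using True b(2) by (simp only: if_True) metis
 next
  case False
  then obtain a' z' where z3: "?z3 = a' # z'" unfolding t_def by (cases ?z3) (auto split: if_splits)
  have "sem f Judge (ss, q) = (ss(40 := [], 33 := [], 37 := [], 26 := ?w, 32 := z'), q)"
   unfolding J z3 by (auto simp: fun_eq_iff)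
  note F = this
  have "val ?w = 20 + (if t then val (ss 39) else 0)" "val ?w + 2 <= 2 ^ length ?w" unfolding w using False b(3) by simp_all
  then show ?thesis by (intro exI[of _ ?w] exI[of _ z'] conjI F)
 qed
qed

lemma ok_dact: "{33, 35, 36, 37, 39, 45} \<subseteq> A ==> ok A (dact p b)"
 unfolding dact_def by (cases "letter b") (auto split: option.split)

lemma ok_Block: "{30, 33, 35, 36, 37, 39, 45} \<subseteq> A ==> ok A Block"
 unfolding Block_def Bit_def ok.simps by (intro conjI allI ok_CaseN ok_dact) auto

lemma frame_SimStep: "j \<notin> {38, 40, 41, 42, 43, 44} ==> fst (fold (%_. sem f SimStep) v s) j = fst s j"
proof (induction v arbitrary: s)
 case (Cons a v)
 then show ?case using sem_frame[OF ok_SimStep[OF order_refl], of j f] by simp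
qed simp

text \<open>The replayed machine takes over the query tape itself, so that tape has to be blank with
  its head at 0 when the program starts.\<close>

lemma sem_Tent:
 assumes n: "ss 10 = replicate n S1" "ss 12 = replicate N S1" and d: "ss 30 = d" "bits d" "length d = n - 1" and z: "ss 32 = z"
  and e: "\<And>j. j \<in> {13, 14, 15, 16, 26} \<or> 33 <= j ==> ss j = []"
  and D: "fold dstep (bl n d) (0, [], 0, [], 0) = (p, ls, k, w, h)"
 shows "\<exists>ss' q'. sem f Tent (ss, %_. None, 0) = (ss', q') \<and> (\<forall>j<26. ss' j = ss j) \<and>
  val (ss' 26) = 20 + (if z = [] \<and> wins f (syms (rev ls)) (marks ls) (rev w) \<and> p = 3 \<and> k = 0 then 2 ^ N div 2 ^ (6 * h + 10) else 0) \<and>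
  val (ss' 26) + 2 <= 2 ^ length (ss' 26)"
proof -
 let ?q = "(%_. None, 0) :: (nat => cell) \<times> nat"
 let ?H = "drop 10 (replicate N S0 @ [S1])"
 let ?ss1 = "ss(34 := replicate n S1)"
 have e13: "ss 13 = []" by (rule e) simp
 have eg: "ss j = []" if "33 <= j" for j using e that by blast
 have 1: "sem f (Push 39 S1 ;; Each 12 13 (%_. Push 39 S0) ;; PopN 39 10 ;; Dup 10 13 34) (ss, ?q) = (dstore (0, [], 0, [], 0) d ?H ?ss1, ?q)"
  using n e13 eg[of 39] eg[of 34] eg[of 33] eg[of 35] eg[of 36] eg[of 37] eg[of 45] d(1) by (simp add: dstore_def del: PopN.simps) (auto simp: fun_eq_iff)
 have i0: "dinv (0, [], 0, [], 0) []" by (simp add: dinv_def)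
 have oB: "ok (- {34}) Block" by (rule ok_Block) auto
 let ?D = "dstore (p, ls, k, w, h) (drop (3 * n) d) ?H ?ss1"
 have 34: "dstore (0, [], 0, [], 0) d ?H ?ss1 34 = replicate n S1" by (simp add: dstore_def)
 have 2: "sem f (For 34 (%_. Block)) (dstore (0, [], 0, [], 0) d ?H ?ss1, ?q) = (?D(34 := []), ?q)"
  unfolding sem_For[OF oB] fst_conv 34 fold_Block[OF d(2) i0] length_replicate D upd_pair ..
 have di: "dinv (p, ls, k, w, h) (concat (bl n d))" using dinv_fold[OF i0, of "bl n d"] bl_bits[OF d(2)] unfolding D by auto
 have p4: "p <= 4" using di by (simp add: dinv_def)
 let ?u = "syms (rev ls)"
 let ?L = "?D(34 := [], 35 := [], 42 := concat (map ccode (map Some ?u)), 45 := [], 38 := rev w, 40 := replicate (start M) S1)"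
 have o35: "ok (- {35}) (PushW 42 [S1, a])" for a by simp
 have 3: "sem f Load (?D(34 := []), ?q) = (?L, ?q)"
 proof -
  have a: "sem f (For 35 (%a. PushW 42 [S1, a])) (?D(34 := []), ?q) = (?D(34 := [], 42 := concat (map ccode (map Some ?u)), 35 := []), ?q)"
   unfolding sem_For[OF o35] fst_conv fold_input upd_pair using eg[of 42] by (simp add: dstore_def rev_map rev_filter)
  show ?thesis unfolding Load_def sem.simps(3) a using eg[of 38] eg[of 40] by (simp add: dstore_def del: PushW.simps) (auto simp: fun_eq_iff)
 qed
 have rp: "rep ?u (init_config M) (?L, ?q)"
 proof -
  have st: "start M < nstates M" using wf by (simp add: wf_otm_def)
  have t1: "tape [] (concat (map ccode (map Some ?u))) (input_cell ?u) 0"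
   unfolding tape_def by (intro exI[of _ "map Some ?u"]) (auto simp: input_cell_def)
  have t2: "tape [] [] (%_. None) 0" unfolding tape_def by (intro exI[of _ "[]"]) auto
  show ?thesis unfolding rep_def init_config_def using st t1 t2 eg[of 41] eg[of 43] eg[of 44] by (simp add: dstore_def)
 qed
 have o36: "ok (- {36}) SimStep" by (rule ok_SimStep) auto
 let ?F = "fold (%_. sem f SimStep) (replicate (marks ls) S1) (?L, ?q)"
 have L36: "?L 36 = replicate (marks ls) S1" "?L 38 = rev w" by (simp_all add: dstore_def)
 obtain \<rho> q' where F: "?F = (\<rho>, q')" by (cases ?F)
 let ?c = "run f ?u (marks ls) (rev w) (init_config M)"
 have rf: "rep ?u ?c (\<rho>, q')" using fold_SimStep[OF rp, of f "replicate (marks ls) S1"] L36(2) unfolding F by simp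
 have fr: "\<rho> j = ?L j" if "j \<notin> {38, 40, 41, 42, 43, 44}" for j
  using frame_SimStep[OF that, of f "replicate (marks ls) S1" "(?L, ?q)"] unfolding F by simp
 have 4: "sem f (For 36 (%_. SimStep)) (?L, ?q) = (\<rho>(36 := []), q')"
  unfolding sem_For[OF o36] fst_conv L36(1) F by simp
 have c: "\<rho> 40 = replicate (st ?c) S1" "st ?c <= nstates M" using rf by (auto simp: rep_def)
 let ?\<rho> = "\<rho>(36 := [])"
 have 39: "?\<rho> 39 = drop (6 * h) ?H" using fr[of 39] by (simp add: dstore_def)
 have v39: "val (?\<rho> 39) = 2 ^ N div 2 ^ (6 * h + 10)" unfolding 39 drop_drop val_drop by (simp add: val_append)
 have low: "?\<rho> j = ss j" if "j < 33" "j ~= 30" for j using fr[of j] that by (simp add: dstore_def)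
 have "\<exists>v z'. sem f Judge (?\<rho>, q') = (?\<rho>(40 := [], 33 := [], 37 := [], 26 := v, 32 := z'), q') \<and>
  val v = 20 + (if z = [] \<and> st ?c \<in> acc M \<and> p = 3 \<and> k = 0 then val (?\<rho> 39) else 0) \<and> val v + 2 <= 2 ^ length v"
 proof (rule sem_Judge)
  show "?\<rho> 40 = replicate (st ?c) S1" "st ?c <= nstates M" using c by simp_all
  show "?\<rho> 33 = replicate p S1" using fr[of 33] by (simp add: dstore_def)
  show "p <= 4" by (rule p4)
  show "?\<rho> 37 = replicate k S1" using fr[of 37] by (simp add: dstore_def)
  show "?\<rho> 12 = replicate N S1" using low[of 12] n by simp
  show "?\<rho> 32 = z" using low[of 32] z by simp
  show "val (?\<rho> 39) <= 2 ^ N" unfolding v39 by simp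
  show "?\<rho> j = []" if "j \<in> {13, 14, 15, 16, 26}" for j using low[of j] e[of j] that by auto
 qed
 then obtain v z' where 5: "sem f Judge (?\<rho>, q') = (?\<rho>(40 := [], 33 := [], 37 := [], 26 := v, 32 := z'), q')"
  "val v = 20 + (if z = [] \<and> st ?c \<in> acc M \<and> p = 3 \<and> k = 0 then 2 ^ N div 2 ^ (6 * h + 10) else 0)" "val v + 2 <= 2 ^ length v" unfolding v39 by blast
 have "sem f Tent (ss, ?q) = (?\<rho>(40 := [], 33 := [], 37 := [], 26 := v, 32 := z'), q')"
  unfolding Tent_def using 1 2 3 4 5(1) by (simp only: sem.simps(3))
 then show ?thesis using 5(2,3) low unfolding wins_def
  by (intro exI[of _ "?\<rho>(40 := [], 33 := [], 37 := [], 26 := v, 32 := z')"], intro exI[of _ q']) simp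
qed

section \<open>The spikes belonging to an oracle, and their recognition\<close>

definition spikes :: "fn => (word \<times> word) set" where
 "spikes f = {(cwd ls, w) | ls w. bits w \<and> length w = 3 * marks ls \<and> wins f (syms ls) (marks ls) w}"

lemma good_spikes: "good (spikes f)"
proof -
 have "marks ls <= length ls" for ls :: "cell list" by (rule length_filter_le)
 then show ?thesis unfolding good_def spikes_def by auto
qed

text \<open>Successful decoding yields a spike at \<open>J\<close> by the invariant
  \<open>dinv\<close>. Conversely a spike at \<open>J\<close> has the same binary fraction as the
  digits read, and words of equal length are determined by their fractions; hence decoding would
  have succeeded.\<close>

lemma hw_decode:
 assumes d: "bits d" "length d = n - 1" "bin_val d = J mod 2 ^ (n - 1)" and z: "z = [] \<longleftrightarrow> J < 2 ^ (n - 1)"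
  and D: "fold dstep (bl n d) (0, [], 0, [], 0) = (p, ls, k, w, h)"
 shows "hw_spec (spikes f) (n + 4) J (if z = [] \<and> wins f (syms (rev ls)) (marks ls) (rev w) \<and> p = 3 \<and> k = 0 then 2 ^ (n + 4) div 2 ^ (6 * h + 10) else 0)"
proof -
 have i0: "dinv (0, [], 0, [], 0) []" by (simp add: dinv_def)
 have di: "dinv (p, ls, k, w, h) (concat (bl n d))" using dinv_fold[OF i0, of "bl n d"] bl_bits[OF d(1)] unfolding D by auto
 have cb: "concat (bl n d) = d @ replicate (3 * n - length d) S0" by (rule concat_bl) (use d(2) in simp)
 have frd: "fr (concat (bl n d)) * 2 ^ (n + 4) = 32 * real J" if "J < 2 ^ (n - 1)" "0 < n"
 proof -
  have "bin_val d = J" using d(3) that(1) by simp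
  moreover have "(2::real) ^ (n + 4) = 2 ^ (n - 1) * 32" using that(2) by (cases n) (simp_all add: power_add)
  ultimately show ?thesis unfolding cb fr_zeros unfolding fr_def d(2) by simp
 qed
 show ?thesis
 proof (cases "z = [] \<and> wins f (syms (rev ls)) (marks ls) (rev w) \<and> p = 3 \<and> k = 0")
  case True
  then obtain j where j: "concat (bl n d) = cwd (rev ls) @ [S1, S0, S0, S0, S0, S0] @ rev w @ replicate j S0" "length w = 3 * marks ls" "bits w" "h = Suc (length ls)"
   using di unfolding dinv_def by auto
  have n0: "0 < n" using j(1) by (cases n) (auto simp: cwd_def)
  have "spike_x (cwd (rev ls)) (rev w) = fr (concat (bl n d))"
   unfolding j(1) spike_x_def using fr_zeros[of "cwd (rev ls) @ [S1, S0, S0, S0, S0, S0] @ rev w" j] by simp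
  then have "spike_x (cwd (rev ls)) (rev w) * 2 ^ (n + 4) = 32 * real J" using frd z True n0 by simp
  moreover have "(cwd (rev ls), rev w) \<in> spikes f" unfolding spikes_def using j True
   by (intro CollectI exI[of _ "rev ls"] exI[of _ "rev w"]) (auto simp: bits_def rev_filter[symmetric])
  moreover have "6 * h + 10 = 2 * length (cwd (rev ls)) + 10" using j(4) by simp
  ultimately show ?thesis unfolding hw_spec_def using True by (intro disjI1 exI[of _ "cwd (rev ls)"] exI[of _ "rev w"]) simp
 next
  case False
  have "spike_x e v * 2 ^ (n + 4) ~= 32 * real J" if ev: "(e, v) \<in> spikes f" for e v
  proof
   assume eq: "spike_x e v * 2 ^ (n + 4) = 32 * real J"
   obtain L where L: "e = cwd L" "bits v" "length v = 3 * marks L" "wins f (syms L) (marks L) v" using ev unfolding spikes_def by blast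
   have X: "1 / 2 ^ length e / 2 <= spike_x e v" "spike_x e v < 1"
    using spike_x_lower(1) fr_bounds(2)[of "e @ [S1, S0, S0, S0, S0, S0] @ v"] unfolding spike_x_def
    by (simp, smt (verit) zero_less_divide_1_iff zero_less_power zero_less_numeral)
   \<comment> \<open>For \<open>n = 0\<close> the coarse grid has mesh 2, and the only grid point
     below 1 is 0, where there is no spike.\<close>
   have n0: "0 < n"
   proof (rule ccontr)
    assume "\<not> 0 < n"
    then have "spike_x e v * 16 = 32 * real J" using eq by simp
    then have "real J < 1" using X(2) by linarith
    then have "J = 0" by simp
    then have "spike_x e v = 0" using \<open>spike_x e v * 16 = 32 * real J\<close> by simp
    then show False using X(1) by (smt (verit) zero_less_divide_1_iff zero_less_power zero_less_numeral half_gt_zero)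
   qed
   have p2: "(2::real) ^ (n + 4) = 2 ^ (n - 1) * 32" using n0 by (cases n) (simp_all add: power_add)
   then have eq': "spike_x e v * 2 ^ (n - 1) = real J" using eq by simp
   then have "real J < 1 * 2 ^ (n - 1)" using X(2) by (metis mult_strict_right_mono zero_less_numeral zero_less_power)
   then have "real J < real (2 ^ (n - 1))" by simp
   then have J: "J < 2 ^ (n - 1)" by (simp only: of_nat_less_iff)
   have "real J ~= 0" using eq' X(1) by (smt (verit) zero_less_divide_1_iff zero_less_power zero_less_numeral half_gt_zero mult_eq_0_iff)
   let ?s = "e @ [S1, S0, S0, S0, S0, S0] @ v"
   \<comment> \<open>Otherwise the position times \<open>2 ^ length e\<close> would be an integer,
     yet it lies between 1/2 and 1/2 + 1/64 above the integer \<open>bin_val e\<close>.\<close>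
   have lenle: "length e + 1 <= n - 1"
   proof (rule ccontr)
    assume "\<not> length e + 1 <= n - 1"
    then have le: "n - 1 <= length e" by simp
    define m where "m = length e - (n - 1)"
    have le2: "length e = n - 1 + m" using le unfolding m_def by simp
    have b: "mid_x e <= spike_x e v" "spike_x e v <= mid_x e + 1 / 2 ^ length e / 64" by (rule spike_x_bounds)+
    have "real J * 2 ^ m = spike_x e v * 2 ^ length e" unfolding le2 power_add eq'[symmetric] by simp
    then have "real (J * 2 ^ m) = spike_x e v * 2 ^ length e" by simp
    moreover have "mid_x e * 2 ^ length e = real (bin_val e) + 1 / 2" unfolding mid_x_eq fr_def by (simp add: field_simps)
    moreover have "mid_x e * 2 ^ length e <= spike_x e v * 2 ^ length e" using b(1) by (intro mult_right_mono) auto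
    moreover have "spike_x e v * 2 ^ length e <= (mid_x e + 1 / 2 ^ length e / 64) * 2 ^ length e" using b(2) by (intro mult_right_mono) auto
    moreover have "(mid_x e + 1 / 2 ^ length e / 64) * 2 ^ length e = mid_x e * 2 ^ length e + 1 / 64" by (simp add: distrib_right)
    ultimately have "real (bin_val e) < real (J * 2 ^ m)" "real (J * 2 ^ m) < real (bin_val e + 1)" by linarith+
    then show False by (simp only: of_nat_less_iff)
   qed
   have "marks L <= length L" by (rule length_filter_le)
   moreover have "length ?s = 9 + 3 * length L + 3 * marks L" "length e = 3 * length L + 3" using L(1,3) by simp_all
   ultimately have sl: "length ?s <= 3 * n" using lenle by linarith
   have bs: "bits (concat (bl n d))" "length (concat (bl n d)) = 3 * n" unfolding cb using d(1,2) by (auto simp: bits_def)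
   have bs': "bits (?s @ replicate (3 * n - length ?s) S0)" using L bits_cwd by (auto simp: bits_def)
   have "fr (concat (bl n d)) * 2 ^ (n + 4) = fr ?s * 2 ^ (n + 4)" using frd[OF J n0] eq unfolding spike_x_def by simp
   then have "fr (concat (bl n d)) = fr (?s @ replicate (3 * n - length ?s) S0)" unfolding fr_zeros by simp
   from fr_inj[OF bs(1) bs' _ this] have "concat (bl n d) = ?s @ replicate (3 * n - length ?s) S0" using bs(2) sl by simp
   then have c: "concat (bl n d) = cwd L @ [S1, S0, S0, S0, S0, S0] @ v @ replicate (3 * n - length ?s) S0" unfolding L(1) by simp
   have "fold dstep (bl n d) (0, [], 0, [], 0) = (3, rev L, 0, rev v, Suc (length L))"
    by (rule decode_complete[OF c _ L(3)]) (use bl_bits[OF d(1)] in blast)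
   then have "p = 3" "ls = rev L" "k = 0" "w = rev v" using D by auto
   then show False using False z J L(4) by (auto simp: rev_filter[symmetric])
  qed
  then show ?thesis unfolding hw_spec_def using False by (simp only: if_False) blast
 qed
qed

end

subsection \<open>Evaluating second-order polynomials\<close>

text \<open>Values are kept in unary on stack \<open>j\<close>; stacks from \<open>i\<close> on are
  scratch, one per nesting depth of products and applications. The type-1 variable is evaluated by
  asking for the word of \<open>k\<close> zeros, whose answer has length
  \<open>regsize f k\<close>.\<close>

primrec EvalP :: "sopoly => nat => nat => com" where
 "EvalP (PConst c) j i = PushW j (replicate c S1)"
| "EvalP PVar j i = Each 1 2 (%_. Push j S1)"
| "EvalP (PAdd p q) j i = EvalP p j i ;; EvalP q j i"
| "EvalP (PMul p q) j i = EvalP p i (Suc i) ;; For i (%_. EvalP q j (Suc i))"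
| "EvalP (PApp p) j i = EvalP p i (Suc i) ;; For i (%_. QWr (Some S0) Rgt) ;; (QWr None Stay ;; QAsk) ;; QLen i ;;
   For i (%_. QWr None Lft ;; Push j S1)"

primrec depth :: "sopoly => nat" where
 "depth (PConst c) = 0" | "depth PVar = 0" | "depth (PAdd p q) = max (depth p) (depth q)"
| "depth (PMul p q) = Suc (max (depth p) (depth q))" | "depth (PApp p) = Suc (depth p)"

text \<open>The answers of the oracle enter the running time, so no polynomial in the size of the
  store can bound it; the bound is itself a second-order polynomial.\<close>

primrec cost :: "sopoly => sopoly" where
 "cost (PConst c) = PConst (Suc c)"
| "cost PVar = PAdd (PConst 2) (PMul (PConst 5) PVar)"
| "cost (PAdd p q) = PAdd (cost p) (cost q)"
| "cost (PMul p q) = PAdd (cost p) (PAdd (PConst 1) (PMul p (PAdd (PConst 1) (cost q))))"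
| "cost (PApp p) = PAdd (cost p) (PAdd (PMul (PConst 2) p) (PAdd (PMul (PConst 4) (PApp p)) (PConst 5)))"

lemma cost_ok: "sp_ok p ==> sp_ok (cost p)" by (induction p) auto

lemma ok_EvalP: "{1, 2, j} \<subseteq> A ==> {i..<i + depth p} \<subseteq> A ==> j < i ==> 2 < i ==> j \<notin> {1, 2} ==> ok A (EvalP p j i)"
proof (induction p arbitrary: j i A)
 case (PAdd p q)
 have "{i..<i + depth p} \<subseteq> A" "{i..<i + depth q} \<subseteq> A" by (rule subset_trans[OF _ PAdd.prems(2)]; auto)+
 then show ?case using PAdd.IH[of j A i] PAdd.prems by simp
next
 case (PMul p q)
 have a: "{Suc i..<Suc i + depth p} \<subseteq> A" "{Suc i..<Suc i + depth q} \<subseteq> A" by (rule subset_trans[OF _ PMul.prems(2)]; auto)+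
 have i: "i \<in> A" by (rule subsetD[OF PMul.prems(2)]) simp
 have "ok A (EvalP p i (Suc i))" by (rule PMul.IH(1)) (use PMul.prems i a in auto)
 moreover have "ok (A - {i}) (EvalP q j (Suc i))" by (rule PMul.IH(2)) (use PMul.prems a in auto)
 ultimately show ?case using PMul.prems by auto
next
 case (PApp p)
 have "ok A (EvalP p i (Suc i))" by (rule PApp.IH) (use PApp.prems in auto)
 then show ?case using PApp.prems by auto
qed auto

lemma qlen_word_tape: "qlen (word_tape a) 0 = length a"
 unfolding qlen_def word_tape_def by (rule Least_equality) (auto split: if_splits)

text \<open>After measuring an answer the head stands behind it; one move per counted symbol returns
  it to 0, where the next query can be written.\<close>

lemma fold_rewind: "fold (%_. sem f (QWr None Lft ;; Push j S1)) v (ss, t, length v) = (ss(j := replicate (length v) S1 @ ss j), fst (snd (fold (%_. sem f (QWr None Lft ;; Push j S1)) v (ss, t, length v))), 0)"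
proof (induction v arbitrary: ss t)
 case (Cons a v)
 let ?G = "sem f (QWr None Lft ;; Push j S1)"
 have s: "?G (ss, t, length (a # v)) = (ss(j := S1 # ss j), t(Suc (length v) := None), length v)" by simp
 show ?case unfolding fold.simps o_apply s
  by (subst (1) Cons.IH) (simp add: replicate_app_Cons_same)
qed simp

lemma ww_zero: "(t, 0) = ww t []" by (simp add: ww_def)

lemma sem_App:
 assumes "ss i = replicate k S1" "j ~= i"
 shows "\<exists>t'. sem f (For i (%_. QWr (Some S0) Rgt) ;; (QWr None Stay ;; QAsk) ;; QLen i ;; For i (%_. QWr None Lft ;; Push j S1)) (ss, ww t []) =
  (ss(i := [], j := replicate (regsize f k) S1 @ ss j), ww t' [])"
proof -
 let ?a = "f (replicate k S0)" let ?ss1 = "ss(i := [])" let ?ss2 = "ss(i := replicate (length ?a) S1)"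
 have 1: "sem f (For i (%_. QWr (Some S0) Rgt)) (ss, ww t []) = (?ss1, ww t (replicate k S0))"
  by (subst sem_For) (use assms in \<open>simp_all add: fold_write del: sem.simps fold_replicate\<close>)
 have 2: "sem f (QLen i) (?ss1, ww (word_tape ?a) []) = (?ss2, word_tape ?a, length ?a)"
  by (simp add: ww_def Let_def qlen_word_tape)
 have o: "ok (- {i}) (QWr None Lft ;; Push j S1)" using assms(2) by simp
 let ?F = "fold (%_. sem f (QWr None Lft ;; Push j S1)) (replicate (length ?a) S1) (?ss2, word_tape ?a, length ?a)"
 have F: "?F = (?ss2(j := replicate (length ?a) S1 @ ?ss2 j), fst (snd ?F), 0)"
  using fold_rewind[of f j "replicate (length ?a) S1" ?ss2 "word_tape ?a"] unfolding length_replicate .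
 have i2: "?ss2 i = replicate (length ?a) S1" by simp
 have 3: "sem f (For i (%_. QWr None Lft ;; Push j S1)) (?ss2, word_tape ?a, length ?a) = (ss(i := [], j := replicate (length ?a) S1 @ ss j), fst (snd ?F), 0)"
  unfolding sem_For[OF o] fst_conv i2 by (subst F) (use assms(2) in \<open>auto simp: fun_eq_iff\<close>)
 have "sem f (For i (%_. QWr (Some S0) Rgt) ;; (QWr None Stay ;; QAsk) ;; QLen i ;; For i (%_. QWr None Lft ;; Push j S1)) (ss, ww t []) =
   sem f (For i (%_. QWr None Lft ;; Push j S1)) (sem f (QLen i) (sem f (QWr None Stay ;; QAsk) (sem f (For i (%_. QWr (Some S0) Rgt)) (ss, ww t []))))"
  by (simp only: sem.simps(3))
 then show ?thesis unfolding 1 sem_ask 2 3 regsize_def ww_zero by blast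
qed

lemma ops_App:
 assumes "ss i = replicate k S1" "j ~= i"
 shows "ops f (For i (%_. QWr (Some S0) Rgt) ;; (QWr None Stay ;; QAsk) ;; QLen i ;; For i (%_. QWr None Lft ;; Push j S1)) (ss, ww t []) <= 2 * k + 4 * regsize f k + 5"
proof -
 let ?a = "f (replicate k S0)" let ?ss1 = "ss(i := [])" let ?ss2 = "ss(i := replicate (length ?a) S1)"
 have 1: "sem f (For i (%_. QWr (Some S0) Rgt)) (ss, ww t []) = (?ss1, ww t (replicate k S0))"
  by (subst sem_For) (use assms in \<open>simp_all add: fold_write del: sem.simps fold_replicate\<close>)
 have 2: "sem f (QLen i) (?ss1, ww (word_tape ?a) []) = (?ss2, word_tape ?a, length ?a)"
  by (simp add: ww_def Let_def qlen_word_tape)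
 have o1: "ops f (For i (%_. QWr (Some S0) Rgt)) (ss, ww t []) <= 1 + length (fst (ss, ww t []) i) * (1 + 1)"
  by (rule ops_For_inv[where I = "%_. True"]) auto
 have o2: "ops f (For i (%_. QWr None Lft ;; Push j S1)) (?ss2, word_tape ?a, length ?a) <= 1 + length (fst (?ss2, word_tape ?a, length ?a) i) * (1 + 2)"
  by (rule ops_For_inv[where I = "%_. True"]) auto
 have o3: "ops f (QLen i) (?ss1, ww (word_tape ?a) []) = 1 + length ?a" by (simp add: ww_def qlen_word_tape)
 have o4: "ops f (QWr None Stay ;; QAsk) s = 2" for s by simp
 have "ops f (For i (%_. QWr (Some S0) Rgt) ;; (QWr None Stay ;; QAsk) ;; QLen i ;; For i (%_. QWr None Lft ;; Push j S1)) (ss, ww t []) =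
   ops f (For i (%_. QWr (Some S0) Rgt)) (ss, ww t []) + (2 + ((1 + length ?a) + ops f (For i (%_. QWr None Lft ;; Push j S1)) (?ss2, word_tape ?a, length ?a)))"
 proof -
  have s2: "ops f (c ;; d) s = ops f c s + ops f d (sem f c s)" for c d s by simp
  show ?thesis unfolding s2[of "For i (%_. QWr (Some S0) Rgt)"] 1 s2[of "QWr None Stay ;; QAsk"] o4 sem_ask s2[of "QLen i"] o3 2 ..
 qed
 also have "\<dots> <= 2 * k + 4 * regsize f k + 5" using o1 o2 assms(1) unfolding regsize_def by simp
 finally show ?thesis .
qed

lemma EvalP_correct:
 assumes "ss 2 = []" "\<And>l. i <= l ==> ss l = []" "j < i" "2 < i" "j \<notin> {1, 2}"
 shows "(\<exists>t'. sem f (EvalP p j i) (ss, ww t []) = (ss(j := replicate (sp_eval p (regsize f) (length (ss 1))) S1 @ ss j), ww t' [])) \<and>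
  ops f (EvalP p j i) (ss, ww t []) <= sp_eval (cost p) (regsize f) (length (ss 1))"
 using assms
proof (induction p arbitrary: ss t j i)
 case (PConst c)
 show ?case by (auto simp: ops_PushW simp del: PushW.simps intro: exI[of _ t])
next
 case PVar
 have "ops f (Each 1 2 (%_. Push j S1)) (ss, ww t []) <= 2 + length (fst (ss, ww t []) 1) * (4 + 1)"
  by (rule ops_Each) (use PVar in auto)
 moreover have "sem f (Each 1 2 (%_. Push j S1)) (ss, ww t []) = (ss(j := replicate (length (ss 1)) S1 @ ss j), ww t [])"
  by (rule sem_Each_push) (use PVar in auto)
 ultimately show ?case by (auto simp: mult.commute)
next
 case (PAdd p q)
 let ?P = "sp_eval p (regsize f) (length (ss 1))" let ?ss = "ss(j := replicate ?P S1 @ ss j)"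
 have 1: "(\<exists>t'. sem f (EvalP p j i) (ss, ww t []) = (?ss, ww t' [])) \<and> ops f (EvalP p j i) (ss, ww t []) <= sp_eval (cost p) (regsize f) (length (ss 1))"
  by (rule PAdd.IH(1)) (use PAdd.prems in auto)
 then obtain t' where t': "sem f (EvalP p j i) (ss, ww t []) = (?ss, ww t' [])" by blast
 have l1: "?ss 1 = ss 1" using PAdd.prems by auto
 have "(\<exists>t''. sem f (EvalP q j i) (?ss, ww t' []) = (?ss(j := replicate (sp_eval q (regsize f) (length (?ss 1))) S1 @ ?ss j), ww t'' [])) \<and>
  ops f (EvalP q j i) (?ss, ww t' []) <= sp_eval (cost q) (regsize f) (length (?ss 1))"
  by (rule PAdd.IH(2)) (use PAdd.prems in auto)
 then obtain t'' where t'': "sem f (EvalP q j i) (?ss, ww t' []) = (?ss(j := replicate (sp_eval q (regsize f) (length (ss 1))) S1 @ ?ss j), ww t'' [])"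
  "ops f (EvalP q j i) (?ss, ww t' []) <= sp_eval (cost q) (regsize f) (length (ss 1))" unfolding l1 by blast
 have "replicate b S1 @ replicate a S1 @ x = replicate (a + b) S1 @ x" for a b x by (simp add: replicate_add[symmetric] add.commute flip: append_assoc)
 note rr = this[of "sp_eval q (regsize f) (length (ss 1))" ?P "ss j"]
 have "sem f (EvalP (PAdd p q) j i) (ss, ww t []) = (?ss(j := replicate (sp_eval q (regsize f) (length (ss 1))) S1 @ ?ss j), ww t'' [])"
  by (simp only: EvalP.simps sem.simps(3) t' t''(1))
 also have "?ss(j := replicate (sp_eval q (regsize f) (length (ss 1))) S1 @ ?ss j) = ss(j := replicate (sp_eval (PAdd p q) (regsize f) (length (ss 1))) S1 @ ss j)"
  by (simp only: fun_upd_same fun_upd_upd rr sp_eval.simps)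
 finally have "sem f (EvalP (PAdd p q) j i) (ss, ww t []) = (ss(j := replicate (sp_eval (PAdd p q) (regsize f) (length (ss 1))) S1 @ ss j), ww t'' [])" .
 then show ?case using 1 t' t''(2) by auto
next
 case (PMul p q)
 let ?L = "regsize f" let ?n = "length (ss 1)"
 let ?P = "sp_eval p ?L ?n" let ?Q = "sp_eval q ?L ?n" let ?ss = "ss(i := replicate ?P S1)" let ?C = "sp_eval (cost q) ?L ?n"
 have "(\<exists>t'. sem f (EvalP p i (Suc i)) (ss, ww t []) = (ss(i := replicate ?P S1 @ ss i), ww t' [])) \<and> ops f (EvalP p i (Suc i)) (ss, ww t []) <= sp_eval (cost p) ?L ?n"
  by (rule PMul.IH(1)) (use PMul.prems in auto)
 then obtain t' where t': "sem f (EvalP p i (Suc i)) (ss, ww t []) = (?ss, ww t' [])" "ops f (EvalP p i (Suc i)) (ss, ww t []) <= sp_eval (cost p) ?L ?n"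
  using PMul.prems(2)[of i] by auto
 have loop: "(\<exists>t2. floop i (%_. sem f (EvalP q j (Suc i))) v (\<tau>, ww t1 []) = (\<tau>(j := replicate (length v * ?Q) S1 @ \<tau> j, i := []), ww t2 [])) \<and>
   fops i (%_. sem f (EvalP q j (Suc i))) (%_. ops f (EvalP q j (Suc i))) v (\<tau>, ww t1 []) <= 1 + length v * (1 + ?C)"
  if "\<tau> 2 = []" "\<And>l. Suc i <= l ==> \<tau> l = []" "\<tau> 1 = ss 1" for v :: word and \<tau> t1
  using that
 proof (induction v arbitrary: \<tau> t1)
  case Nil
  show ?case using PMul.prems(3) by (auto simp: fun_eq_iff intro!: exI[of _ t1])
 next
  case (Cons a v)
  let ?\<tau> = "\<tau>(i := v)"
  have n1: "?\<tau> 1 = ss 1" using Cons.prems(3) PMul.prems(4) by simp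
  have "(\<exists>t2. sem f (EvalP q j (Suc i)) (?\<tau>, ww t1 []) = (?\<tau>(j := replicate (sp_eval q ?L (length (?\<tau> 1))) S1 @ ?\<tau> j), ww t2 [])) \<and>
    ops f (EvalP q j (Suc i)) (?\<tau>, ww t1 []) <= sp_eval (cost q) ?L (length (?\<tau> 1))"
   by (rule PMul.IH(2)) (use Cons.prems PMul.prems in auto)
  then obtain t2 where t2: "sem f (EvalP q j (Suc i)) (?\<tau>, ww t1 []) = (?\<tau>(j := replicate ?Q S1 @ ?\<tau> j), ww t2 [])"
   "ops f (EvalP q j (Suc i)) (?\<tau>, ww t1 []) <= ?C" unfolding n1 by blast
  let ?\<rho> = "?\<tau>(j := replicate ?Q S1 @ ?\<tau> j)"
  have r: "?\<rho> 2 = []" "\<And>l. Suc i <= l ==> ?\<rho> l = []" "?\<rho> 1 = ss 1" using Cons.prems PMul.prems by auto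
  obtain t3 where t3: "floop i (%_. sem f (EvalP q j (Suc i))) v (?\<rho>, ww t2 []) = (?\<rho>(j := replicate (length v * ?Q) S1 @ ?\<rho> j, i := []), ww t3 [])"
   "fops i (%_. sem f (EvalP q j (Suc i))) (%_. ops f (EvalP q j (Suc i))) v (?\<rho>, ww t2 []) <= 1 + length v * (1 + ?C)"
   using Cons.IH[of ?\<rho> t2, OF r] by blast
  have "replicate (length v * ?Q) S1 @ replicate ?Q S1 @ \<tau> j = replicate (length (a # v) * ?Q) S1 @ \<tau> j" by (simp add: replicate_add[symmetric] add.commute flip: append_assoc)
  then have "floop i (%_. sem f (EvalP q j (Suc i))) (a # v) (\<tau>, ww t1 []) = (\<tau>(j := replicate (length (a # v) * ?Q) S1 @ \<tau> j, i := []), ww t3 [])"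
   using t2(1) t3(1) PMul.prems(3) by (auto simp: fun_eq_iff)
  moreover have "fops i (%_. sem f (EvalP q j (Suc i))) (%_. ops f (EvalP q j (Suc i))) (a # v) (\<tau>, ww t1 []) <= 1 + length (a # v) * (1 + ?C)"
   using t2 t3(2) by simp
  ultimately show ?case by blast
 qed
 have r: "?ss 2 = []" "\<And>l. Suc i <= l ==> ?ss l = []" "?ss 1 = ss 1" using PMul.prems by auto
 obtain t2 where t2: "floop i (%_. sem f (EvalP q j (Suc i))) (replicate ?P S1) (?ss, ww t' []) = (?ss(j := replicate (?P * ?Q) S1 @ ?ss j, i := []), ww t2 [])"
  "fops i (%_. sem f (EvalP q j (Suc i))) (%_. ops f (EvalP q j (Suc i))) (replicate ?P S1) (?ss, ww t' []) <= 1 + ?P * (1 + ?C)"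
  using loop[of ?ss "replicate ?P S1" t', OF r] unfolding length_replicate by blast
 have ei: "ss i = []" using PMul.prems(2) by simp
 have "sem f (EvalP (PMul p q) j i) (ss, ww t []) = (ss(j := replicate (?P * ?Q) S1 @ ss j), ww t2 [])"
  using t'(1) t2(1) PMul.prems(3) ei by (auto simp: fun_eq_iff)
 moreover have "ops f (EvalP (PMul p q) j i) (ss, ww t []) <= sp_eval (cost (PMul p q)) ?L ?n"
  using t' t2(2) by simp
 ultimately show ?case by auto
next
 case (PApp p)
 let ?L = "regsize f" let ?n = "length (ss 1)" let ?P = "sp_eval p ?L ?n" let ?ss = "ss(i := replicate ?P S1)"
 let ?c = "For i (%_. QWr (Some S0) Rgt) ;; (QWr None Stay ;; QAsk) ;; QLen i ;; For i (%_. QWr None Lft ;; Push j S1)"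
 have "(\<exists>t'. sem f (EvalP p i (Suc i)) (ss, ww t []) = (ss(i := replicate ?P S1 @ ss i), ww t' [])) \<and> ops f (EvalP p i (Suc i)) (ss, ww t []) <= sp_eval (cost p) ?L ?n"
  by (rule PApp.IH) (use PApp.prems in auto)
 then obtain t' where t': "sem f (EvalP p i (Suc i)) (ss, ww t []) = (?ss, ww t' [])" "ops f (EvalP p i (Suc i)) (ss, ww t []) <= sp_eval (cost p) ?L ?n"
  using PApp.prems(2)[of i] by auto
 have a: "?ss i = replicate ?P S1" "j ~= i" using PApp.prems(3) by auto
 obtain t2 where t2: "sem f ?c (?ss, ww t' []) = (?ss(i := [], j := replicate (?L ?P) S1 @ ?ss j), ww t2 [])" using sem_App[where ss = ?ss, OF a, of f t'] by blast
 have e: "EvalP (PApp p) j i = EvalP p i (Suc i) ;; ?c" by simp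
 have ei: "ss i = []" using PApp.prems(2) by simp
 have s2: "ops f (c ;; d) s = ops f c s + ops f d (sem f c s)" for c d s by simp
 have "sem f (EvalP (PApp p) j i) (ss, ww t []) = (ss(j := replicate (?L ?P) S1 @ ss j), ww t2 [])"
  unfolding e sem.simps(3)[of f "EvalP p i (Suc i)"] t'(1) t2 using ei a(2) by (auto simp: fun_eq_iff)
 moreover have "ops f (EvalP (PApp p) j i) (ss, ww t []) <= sp_eval (cost (PApp p)) ?L ?n"
  unfolding e s2 t'(1) using t'(2) ops_App[where ss = ?ss, OF a, of f t'] by simp
 ultimately show ?case by auto
qed

subsection \<open>The program writing the query\<close>

text \<open>With \<open>E\<close> the numerator of the word on stack 4, the ordinate needs
  \<open>4 * E^2 - 1\<close>, and this without subtraction: \<open>E\<close> is odd, so its square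
  is \<open>1 + 2 * t\<close>, and replacing its lowest digit by the digits 1, 1, 0 gives
  \<open>3 + 8 * t\<close>.\<close>

definition Code :: com where
 "Code = Each 1 2 (%a. PushW 4 (rev (lcode (Some a)))) ;; Each 3 2 (%_. PushW 4 (rev (lcode None))) ;; PushW 4 [S1, S0, S1, S1] ;;
   Each 4 2 (%_. Push 5 S1) ;; Sq 4 6 7 8 9 10 ;; Pop 6 ;; PushW 6 [S1, S1, S0]"

text \<open>A stack is filled from its end, so the tuple is written back to front. All lengths are
  linear in the width \<open>a\<close> of stack 5, which is one more than that of the code word. The
  digits of the square are normalised because only its value is known, not that its symbols are
  \<open>S0\<close> and \<open>S1\<close>.\<close>

definition Out :: com where
 "Out = (Each 5 2 (%_. PushW 0 [S0, S0]) ;; PushW 0 (replicate 10 S0) ;; Push 0 S0 ;; Each 5 2 (%_. PushW 0 [S1, S1]) ;; PushW 0 (replicate 10 S1)) ;;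
   (Each 5 2 (%_. PushW 0 [S0, S0]) ;; PushW 0 (replicate 8 S0) ;; PushW 0 [SSlash, S1] ;; For 6 (%a. Push 0 (if a = S1 then S1 else S0)) ;;
    PushW 0 [S0, SPlus] ;; Each 5 2 (%_. PushW 0 [S1, S1, S1, S1]) ;; PushW 0 (replicate 13 S1)) ;;
   (Each 5 2 (%_. Push 0 S0) ;; PushW 0 [SSlash, S1] ;; Mv 4 0 ;; PushW 0 [S0, SPlus] ;; Each 5 2 (%_. PushW 0 [S1, S1]) ;; PushW 0 (replicate 3 S1))"

lemma fold_PushW: "fold (%a. sem f (PushW j (g a))) v (ss, q) = (ss(j := concat (map g (rev v)) @ ss j), q)"
 by (induction v arbitrary: ss) (simp_all del: PushW.simps)

lemma sem_Each_PushW: "i ~= t ==> j ~= i ==> j ~= t ==> ss t = [] ==>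
  sem f (Each i t (%a. PushW j (g a))) (ss, q) = (ss(j := concat (map g (rev (ss i))) @ ss j), q)"
 by (subst sem_Each) (simp_all add: fold_PushW)

lemma concat_replicate_const: "concat (replicate a (replicate c x)) = replicate (c * a) x"
 by (induction a) (simp_all add: replicate_add[symmetric])

definition query_code :: "word => nat => cell list" where "query_code u m = map Some u @ replicate m None"

lemma sem_Code:
 assumes "ss 1 = u" "ss 3 = replicate m S1" and e: "\<And>j. j \<in> {2, 4, 5, 6, 7, 8, 9, 10} ==> ss j = []"
 defines "E \<equiv> cwd (query_code u m) @ [S1]"
 shows "\<exists>v. sem f Code (ss, q) = (ss(4 := rev E, 5 := replicate (length E) S1, 6 := v), q) \<and> length v = 2 * length E + 2 \<and> val v + 1 = 4 * (bin_val E)\<^sup>2"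
proof -
 have e': "ss 2 = []" "ss 4 = []" "ss 5 = []" "ss 6 = []" "ss 7 = []" "ss 8 = []" "ss 9 = []" "ss 10 = []" by (rule e; simp)+
 let ?ss1 = "ss(4 := rev E)" let ?ss2 = "?ss1(5 := replicate (length E) S1)"
 have rc: "rev (concat (map lcode ls)) = concat (map (%x. rev (lcode x)) (rev ls))" for ls by (induction ls) auto
 have E: "rev E = [S1, S0, S1, S1] @ concat (map (%_. rev (lcode None)) (rev (replicate m S1))) @ concat (map (%a. rev (lcode (Some a))) (rev u))"
 proof -
  have "rev E = [S1, S0, S1, S1] @ concat (map (%x. rev (lcode x)) (rev (map Some u @ replicate m None)))" unfolding E_def cwd_def query_code_def rev_append rc by simp
  also have "concat (map (%x. rev (lcode x)) (rev (map Some u @ replicate m None))) =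
    concat (map (%x. rev (lcode x)) (rev (replicate m None))) @ concat (map (%x. rev (lcode x)) (rev (map Some u)))" by simp
  finally show ?thesis by (simp only: rev_map map_map o_def rev_replicate map_replicate)
 qed
 have 1: "sem f (Each 1 2 (%a. PushW 4 (rev (lcode (Some a)))) ;; Each 3 2 (%_. PushW 4 (rev (lcode None))) ;; PushW 4 [S1, S0, S1, S1]) (ss, q) = (?ss1, q)"
  unfolding E sem.simps(3) using e' assms(1,2) by (simp add: sem_Each_PushW del: PushW.simps lcode.simps)
 have 2: "sem f (Each 4 2 (%_. Push 5 S1)) (?ss1, q) = (?ss2, q)" using e' by simp
 obtain v where v: "sem f (Sq 4 6 7 8 9 10) (?ss2, q) = (?ss2(6 := v), q)" "length v = 2 * length E" "val v = (bin_val E)\<^sup>2"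
  using sem_Sq[of 4 6 7 8 9 10 ?ss2 f q] e' by (auto simp: bin_val_val)
 have l0: "length E > 0" by (simp add: E_def)
 have "val (rev E) mod 2 = 1" unfolding E_def by simp
 then have "odd (val v)" unfolding v(3) bin_val_val by (simp add: odd_iff_mod_2_eq_one)
 then have hv: "val v = 1 + 2 * val (tl v)" using val_hb[of v] by (auto split: if_splits)
 have "sem f Code (ss, q) = (?ss2(6 := [S1, S1, S0] @ tl v), q)"
 proof -
  have "sem f Code (ss, q) = sem f (Pop 6 ;; PushW 6 [S1, S1, S0]) (sem f (Sq 4 6 7 8 9 10) (sem f (Each 4 2 (%_. Push 5 S1))
   (sem f (Each 1 2 (%a. PushW 4 (rev (lcode (Some a)))) ;; Each 3 2 (%_. PushW 4 (rev (lcode None))) ;; PushW 4 [S1, S0, S1, S1]) (ss, q))))"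
   unfolding Code_def by (simp only: sem.simps(3))
  then show ?thesis unfolding 1 2 v(1) by (simp del: PushW.simps)
 qed
 then show ?thesis using v(2) hv l0 v(3) by (intro exI[of _ "[S1, S1, S0] @ tl v"]) auto
qed

lemma fold_norm: "fold (%a. sem f (Push j (if a = S1 then S1 else S0))) v (ss, q) = (ss(j := rev (map (%a. if a = S1 then S1 else S0) v) @ ss j), q)"
 by (induction v arbitrary: ss) simp_all

lemma val_norm: "val (map (%a. if a = S1 then S1 else S0) v) = val v" by (induction v) auto

lemma sem_Out:
 assumes "ss 0 = []" "ss 2 = []" "ss 4 = rev E" "ss 5 = replicate a S1" "length E = a" "ss 6 = v" "length v = 2 * a + 2"
 shows "fst (sem f Out (ss, q)) 0 = tuple [dstr SPlus E a, dstr SPlus (rev (map (%a. if a = S1 then S1 else S0) v)) (2 * a + 8), replicate (2 * a + 10) S0]"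
proof -
 let ?v = "rev (map (%a. if a = S1 then S1 else S0) v)"
 have p: "sem f (Each 5 2 (%_. PushW 0 (replicate c x))) (\<tau>, q) = (\<tau>(0 := replicate (c * a) x @ \<tau> 0), q)" if "\<tau> 2 = []" "\<tau> 5 = replicate a S1" for \<tau> c x
  by (subst sem_Each_PushW) (use that in \<open>simp_all add: concat_replicate_const del: PushW.simps\<close>)
 have r0: "[S0, S0] = replicate 2 S0" and r1: "[S1, S1] = replicate 2 S1" and r4: "[S1, S1, S1, S1] = replicate 4 S1" by (simp_all add: numeral_eq_Suc)
 have n: "sem f (For 6 (%a. Push 0 (if a = S1 then S1 else S0))) (\<tau>, q) = (\<tau>(0 := rev (map (%a. if a = S1 then S1 else S0) (\<tau> 6)) @ \<tau> 0, 6 := []), q)" for \<tau>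
  by (subst sem_For) (simp_all add: fold_norm)
 let ?c3 = "replicate (10 + 2 * a) S1 @ [S0] @ replicate (10 + 2 * a) S0"
 let ?ss1 = "ss(0 := ?c3)"
 have ra: "replicate k x @ replicate l x @ w = replicate (k + l) x @ w" for k l and x :: sym and w by (simp add: replicate_add)
 have 1: "sem f (Each 5 2 (%_. PushW 0 [S0, S0]) ;; PushW 0 (replicate 10 S0) ;; Push 0 S0 ;; Each 5 2 (%_. PushW 0 [S1, S1]) ;; PushW 0 (replicate 10 S1)) (ss, q) = (?ss1, q)"
  unfolding r0 r1 sem.simps(3) using assms by (simp add: p ra replicate_add[symmetric] del: PushW.simps replicate.simps)
 let ?ss2 = "ss(0 := replicate (13 + 4 * a) S1 @ [S0, SPlus] @ ?v @ [SSlash, S1] @ replicate (8 + 2 * a) S0 @ ?c3, 6 := [])"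
 have 2: "sem f (Each 5 2 (%_. PushW 0 [S0, S0]) ;; PushW 0 (replicate 8 S0) ;; PushW 0 [SSlash, S1] ;; For 6 (%a. Push 0 (if a = S1 then S1 else S0)) ;;
    PushW 0 [S0, SPlus] ;; Each 5 2 (%_. PushW 0 [S1, S1, S1, S1]) ;; PushW 0 (replicate 13 S1)) (?ss1, q) = (?ss2, q)"
  unfolding r4 r0 sem.simps(3) using assms by (simp add: p n ra fun_upd_twist del: PushW.simps replicate.simps sem.simps(5))
 let ?ss3 = "?ss2(0 := replicate (3 + 2 * a) S1 @ [S0, SPlus] @ E @ [SSlash, S1] @ replicate a S0 @ ?ss2 0, 4 := [])"
 have 3: "sem f (Each 5 2 (%_. Push 0 S0) ;; PushW 0 [SSlash, S1] ;; Mv 4 0 ;; PushW 0 [S0, SPlus] ;; Each 5 2 (%_. PushW 0 [S1, S1]) ;; PushW 0 (replicate 3 S1)) (?ss2, q) = (?ss3, q)"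
  unfolding r1 sem.simps(3) using assms by (simp add: p ra fun_upd_twist del: PushW.simps replicate.simps)
 have S: "sem f Out (ss, q) = (?ss3, q)" unfolding Out_def using 1 2 3 by (simp only: sem.simps(3)[of f "_ ;; _"])
 have l: "length (dstr SPlus E a) = 3 + 2 * a" "length (dstr SPlus ?v (2 * a + 8)) = 13 + 4 * a" using assms(5,7) by simp_all
 have t: "tuple [b, c, d] = replicate (length b) S1 @ [S0] @ b @ replicate (length c) S1 @ [S0] @ c @ replicate (length d) S1 @ [S0] @ d" for b c d
  by (simp add: tuple_def)
 show ?thesis unfolding S t l length_replicate unfolding dstr_def add.commute[of "2 * a"] by (simp del: replicate.simps)
qed

subsection \<open>The two reduction programs\<close>

lemma pb_Check50: "pb 50 Check" "ok {..<50} Check"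
 unfolding Check_def by (auto intro!: pb_Case pb_basic)

lemma ok_RangeTest: "ok {..<50} RangeTest" by (simp add: RangeTest_def Check_def)
lemma pb_RangeTest: "pb 50 RangeTest"
 unfolding RangeTest_def
 by (intro pb_Seq pb_Dup pb_Case pb_Cmp pb_Check50) (auto intro!: pb_Seq pb_PushW pb_Each_Push pb_basic simp del: PushW.simps)

lemma ok_Digits: "ok {..<50} Digits" by (simp add: Digits_def)
lemma pb_Digits: "pb 50 Digits"
 unfolding Digits_def
 by (intro pb_Seq pb_Each_Push pb_PushW pb_AddTo pb_PopN pb_Dup pb_Pop pb_For[where k = 1])
  (auto intro!: pb_Case pb_basic gr_Case gr_Push gr_Skip simp del: PushW.simps PopN.simps)

lemma ok_Arc: "ok {..<50} Arc" by (simp add: Arc_def)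
lemma pb_Arc: "pb 50 Arc"
 unfolding Arc_def by (intro pb_Seq pb_Sq pb_Dup pb_For[where k = 0] pb_Pop gr_Pop pb_PopN) auto

lemma ok_NearV: "ok {..<50} NearV" by (auto simp: NearV_def WideV_def Check_def)
lemma pb_NearV: "pb 50 NearV"
proof -
 have E: "pb 50 (Each j 13 (%_. Push 23 S0))" "ok {..<50} (Each j 13 (%_. Push 23 S0))" if "j \<in> {8, 17, 26}" for j using that by (auto intro!: pb_Each_Push)
 have D: "pb 50 (Dup i 13 j)" "ok {..<50} (Dup i 13 j)" if "i \<in> {8, 17, 26}" "j \<in> {23, 24}" for i j using that by (auto intro!: pb_Dup)
 have W: "pb 50 WideV" "ok {..<50} WideV" unfolding WideV_def using E D by (auto intro!: pb_Seq)
 have A: "pb 50 (AddTo 23 j 14 15 16)" "ok {..<50} (AddTo 23 j 14 15 16)" if "j \<in> {8, 17}" for j using that by (auto intro!: pb_AddTo)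
 have C: "pb 50 (Cmp 23 24 25)" "ok {..<50} (Cmp 23 24 25)" "pb 50 (Cmp 24 23 25)" "ok {..<50} (Cmp 24 23 25)" by (auto intro!: pb_Cmp)
 have 1: "pb 50 (Each 8 13 (%_. Push 23 S0) ;; Each 17 13 (%_. Push 23 S0) ;; Each 26 13 (%_. Push 23 S0) ;;
    AddTo 23 8 14 15 16 ;; AddTo 23 17 14 15 16 ;; Dup 26 13 24 ;; Cmp 23 24 25 ;; Check)"
  by (intro pb_Seq E D A C pb_Check50) auto
 have 2: "pb 50 (WideV ;; AddTo 23 17 14 15 16 ;; Dup 8 13 24 ;; Cmp 24 23 25 ;; Check ;;
    WideV ;; AddTo 23 8 14 15 16 ;; Dup 17 13 24 ;; Cmp 24 23 25 ;; Check)"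
  by (intro pb_Seq W D A C pb_Check50) auto
 show ?thesis unfolding NearV_def by (rule pb_Case) (use 1 2 in auto)
qed

lemma pb_Verdict50: "pb 50 Verdict"
 unfolding Verdict_def by (intro pb_Seq pb_Clr pb_Case) (auto intro: pb_basic)

lemma sem_Verdict: "fst (sem f Verdict s) 0 = (if fst s 22 = [] then [S1] else [S0])"
 by (cases s; cases "fst s 22") (simp_all add: Verdict_def)

lemma gr_dact: "length b = 3 ==> gr 50 7 (dact p b)"
proof -
 assume b: "length b = 3"
 have P: "gr 50 7 (PushW 33 (replicate (if c then i else 4) S1))" if "i <= 4" for c i using that by (intro gr_PushW) auto
 have L: "gr 50 7 (case letter b of Some x => (case x of None => Push 36 S1 ;; Push 37 S1 | Some a => Push 35 a)
    | None => PushW 33 (replicate (if b = [S1, S1, S0] then 1 else 4) S1))"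
 proof (cases "letter b")
  case None
  show ?thesis unfolding None option.case by (rule P) simp
 next
  case (Some x)
  show ?thesis unfolding Some option.case by (cases x) (auto intro!: gr_Push gr_Seq[OF gr_Push[of 1] gr_Push[of 1]])
 qed
 have Q: "gr 50 7 (PushW 33 (replicate 3 S1) ;; PushW 45 (rev b))"
  by (rule gr_Seq[OF gr_PushW[where k = 3] gr_PushW[where k = 3]]) (use b in auto)
 have 3: "gr 50 7 (Case 37 (%x. if x = None then PushW 33 (replicate (if b = [S0, S0, S0] then 3 else 4) S1)
    else PushW 33 (replicate 3 S1) ;; PushW 45 (rev b)))"
  using P[of 3 "b = [S0, S0, S0]"] gr_mono[OF Q, of 8] by (auto simp del: PushW.simps replicate.simps intro!: gr_Case)
 have 4: "gr 50 7 (PushW 33 (replicate 4 S1))" by (intro gr_PushW) simp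
 have 0: "gr 50 7 (PopN 39 6 ;; (case letter b of Some x => (case x of None => Push 36 S1 ;; Push 37 S1 | Some a => Push 35 a)
    | None => PushW 33 (replicate (if b = [S1, S1, S0] then 1 else 4) S1)))"
  by (rule gr_Seq[OF gr_PopN[where k = 0] L]) auto
 have if_rule: "gr 50 7 (if c then x else y)" if "gr 50 7 x" "gr 50 7 y" for c x y using that by simp
 show ?thesis unfolding dact_def by (intro if_rule 0 3 4 P) simp_all
qed

lemma pb_dact: "pb 50 (dact p b)"
proof -
 have if_rule: "pb 50 (if c then x else y)" if "pb 50 x" "pb 50 y" for c x y using that by simp
 have L: "pb 50 (case letter b of Some x => (case x of None => Push 36 S1 ;; Push 37 S1 | Some a => Push 35 a)
    | None => PushW 33 (replicate (if b = [S1, S1, S0] then 1 else 4) S1))"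
 proof (cases "letter b")
  case None
  show ?thesis unfolding None option.case by (rule pb_PushW) simp
 next
  case (Some x)
  show ?thesis unfolding Some option.case by (cases x) (auto intro!: pb_Seq pb_basic)
 qed
 have 3: "pb 50 (Case 37 (%x. if x = None then PushW 33 (replicate (if b = [S0, S0, S0] then 3 else 4) S1)
    else PushW 33 (replicate 3 S1) ;; PushW 45 (rev b)))"
  by (intro pb_Case if_rule pb_Seq pb_PushW) simp_all
 show ?thesis unfolding dact_def by (intro if_rule pb_Seq pb_PopN L 3 pb_PushW) simp_all
qed

lemma gr_Block: "gr 50 7 Block"
 unfolding Block_def Bit_def
 by (intro gr_Case gr_CaseN) (auto intro!: gr_mono[OF gr_dact])

lemma pb_Block: "pb 50 Block"
 unfolding Block_def Bit_def by (intro pb_Case pb_CaseN pb_dact) auto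

context simulation
begin

lemma ok_Tent: "ok {..<50} Tent"
proof -
 have "ok ({..<50} - {34}) Block" by (rule ok_Block) auto
 moreover have "ok ({..<50} - {36}) SimStep" by (rule ok_SimStep) auto
 ultimately show ?thesis unfolding Tent_def Load_def Judge_def by (auto intro!: ok_CaseN simp del: PushW.simps PopN.simps)
qed

lemma pb_Tent: "pb 50 Tent"
proof -
 obtain k where k: "gr 50 k SimStep" using gr_SimStep by blast
 have 1: "pb 50 (Push 39 S1 ;; Each 12 13 (%_. Push 39 S0) ;; PopN 39 10 ;; Dup 10 13 34)"
  by (intro pb_Seq pb_basic pb_Each_Push pb_PopN pb_Dup) auto
 have 2: "pb 50 (For 34 (%_. Block))" by (rule pb_For[OF _ _ pb_Block gr_Block]) (auto intro: ok_Block)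
 have 3: "pb 50 Load" unfolding Load_def
  by (intro pb_Seq pb_Mv pb_PushW pb_For[where k = 2] gr_PushW) auto
 have 4: "pb 50 (For 36 (%_. SimStep))" by (rule pb_For[OF _ _ pb_SimStep k]) (auto intro: ok_SimStep)
 have 5: "pb 50 Judge" unfolding Judge_def
  by (intro pb_Seq pb_CaseN pb_For[where k = 1] pb_Each_Push pb_PushW pb_Case)
   (auto intro!: pb_basic gr_Push pb_AddTo ok_CaseN simp del: PushW.simps)
 have o: "ok {..<50} (Push 39 S1 ;; Each 12 13 (%_. Push 39 S0) ;; PopN 39 10 ;; Dup 10 13 34)" "ok {..<50} (For 34 (%_. Block))" "ok {..<50} Load" "ok {..<50} (For 36 (%_. SimStep))"
  using ok_Tent unfolding Tent_def by auto
 show ?thesis unfolding Tent_def by (intro pb_Seq 1 2 3 4 5 o)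
qed

definition Sprog :: com where
 "Sprog = Parse ;; Scale 4 ;; RangeTest ;; Digits ;; Tent ;; Arc ;; NearV ;; Verdict"

lemma ok_Sprog: "ok {..<50} Sprog"
 using ok_Tent ok_RangeTest ok_Digits ok_Arc ok_NearV by (auto simp: Sprog_def Verdict_def intro!: ok_Parse ok_Scale)

lemma pb_Sprog: "pb 50 Sprog"
 unfolding Sprog_def
 by (intro pb_Seq pb_Parse pb_Scale pb_RangeTest pb_Digits pb_Tent pb_Arc pb_NearV pb_Verdict50 ok_Tent ok_RangeTest ok_Digits ok_Arc ok_NearV)
  (auto intro!: ok_Parse ok_Scale)

lemma sem_Sprog:
 assumes x: "set x \<subseteq> {S0, S1}" "set x' \<subseteq> {S0, S1}" and N: "N = n + 4"
  and \<xi>: "\<xi> = bin_val x * 2 ^ N div 2 ^ k" "\<upsilon> = bin_val x' * 2 ^ N div 2 ^ k'"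
 shows "\<exists>v. hw_spec (spikes f) N ((\<xi> + 16) div 32) v \<and>
  (fst (sem f Sprog (s0 (tuple [dstr s x k, dstr s' x' k', replicate n S0]))) 0 = [S1] \<longleftrightarrow> in_range s N \<xi> \<and> nearby s' \<upsilon> (\<xi>\<^sup>2 div 2 ^ (N + 6)) (20 + v))"
proof -
 let ?q = "(%_. None, 0) :: (nat => cell) \<times> nat"
 let ?u = "tuple [dstr s x k, dstr s' x' k', replicate n S0]"
 let ?ss0 = "(%_::nat. [])(0 := rev ?u)"
 let ?ss1 = "?ss0(0 := [], 4 := [s], 5 := rev x, 6 := replicate k S0, 7 := [s'], 8 := rev x', 9 := replicate k' S0, 10 := replicate n S1)"
 have p1: "sem f Parse (?ss0, ?q) = (?ss1, ?q)" by (rule sem_Parse[where ss = ?ss0, OF x]) simp_all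
 have e1: "?ss1 12 = []" "?ss1 13 = []" by simp_all
 define ss2 where "ss2 = ?ss1(12 := replicate N S1, 5 := scaled x k N, 6 := [], 8 := scaled x' k' N, 9 := [])"
 have p2: "sem f (Scale 4) (?ss1, ?q) = (ss2, ?q)"
  unfolding sem_Scale[where ss = ?ss1, OF e1] Let_def N scaled_def ss2_def by simp
 have v: "val (ss2 5) = \<xi>" "val (ss2 8) = \<upsilon>" unfolding ss2_def \<xi> by (simp_all add: val_scaled)
 have z: "ss2 j = []" if "13 <= j" for j using that by (simp add: ss2_def)
 have b: "ss2 4 = [s]" "ss2 7 = [s']" "ss2 10 = replicate n S1" "ss2 12 = replicate N S1" "ss2 22 = []" by (simp_all add: ss2_def)
 define z1 where "z1 = (if in_range s N \<xi> then [] else [S1])"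
 define ss3 where "ss3 = ss2(4 := [], 22 := z1)"
 have p3: "sem f RangeTest (ss2, ?q) = (ss3, ?q)"
 proof -
  have e: "ss2 j = []" if "j \<in> {13, 23, 24, 25}" for j using that z[of j] by auto
  show ?thesis using sem_RangeTest[where ss = ss2 and f = f and q = ?q, OF b(1,3) e] unfolding N[symmetric] ss3_def z1_def v(1) b(5) by simp
 qed
 have n3: "ss3 10 = replicate n S1" using b(3) by (simp add: ss3_def)
 have e3: "ss3 j = []" if "j \<in> {13, 14, 15, 16, 23, 30, 31, 32}" for j using that z[of j] by (auto simp: ss3_def)
 have v3: "val (ss3 5) = \<xi>" using v(1) by (simp add: ss3_def)
 obtain d z2 where p4: "sem f Digits (ss3, ?q) = (ss3(30 := d, 32 := z2), ?q)" "bits d" "length d = n - 1"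
  "bin_val d = (\<xi> + 16) div 32 mod 2 ^ (n - 1)" "z2 = [] \<longleftrightarrow> (\<xi> + 16) div 32 < 2 ^ (n - 1)"
  using sem_Digits[where ss = ss3 and f = f and q = ?q, OF n3 e3] unfolding v3 by blast
 define ss4 where "ss4 = ss3(30 := d, 32 := z2)"
 obtain p ls k0 w h where D: "fold dstep (bl n d) (0, [], 0, [], 0) = (p, ls, k0, w, h)" by (cases "fold dstep (bl n d) (0, [], 0, [], 0)")
 define hv where "hv = (if z2 = [] \<and> wins f (syms (rev ls)) (marks ls) (rev w) \<and> p = 3 \<and> k0 = 0 then 2 ^ N div 2 ^ (6 * h + 10) else (0::nat))"
 have hw: "hw_spec (spikes f) N ((\<xi> + 16) div 32) hv" unfolding hv_def N by (rule hw_decode[OF p4(2-5) D])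
 have s4: "ss4 10 = replicate n S1" "ss4 12 = replicate N S1" "ss4 30 = d" "ss4 32 = z2" using b by (simp_all add: ss4_def ss3_def)
 have e4: "ss4 j = []" if "j \<in> {13, 14, 15, 16, 26} \<or> 33 <= j" for j using that z[of j] by (auto simp: ss4_def ss3_def)
 obtain ss5 q5 where p5: "sem f Tent (ss4, ?q) = (ss5, q5)" "\<And>j. j < 26 ==> ss5 j = ss4 j" "val (ss5 26) = 20 + hv" "val (ss5 26) + 2 <= 2 ^ length (ss5 26)"
  using sem_Tent[where ss = ss4 and f = f, OF s4(1,2,3) p4(2,3) s4(4) e4 D] unfolding hv_def by blast
 have l5: "ss5 j = ss2 j" if "j < 26" "j ~= 4" "j ~= 22" for j using p5(2)[of j] that by (simp add: ss4_def ss3_def)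
 have c12: "ss5 12 = replicate N S1" using l5[of 12] b(4) by simp
 have e5: "ss5 j = []" if "j \<in> {13, 14, 15, 16, 17, 18, 23, 24, 25}" for j using l5[of j] z[of j] that by auto
 obtain a where p6: "sem f Arc (ss5, q5) = (ss5(17 := a), q5)" "val a = \<xi>\<^sup>2 div 2 ^ (N + 6)"
 proof -
  have "\<exists>a. sem f Arc (ss5, q5) = (ss5(17 := a), q5) \<and> val a = (val (ss5 5))\<^sup>2 div 2 ^ (N + 6)"
   by (rule sem_Arc[where ss = ss5 and N = N]) (use c12 e5 in auto)
  moreover have "val (ss5 5) = \<xi>" using l5[of 5] v(1) by simp
  ultimately show thesis using that by auto
 qed
 let ?ss6 = "ss5(17 := a)"
 have "\<exists>b. sem f NearV (?ss6, q5) = (?ss6(7 := [], 22 := b @ ?ss6 22), q5) \<and> (b = [] \<longleftrightarrow> nearby s' (val (?ss6 8)) (val (?ss6 17)) (val (?ss6 26)))"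
 proof (rule sem_NearV[where ss = ?ss6])
  show "?ss6 j = []" if "j \<in> {13, 14, 15, 16, 23, 24, 25}" for j using e5[of j] that by auto
  show "val (?ss6 26) + 2 <= 2 ^ length (?ss6 26)" using p5(4) by simp
  show "?ss6 7 = [s']" using l5[of 7] b(2) by simp
 qed
 obtain bb where p7: "sem f NearV (?ss6, q5) = (?ss6(7 := [], 22 := bb @ ?ss6 22), q5)" "bb = [] \<longleftrightarrow> nearby s' \<upsilon> (\<xi>\<^sup>2 div 2 ^ (N + 6)) (20 + hv)"
 proof -
  have "val (?ss6 8) = \<upsilon>" "val (?ss6 17) = \<xi>\<^sup>2 div 2 ^ (N + 6)" "val (?ss6 26) = 20 + hv" using l5[of 8] v(2) p6(2) p5(3) by simp_all
  then show thesis using that \<open>\<exists>b. sem f NearV (?ss6, q5) = (?ss6(7 := [], 22 := b @ ?ss6 22), q5) \<and> (b = [] \<longleftrightarrow> nearby s' (val (?ss6 8)) (val (?ss6 17)) (val (?ss6 26)))\<close> by (simp only:) blast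
 qed
 have f22: "?ss6 22 = z1" using p5(2)[of 22] by (simp add: ss4_def ss3_def)
 have "sem f Sprog (s0 ?u) = sem f Verdict (?ss6(7 := [], 22 := bb @ z1), q5)"
  unfolding Sprog_def s0_def sem.simps(3) p1 p2 p3 p4(1) ss4_def[symmetric] p5(1) p6(1) p7(1) f22 ..
 then have "fst (sem f Sprog (s0 ?u)) 0 = [S1] \<longleftrightarrow> bb @ z1 = []" by (simp add: sem_Verdict)
 then show ?thesis using hw p7(2) unfolding z1_def by (intro exI[of _ hv]) auto
qed

text \<open>Whatever the input looks like, even if it encodes no query, \<open>Verdict\<close>
  leaves exactly one of the two admissible words.\<close>

lemma Sprog_Pred: "(%u. fst (sem f Sprog (s0 u)) 0) \<in> Pred"
proof -
 have "fst (sem f Sprog (s0 u)) 0 = [S0] \<or> fst (sem f Sprog (s0 u)) 0 = [S1]" for u unfolding Sprog_def sem.simps(3) sem_Verdict by simp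
 then show ?thesis unfolding Pred_def regular_def by (auto, metis le_refl length_Cons list.size(3))
qed

lemma Sprog_name: "is_psi_name (%u. fst (sem f Sprog (s0 u)) 0) (shape (spikes f))"
 unfolding is_psi_name_def
proof (intro conjI allI impI)
 show "(%u. fst (sem f Sprog (s0 u)) 0) \<in> Pred" by (rule Sprog_Pred)
 show "shape (spikes f) \<in> Acal" by (rule closed_shape[OF good_spikes])
 fix n :: nat and u v :: word assume uv: "u \<in> D \<and> v \<in> D"
 obtain s x k where u: "u = dstr s x k" "s \<in> {SPlus, SMinus}" "set x \<subseteq> {S0, S1}" using uv unfolding D_dstr by blast
 obtain s' x' k' where v: "v = dstr s' x' k'" "s' \<in> {SPlus, SMinus}" "set x' \<subseteq> {S0, S1}" using uv unfolding D_dstr by blast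
 define N where "N = n + 4"
 define \<xi> \<upsilon> where "\<xi> = bin_val x * 2 ^ N div 2 ^ k" and "\<upsilon> = bin_val x' * 2 ^ N div 2 ^ k'"
 obtain hv where hv: "hw_spec (spikes f) N ((\<xi> + 16) div 32) hv"
  "fst (sem f Sprog (s0 (tuple [u, v, replicate n S0]))) 0 = [S1] \<longleftrightarrow> in_range s N \<xi> \<and> nearby s' \<upsilon> (\<xi>\<^sup>2 div 2 ^ (N + 6)) (20 + hv)"
  using sem_Sprog[where f = f and s = s and s' = s', OF u(3) v(3) N_def \<xi>_def \<upsilon>_def] unfolding u(1) v(1) by blast
 have cell: "dyad_val (dstr s x k) = (if s = SMinus then -1 else 1) * \<bar>dyad_val (dstr s x k)\<bar>" "real (bin_val x * 2 ^ N div 2 ^ k) <= \<bar>dyad_val (dstr s x k)\<bar> * 2 ^ N"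
  "\<bar>dyad_val (dstr s x k)\<bar> * 2 ^ N < real (bin_val x * 2 ^ N div 2 ^ k) + 1" if "set x \<subseteq> {S0, S1}" for s x k
  unfolding dyad_val_dstr[OF that] using div_real[of "bin_val x * 2 ^ N" k] by (simp_all add: abs_mult)
 note cu = cell[OF u(3), where s = s and k = k, folded u(1) \<xi>_def] and cv = cell[OF v(3), where s = s' and k = k', folded v(1) \<upsilon>_def]
 interpret probe "spikes f" n N \<xi> \<upsilon> hv s s' "dyad_val u" "dyad_val v"
  by (rule probe.intro[OF good_spikes N_def u(2) v(2) cu cv hv(1)])
 show "fst (sem f Sprog (s0 (tuple [u, v, replicate n S0]))) 0 = [S1]" if "setdist_e (dyad_val u, dyad_val v) (shape (spikes f)) < ereal ((1/2) ^ n)"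
  unfolding hv(2) by (rule probe_complete[OF that])
 show "fst (sem f Sprog (s0 (tuple [u, v, replicate n S0]))) 0 = [S0]" if "setdist_e (dyad_val u, dyad_val v) (shape (spikes f)) > ereal (2 * (1/2) ^ n)"
 proof -
  have "fst (sem f Sprog (s0 (tuple [u, v, replicate n S0]))) 0 ~= [S1]" unfolding hv(2) using probe_sound that by blast
  then show ?thesis using Sprog_Pred[of f] unfolding Pred_def by blast
 qed
qed

end

section \<open>Both reduction maps are computable in polynomial time\<close>

lemma FP2_program:
 assumes "3 <= K" "ok {..<K} c" "sp_ok P" "\<And>f u. f \<in> Reg ==> ops f c (s0 u) <= sp_eval P (regsize f) (length u)"
  "\<And>f. f \<in> Reg ==> (%u. fst (sem f c (s0 u)) 0) \<in> Reg"
 shows "graph_on_Reg (%f u. fst (sem f c (s0 u)) 0) \<in> FP2"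
proof -
 obtain M where M: "deterministic M" "poly_time M" "\<And>f u. outputs M f u (fst (sem f c (s0 u)) 0)" using FP_machine[OF assms(1-4)] by blast
 have "graph_on_Reg (%f u. fst (sem f c (s0 u)) 0) \<subseteq> Reg \<times> Reg" unfolding graph_on_Reg_def using assms(5) by auto
 moreover have "\<exists>g\<in>mimg (graph_on_Reg (%f u. fst (sem f c (s0 u)) 0)) f. \<forall>u. outputs M f u (g u)" if "f \<in> mdom (graph_on_Reg (%f u. fst (sem f c (s0 u)) 0))" for f
 proof -
  have "f \<in> Reg" using that unfolding mdom_def graph_on_Reg_def by auto
  then have "(%u. fst (sem f c (s0 u)) 0) \<in> mimg (graph_on_Reg (%f u. fst (sem f c (s0 u)) 0)) f" unfolding mimg_def graph_on_Reg_def by auto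
  then show ?thesis by (rule bexI[rotated]) (simp add: M(3))
 qed
 ultimately show ?thesis unfolding FP2_def mem_Collect_eq using M(1,2) by blast
qed

lemma tsize_single: "j < K ==> tsize K ((%_. [])(j := w), q) = length w"
 unfolding tsize_def by (simp add: if_distrib sum.delta cong: if_cong)

lemma (in simulation) Sprog_FP2: "graph_on_Reg (%f u. fst (sem f Sprog (s0 u)) 0) \<in> FP2"
proof -
 obtain C d where C: "\<And>f s. ops f Sprog s <= C * (tsize 50 s + 1) ^ d" using pb_Sprog unfolding pb_def pbd_def by blast
 let ?P = "PMul (PConst (Suc C)) (ppow (PAdd PVar (PConst 1)) d)"
 show ?thesis
 proof (rule FP2_program[where K = 50 and P = ?P])
  show "sp_ok ?P" by (simp add: ppow_ok)
  show "ops f Sprog (s0 u) <= sp_eval ?P (regsize f) (length u)" for f u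
  proof -
   have "ops f Sprog (s0 u) <= C * (length u + 1) ^ d" using C[of f "s0 u"] unfolding s0_def tsize_single[of 0 50, simplified] by simp
   also have "\<dots> <= Suc C * (length u + 1) ^ d" by simp
   finally show ?thesis by simp
  qed
  show "(%u. fst (sem f Sprog (s0 u)) 0) \<in> Reg" for f using Sprog_Pred[of f] unfolding Pred_def Reg_def by simp
 qed (simp_all add: ok_Sprog)
qed

definition Tprog :: "sopoly => com" where
 "Tprog P = Mv 0 1 ;; EvalP P 3 20 ;; Code ;; Out"

lemma sp_eval_mono: "mono L ==> m <= n ==> sp_eval P L m <= sp_eval P L n"
 by (induction P) (auto intro: add_mono mult_le_mono monoD)

lemma regsize_mono: "f \<in> Reg ==> mono (regsize f)"
 unfolding Reg_def regular_def regsize_def by (intro monoI) simp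

lemma sem_Tprog:
 fixes f u P
 defines "m \<equiv> sp_eval P (regsize f) (length u)"
 defines "e \<equiv> cwd (query_code u m)"
 shows "\<exists>y. fst (sem f (Tprog P) (s0 u)) 0 = tuple [dstr SPlus (e @ [S1]) (length e + 1), dstr SPlus y (2 * length e + 10), replicate (2 * length e + 12) S0] \<and>
  set y \<subseteq> {S0, S1} \<and> length y = 2 * length e + 4 \<and> bin_val y + 1 = 4 * (bin_val (e @ [S1]))\<^sup>2"
  and "\<exists>s. sem f (Mv 0 1 ;; EvalP P 3 20) (s0 u) = ((%_. [])(1 := u, 3 := replicate m S1), s)"
  and "ops f (Mv 0 1 ;; EvalP P 3 20) (s0 u) <= 1 + 2 * length u + sp_eval (cost P) (regsize f) (length u)"
proof -
 let ?ss1 = "(%_::nat. [])(1 := u)" let ?ss2 = "?ss1(3 := replicate m S1)"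
 have z: "(%_. None, 0) = ww (%_. None) []" by (simp add: ww_def)
 have 1: "sem f (Mv 0 1) (s0 u) = (?ss1, ww (%_. None) [])" unfolding s0_def z by (auto simp: fun_eq_iff)
 have "(\<exists>t'. sem f (EvalP P 3 20) (?ss1, ww (%_. None) []) = (?ss1(3 := replicate (sp_eval P (regsize f) (length (?ss1 1))) S1 @ ?ss1 3), ww t' [])) \<and>
  ops f (EvalP P 3 20) (?ss1, ww (%_. None) []) <= sp_eval (cost P) (regsize f) (length (?ss1 1))"
  by (rule EvalP_correct) auto
 then obtain t' where 2: "sem f (EvalP P 3 20) (?ss1, ww (%_. None) []) = (?ss2, ww t' [])"
  "ops f (EvalP P 3 20) (?ss1, ww (%_. None) []) <= sp_eval (cost P) (regsize f) (length u)" unfolding m_def by auto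
 show "\<exists>s. sem f (Mv 0 1 ;; EvalP P 3 20) (s0 u) = (?ss2, s)" unfolding sem.simps(3) 1 2(1) by blast
 show "ops f (Mv 0 1 ;; EvalP P 3 20) (s0 u) <= 1 + 2 * length u + sp_eval (cost P) (regsize f) (length u)"
  unfolding ops.simps(3) 1 using 2(2) ops_Mv[of 0 1 f "s0 u"] by simp
 let ?E = "e @ [S1]"
 have "\<exists>v. sem f Code (?ss2, ww t' []) = (?ss2(4 := rev (cwd (query_code u m) @ [S1]), 5 := replicate (length (cwd (query_code u m) @ [S1])) S1, 6 := v), ww t' []) \<and>
   length v = 2 * length (cwd (query_code u m) @ [S1]) + 2 \<and> val v + 1 = 4 * (bin_val (cwd (query_code u m) @ [S1]))\<^sup>2"
  by (rule sem_Code) auto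
 then obtain v where v: "sem f Code (?ss2, ww t' []) = (?ss2(4 := rev ?E, 5 := replicate (length ?E) S1, 6 := v), ww t' [])" "length v = 2 * length ?E + 2" "val v + 1 = 4 * (bin_val ?E)\<^sup>2"
  unfolding e_def by blast
 let ?y = "rev (map (%a. if a = S1 then S1 else S0) v)"
 have "fst (sem f Out (?ss2(4 := rev ?E, 5 := replicate (length ?E) S1, 6 := v), ww t' [])) 0 = tuple [dstr SPlus ?E (length ?E), dstr SPlus ?y (2 * length ?E + 8), replicate (2 * length ?E + 10) S0]"
  by (rule sem_Out) (use v(2) in simp_all)
 moreover have "sem f (Tprog P) (s0 u) = sem f Out (?ss2(4 := rev ?E, 5 := replicate (length ?E) S1, 6 := v), ww t' [])"
  unfolding Tprog_def sem.simps(3) 1 2(1) v(1) ..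
 moreover have "length ?E = length e + 1" "2 * length ?E + 8 = 2 * length e + 10" "2 * length ?E + 10 = 2 * length e + 12" by simp_all
 ultimately have "fst (sem f (Tprog P) (s0 u)) 0 = tuple [dstr SPlus ?E (length e + 1), dstr SPlus ?y (2 * length e + 10), replicate (2 * length e + 12) S0]" by (simp only:)
 moreover have "bin_val ?y + 1 = 4 * (bin_val ?E)\<^sup>2" using v(3) by (simp add: bin_val_val val_norm)
 ultimately show "\<exists>y. fst (sem f (Tprog P) (s0 u)) 0 = tuple [dstr SPlus (e @ [S1]) (length e + 1), dstr SPlus y (2 * length e + 10), replicate (2 * length e + 12) S0] \<and>
  set y \<subseteq> {S0, S1} \<and> length y = 2 * length e + 4 \<and> bin_val y + 1 = 4 * (bin_val (e @ [S1]))\<^sup>2"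
  using v(2) by (intro exI[of _ ?y]) auto
qed

text \<open>All components are padded to lengths that depend only on the length of \<open>u\<close>,
  and that dependence is monotone because second-order polynomials are monotone at monotone
  arguments.\<close>

lemma Tprog_Reg: "f \<in> Reg ==> (%u. fst (sem f (Tprog P) (s0 u)) 0) \<in> Reg"
proof -
 assume f: "f \<in> Reg"
 define l where "l n = 3 * (n + sp_eval P (regsize f) n) + 3" for n
 have len: "length (fst (sem f (Tprog P) (s0 u)) 0) = 16 * l (length u) + 71" for u
 proof -
  let ?e = "cwd (query_code u (sp_eval P (regsize f) (length u)))"
  have e: "length ?e = l (length u)" by (simp add: query_code_def l_def)
  obtain y where y: "fst (sem f (Tprog P) (s0 u)) 0 = tuple [dstr SPlus (?e @ [S1]) (length ?e + 1), dstr SPlus y (2 * length ?e + 10), replicate (2 * length ?e + 12) S0]" "length y = 2 * length ?e + 4"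
   using sem_Tprog(1)[of f P u] by blast
  show ?thesis unfolding y(1) length_tuple3 length_dstr length_append length_replicate y(2) e by simp
 qed
 have "l m <= l n" if "m <= n" for m n using sp_eval_mono[OF regsize_mono[OF f] that, of P] that unfolding l_def by simp
 then show ?thesis by (simp add: Reg_def regular_def len)
qed

text \<open>Evaluation of the bound is charged by \<open>cost\<close>; the rest is polynomial in the
  store that it leaves, whose size is \<open>length u\<close> plus the value of \<open>P\<close>, so
  substitution gives a second-order polynomial again.\<close>

lemma Tprog_FP2: "sp_ok P ==> graph_on_Reg (%f u. fst (sem f (Tprog P) (s0 u)) 0) \<in> FP2"
proof -
 assume P: "sp_ok P"
 let ?K = "20 + depth P"
 have "ok {..<?K} (EvalP P 3 20)" by (rule ok_EvalP) auto
 then have oE: "ok {..<?K} (Mv 0 1 ;; EvalP P 3 20)" by simp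
 have oC: "ok {..<?K} Code" "ok {..<?K} Out" by (simp_all add: Code_def Out_def del: PushW.simps)
 have pC: "pb ?K Code" unfolding Code_def
  by (intro pb_Seq pb_Each[where k = 3] pb_Each_Push pb_PushW pb_Sq pb_Pop gr_PushW) (auto simp del: PushW.simps lcode.simps)
 have pO: "pb ?K Out" unfolding Out_def
  by (intro pb_Seq pb_Each[where k = 4] pb_PushW pb_For[where k = 1] pb_Mv pb_basic gr_PushW gr_Push) (auto simp del: PushW.simps)
 have "pb ?K (Code ;; Out)" by (intro pb_Seq pC pO oC)
 then obtain C d where C: "\<And>f s. ops f (Code ;; Out) s <= C * (tsize ?K s + 1) ^ d" unfolding pb_def pbd_def by blast
 let ?Q = "PAdd (PAdd (PConst 1) (PMul (PConst 2) PVar)) (PAdd (cost P) (PMul (PConst (Suc C)) (ppow (PAdd (PAdd PVar P) (PConst 1)) d)))"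
 show ?thesis
 proof (rule FP2_program[where K = ?K and P = ?Q])
  show "ok {..<?K} (Tprog P)" using oE oC unfolding Tprog_def by simp
  show "sp_ok ?Q" using P by (simp add: ppow_ok cost_ok)
  show "(%u. fst (sem f (Tprog P) (s0 u)) 0) \<in> Reg" if "f \<in> Reg" for f by (rule Tprog_Reg[OF that])
  fix f :: fn and u :: word
  let ?m = "sp_eval P (regsize f) (length u)"
  obtain s where s: "sem f (Mv 0 1 ;; EvalP P 3 20) (s0 u) = ((%_. [])(1 := u, 3 := replicate ?m S1), s)" using sem_Tprog(2) by blast
  have ts: "tsize ?K ((%_. [])(1 := u, 3 := replicate ?m S1), s) = length u + ?m"
  proof -
   have "tsize ?K (upd 3 (replicate ?m S1) ((%_. [])(1 := u), s)) + length (fst ((%_::nat. [])(1 := u), s) 3) = tsize ?K ((%_. [])(1 := u), s) + length (replicate ?m S1)"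
    by (rule size_upd) simp
   then show ?thesis using tsize_single[of 1 ?K u s] by simp
  qed
  have "ops f (Tprog P) (s0 u) = ops f (Mv 0 1 ;; EvalP P 3 20) (s0 u) + ops f (Code ;; Out) (sem f (Mv 0 1 ;; EvalP P 3 20) (s0 u))"
   unfolding Tprog_def by simp
  also have "\<dots> <= (1 + 2 * length u + sp_eval (cost P) (regsize f) (length u)) + C * (length u + ?m + 1) ^ d"
   using sem_Tprog(3)[of f P u] C[of f "sem f (Mv 0 1 ;; EvalP P 3 20) (s0 u)"] unfolding s ts by (rule add_mono)
  also have "\<dots> <= sp_eval ?Q (regsize f) (length u)" by simp
  finally show "ops f (Tprog P) (s0 u) <= sp_eval ?Q (regsize f) (length u)" .
 qed simp
qed

theorem mainTheorem9:
 shows "rep_comp psi_circ CH psi_circ \<in> NP2 \<and>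
     (\<forall>A\<in>NP2. A \<le>\<^sub>m\<^sub>2 rep_comp psi_circ CH psi_circ)"
proof (intro conjI ballI)
 show "rep_comp psi_circ CH psi_circ \<in> NP2" by (rule hull_NP)
 fix A assume "A \<in> NP2"
 then obtain M where A: "A \<subseteq> Reg \<times> Pred" and M: "wf_otm M" "poly_time M"
  and MA: "\<And>f. f \<in> mdom A ==> \<exists>g\<in>mimg A f. \<forall>u. g u = [S1] \<longleftrightarrow> accepts M f u" unfolding NP2_def by blast
 obtain zs where "simulation M zs" using simulation_exists[OF M(1)] by blast
 then interpret simulation M zs .
 obtain P where P: "sp_ok P" "\<And>f u. f \<in> Reg ==> time_bounded M f u (sp_eval P (regsize f) (length u))" using M(2) unfolding poly_time_def by blast
 \<comment> \<open>The factor converts steps into choice bits, as \<open>accepts_wins\<close> asks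
   for.\<close>
 define R where "R = PMul (PConst (length zs)) P"
 have R: "sp_ok R" using P(1) zs_ne by (simp add: R_def)
 let ?s = "%f u. fst (sem f Sprog (s0 u)) 0" let ?t = "%f u. fst (sem f (Tprog R) (s0 u)) 0"
 have "?s f \<in> mdom (rep_comp psi_circ CH psi_circ) \<and> (\<forall>th\<in>mimg (rep_comp psi_circ CH psi_circ) (?s f). th \<circ> ?t f \<in> mimg A f)" if fA: "f \<in> mdom A" for f
 proof
  have fR: "f \<in> Reg" using fA A unfolding mdom_def by blast
  note pc = psi_circ_name[OF Sprog_name[of f]]
  show "?s f \<in> mdom (rep_comp psi_circ CH psi_circ)" by (rule hull_domain[OF pc])
  show "\<forall>th\<in>mimg (rep_comp psi_circ CH psi_circ) (?s f). th \<circ> ?t f \<in> mimg A f"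
  proof
   fix th assume "th \<in> mimg (rep_comp psi_circ CH psi_circ) (?s f)"
   then have "psi_circ th = Some (convex hull (shape (spikes f)))" unfolding mimg_def rep_comp_def CH_def using pc by auto
   note th = psi_circ_Some[OF this]
   obtain g where g: "g \<in> mimg A f" "\<And>u. g u = [S1] \<longleftrightarrow> accepts M f u" using MA[OF fA] by blast
   have gP: "g \<in> Pred" using g(1) A unfolding mimg_def by blast
   have "th (?t f u) = g u" for u
   proof -
    define m where "m = sp_eval R (regsize f) (length u)"
    define e where "e = cwd (query_code u m)"
    obtain y where y: "?t f u = tuple [dstr SPlus (e @ [S1]) (length e + 1), dstr SPlus y (2 * length e + 10), replicate (2 * length e + 12) S0]"
     "set y \<subseteq> {S0, S1}" "bin_val y + 1 = 4 * (bin_val (e @ [S1]))\<^sup>2" using sem_Tprog(1)[of f R u] unfolding m_def[symmetric] e_def[symmetric] by blast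
    have be: "set (e @ [S1]) \<subseteq> {S0, S1}" using bits_cwd[of "query_code u m"] unfolding e_def bits_def by auto
    have D: "dstr SPlus (e @ [S1]) (length e + 1) \<in> D" "dstr SPlus y (2 * length e + 10) \<in> D" unfolding D_dstr using be y(2) by blast+
    have d1: "dyad_val (dstr SPlus (e @ [S1]) (length e + 1)) = mid_x e" unfolding dyad_val_dstr[OF be] mid_x_def fr_def by simp
    have "real (bin_val y) = 4 * (real (bin_val (e @ [S1])))\<^sup>2 - 1" using arg_cong[OF y(3), of real] by simp
    \<comment> \<open>With \<open>E\<close> the numerator of \<open>mid_x e\<close> over
      \<open>2 ^ (length e + 1)\<close>, the difference of
      \<open>E^2 / 2 ^ (2 * length e + 8)\<close> and the height is \<open>4 * E^2 - 1\<close> over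
      \<open>2 ^ (2 * length e + 10)\<close>.\<close>
    then have d2: "dyad_val (dstr SPlus y (2 * length e + 10)) = (mid_x e)\<^sup>2 / 64 - spike_h e"
     unfolding dyad_val_dstr[OF y(2)] mid_x_def fr_def spike_h_def by (simp add: power_add power_divide power_mult_distrib power_even_eq diff_divide_distrib)
    note name = th[unfolded is_psi_name_def, THEN conjunct2, THEN conjunct2, rule_format, OF conjI[OF D], of "2 * length e + 12", unfolded d1 d2, folded y(1)]
    have sy: "syms (query_code u m) = u" "marks (query_code u m) = m" unfolding query_code_def by (simp_all add: filter_map o_def comp_def)
    show ?thesis
    proof (cases "accepts M f u")
     case True
     have "m = length zs * sp_eval P (regsize f) (length u)" unfolding m_def R_def by simp
     from accepts_wins[OF True P(2)[OF fR] this] obtain w where w: "bits w" "length w = 3 * m" "wins f u m w" by blast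
     have "(e, w) \<in> spikes f" unfolding spikes_def e_def using w sy by (intro CollectI exI[of _ "query_code u m"] exI[of _ w]) simp
     from hull_spike[OF this refl] have "th (?t f u) = [S1]" using name by blast
     then show ?thesis using g(2)[of u] True by simp
    next
     case False
     have "(e, w) \<notin> spikes f" for w
     proof
      assume "(e, w) \<in> spikes f"
      then obtain ls where ls: "e = cwd ls" "wins f (syms ls) (marks ls) w" unfolding spikes_def by blast
      \<comment> \<open>The code word determines input and time bound, so a spike at
        \<open>e\<close> would certify acceptance of this very input.\<close>
      have "ls = query_code u m" using cwd_prefix[of ls "[]" "query_code u m" "[]"] ls(1) unfolding e_def by simp
      then show False using ls(2) sy wins_accepts False by simp
     qed
     from hull_no_spike[OF good_spikes e_def this refl] have "th (?t f u) = [S0]" using name by blast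
     moreover have "g u = [S0]" using g(2)[of u] False gP unfolding Pred_def by blast
     ultimately show ?thesis by simp
    qed
   qed
   then have "th \<circ> ?t f = g" by (simp add: fun_eq_iff)
   then show "th \<circ> ?t f \<in> mimg A f" using g(1) by simp
  qed
 qed
 then show "A \<le>\<^sub>m\<^sub>2 rep_comp psi_circ CH psi_circ" unfolding mreduces_def using Sprog_FP2 Tprog_FP2[OF R] by blast
qed

end
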